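(* Let $R$ be a complete noetherian local ring and $\mathcal{E}$ a Hom-noetherian idempotent complete exact $R$-category with a projective generator $P$ and with AR conflations. Suppose that $\mathsf{AR}(\mathcal{E})\otimes_{\mathbb{Z}} \mathbb{Q} = \mathsf{Ex}(\mathcal{E}) \otimes_{\mathbb{Z}} \mathbb{Q}$ holds. Then the following hold. (1) For every object $M$ in $\mathsf{eff}\,\mathcal{E}$, the set $\mathrm{supp}\, M \cap \mathsf{ind}(\Omega\underline{\mathcal{E}})$ is finite, where the support is considered inside $\mathsf{ind}\,\underline{\mathcal{E}}$. (2) Assume in addition that $\underline{\mathcal{E}}$ has a weak cogenerator. Then $\Omega\mathcal{E}$ is of finite type.
   Context: All categories and functors are additive, and subcategories are additive, full and closed under isomorphisms. $R$ is commutative. Exact categories are in the sense of Quillen, with conflations $0\to X\xrightarrow{f} Y\xrightarrow{g} Z\to 0$; such $f$ is an inflation, such $g$ a deflation. An exact $R$-category is an $R$-linear exact category; it is Hom-noetherian if all its Hom-modules are finitely generated over $R$. Under the hypotheses $\mathcal{E}$ is Krull-Schmidt. $\mathsf{add}\,G$ consists of all direct summands of finite direct sums of $G$; $\mathcal{E}$ has a projective generator $P$ if it has enough projectives and its projectives are exactly $\mathsf{add}\,P$; a category $\mathcal{C}$ is of finite type if $\mathcal{C}=\mathsf{add}\,G$ for some $G\in\mathcal{C}$. $\mathsf{ind}$ denotes the set of isomorphism classes of indecomposable objects. The stable category $\underline{\mathcal{E}}$ is the quotient of $\mathcal{E}$ by the ideal of morphisms factoring through projectives. The syzygy functor $\Omega:\underline{\mathcal{E}}\to\underline{\mathcal{E}}$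 sends $X$ to $\Omega X$ given by a conflation $0\to\Omega X\to P_X\to X\to 0$ with $P_X$ projective. $\Omega\mathcal{E}$ is the subcategory of $\mathcal{E}$ of objects $X$ admitting an inflation $X\rightarrowtail Q$ in $\mathcal{E}$ with $Q$ projective; $\Omega\underline{\mathcal{E}}$ is the essential image of $\Omega:\underline{\mathcal{E}}\to\underline{\mathcal{E}}$, which coincides with the essential image of $\Omega\mathcal{E}$ in $\underline{\mathcal{E}}$. An object $C$ of an additive category $\mathcal{C}$ is a weak cogenerator if, for every $X\in\mathcal{C}$, $\mathcal{C}(X,C)=0$ implies $X=0$. $\mathsf{Mod}\,\mathcal{E}$ is the category of additive contravariant functors from $\mathcal{E}$ to abelian groups. $\mathsf{eff}\,\mathcal{E}$ is its subcategory of those $M$ admitting an exact sequence $\mathcal{E}(-,Y)\xrightarrow{\mathcal{E}(-,f)}\mathcal{E}(-,Z)\to M\to 0$ with $f:Y\to Z$ a deflation. Such $M$ vanishes on projectives, hence is a functor on $\underline{\mathcal{E}}$, and $\mathrm{supp}\,M=\{X\in\mathsf{ind}\,\underline{\mathcal{E}} \mid M(X)\neq 0\}$. Let $\mathcal{J}$ be the Jacobson radical of $\mathcal{E}$. A morphism $g:Y\to Z$ is right almost split if $Z$ is indecomposable, $g\in\mathcal{J}$, and any $h: W\to Z$ in $\mathcal{J}$ factors through $g$; left almost split is the dual notion. A conflation $0\to X\xrightarrow{f}Y\xrightarrow{g}Z\to 0$ is an AR conflation if $f$ is left almost split and $g$ is right almost split. $\mathcal{E}$ has AR conflations if every indecomposable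 non-projective object is the end term $Z$ of some AR conflation and every indecomposable non-injective object is the first term $X$ of some AR conflation. $\mathsf{K}_0(\mathcal{E},0)$ is the free abelian group on $\mathsf{ind}\,\mathcal{E}$, where for $X\cong\bigoplus X_i$ with $X_i$ indecomposable one puts $[X]=\sum [X_i]$. $\mathsf{Ex}(\mathcal{E})$ (resp. $\mathsf{AR}(\mathcal{E})$) is the subgroup of $\mathsf{K}_0(\mathcal{E},0)$ generated by $[X]-[Y]+[Z]$ for all conflations (resp. all AR conflations) $0\to X\to Y\to Z\to 0$ in $\mathcal{E}$. The equality after $\otimes_{\mathbb{Z}}\mathbb{Q}$ is one of subspaces of $\mathsf{K}_0(\mathcal{E},0)\otimes_{\mathbb{Z}}\mathbb{Q}$. *)

theory Defs
  imports "HOL-Algebra.Module" "HOL-Algebra.Ring_Divisibility" "HOL-Algebra.Ideal_Product"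
    "HOL-Algebra.Free_Abelian_Groups"
begin

section \<open>Complete noetherian local rings and finitely generated modules\<close>

text \<open>Completeness is bijectivity of the canonical map from \<open>R\<close> to the inverse limit of the
  \<open>R / m^n\<close>: a compatible family of residue classes is presented by representatives \<open>a n\<close>.\<close>

definition adically_complete :: "('r, 'b) ring_scheme \<Rightarrow> 'r set \<Rightarrow> bool"
  where "adically_complete R m \<longleftrightarrow>
    (\<forall>a :: nat \<Rightarrow> 'r.
      (\<forall>n. a n \<in> carrier R \<and> a (Suc n) \<ominus>\<^bsub>R\<^esub> a n \<in> m [^]\<^bsub>ideals_set R\<^esub> n) \<longrightarrow>
      (\<exists>!x \<in> carrier R. \<forall>n. x \<ominus>\<^bsub>R\<^esub> a n \<in> m [^]\<^bsub>ideals_set R\<^esub> n))"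

definition complete_noetherian_local_ring :: "('r, 'b) ring_scheme \<Rightarrow> bool"
  where "complete_noetherian_local_ring R \<longleftrightarrow>
    cring R \<and> noetherian_ring R \<and> (\<exists>!m. maximalideal m R) \<and>
    (\<forall>m. maximalideal m R \<longrightarrow> adically_complete R m)"

definition finitely_generated_module ::
    "('r, 'b) ring_scheme \<Rightarrow> ('r, 'm, 'c) module_scheme \<Rightarrow> bool"
  where "finitely_generated_module R M \<longleftrightarrow>
    (\<exists>S. finite S \<and> S \<subseteq> carrier M \<and> (\<forall>N. submodule N R M \<and> S \<subseteq> N \<longrightarrow> N = carrier M))"

section \<open>Linear and additive categories\<close>

text \<open>Each \<open>Hom C X Y\<close> is a module record (whose \<open>mult\<close> and \<open>one\<close> fields are irrelevant).
  Composition is indexed by objects, so Hom-sets need not be disjoint: \<open>Cmp C X Y Z g f\<close> is the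
  composite of \<open>f : X \<rightarrow> Y\<close> followed by \<open>g : Y \<rightarrow> Z\<close>.\<close>

record ('r, 'o, 'm) lincat =
  Ob :: "'o set"
  Hom :: "'o \<Rightarrow> 'o \<Rightarrow> ('r, 'm) module"
  Cmp :: "'o \<Rightarrow> 'o \<Rightarrow> 'o \<Rightarrow> 'm \<Rightarrow> 'm \<Rightarrow> 'm"
  Idm :: "'o \<Rightarrow> 'm"

abbreviation Mor :: "('r, 'o, 'm, 'z) lincat_scheme \<Rightarrow> 'o \<Rightarrow> 'o \<Rightarrow> 'm set"
  where "Mor C X Y \<equiv> carrier (Hom C X Y)"

abbreviation zmor :: "('r, 'o, 'm, 'z) lincat_scheme \<Rightarrow> 'o \<Rightarrow> 'o \<Rightarrow> 'm"
  where "zmor C X Y \<equiv> \<zero>\<^bsub>Hom C X Y\<^esub>"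

locale lin_category =
  fixes R :: "('r, 'b) ring_scheme" and C :: "('r, 'o, 'm, 'z) lincat_scheme"
  assumes cring_R: "cring R"
    and Hom_module: "\<lbrakk>X \<in> Ob C; Y \<in> Ob C\<rbrakk> \<Longrightarrow> module R (Hom C X Y)"
    and Idm_closed: "X \<in> Ob C \<Longrightarrow> Idm C X \<in> Mor C X X"
    and Cmp_closed: "\<lbrakk>X \<in> Ob C; Y \<in> Ob C; Z \<in> Ob C; f \<in> Mor C X Y; g \<in> Mor C Y Z\<rbrakk>
      \<Longrightarrow> Cmp C X Y Z g f \<in> Mor C X Z"
    and Cmp_assoc: "\<lbrakk>W \<in> Ob C; X \<in> Ob C; Y \<in> Ob C; Z \<in> Ob C;
        f \<in> Mor C W X; g \<in> Mor C X Y; h \<in> Mor C Y Z\<rbrakk>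
      \<Longrightarrow> Cmp C W Y Z h (Cmp C W X Y g f) = Cmp C W X Z (Cmp C X Y Z h g) f"
    and Cmp_Idm_right: "\<lbrakk>X \<in> Ob C; Y \<in> Ob C; f \<in> Mor C X Y\<rbrakk> \<Longrightarrow> Cmp C X X Y f (Idm C X) = f"
    and Cmp_Idm_left: "\<lbrakk>X \<in> Ob C; Y \<in> Ob C; f \<in> Mor C X Y\<rbrakk> \<Longrightarrow> Cmp C X Y Y (Idm C Y) f = f"
    and Cmp_add_left: "\<lbrakk>X \<in> Ob C; Y \<in> Ob C; Z \<in> Ob C; f \<in> Mor C X Y; g \<in> Mor C Y Z; g' \<in> Mor C Y Z\<rbrakk>
      \<Longrightarrow> Cmp C X Y Z (g \<oplus>\<^bsub>Hom C Y Z\<^esub> g') f = Cmp C X Y Z g f \<oplus>\<^bsub>Hom C X Z\<^esub> Cmp C X Y Z g' f"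
    and Cmp_add_right: "\<lbrakk>X \<in> Ob C; Y \<in> Ob C; Z \<in> Ob C; f \<in> Mor C X Y; f' \<in> Mor C X Y; g \<in> Mor C Y Z\<rbrakk>
      \<Longrightarrow> Cmp C X Y Z g (f \<oplus>\<^bsub>Hom C X Y\<^esub> f') = Cmp C X Y Z g f \<oplus>\<^bsub>Hom C X Z\<^esub> Cmp C X Y Z g f'"
    and Cmp_smult_left: "\<lbrakk>r \<in> carrier R; X \<in> Ob C; Y \<in> Ob C; Z \<in> Ob C; f \<in> Mor C X Y; g \<in> Mor C Y Z\<rbrakk>
      \<Longrightarrow> Cmp C X Y Z (r \<odot>\<^bsub>Hom C Y Z\<^esub> g) f = r \<odot>\<^bsub>Hom C X Z\<^esub> Cmp C X Y Z g f"
    and Cmp_smult_right: "\<lbrakk>r \<in> carrier R; X \<in> Ob C; Y \<in> Ob C; Z \<in> Ob C; f \<in> Mor C X Y; g \<in> Mor C Y Z\<rbrakk>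
      \<Longrightarrow> Cmp C X Y Z g (r \<odot>\<^bsub>Hom C X Y\<^esub> f) = r \<odot>\<^bsub>Hom C X Z\<^esub> Cmp C X Y Z g f"

definition is_iso :: "('r, 'o, 'm, 'z) lincat_scheme \<Rightarrow> 'o \<Rightarrow> 'o \<Rightarrow> 'm \<Rightarrow> bool"
  where "is_iso C X Y f \<longleftrightarrow> f \<in> Mor C X Y \<and>
    (\<exists>g \<in> Mor C Y X. Cmp C X Y X g f = Idm C X \<and> Cmp C Y X Y f g = Idm C Y)"

definition isomorphic :: "('r, 'o, 'm, 'z) lincat_scheme \<Rightarrow> 'o \<Rightarrow> 'o \<Rightarrow> bool"
  where "isomorphic C X Y \<longleftrightarrow> (\<exists>f. is_iso C X Y f)"

definition zero_object :: "('r, 'o, 'm, 'z) lincat_scheme \<Rightarrow> 'o \<Rightarrow> bool"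
  where "zero_object C X \<longleftrightarrow> X \<in> Ob C \<and> Idm C X = zmor C X X"

text \<open>\<open>X\<close> is a direct sum (biproduct) of the list \<open>Xs\<close>; for the empty list this says that
  \<open>X\<close> is a zero object.\<close>

definition direct_sum :: "('r, 'o, 'm, 'z) lincat_scheme \<Rightarrow> 'o list \<Rightarrow> 'o \<Rightarrow> bool"
  where "direct_sum C Xs X \<longleftrightarrow> X \<in> Ob C \<and> set Xs \<subseteq> Ob C \<and>
    (\<exists>\<iota> \<pi>.
      (\<forall>k < length Xs. \<iota> k \<in> Mor C (Xs ! k) X \<and> \<pi> k \<in> Mor C X (Xs ! k)) \<and>
      (\<forall>j < length Xs. \<forall>k < length Xs.
        Cmp C (Xs ! k) X (Xs ! j) (\<pi> j) (\<iota> k) =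
          (if j = k then Idm C (Xs ! k) else zmor C (Xs ! k) (Xs ! j))) \<and>
      finsum (Hom C X X) (\<lambda>k. Cmp C X (Xs ! k) X (\<iota> k) (\<pi> k)) {..<length Xs} = Idm C X)"

locale additive_category = lin_category +
  assumes has_direct_sums: "set Xs \<subseteq> Ob C \<Longrightarrow> \<exists>X. direct_sum C Xs X"

definition idempotent_complete :: "('r, 'o, 'm, 'z) lincat_scheme \<Rightarrow> bool"
  where "idempotent_complete C \<longleftrightarrow>
    (\<forall>X \<in> Ob C. \<forall>e \<in> Mor C X X. Cmp C X X X e e = e \<longrightarrow>
      (\<exists>Y \<in> Ob C. \<exists>r \<in> Mor C X Y. \<exists>s \<in> Mor C Y X.
        Cmp C X Y X s r = e \<and> Cmp C Y X Y r s = Idm C Y))"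

definition hom_noetherian :: "('r, 'b) ring_scheme \<Rightarrow> ('r, 'o, 'm, 'z) lincat_scheme \<Rightarrow> bool"
  where "hom_noetherian R C \<longleftrightarrow>
    (\<forall>X \<in> Ob C. \<forall>Y \<in> Ob C. finitely_generated_module R (Hom C X Y))"

definition indecomposable :: "('r, 'o, 'm, 'z) lincat_scheme \<Rightarrow> 'o \<Rightarrow> bool"
  where "indecomposable C X \<longleftrightarrow> X \<in> Ob C \<and> \<not> zero_object C X \<and>
    (\<forall>A B. direct_sum C [A, B] X \<longrightarrow> zero_object C A \<or> zero_object C B)"

definition iso_class :: "('r, 'o, 'm, 'z) lincat_scheme \<Rightarrow> 'o \<Rightarrow> 'o set"
  where "iso_class C X = {Y \<in> Ob C. isomorphic C X Y}"

definition ind :: "('r, 'o, 'm, 'z) lincat_scheme \<Rightarrow> 'o set set"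
  where "ind C = iso_class C ` {X. indecomposable C X}"

definition add_of :: "('r, 'o, 'm, 'z) lincat_scheme \<Rightarrow> 'o \<Rightarrow> 'o set"
  where "add_of C G = {X. \<exists>n Y X'. direct_sum C (replicate n G) Y \<and> direct_sum C [X, X'] Y}"

definition finite_type :: "('r, 'o, 'm, 'z) lincat_scheme \<Rightarrow> bool"
  where "finite_type C \<longleftrightarrow> (\<exists>G \<in> Ob C. Ob C = add_of C G)"

definition weak_cogenerator :: "('r, 'o, 'm, 'z) lincat_scheme \<Rightarrow> 'o \<Rightarrow> bool"
  where "weak_cogenerator C D \<longleftrightarrow> D \<in> Ob C \<and>
    (\<forall>X \<in> Ob C. Mor C X D = {zmor C X D} \<longrightarrow> zero_object C X)"

definition full_subcategory ::
    "('r, 'o, 'm, 'z) lincat_scheme \<Rightarrow> 'o set \<Rightarrow> ('r, 'o, 'm, 'z) lincat_scheme"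
  where "full_subcategory C S = C\<lparr>Ob := S\<rparr>"

definition jacobson_radical :: "('r, 'o, 'm, 'z) lincat_scheme \<Rightarrow> 'o \<Rightarrow> 'o \<Rightarrow> 'm set"
  where "jacobson_radical C X Y = {f \<in> Mor C X Y.
    \<forall>g \<in> Mor C Y X. is_iso C X X (Idm C X \<ominus>\<^bsub>Hom C X X\<^esub> Cmp C X Y X g f)}"

text \<open>The quotient of \<open>C\<close> by an ideal \<open>I\<close>; morphisms are cosets. All summands of each union
  below coincide when \<open>I\<close> is an ideal.\<close>

definition quotient_category ::
    "('r, 'o, 'm, 'z) lincat_scheme \<Rightarrow> ('o \<Rightarrow> 'o \<Rightarrow> 'm set) \<Rightarrow> ('r, 'o, 'm set) lincat"
  where "quotient_category C I = \<lparr>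
    Ob = Ob C,
    Hom = (\<lambda>X Y. \<lparr>
      carrier = a_rcosets\<^bsub>Hom C X Y\<^esub> (I X Y),
      monoid.mult = (\<lambda>_ _. undefined), monoid.one = undefined,
      ring.zero = I X Y,
      ring.add = (\<lambda>A B. A <+>\<^bsub>Hom C X Y\<^esub> B),
      module.smult = (\<lambda>r A. \<Union>a\<in>A. I X Y +>\<^bsub>Hom C X Y\<^esub> (r \<odot>\<^bsub>Hom C X Y\<^esub> a))\<rparr>),
    Cmp = (\<lambda>X Y Z B A. \<Union>b\<in>B. \<Union>a\<in>A. I X Z +>\<^bsub>Hom C X Z\<^esub> Cmp C X Y Z b a),
    Idm = (\<lambda>X. I X X +>\<^bsub>Hom C X X\<^esub> Idm C X)\<rparr>"

definition is_kernel :: "('r, 'o, 'm, 'z) lincat_scheme \<Rightarrow> 'o \<Rightarrow> 'm \<Rightarrow> 'o \<Rightarrow> 'm \<Rightarrow> 'o \<Rightarrow> bool"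
  where "is_kernel C X f Y g Z \<longleftrightarrow> Cmp C X Y Z g f = zmor C X Z \<and>
    (\<forall>W \<in> Ob C. \<forall>h \<in> Mor C W Y. Cmp C W Y Z g h = zmor C W Z \<longrightarrow>
      (\<exists>!u \<in> Mor C W X. Cmp C W X Y f u = h))"

definition is_cokernel :: "('r, 'o, 'm, 'z) lincat_scheme \<Rightarrow> 'o \<Rightarrow> 'm \<Rightarrow> 'o \<Rightarrow> 'm \<Rightarrow> 'o \<Rightarrow> bool"
  where "is_cokernel C X f Y g Z \<longleftrightarrow> Cmp C X Y Z g f = zmor C X Z \<and>
    (\<forall>W \<in> Ob C. \<forall>h \<in> Mor C Y W. Cmp C X Y W h f = zmor C X W \<longrightarrow>
      (\<exists>!u \<in> Mor C Z W. Cmp C Y Z W u g = h))"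

text \<open>The square with sides \<open>f : X \<rightarrow> Y\<close>, \<open>h : X \<rightarrow> X'\<close>, \<open>h' : Y \<rightarrow> Y'\<close>, \<open>f' : X' \<rightarrow> Y'\<close>
  is a pushout.\<close>

definition is_pushout :: "('r, 'o, 'm, 'z) lincat_scheme \<Rightarrow>
    'o \<Rightarrow> 'm \<Rightarrow> 'o \<Rightarrow> 'm \<Rightarrow> 'o \<Rightarrow> 'm \<Rightarrow> 'm \<Rightarrow> 'o \<Rightarrow> bool"
  where "is_pushout C X f Y h X' h' f' Y' \<longleftrightarrow>
    h' \<in> Mor C Y Y' \<and> f' \<in> Mor C X' Y' \<and> Cmp C X Y Y' h' f = Cmp C X X' Y' f' h \<and>
    (\<forall>W \<in> Ob C. \<forall>u \<in> Mor C Y W. \<forall>v \<in> Mor C X' W. Cmp C X Y W u f = Cmp C X X' W v h \<longrightarrow>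
      (\<exists>!w \<in> Mor C Y' W. Cmp C Y Y' W w h' = u \<and> Cmp C X' Y' W w f' = v))"

text \<open>The square with sides \<open>g' : Y' \<rightarrow> Z'\<close>, \<open>h' : Y' \<rightarrow> Y\<close>, \<open>h : Z' \<rightarrow> Z\<close>, \<open>g : Y \<rightarrow> Z\<close>
  is a pullback.\<close>

definition is_pullback :: "('r, 'o, 'm, 'z) lincat_scheme \<Rightarrow>
    'o \<Rightarrow> 'm \<Rightarrow> 'o \<Rightarrow> 'm \<Rightarrow> 'o \<Rightarrow> 'm \<Rightarrow> 'm \<Rightarrow> 'o \<Rightarrow> bool"
  where "is_pullback C Y g Z h Z' h' g' Y' \<longleftrightarrow>
    h' \<in> Mor C Y' Y \<and> g' \<in> Mor C Y' Z' \<and> Cmp C Y' Y Z g h' = Cmp C Y' Z' Z h g' \<and>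
    (\<forall>W \<in> Ob C. \<forall>u \<in> Mor C W Y. \<forall>v \<in> Mor C W Z'. Cmp C W Y Z g u = Cmp C W Z' Z h v \<longrightarrow>
      (\<exists>!w \<in> Mor C W Y'. Cmp C W Y' Y h' w = u \<and> Cmp C W Y' Z' g' w = v))"

section \<open>Exact categories\<close>

text \<open>\<open>conflation E X f Y g Z\<close> means that \<open>0 \<rightarrow> X \<rightarrow> Y \<rightarrow> Z \<rightarrow> 0\<close> with maps \<open>f\<close> and \<open>g\<close> is a
  conflation.\<close>

record ('r, 'o, 'm) excat = "('r, 'o, 'm) lincat" +
  conflation :: "'o \<Rightarrow> 'm \<Rightarrow> 'o \<Rightarrow> 'm \<Rightarrow> 'o \<Rightarrow> bool"

definition inflation :: "('r, 'o, 'm, 'z) excat_scheme \<Rightarrow> 'o \<Rightarrow> 'm \<Rightarrow> 'o \<Rightarrow> bool"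
  where "inflation E X f Y \<longleftrightarrow> (\<exists>g Z. conflation E X f Y g Z)"

definition deflation :: "('r, 'o, 'm, 'z) excat_scheme \<Rightarrow> 'o \<Rightarrow> 'm \<Rightarrow> 'o \<Rightarrow> bool"
  where "deflation E Y g Z \<longleftrightarrow> (\<exists>X f. conflation E X f Y g Z)"

text \<open>Quillen's axioms without the one that Keller showed to be redundant.\<close>

locale exact_category = additive_category R E
  for R :: "('r, 'b) ring_scheme" and E :: "('r, 'o, 'm, 'z) excat_scheme" +
  assumes conflation_objects: "conflation E X f Y g Z \<Longrightarrow> X \<in> Ob E \<and> Y \<in> Ob E \<and> Z \<in> Ob E"
    and conflation_morphisms: "conflation E X f Y g Z \<Longrightarrow> f \<in> Mor E X Y \<and> g \<in> Mor E Y Z"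
    and conflation_kernel: "conflation E X f Y g Z \<Longrightarrow> is_kernel E X f Y g Z"
    and conflation_cokernel: "conflation E X f Y g Z \<Longrightarrow> is_cokernel E X f Y g Z"
    and conflation_iso: "\<lbrakk>conflation E X f Y g Z; X' \<in> Ob E; Y' \<in> Ob E; Z' \<in> Ob E;
        f' \<in> Mor E X' Y'; g' \<in> Mor E Y' Z';
        is_iso E X X' a; is_iso E Y Y' b; is_iso E Z Z' c;
        Cmp E X X' Y' f' a = Cmp E X Y Y' b f; Cmp E Y Y' Z' g' b = Cmp E Y Z Z' c g\<rbrakk>
      \<Longrightarrow> conflation E X' f' Y' g' Z'"
    and inflation_Idm: "X \<in> Ob E \<Longrightarrow> inflation E X (Idm E X) X"
    and deflation_Idm: "X \<in> Ob E \<Longrightarrow> deflation E X (Idm E X) X"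
    and inflation_Cmp: "\<lbrakk>inflation E X f Y; inflation E Y f' Z\<rbrakk>
      \<Longrightarrow> inflation E X (Cmp E X Y Z f' f) Z"
    and deflation_Cmp: "\<lbrakk>deflation E X g Y; deflation E Y g' Z\<rbrakk>
      \<Longrightarrow> deflation E X (Cmp E X Y Z g' g) Z"
    and inflation_pushout: "\<lbrakk>inflation E X f Y; X' \<in> Ob E; h \<in> Mor E X X'\<rbrakk>
      \<Longrightarrow> \<exists>Y' \<in> Ob E. \<exists>h' f'. is_pushout E X f Y h X' h' f' Y' \<and> inflation E X' f' Y'"
    and deflation_pullback: "\<lbrakk>deflation E Y g Z; Z' \<in> Ob E; h \<in> Mor E Z' Z\<rbrakk>
      \<Longrightarrow> \<exists>Y' \<in> Ob E. \<exists>h' g'. is_pullback E Y g Z h Z' h' g' Y' \<and> deflation E Y' g' Z'"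

definition projective :: "('r, 'o, 'm, 'z) excat_scheme \<Rightarrow> 'o \<Rightarrow> bool"
  where "projective E Q \<longleftrightarrow> Q \<in> Ob E \<and>
    (\<forall>Y g Z. deflation E Y g Z \<longrightarrow> (\<forall>h \<in> Mor E Q Z. \<exists>u \<in> Mor E Q Y. Cmp E Q Y Z g u = h))"

definition injective :: "('r, 'o, 'm, 'z) excat_scheme \<Rightarrow> 'o \<Rightarrow> bool"
  where "injective E Q \<longleftrightarrow> Q \<in> Ob E \<and>
    (\<forall>X f Y. inflation E X f Y \<longrightarrow> (\<forall>h \<in> Mor E X Q. \<exists>u \<in> Mor E Y Q. Cmp E X Y Q u f = h))"

definition enough_projectives :: "('r, 'o, 'm, 'z) excat_scheme \<Rightarrow> bool"
  where "enough_projectives E \<longleftrightarrow>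
    (\<forall>X \<in> Ob E. \<exists>Q g. projective E Q \<and> deflation E Q g X)"

definition projective_generator :: "('r, 'o, 'm, 'z) excat_scheme \<Rightarrow> 'o \<Rightarrow> bool"
  where "projective_generator E P \<longleftrightarrow>
    P \<in> Ob E \<and> enough_projectives E \<and> {Q. projective E Q} = add_of E P"

definition projective_ideal :: "('r, 'o, 'm, 'z) excat_scheme \<Rightarrow> 'o \<Rightarrow> 'o \<Rightarrow> 'm set"
  where "projective_ideal E X Y = {f \<in> Mor E X Y.
    \<exists>Q. projective E Q \<and> (\<exists>a \<in> Mor E X Q. \<exists>b \<in> Mor E Q Y. f = Cmp E X Q Y b a)}"

definition stable_category :: "('r, 'o, 'm, 'z) excat_scheme \<Rightarrow> ('r, 'o, 'm set) lincat"
  where "stable_category E = quotient_category E (projective_ideal E)"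

text \<open>\<open>W\<close> is a value of the syzygy functor at \<open>X\<close>; that value is only determined up to
  isomorphism in the stable category.\<close>

definition is_syzygy :: "('r, 'o, 'm, 'z) excat_scheme \<Rightarrow> 'o \<Rightarrow> 'o \<Rightarrow> bool"
  where "is_syzygy E X W \<longleftrightarrow> (\<exists>Q f g. projective E Q \<and> conflation E W f Q g X)"

definition Omega :: "('r, 'o, 'm, 'z) excat_scheme \<Rightarrow> ('r, 'o, 'm, 'z) excat_scheme"
  where "Omega E = full_subcategory E
    {X \<in> Ob E. \<exists>Q f. projective E Q \<and> inflation E X f Q}"

definition Omega_stable :: "('r, 'o, 'm, 'z) excat_scheme \<Rightarrow> ('r, 'o, 'm set) lincat"
  where "Omega_stable E = full_subcategory (stable_category E)
    {Y \<in> Ob E. \<exists>X W. is_syzygy E X W \<and> isomorphic (stable_category E) W Y}"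

section \<open>Effaceable functors\<close>

text \<open>Additive contravariant functors to abelian groups, the latter written multiplicatively as in the
  library's group records. For \<open>f : X \<rightarrow> Y\<close>, the induced map from \<open>FOb M Y\<close> to \<open>FOb M X\<close> is
  \<open>FMap M X Y f\<close>.\<close>

record ('o, 'm, 'g) cofunctor =
  FOb :: "'o \<Rightarrow> 'g monoid"
  FMap :: "'o \<Rightarrow> 'o \<Rightarrow> 'm \<Rightarrow> 'g \<Rightarrow> 'g"

definition additive_functors :: "('r, 'o, 'm, 'z) lincat_scheme \<Rightarrow> ('o, 'm, 'g) cofunctor set"
  where "additive_functors C = {M.
    (\<forall>X \<in> Ob C. comm_group (FOb M X)) \<and>
    (\<forall>X \<in> Ob C. \<forall>Y \<in> Ob C. \<forall>f \<in> Mor C X Y. FMap M X Y f \<in> hom (FOb M Y) (FOb M X)) \<and>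
    (\<forall>X \<in> Ob C. \<forall>x \<in> carrier (FOb M X). FMap M X X (Idm C X) x = x) \<and>
    (\<forall>X \<in> Ob C. \<forall>Y \<in> Ob C. \<forall>Z \<in> Ob C. \<forall>f \<in> Mor C X Y. \<forall>g \<in> Mor C Y Z.
      \<forall>z \<in> carrier (FOb M Z). FMap M X Z (Cmp C X Y Z g f) z = FMap M X Y f (FMap M Y Z g z)) \<and>
    (\<forall>X \<in> Ob C. \<forall>Y \<in> Ob C. \<forall>f \<in> Mor C X Y. \<forall>g \<in> Mor C X Y. \<forall>y \<in> carrier (FOb M Y).
      FMap M X Y (f \<oplus>\<^bsub>Hom C X Y\<^esub> g) y = FMap M X Y f y \<otimes>\<^bsub>FOb M X\<^esub> FMap M X Y g y)}"

text \<open>\<open>\<eta>\<close> is the natural epimorphism from the functor represented by \<open>Z\<close> onto \<open>M\<close>; exactness of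
  the presentation is tested pointwise.\<close>

definition eff :: "('r, 'o, 'm, 'z) excat_scheme \<Rightarrow> ('o, 'm, 'g) cofunctor set"
  where "eff E = {M \<in> additive_functors E. \<exists>Y f Z \<eta>. deflation E Y f Z \<and>
    (\<forall>W \<in> Ob E. \<eta> W \<in> hom (add_monoid (Hom E W Z)) (FOb M W)) \<and>
    (\<forall>V \<in> Ob E. \<forall>W \<in> Ob E. \<forall>u \<in> Mor E V W. \<forall>h \<in> Mor E W Z.
      \<eta> V (Cmp E V W Z h u) = FMap M V W u (\<eta> W h)) \<and>
    (\<forall>W \<in> Ob E. \<eta> W ` Mor E W Z = carrier (FOb M W)) \<and>
    (\<forall>W \<in> Ob E. kernel (add_monoid (Hom E W Z)) (FOb M W) (\<eta> W) = Cmp E W Y Z f ` Mor E W Y)}"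

text \<open>For effaceable \<open>M\<close> the condition does not depend on the representative \<open>X\<close> of the stable
  isomorphism class \<open>c\<close>.\<close>

definition supp :: "('r, 'o, 'm, 'z) excat_scheme \<Rightarrow> ('o, 'm, 'g) cofunctor \<Rightarrow> 'o set set"
  where "supp E M = {c \<in> ind (stable_category E). \<exists>X \<in> c. \<not> trivial_group (FOb M X)}"

section \<open>AR conflations and Grothendieck groups\<close>

definition right_almost_split :: "('r, 'o, 'm, 'z) lincat_scheme \<Rightarrow> 'o \<Rightarrow> 'm \<Rightarrow> 'o \<Rightarrow> bool"
  where "right_almost_split C Y g Z \<longleftrightarrow>
    Y \<in> Ob C \<and> indecomposable C Z \<and> g \<in> jacobson_radical C Y Z \<and>
    (\<forall>W \<in> Ob C. \<forall>h \<in> jacobson_radical C W Z. \<exists>u \<in> Mor C W Y. h = Cmp C W Y Z g u)"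

definition left_almost_split :: "('r, 'o, 'm, 'z) lincat_scheme \<Rightarrow> 'o \<Rightarrow> 'm \<Rightarrow> 'o \<Rightarrow> bool"
  where "left_almost_split C X f Y \<longleftrightarrow>
    Y \<in> Ob C \<and> indecomposable C X \<and> f \<in> jacobson_radical C X Y \<and>
    (\<forall>W \<in> Ob C. \<forall>h \<in> jacobson_radical C X W. \<exists>u \<in> Mor C Y W. h = Cmp C X Y W u f)"

definition AR_conflation ::
    "('r, 'o, 'm, 'z) excat_scheme \<Rightarrow> 'o \<Rightarrow> 'm \<Rightarrow> 'o \<Rightarrow> 'm \<Rightarrow> 'o \<Rightarrow> bool"
  where "AR_conflation E X f Y g Z \<longleftrightarrow>
    conflation E X f Y g Z \<and> left_almost_split E X f Y \<and> right_almost_split E Y g Z"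

definition has_AR_conflations :: "('r, 'o, 'm, 'z) excat_scheme \<Rightarrow> bool"
  where "has_AR_conflations E \<longleftrightarrow>
    (\<forall>Z. indecomposable E Z \<and> \<not> projective E Z \<longrightarrow> (\<exists>X f Y g. AR_conflation E X f Y g Z)) \<and>
    (\<forall>X. indecomposable E X \<and> \<not> injective E X \<longrightarrow> (\<exists>f Y g Z. AR_conflation E X f Y g Z))"

definition K0_split :: "('r, 'o, 'm, 'z) lincat_scheme \<Rightarrow> ('o set \<Rightarrow>\<^sub>0 int) monoid"
  where "K0_split C = free_Abelian_group (ind C)"

text \<open>Well defined when \<open>C\<close> is Krull-Schmidt.\<close>

definition K0_class :: "('r, 'o, 'm, 'z) lincat_scheme \<Rightarrow> 'o \<Rightarrow> 'o set \<Rightarrow>\<^sub>0 int"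
  where "K0_class C X = (THE v. \<exists>Xs. (\<forall>Y \<in> set Xs. indecomposable C Y) \<and> direct_sum C Xs X \<and>
    v = (\<Sum>Y\<leftarrow>Xs. frag_of (iso_class C Y)))"

definition Ex_group :: "('r, 'o, 'm, 'z) excat_scheme \<Rightarrow> ('o set \<Rightarrow>\<^sub>0 int) set"
  where "Ex_group E = generate (K0_split E)
    {K0_class E X - K0_class E Y + K0_class E Z | X f Y g Z. conflation E X f Y g Z}"

definition AR_group :: "('r, 'o, 'm, 'z) excat_scheme \<Rightarrow> ('o set \<Rightarrow>\<^sub>0 int) set"
  where "AR_group E = generate (K0_split E)
    {K0_class E X - K0_class E Y + K0_class E Z | X f Y g Z. AR_conflation E X f Y g Z}"

text \<open>For a free abelian group on \<open>S\<close>, its tensor product with the rationals is the rational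
  vector space on \<open>S\<close>, where \<open>pure_tensor a q\<close> is the element \<open>a \<otimes> q\<close>. For a subgroup \<open>A\<close>,
  \<open>tensor_rat A\<close> is the subspace \<open>A \<otimes> \<rat>\<close>, i.e. the set of finite sums of pure tensors.\<close>

definition pure_tensor :: "('a \<Rightarrow>\<^sub>0 int) \<Rightarrow> rat \<Rightarrow> ('a \<Rightarrow>\<^sub>0 rat)"
  where "pure_tensor a q = Poly_Mapping.map (\<lambda>n. of_int n * q) a"

definition tensor_rat :: "('a \<Rightarrow>\<^sub>0 int) set \<Rightarrow> ('a \<Rightarrow>\<^sub>0 rat) set"
  where "tensor_rat A = {\<Sum>a\<in>S. pure_tensor a (q a) | S q. finite S \<and> S \<subseteq> A}"

end

theory Submission
  imports Defs "HOL-Library.Extended_Nat"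
begin

text \<open>For a conflation \<open>0 \<rightarrow> U \<rightarrow> Q \<rightarrow> V \<rightarrow> 0\<close> with \<open>Q\<close> projective, the length of \<open>Ext\<^sup>1(V, X)\<close> is an
  additive function of \<open>X\<close>. It is finite: every nonzero class in \<open>Ext\<^sup>1(V, X)\<close> pulls back to the
  class of the AR conflation starting at \<open>X\<close>, which by Krull's intersection theorem is not divisible
  by high powers of an element of the maximal ideal. For a conflation \<open>0 \<rightarrow> X \<rightarrow> Y \<rightarrow> Z \<rightarrow> 0\<close> presenting an
  effaceable functor \<open>M\<close>, the long exact sequence shows that the value of this function on
  \<open>[X] - [Y] + [Z]\<close> is the length of \<open>M(V)\<close> plus the length of \<open>M(U)\<close>. By assumption some
  multiple of \<open>[X] - [Y] + [Z]\<close> is a combination of finitely many AR conflations, ending at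
  \<open>W\<^sub>1, \<dots>, W\<^sub>n\<close> say, and their functors are supported at the \<open>W\<^sub>j\<close>. So if \<open>M(U) \<noteq> 0\<close>, then some
  \<open>W\<^sub>j\<close> is a direct summand of \<open>U\<close> or of \<open>V\<close>. Taking \<open>V\<close> indecomposable, it follows that in the
  stable category some \<open>W\<^sub>j\<close> or \<open>\<Omega>W\<^sub>j\<close> is a direct summand of \<open>U = \<Omega>V\<close>. The second claim is the case
  \<open>M = \<close> stable \<open>Hom(-, D)\<close> for a weak cogenerator \<open>D\<close>.\<close>

section \<open>Length of modules\<close>

text \<open>Hom modules over R may have infinite length, so the functional cannot be the length of
  Hom(V, -); the finiteness of Ext^1(V, -) is where the existence of AR conflations is used. Its
  value on a conflation is a sum of two lengths, so no cancellation can hide M(U) \<noteq> 0.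

  There is a reason why only syzygies are reached. A nonzero value yields some W as a summand of V
  or of U = \<Omega>V. If M(V) \<noteq> 0, a summand W of \<Omega>V says too little about V. If M(U)
  \<noteq> 0 and V is indecomposable, both cases exhibit a stable summand of U from the finite list
  of all W and \<Omega>W.

  Two foundations are needed. Classes in the Grothendieck group presuppose the Krull-Schmidt
  property, which rests on lifting idempotents modulo the maximal ideal; this is where completeness
  enters. And summands in the stable category are compared through honest summands of X \<oplus> Q
  with Q projective, since idempotents are known to split in the exact category only.\<close>

definition mstep :: "('r, 'b) ring_scheme \<Rightarrow> ('r, 'm, 'c) module_scheme \<Rightarrow> ('m set \<times> 'm set) set"
  where "mstep R M = {(A, B). submodule A R M \<and> submodule B R M \<and> A \<subset> B}"

text \<open>The length of B / A, as the supremum over strict chains of submodules from A to B.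
  Working with intervals of submodules keeps quotient modules out of the argument; values in
  \<open>enat\<close> allow infinite length.\<close>

definition mlen ::
    "('r, 'b) ring_scheme \<Rightarrow> ('r, 'm, 'c) module_scheme \<Rightarrow> 'm set \<Rightarrow> 'm set \<Rightarrow> enat"
  where "mlen R M A B = Sup {enat n | n. (A, B) \<in> mstep R M ^^ n}"

definition linear_map ::
    "('r, 'b) ring_scheme \<Rightarrow> ('r, 'm, 'c) module_scheme \<Rightarrow> ('r, 'n, 'd) module_scheme \<Rightarrow>
      ('m \<Rightarrow> 'n) \<Rightarrow> bool"
  where "linear_map R M N h \<longleftrightarrow> h \<in> carrier M \<rightarrow> carrier N \<and>
    (\<forall>x\<in>carrier M. \<forall>y\<in>carrier M. h (x \<oplus>\<^bsub>M\<^esub> y) = h x \<oplus>\<^bsub>N\<^esub> h y) \<and>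
    (\<forall>a\<in>carrier R. \<forall>x\<in>carrier M. h (a \<odot>\<^bsub>M\<^esub> x) = a \<odot>\<^bsub>N\<^esub> h x)"

section \<open>The lattice of submodules, chains and length\<close>

context module
begin

lemma submodule_iff:
  "submodule N R M \<longleftrightarrow> N \<subseteq> carrier M \<and> \<zero>\<^bsub>M\<^esub> \<in> N \<and> (\<forall>x\<in>N. \<forall>y\<in>N. x \<oplus>\<^bsub>M\<^esub> y \<in> N) \<and>
    (\<forall>a\<in>carrier R. \<forall>x\<in>N. a \<odot>\<^bsub>M\<^esub> x \<in> N)"
proof
  assume N: "submodule N R M"
  then obtain x where x: "x \<in> N" using submoduleE(2) by blast
  then have "\<zero> \<odot>\<^bsub>M\<^esub> x \<in> N" using submoduleE(4)[OF N] by blast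
  moreover have "x \<in> carrier M" using x submoduleE(1)[OF N] by blast
  ultimately have "\<zero>\<^bsub>M\<^esub> \<in> N" by simp
  then show "N \<subseteq> carrier M \<and> \<zero>\<^bsub>M\<^esub> \<in> N \<and> (\<forall>x\<in>N. \<forall>y\<in>N. x \<oplus>\<^bsub>M\<^esub> y \<in> N) \<and>
    (\<forall>a\<in>carrier R. \<forall>x\<in>N. a \<odot>\<^bsub>M\<^esub> x \<in> N)" using submoduleE[OF N] by blast
next
  assume N: "N \<subseteq> carrier M \<and> \<zero>\<^bsub>M\<^esub> \<in> N \<and> (\<forall>x\<in>N. \<forall>y\<in>N. x \<oplus>\<^bsub>M\<^esub> y \<in> N) \<and>
    (\<forall>a\<in>carrier R. \<forall>x\<in>N. a \<odot>\<^bsub>M\<^esub> x \<in> N)"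
  show "submodule N R M"
  proof (rule submoduleI)
    fix a assume a: "a \<in> N"
    then have "(\<ominus> \<one>) \<odot>\<^bsub>M\<^esub> a \<in> N" using N by blast
    moreover have "a \<in> carrier M" using a N by blast
    ultimately show "\<ominus>\<^bsub>M\<^esub> a \<in> N" using smult_l_minus[of \<one> a] by simp
  qed (use N in blast)+
qed

lemma
  assumes "submodule N R M"
  shows sm_subset: "N \<subseteq> carrier M"
    and sm_carrier: "x \<in> N \<Longrightarrow> x \<in> carrier M"
    and sm_zero: "\<zero>\<^bsub>M\<^esub> \<in> N"
    and sm_add: "\<lbrakk>x \<in> N; y \<in> N\<rbrakk> \<Longrightarrow> x \<oplus>\<^bsub>M\<^esub> y \<in> N"
    and sm_smult: "\<lbrakk>a \<in> carrier R; x \<in> N\<rbrakk> \<Longrightarrow> a \<odot>\<^bsub>M\<^esub> x \<in> N"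
    and sm_neg: "x \<in> N \<Longrightarrow> \<ominus>\<^bsub>M\<^esub> x \<in> N"
    and sm_minus: "\<lbrakk>x \<in> N; y \<in> N\<rbrakk> \<Longrightarrow> x \<ominus>\<^bsub>M\<^esub> y \<in> N"
  using assms submoduleE[OF assms] unfolding submodule_iff by (auto simp: a_minus_def)

lemma sm_add_cancel:
  assumes N: "submodule N R M" and "x \<in> carrier M" "y \<in> N"
  shows "x \<oplus>\<^bsub>M\<^esub> y \<in> N \<longleftrightarrow> x \<in> N" "y \<oplus>\<^bsub>M\<^esub> x \<in> N \<longleftrightarrow> x \<in> N"
    "x \<ominus>\<^bsub>M\<^esub> y \<in> N \<longleftrightarrow> x \<in> N" "y \<ominus>\<^bsub>M\<^esub> x \<in> N \<longleftrightarrow> x \<in> N"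
proof -
  have yc: "y \<in> carrier M" using assms sm_carrier by blast
  have "x = (x \<oplus>\<^bsub>M\<^esub> y) \<ominus>\<^bsub>M\<^esub> y" "x = (x \<ominus>\<^bsub>M\<^esub> y) \<oplus>\<^bsub>M\<^esub> y" "x = y \<ominus>\<^bsub>M\<^esub> (y \<ominus>\<^bsub>M\<^esub> x)"
    using assms(2) yc
    by (simp_all add: a_minus_def M.a_assoc M.r_neg M.l_neg M.minus_add M.r_neg1 M.r_neg2)
  then show c: "x \<oplus>\<^bsub>M\<^esub> y \<in> N \<longleftrightarrow> x \<in> N" "x \<ominus>\<^bsub>M\<^esub> y \<in> N \<longleftrightarrow> x \<in> N"
    "y \<ominus>\<^bsub>M\<^esub> x \<in> N \<longleftrightarrow> x \<in> N"
    using sm_add[OF N] sm_minus[OF N] assms(3) by metis+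
  then show "y \<oplus>\<^bsub>M\<^esub> x \<in> N \<longleftrightarrow> x \<in> N" using M.a_comm assms(2) yc by simp
qed

lemma submodule_carrier: "submodule (carrier M) R M"
  by (rule carrier_is_submodule)

lemma submodule_zero: "submodule {\<zero>\<^bsub>M\<^esub>} R M"
  unfolding submodule_iff by auto

lemma submodule_Int: "\<lbrakk>submodule A R M; submodule B R M\<rbrakk> \<Longrightarrow> submodule (A \<inter> B) R M"
  unfolding submodule_iff by auto

lemma mem_msum: "x \<in> A <+>\<^bsub>M\<^esub> B \<longleftrightarrow> (\<exists>a\<in>A. \<exists>b\<in>B. x = a \<oplus>\<^bsub>M\<^esub> b)"
  by (auto simp: set_add_def')

lemma submodule_msum:
  assumes A: "submodule A R M" and B: "submodule B R M"
  shows "submodule (A <+>\<^bsub>M\<^esub> B) R M"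
  unfolding submodule_iff
proof (intro conjI ballI subsetI)
  fix x assume "x \<in> A <+>\<^bsub>M\<^esub> B"
  then show "x \<in> carrier M" using sm_carrier[OF A] sm_carrier[OF B] by (auto simp: mem_msum)
next
  show "\<zero>\<^bsub>M\<^esub> \<in> A <+>\<^bsub>M\<^esub> B" unfolding mem_msum
    using sm_zero[OF A] sm_zero[OF B] M.l_zero[OF M.zero_closed] by metis
next
  fix x y assume "x \<in> A <+>\<^bsub>M\<^esub> B" "y \<in> A <+>\<^bsub>M\<^esub> B"
  then obtain a b a' b' where *: "a \<in> A" "b \<in> B" "x = a \<oplus>\<^bsub>M\<^esub> b" "a' \<in> A" "b' \<in> B" "y = a' \<oplus>\<^bsub>M\<^esub> b'"
    by (auto simp: mem_msum)
  then have "x \<oplus>\<^bsub>M\<^esub> y = (a \<oplus>\<^bsub>M\<^esub> a') \<oplus>\<^bsub>M\<^esub> (b \<oplus>\<^bsub>M\<^esub> b')"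
    using sm_carrier[OF A] sm_carrier[OF B] by (simp add: M.a_ac)
  then show "x \<oplus>\<^bsub>M\<^esub> y \<in> A <+>\<^bsub>M\<^esub> B" unfolding mem_msum
    using * sm_add[OF A] sm_add[OF B] by blast
next
  fix c x assume c: "c \<in> carrier R" and "x \<in> A <+>\<^bsub>M\<^esub> B"
  then obtain a b where *: "a \<in> A" "b \<in> B" "x = a \<oplus>\<^bsub>M\<^esub> b" by (auto simp: mem_msum)
  then have "c \<odot>\<^bsub>M\<^esub> x = c \<odot>\<^bsub>M\<^esub> a \<oplus>\<^bsub>M\<^esub> c \<odot>\<^bsub>M\<^esub> b"
    using c sm_carrier[OF A] sm_carrier[OF B] by (simp add: smult_r_distr)
  then show "c \<odot>\<^bsub>M\<^esub> x \<in> A <+>\<^bsub>M\<^esub> B" unfolding mem_msum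
    using * c sm_smult[OF A] sm_smult[OF B] by blast
qed

lemma msum_upper1:
  assumes "submodule A R M" "submodule B R M" shows "A \<subseteq> A <+>\<^bsub>M\<^esub> B"
proof
  fix x assume x: "x \<in> A"
  then have "x = x \<oplus>\<^bsub>M\<^esub> \<zero>\<^bsub>M\<^esub>" using sm_carrier[OF assms(1)] by simp
  then show "x \<in> A <+>\<^bsub>M\<^esub> B" unfolding mem_msum using x sm_zero[OF assms(2)] by blast
qed

lemma msum_upper2:
  assumes "submodule A R M" "submodule B R M" shows "B \<subseteq> A <+>\<^bsub>M\<^esub> B"
proof
  fix x assume x: "x \<in> B"
  then have "x = \<zero>\<^bsub>M\<^esub> \<oplus>\<^bsub>M\<^esub> x" using sm_carrier[OF assms(2)] by simp
  then show "x \<in> A <+>\<^bsub>M\<^esub> B" unfolding mem_msum using x sm_zero[OF assms(1)] by blast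
qed

lemma msum_least: "\<lbrakk>submodule C R M; A \<subseteq> C; B \<subseteq> C\<rbrakk> \<Longrightarrow> A <+>\<^bsub>M\<^esub> B \<subseteq> C"
  using sm_add by (force simp: mem_msum)

lemma msum_mono: "\<lbrakk>A \<subseteq> A'; B \<subseteq> B'\<rbrakk> \<Longrightarrow> A <+>\<^bsub>M\<^esub> B \<subseteq> A' <+>\<^bsub>M\<^esub> B'"
  unfolding subset_iff mem_msum by blast

lemma msum_commute:
  assumes "submodule A R M" "submodule B R M" shows "A <+>\<^bsub>M\<^esub> B = B <+>\<^bsub>M\<^esub> A"
  by (intro equalityI msum_least submodule_msum msum_upper1 msum_upper2 assms)

lemma msum_absorb:
  assumes "submodule A R M" "submodule B R M" "A \<subseteq> B" shows "A <+>\<^bsub>M\<^esub> B = B" "B <+>\<^bsub>M\<^esub> A = B"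
  using msum_least[of B A B] msum_least[of B B A] msum_upper2[of A B] msum_upper1[of B A] assms by blast+

lemma modular_strict:
  assumes A: "submodule A R M" and B: "submodule B R M" and N: "submodule N R M"
    and "A \<subseteq> B" "A \<inter> N = B \<inter> N" "A <+>\<^bsub>M\<^esub> N = B <+>\<^bsub>M\<^esub> N"
  shows "A = B"
proof
  show "B \<subseteq> A"
  proof
    fix b assume b: "b \<in> B"
    then have "b \<in> A <+>\<^bsub>M\<^esub> N" using msum_upper1[OF B N] assms by blast
    then obtain a n where an: "a \<in> A" "n \<in> N" "b = a \<oplus>\<^bsub>M\<^esub> n" by (auto simp: mem_msum)
    then have "n \<in> B" using b assms(4) sm_add_cancel(2)[OF B, of n a] sm_carrier[OF N] by blast
    then have "n \<in> A" using an assms(5) by blast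
    then show "b \<in> A" using an sm_add[OF A] by blast
  qed
qed fact

definition span1 :: "'c \<Rightarrow> 'c set"
  where "span1 x = (\<lambda>a. a \<odot>\<^bsub>M\<^esub> x) ` carrier R"

lemma submodule_span1:
  assumes x: "x \<in> carrier M" shows "submodule (span1 x) R M"
  unfolding submodule_iff span1_def
proof (intro conjI ballI)
  show "\<zero>\<^bsub>M\<^esub> \<in> (\<lambda>a. a \<odot>\<^bsub>M\<^esub> x) ` carrier R"
    using x by (intro image_eqI[of _ _ \<zero>]) auto
next
  fix y z assume "y \<in> (\<lambda>a. a \<odot>\<^bsub>M\<^esub> x) ` carrier R" "z \<in> (\<lambda>a. a \<odot>\<^bsub>M\<^esub> x) ` carrier R"
  then obtain a b where "a \<in> carrier R" "b \<in> carrier R" "y = a \<odot>\<^bsub>M\<^esub> x" "z = b \<odot>\<^bsub>M\<^esub> x" by auto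
  then show "y \<oplus>\<^bsub>M\<^esub> z \<in> (\<lambda>a. a \<odot>\<^bsub>M\<^esub> x) ` carrier R"
    using x by (intro image_eqI[of _ _ "a \<oplus> b"]) (auto simp: smult_l_distr)
next
  fix c y assume "c \<in> carrier R" "y \<in> (\<lambda>a. a \<odot>\<^bsub>M\<^esub> x) ` carrier R"
  then obtain a where "a \<in> carrier R" "y = a \<odot>\<^bsub>M\<^esub> x" by auto
  then show "c \<odot>\<^bsub>M\<^esub> y \<in> (\<lambda>a. a \<odot>\<^bsub>M\<^esub> x) ` carrier R"
    using x \<open>c \<in> carrier R\<close> by (intro image_eqI[of _ _ "c \<otimes> a"]) (auto simp: smult_assoc1)
qed (use x in auto)

lemma span1_self: "x \<in> carrier M \<Longrightarrow> x \<in> span1 x"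
  unfolding span1_def by (rule image_eqI[of _ _ \<one>]) auto

lemma span1_least: "\<lbrakk>submodule N R M; x \<in> N\<rbrakk> \<Longrightarrow> span1 x \<subseteq> N"
  unfolding span1_def using sm_smult by blast

lemma mem_msum_span1:
  "y \<in> N <+>\<^bsub>M\<^esub> span1 x \<longleftrightarrow> (\<exists>n\<in>N. \<exists>a\<in>carrier R. y = n \<oplus>\<^bsub>M\<^esub> a \<odot>\<^bsub>M\<^esub> x)"
  by (auto simp: mem_msum span1_def)

lemma mstep_relpow_mono: "(A, B) \<in> mstep R M ^^ n \<Longrightarrow> A \<subseteq> B"
  by (induction n arbitrary: B) (auto simp: mstep_def)

lemma mstep_relpow_transport:
  assumes "(A, B) \<in> mstep R M ^^ n"
    and "\<And>X Y. \<lbrakk>submodule X R M; submodule Y R M; A \<subseteq> X; X \<subset> Y; Y \<subseteq> B\<rbrakk> \<Longrightarrow> (F X, F Y) \<in> mstep R' M'"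
  shows "(F A, F B) \<in> mstep R' M' ^^ n"
  using assms
proof (induction n arbitrary: B)
  case (Suc n)
  from Suc.prems(1) obtain C where C: "(A, C) \<in> mstep R M ^^ n" "(C, B) \<in> mstep R M" by auto
  have "A \<subseteq> C" using C(1) by (rule mstep_relpow_mono)
  have "(F A, F C) \<in> mstep R' M' ^^ n"
    using C by (intro Suc.IH Suc.prems(2)) (auto simp: mstep_def)
  moreover have "(F C, F B) \<in> mstep R' M'"
    using C(2) \<open>A \<subseteq> C\<close> by (intro Suc.prems(2)) (auto simp: mstep_def)
  ultimately show ?case by auto
qed simp

text \<open>Inequalities between lengths come from any operation on submodules that is strictly
  monotone between \<open>A\<close> and \<open>B\<close>. Below it is an image, a preimage, or the
  sum or intersection with a fixed submodule.\<close>

lemma mlen_transport: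
  assumes "\<And>X Y. \<lbrakk>submodule X R M; submodule Y R M; A \<subseteq> X; X \<subset> Y; Y \<subseteq> B\<rbrakk> \<Longrightarrow> (F X, F Y) \<in> mstep R' M'"
    and "F A = A'" "F B = B'"
  shows "mlen R M A B \<le> mlen R' M' A' B'"
  unfolding mlen_def using mstep_relpow_transport[where F = F] assms
  by (intro Sup_subset_mono) fastforce

lemma relpow_mlen: "(A, B) \<in> mstep R M ^^ n \<Longrightarrow> enat n \<le> mlen R M A B"
  unfolding mlen_def by (intro Sup_upper) auto

lemma mlen_le: "(\<And>n. (A, B) \<in> mstep R M ^^ n \<Longrightarrow> enat n \<le> c) \<Longrightarrow> mlen R M A B \<le> c"
  unfolding mlen_def by (intro Sup_least) auto

lemma mlen_refl [simp]: "mlen R M A A = 0"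
proof -
  have "n = 0" if "(A, A) \<in> mstep R M ^^ n" for n
  proof (cases n)
    case (Suc k)
    with that obtain C where "(A, C) \<in> mstep R M ^^ k" "(C, A) \<in> mstep R M" by auto
    then show ?thesis using mstep_relpow_mono[of A C k] by (auto simp: mstep_def)
  qed simp
  then have "mlen R M A A \<le> 0" by (intro mlen_le) (auto simp: zero_enat_def)
  then show ?thesis by simp
qed

lemma mlen_eq_0_iff:
  assumes "submodule A R M" "submodule B R M" "A \<subseteq> B"
  shows "mlen R M A B = 0 \<longleftrightarrow> A = B"
proof
  assume "mlen R M A B = 0"
  moreover have "(A, B) \<in> mstep R M ^^ 1" if "A \<noteq> B" using that assms by (auto simp: mstep_def)
  ultimately show "A = B" using relpow_mlen[of A B 1] by (auto simp: one_enat_def zero_enat_def)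
qed simp

text \<open>Intersect the chain with N, and add N to it. By the modular law a strict step stays
  strict in at least one of the two new chains, so their lengths add up to at least n.\<close>

lemma relpow_split:
  assumes "(A, B) \<in> mstep R M ^^ n" "submodule A R M" "submodule N R M"
  shows "\<exists>a b. n \<le> a + b \<and> (A \<inter> N, B \<inter> N) \<in> mstep R M ^^ a \<and>
    (A <+>\<^bsub>M\<^esub> N, B <+>\<^bsub>M\<^esub> N) \<in> mstep R M ^^ b"
  using assms(1)
proof (induction n arbitrary: B)
  case 0
  then show ?case by (intro exI[of _ 0]) auto
next
  case (Suc n)
  from Suc.prems(1) obtain C where C: "(A, C) \<in> mstep R M ^^ n" "(C, B) \<in> mstep R M" by auto
  from Suc.IH[OF C(1)] obtain a b where ab: "n \<le> a + b" "(A \<inter> N, C \<inter> N) \<in> mstep R M ^^ a"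
    "(A <+>\<^bsub>M\<^esub> N, C <+>\<^bsub>M\<^esub> N) \<in> mstep R M ^^ b" by blast
  have CB: "submodule C R M" "submodule B R M" "C \<subset> B" using C(2) by (auto simp: mstep_def)
  have sub: "C \<inter> N \<subseteq> B \<inter> N" "C <+>\<^bsub>M\<^esub> N \<subseteq> B <+>\<^bsub>M\<^esub> N" using CB msum_mono by blast+
  have sm: "submodule (C \<inter> N) R M" "submodule (B \<inter> N) R M" "submodule (C <+>\<^bsub>M\<^esub> N) R M"
    "submodule (B <+>\<^bsub>M\<^esub> N) R M" using CB assms submodule_Int submodule_msum by blast+
  define a' where "a' = (if C \<inter> N = B \<inter> N then a else Suc a)"
  define b' where "b' = (if C <+>\<^bsub>M\<^esub> N = B <+>\<^bsub>M\<^esub> N then b else Suc b)"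
  have "(A \<inter> N, B \<inter> N) \<in> mstep R M ^^ a'"
    using ab(2) sub(1) sm unfolding a'_def by (auto simp: mstep_def)
  moreover have "(A <+>\<^bsub>M\<^esub> N, B <+>\<^bsub>M\<^esub> N) \<in> mstep R M ^^ b'"
    using ab(3) sub(2) sm unfolding b'_def by (auto simp: mstep_def)
  moreover have "Suc n \<le> a' + b'"
    using ab(1) modular_strict[OF CB(1,2) assms(3)] CB(3) unfolding a'_def b'_def by auto
  ultimately show ?case by blast
qed

lemma mlen_add:
  assumes A: "submodule A R M" and B: "submodule B R M" and C: "submodule C R M"
    and "A \<subseteq> B" "B \<subseteq> C"
  shows "mlen R M A C = mlen R M A B + mlen R M B C"
proof (rule antisym)
  show "mlen R M A C \<le> mlen R M A B + mlen R M B C"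
  proof (rule mlen_le)
    fix n assume "(A, C) \<in> mstep R M ^^ n"
    from relpow_split[OF this A B] obtain a b where ab: "n \<le> a + b"
      "(A \<inter> B, C \<inter> B) \<in> mstep R M ^^ a" "(A <+>\<^bsub>M\<^esub> B, C <+>\<^bsub>M\<^esub> B) \<in> mstep R M ^^ b" by blast
    have "A \<inter> B = A" "C \<inter> B = B" "A <+>\<^bsub>M\<^esub> B = B" "C <+>\<^bsub>M\<^esub> B = C"
      using assms msum_absorb by blast+
    then have "enat a \<le> mlen R M A B" "enat b \<le> mlen R M B C" using ab relpow_mlen by simp_all
    then have "enat a + enat b \<le> mlen R M A B + mlen R M B C" by (rule add_mono)
    moreover have "enat n \<le> enat a + enat b" using ab(1) by simp
    ultimately show "enat n \<le> mlen R M A B + mlen R M B C" by (rule order_trans[rotated])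
  qed
next
  have ne: "\<exists>n. (X, Y) \<in> mstep R M ^^ n" if "submodule X R M" "submodule Y R M" "X \<subseteq> Y" for X Y
  proof (cases "X = Y")
    case False
    then have "(X, Y) \<in> mstep R M ^^ 1" using that by (auto simp: mstep_def)
    then show ?thesis by blast
  qed (auto intro: exI[of _ 0])
  have *: "enat m + enat n \<le> mlen R M A C"
    if "(A, B) \<in> mstep R M ^^ m" "(B, C) \<in> mstep R M ^^ n" for m n
  proof -
    have "(A, C) \<in> mstep R M ^^ (m + n)" using that by (auto simp: relpow_add)
    then show ?thesis using relpow_mlen[of A C "m + n"] by simp
  qed
  \<comment> \<open>If the total length is a finite k, a chain of length m from A to B leaves at
    most k - m steps from B to C. The supremum is taken over the second chain first and then over
    the first one.\<close>
  show "mlen R M A B + mlen R M B C \<le> mlen R M A C"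
  proof (cases "mlen R M A C")
    case (enat k)
    obtain m0 where m0: "(A, B) \<in> mstep R M ^^ m0" using ne[OF A B] assms by blast
    obtain n0 where n0: "(B, C) \<in> mstep R M ^^ n0" using ne[OF B C] assms by blast
    have "mlen R M B C \<le> enat k"
    proof (rule mlen_le)
      fix n assume "(B, C) \<in> mstep R M ^^ n"
      from *[OF m0 this] show "enat n \<le> enat k" using enat by simp
    qed
    then obtain l where l: "mlen R M B C = enat l" using enat by (cases "mlen R M B C") auto
    have **: "enat m + mlen R M B C \<le> enat k" if m: "(A, B) \<in> mstep R M ^^ m" for m
    proof -
      have "m \<le> k" using *[OF m n0] enat by simp
      have "mlen R M B C \<le> enat (k - m)"
      proof (rule mlen_le)
        fix n assume "(B, C) \<in> mstep R M ^^ n"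
        from *[OF m this] show "enat n \<le> enat (k - m)" using enat by simp
      qed
      then show ?thesis using l \<open>m \<le> k\<close> by simp
    qed
    have "l \<le> k" using **[OF m0] l by simp
    have "mlen R M A B \<le> enat (k - l)"
    proof (rule mlen_le)
      fix m assume "(A, B) \<in> mstep R M ^^ m"
      from **[OF this] show "enat m \<le> enat (k - l)" using l by simp
    qed
    then show ?thesis using enat l \<open>l \<le> k\<close> by (cases "mlen R M A B") auto
  qed simp
qed

lemma mlen_mono:
  assumes "submodule A R M" "submodule B R M" "submodule C R M" "A \<subseteq> B" "B \<subseteq> C"
  shows "mlen R M A B \<le> mlen R M A C" "mlen R M B C \<le> mlen R M A C"
  using mlen_add[OF assms] by auto

text \<open>The intervals from A \<inter> B to B and from A to A + B correspond under X \<mapsto> A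
  + X and X \<mapsto> X \<inter> B; both operations preserve strict inclusions by the modular
  law.\<close>

lemma mlen_second_iso:
  assumes A: "submodule A R M" and B: "submodule B R M"
  shows "mlen R M (A \<inter> B) B = mlen R M A (A <+>\<^bsub>M\<^esub> B)"
proof (rule antisym)
  show "mlen R M (A \<inter> B) B \<le> mlen R M A (A <+>\<^bsub>M\<^esub> B)"
  proof (rule mlen_transport[where F = "\<lambda>X. A <+>\<^bsub>M\<^esub> X"])
    fix X Y assume X: "submodule X R M" and Y: "submodule Y R M" and XY: "A \<inter> B \<subseteq> X" "X \<subset> Y" "Y \<subseteq> B"
    have "A <+>\<^bsub>M\<^esub> X \<noteq> A <+>\<^bsub>M\<^esub> Y"
    proof
      assume eq: "A <+>\<^bsub>M\<^esub> X = A <+>\<^bsub>M\<^esub> Y"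
      have "X <+>\<^bsub>M\<^esub> A = Y <+>\<^bsub>M\<^esub> A"
        using eq msum_commute A X Y by metis
      moreover have "X \<inter> A = Y \<inter> A" using XY by blast
      ultimately show False using modular_strict[OF X Y A] XY by blast
    qed
    then show "(A <+>\<^bsub>M\<^esub> X, A <+>\<^bsub>M\<^esub> Y) \<in> mstep R M"
      using submodule_msum[OF A X] submodule_msum[OF A Y] msum_mono[of A A X Y] XY by (auto simp: mstep_def)
  next
    show "A <+>\<^bsub>M\<^esub> (A \<inter> B) = A" using msum_absorb(2)[of "A \<inter> B" A] A B submodule_Int by blast
  qed simp
  show "mlen R M A (A <+>\<^bsub>M\<^esub> B) \<le> mlen R M (A \<inter> B) B"
  proof (rule mlen_transport[where F = "\<lambda>X. X \<inter> B"])
    fix X Y assume X: "submodule X R M" and Y: "submodule Y R M" and XY: "A \<subseteq> X" "X \<subset> Y" "Y \<subseteq> A <+>\<^bsub>M\<^esub> B"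
    have "X \<inter> B \<noteq> Y \<inter> B"
    proof
      assume "X \<inter> B = Y \<inter> B"
      moreover have "X <+>\<^bsub>M\<^esub> B = Y <+>\<^bsub>M\<^esub> B"
      proof
        show "X <+>\<^bsub>M\<^esub> B \<subseteq> Y <+>\<^bsub>M\<^esub> B" using XY by (intro msum_mono) auto
        have "A <+>\<^bsub>M\<^esub> B \<subseteq> X <+>\<^bsub>M\<^esub> B" using XY by (intro msum_mono) auto
        then show "Y <+>\<^bsub>M\<^esub> B \<subseteq> X <+>\<^bsub>M\<^esub> B"
          using XY msum_upper2[OF X B] by (intro msum_least submodule_msum X B) blast+
      qed
      ultimately show False using modular_strict[OF X Y B] XY by blast
    qed
    then show "(X \<inter> B, Y \<inter> B) \<in> mstep R M"
      using submodule_Int[OF X B] submodule_Int[OF Y B] XY by (auto simp: mstep_def)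
  next
    show "(A <+>\<^bsub>M\<^esub> B) \<inter> B = B" using msum_upper2[OF A B] by blast
  qed simp
qed

end

section \<open>Linear maps and length\<close>

lemma linear_mapD:
  assumes "linear_map R M N h"
  shows "x \<in> carrier M \<Longrightarrow> h x \<in> carrier N"
    "\<lbrakk>x \<in> carrier M; y \<in> carrier M\<rbrakk> \<Longrightarrow> h (x \<oplus>\<^bsub>M\<^esub> y) = h x \<oplus>\<^bsub>N\<^esub> h y"
    "\<lbrakk>a \<in> carrier R; x \<in> carrier M\<rbrakk> \<Longrightarrow> h (a \<odot>\<^bsub>M\<^esub> x) = a \<odot>\<^bsub>N\<^esub> h x"
  using assms by (auto simp: linear_map_def)

lemma linear_map_zero:
  assumes "module R M" "module R N" "linear_map R M N h" shows "h \<zero>\<^bsub>M\<^esub> = \<zero>\<^bsub>N\<^esub>"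
proof -
  interpret M: module R M by fact
  interpret N: module R N by fact
  have "h (\<zero>\<^bsub>R\<^esub> \<odot>\<^bsub>M\<^esub> \<zero>\<^bsub>M\<^esub>) = \<zero>\<^bsub>R\<^esub> \<odot>\<^bsub>N\<^esub> h \<zero>\<^bsub>M\<^esub>" using linear_mapD(3)[OF assms(3)] by blast
  then show ?thesis using linear_mapD(1)[OF assms(3)] by simp
qed

lemma linear_map_minus:
  assumes "module R M" "module R N" "linear_map R M N h" "x \<in> carrier M" "y \<in> carrier M"
  shows "h (x \<ominus>\<^bsub>M\<^esub> y) = h x \<ominus>\<^bsub>N\<^esub> h y"
proof -
  interpret M: module R M by fact
  interpret N: module R N by fact
  have "h ((\<ominus>\<^bsub>R\<^esub> \<one>\<^bsub>R\<^esub>) \<odot>\<^bsub>M\<^esub> y) = (\<ominus>\<^bsub>R\<^esub> \<one>\<^bsub>R\<^esub>) \<odot>\<^bsub>N\<^esub> h y"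
    using linear_mapD(3)[OF assms(3)] assms(5) by blast
  then have "h (\<ominus>\<^bsub>M\<^esub> y) = \<ominus>\<^bsub>N\<^esub> h y"
    using assms(5) M.smult_l_minus[of "\<one>\<^bsub>R\<^esub>" y] N.smult_l_minus[of "\<one>\<^bsub>R\<^esub>" "h y"] linear_mapD(1)[OF assms(3)]
    by simp
  then show ?thesis using linear_mapD[OF assms(3)] assms(4,5) by (simp add: a_minus_def)
qed

lemma submodule_image:
  assumes "module R M" "module R N" "linear_map R M N h" "submodule A R M"
  shows "submodule (h ` A) R N"
proof -
  interpret M: module R M by fact
  interpret N: module R N by fact
  note h = linear_mapD[OF assms(3)] and A = M.sm_carrier[OF assms(4)]
  show ?thesis unfolding N.submodule_iff
  proof (intro conjI ballI)
    show "h ` A \<subseteq> carrier N" using h A by blast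
    show "\<zero>\<^bsub>N\<^esub> \<in> h ` A" using linear_map_zero[OF assms(1-3)] M.sm_zero[OF assms(4)] by (metis imageI)
  next
    fix x y assume "x \<in> h ` A" "y \<in> h ` A"
    then obtain a b where "a \<in> A" "b \<in> A" "x = h a" "y = h b" by auto
    then show "x \<oplus>\<^bsub>N\<^esub> y \<in> h ` A" using h(2)[of a b] A M.sm_add[OF assms(4)] by (metis imageI)
  next
    fix c x assume "c \<in> carrier R" "x \<in> h ` A"
    then obtain a where "a \<in> A" "x = h a" by auto
    then show "c \<odot>\<^bsub>N\<^esub> x \<in> h ` A" using h(3)[of c a] A M.sm_smult[OF assms(4)] \<open>c \<in> carrier R\<close> by (metis imageI)
  qed
qed

lemma submodule_preimage:
  assumes "module R M" "module R N" "linear_map R M N h" "submodule B R N"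
  shows "submodule {x \<in> carrier M. h x \<in> B} R M"
proof -
  interpret M: module R M by fact
  interpret N: module R N by fact
  show ?thesis unfolding M.submodule_iff
    using linear_mapD(2,3)[OF assms(3)] linear_map_zero[OF assms(1-3)] N.sm_zero[OF assms(4)]
      N.sm_add[OF assms(4)] N.sm_smult[OF assms(4)] by simp
qed

text \<open>Since the kernel of h on B lies in A, every submodule between A and B is recovered from
  its image (\<open>saturated\<close>), so h identifies the two intervals.\<close>

lemma mlen_image:
  assumes M: "module R M" and N: "module R N" and h: "linear_map R M N h"
    and A: "submodule A R M" and B: "submodule B R M" and "A \<subseteq> B"
    and ker: "\<And>x. x \<in> B \<Longrightarrow> h x = \<zero>\<^bsub>N\<^esub> \<Longrightarrow> x \<in> A"
  shows "mlen R N (h ` A) (h ` B) = mlen R M A B"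
proof -
  interpret M: module R M by fact
  interpret N: module R N by fact
  note Bc = M.sm_carrier[OF B]
  have saturated: "x \<in> X" if "submodule X R M" "A \<subseteq> X" "X \<subseteq> B" "x \<in> B" "h x \<in> h ` X" for X x
  proof -
    from that obtain y where y: "y \<in> X" "h x = h y" by auto
    have "h (x \<ominus>\<^bsub>M\<^esub> y) = \<zero>\<^bsub>N\<^esub>"
      using y linear_map_minus[OF M N h] that Bc linear_mapD(1)[OF h] by (simp add: subset_eq N.minus_eq N.r_neg)
    then have "x \<ominus>\<^bsub>M\<^esub> y \<in> A" using ker M.sm_minus[OF B] that y by blast
    then show "x \<in> X" using that y Bc M.sm_add_cancel(3)[of X x y] by blast
  qed
  show ?thesis
  proof (rule antisym)
    show "mlen R M A B \<le> mlen R N (h ` A) (h ` B)"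
    proof (rule M.mlen_transport[where F = "image h"])
      fix X Y assume X: "submodule X R M" and Y: "submodule Y R M" and XY: "A \<subseteq> X" "X \<subset> Y" "Y \<subseteq> B"
      then obtain y where "y \<in> Y" "y \<notin> X" by blast
      then have "h y \<notin> h ` X" using saturated[OF X] XY by blast
      then show "(h ` X, h ` Y) \<in> mstep R N"
        using submodule_image[OF M N h] X Y XY \<open>y \<in> Y\<close> by (auto simp: mstep_def)
    qed auto
    show "mlen R N (h ` A) (h ` B) \<le> mlen R M A B"
    proof (rule N.mlen_transport[where F = "\<lambda>X. B \<inter> {x \<in> carrier M. h x \<in> X}"])
      fix X Y assume X: "submodule X R N" and Y: "submodule Y R N" and XY: "h ` A \<subseteq> X" "X \<subset> Y" "Y \<subseteq> h ` B"
      then obtain y where "y \<in> Y" "y \<notin> X" by blast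
      moreover then obtain b where "b \<in> B" "y = h b" using XY by blast
      ultimately show "(B \<inter> {x \<in> carrier M. h x \<in> X}, B \<inter> {x \<in> carrier M. h x \<in> Y}) \<in> mstep R M"
        using XY Bc M.submodule_Int[OF B submodule_preimage[OF M N h X]] M.submodule_Int[OF B submodule_preimage[OF M N h Y]]
        by (auto simp: mstep_def)
    next
      show "B \<inter> {x \<in> carrier M. h x \<in> h ` A} = A"
        using saturated[OF A] \<open>A \<subseteq> B\<close> Bc by blast
      show "B \<inter> {x \<in> carrier M. h x \<in> h ` B} = B" using Bc by auto
    qed
  qed
qed

section \<open>Noetherian modules over local rings\<close>

text \<open>Well-foundedness of reversed strict inclusion is chosen so that maximal submodules come
  from \<open>wfE_min\<close> and noetherian induction from \<open>wf_induct_rule\<close>.\<close>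

definition noetherian_module ::
    "('r, 'b) ring_scheme \<Rightarrow> ('r, 'm, 'c) module_scheme \<Rightarrow> bool"
  where "noetherian_module R M \<longleftrightarrow>
    wf {(A, B). submodule A R M \<and> submodule B R M \<and> B \<subset> A}"

lemma noetherian_ring_wf:
  assumes "noetherian_ring R"
  shows "wf {(I, J). ideal I R \<and> ideal J R \<and> J \<subset> I}"
  unfolding wf_iff_no_infinite_down_chain
proof
  interpret noetherian_ring R by fact
  assume "\<exists>f. \<forall>i. (f (Suc i), f i) \<in> {(I, J). ideal I R \<and> ideal J R \<and> J \<subset> I}"
  then obtain f where f: "\<And>i. ideal (f i) R" "\<And>i::nat. f i \<subset> f (Suc i)" by blast
  have mono: "f i \<subseteq> f j" if "i \<le> j" for i j
    using lift_Suc_mono_le[of f, OF _ that] f(2) by blast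
  have "subset.chain {I. ideal I R} (range f)"
    unfolding subset.chain_def
  proof (intro conjI ballI)
    show "range f \<subseteq> {I. ideal I R}" using f(1) by blast
    fix X Y assume "X \<in> range f" "Y \<in> range f"
    then obtain i j where ij: "X = f i" "Y = f j" by blast
    show "(\<subset>)\<^sup>=\<^sup>= X Y \<or> (\<subset>)\<^sup>=\<^sup>= Y X"
      using mono[of i j] mono[of j i] nat_le_linear[of i j] ij by auto
  qed
  then have "\<Union> (range f) \<in> range f" by (intro ideal_chain_is_trivial) auto
  then obtain i where "\<Union> (range f) = f i" by auto
  then show False using f(2)[of i] by blast
qed

text \<open>Induction on generators. When x is added to L, a submodule N of L + R x is measured
  lexicographically by \<open>N \<inter> L\<close> and by the ideal \<open>I N\<close> of all a with
  a x in N + L. If B \<subset> A agree in both, then A + L = B + L, and the modular law gives A =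
  B.\<close>

lemma fg_imp_noetherian_module:
  fixes R (structure)
  assumes R: "noetherian_ring R" and "module R M" "finitely_generated_module R M"
  shows "noetherian_module R M"
proof -
  interpret module R M by fact
  define W where "W L = {(A, B). submodule A R M \<and> submodule B R M \<and> B \<subset> A \<and> A \<subseteq> L}" for L
  have "\<exists>L. submodule L R M \<and> S \<subseteq> L \<and> wf (W L)" if "finite S" "S \<subseteq> carrier M" for S
    using that
  proof (induction S)
    case empty
    have "W {\<zero>\<^bsub>M\<^esub>} = {}" unfolding W_def using sm_zero by fastforce
    then show ?case using submodule_zero by (intro exI[of _ "{\<zero>\<^bsub>M\<^esub>}"]) auto
  next
    case (insert x S)
    then obtain L where L: "submodule L R M" "S \<subseteq> L" "wf (W L)" by auto
    have x: "x \<in> carrier M" using insert by auto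
    define L' where "L' = L <+>\<^bsub>M\<^esub> span1 x"
    have L': "submodule L' R M" unfolding L'_def by (intro submodule_msum submodule_span1 L x)
    define I where "I N = {a \<in> carrier R. a \<odot>\<^bsub>M\<^esub> x \<in> N <+>\<^bsub>M\<^esub> L}" for N
    have ideal_I: "ideal (I N) R" if N: "submodule N R M" for N
    proof -
      have s: "submodule (N <+>\<^bsub>M\<^esub> L) R M" using N L submodule_msum by blast
      show ?thesis
      proof (rule idealI)
        show "ring R" by (rule R.ring_axioms)
        show "subgroup (I N) (add_monoid R)"
        proof (rule R.add.subgroupI)
          have "\<zero> \<in> I N" unfolding I_def using x sm_zero[OF s] by simp
          then show "I N \<noteq> {}" by blast
        next
          fix a assume "a \<in> I N"
          then show "\<ominus> a \<in> I N" unfolding I_def using sm_neg[OF s] x by (auto simp: smult_l_minus)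
        next
          fix a b assume "a \<in> I N" "b \<in> I N"
          then show "a \<oplus> b \<in> I N" unfolding I_def using sm_add[OF s] x by (auto simp: smult_l_distr)
        qed (auto simp: I_def)
      next
        fix a b assume "a \<in> I N" "b \<in> carrier R"
        then show "b \<otimes> a \<in> I N" unfolding I_def using sm_smult[OF s] x by (auto simp: smult_assoc1)
        then show "a \<otimes> b \<in> I N" using \<open>a \<in> I N\<close> \<open>b \<in> carrier R\<close> by (simp add: I_def R.m_comm)
      qed
    qed
    have "wf (inv_image (W L <*lex*> {(I, J). ideal I R \<and> ideal J R \<and> J \<subset> I}) (\<lambda>N. (N \<inter> L, I N)))"
      by (intro wf_inv_image wf_lex_prod L noetherian_ring_wf R)
    moreover have "W L' \<subseteq> inv_image (W L <*lex*> {(I, J). ideal I R \<and> ideal J R \<and> J \<subset> I}) (\<lambda>N. (N \<inter> L, I N))"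
    proof clarify
      fix A B assume "(A, B) \<in> W L'"
      then have A: "submodule A R M" and B: "submodule B R M" and AB: "B \<subset> A" "A \<subseteq> L'" by (auto simp: W_def)
      show "(A, B) \<in> inv_image (W L <*lex*> {(I, J). ideal I R \<and> ideal J R \<and> J \<subset> I}) (\<lambda>N. (N \<inter> L, I N))"
      proof (cases "A \<inter> L = B \<inter> L")
        case False
        then show ?thesis using submodule_Int A B L AB by (auto simp: W_def)
      next
        case True
        have "I B \<subseteq> I A" unfolding I_def using msum_mono[of B A L L] AB by blast
        moreover have "I B \<noteq> I A"
        proof
          assume eq: "I B = I A"
          have "A <+>\<^bsub>M\<^esub> L \<subseteq> B <+>\<^bsub>M\<^esub> L"
          proof (rule msum_least)
            show s: "submodule (B <+>\<^bsub>M\<^esub> L) R M" by (intro submodule_msum B L)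
            show LB: "L \<subseteq> B <+>\<^bsub>M\<^esub> L" by (intro msum_upper2 B L)
            show "A \<subseteq> B <+>\<^bsub>M\<^esub> L"
            proof
              fix y assume y: "y \<in> A"
              then obtain l a where la: "l \<in> L" "a \<in> carrier R" "y = l \<oplus>\<^bsub>M\<^esub> a \<odot>\<^bsub>M\<^esub> x"
                using AB(2) unfolding L'_def by (metis mem_msum_span1 subsetD)
              have s': "submodule (A <+>\<^bsub>M\<^esub> L) R M" by (intro submodule_msum A L)
              have "y \<in> A <+>\<^bsub>M\<^esub> L" "l \<in> A <+>\<^bsub>M\<^esub> L"
                using y la msum_upper1[OF A L(1)] msum_upper2[OF A L(1)] by blast+
              then have "a \<odot>\<^bsub>M\<^esub> x \<in> A <+>\<^bsub>M\<^esub> L" using sm_add_cancel(2)[OF s', of "a \<odot>\<^bsub>M\<^esub> x" l] la x by simp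
              then have "a \<odot>\<^bsub>M\<^esub> x \<in> B <+>\<^bsub>M\<^esub> L" using eq la unfolding I_def by blast
              then show "y \<in> B <+>\<^bsub>M\<^esub> L" using la LB sm_add[OF s] by blast
            qed
          qed
          then have "B <+>\<^bsub>M\<^esub> L = A <+>\<^bsub>M\<^esub> L" using msum_mono[of B A L L] AB by blast
          then show False using modular_strict[OF B A L(1)] True AB by blast
        qed
        ultimately show ?thesis using True ideal_I A B by auto
      qed
    qed
    ultimately have "wf (W L')" by (rule wf_subset)
    moreover have "insert x S \<subseteq> L'" unfolding L'_def
      using L(2) msum_upper1[OF L(1) submodule_span1[OF x]] msum_upper2[OF L(1) submodule_span1[OF x]]
        span1_self[OF x] by blast
    ultimately show ?case using L' by blast
  qed
  moreover obtain S where "finite S" "S \<subseteq> carrier M" "\<And>N. submodule N R M \<and> S \<subseteq> N \<Longrightarrow> N = carrier M"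
    using assms(3) unfolding finitely_generated_module_def by blast
  ultimately have "wf (W (carrier M))" by metis
  moreover have "W (carrier M) = {(A, B). submodule A R M \<and> submodule B R M \<and> B \<subset> A}"
    unfolding W_def using sm_subset by blast
  ultimately show ?thesis unfolding noetherian_module_def by simp
qed

locale local_noetherian_module = module R M for R :: "('r, 'b) ring_scheme" (structure)
    and M :: "('r, 'm, 'c) module_scheme" (structure) +
  fixes m :: "'r set"
  assumes ideal_m: "ideal m R"
    and one_notin_m: "\<one> \<notin> m"
    and Units_m: "\<lbrakk>r \<in> carrier R; r \<notin> m\<rbrakk> \<Longrightarrow> r \<in> Units R"
    and noeth_R: "noetherian_ring R"
    and noeth_M: "noetherian_module R M"
begin

lemma m_carrier: "r \<in> m \<Longrightarrow> r \<in> carrier R"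
  using ideal_m ideal.Icarr by metis

lemma m_lmult: "\<lbrakk>r \<in> m; a \<in> carrier R\<rbrakk> \<Longrightarrow> a \<otimes> r \<in> m"
  using ideal_m ideal.I_l_closed by metis

lemma one_minus_m:
  assumes "r \<in> m" shows "\<one> \<ominus> r \<in> Units R"
proof (rule Units_m)
  show "\<one> \<ominus> r \<in> carrier R" using assms m_carrier by simp
  show "\<one> \<ominus> r \<notin> m"
  proof
    assume "\<one> \<ominus> r \<in> m"
    then have "(\<one> \<ominus> r) \<oplus> r \<in> m"
      using assms additive_subgroup.a_closed[OF ideal.axioms(1)[OF ideal_m]] by blast
    moreover have "(\<one> \<ominus> r) \<oplus> r = \<one>" using assms m_carrier by (simp add: R.minus_eq R.a_assoc R.l_neg)
    ultimately show False using one_notin_m by simp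
  qed
qed

text \<open>The equation says (1 - r) x = n, and 1 - r is a unit of the local ring.\<close>

lemma unit_cancel:
  assumes "r \<in> m" "submodule N R M" "x \<in> carrier M" "n \<in> N" "x = n \<oplus>\<^bsub>M\<^esub> r \<odot>\<^bsub>M\<^esub> x"
  shows "x \<in> N"
proof -
  have n: "n \<in> carrier M" using assms sm_carrier by blast
  have r: "r \<in> carrier R" using assms m_carrier by blast
  have "(\<one> \<ominus> r) \<odot>\<^bsub>M\<^esub> x = x \<ominus>\<^bsub>M\<^esub> r \<odot>\<^bsub>M\<^esub> x"
    using assms(3) r by (simp add: R.minus_eq M.minus_eq smult_l_distr smult_l_minus)
  also have "\<dots> = n"
  proof -
    have "v \<ominus>\<^bsub>M\<^esub> u = n" if "v = n \<oplus>\<^bsub>M\<^esub> u" "u \<in> carrier M" for u v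
      using that n by (simp add: M.minus_eq M.a_assoc M.r_neg)
    from this[OF assms(5)] show ?thesis using assms(3) r by blast
  qed
  finally have *: "(\<one> \<ominus> r) \<odot>\<^bsub>M\<^esub> x = n" .
  have u: "\<one> \<ominus> r \<in> Units R" using assms one_minus_m by blast
  then have "x = (inv (\<one> \<ominus> r) \<otimes> (\<one> \<ominus> r)) \<odot>\<^bsub>M\<^esub> x" using assms by simp
  also have "\<dots> = inv (\<one> \<ominus> r) \<odot>\<^bsub>M\<^esub> n" using u assms * r by (subst smult_assoc1) auto
  finally show ?thesis using sm_smult[OF assms(2)] u assms(4) by simp
qed

lemma maximal_submodule:
  assumes "submodule N R M" "Q N"
  shows "\<exists>T. submodule T R M \<and> Q T \<and> (\<forall>U. submodule U R M \<longrightarrow> T \<subset> U \<longrightarrow> \<not> Q U)"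
proof -
  have "N \<in> {N. submodule N R M \<and> Q N}" using assms by simp
  from wfE_min[OF noeth_M[unfolded noetherian_module_def] this] obtain T
    where "T \<in> {N. submodule N R M \<and> Q N}"
      "\<And>U. (U, T) \<in> {(A, B). submodule A R M \<and> submodule B R M \<and> B \<subset> A} \<Longrightarrow> U \<notin> {N. submodule N R M \<and> Q N}" by blast
  then show ?thesis by (intro exI[of _ T]) auto
qed

text \<open>Nakayama's lemma for L / N. Take T maximal among the proper submodules of L that contain
  N. If r x were outside T, then T + R r x = L would contain x, so x = t + a r x, and
  \<open>unit_cancel\<close> puts x into T.\<close>

lemma nakayama:
  assumes N: "submodule N R M" and L: "submodule L R M" and "N \<subset> L"
  obtains T where "submodule T R M" "N \<subseteq> T" "T \<subset> L" "\<And>r x. \<lbrakk>r \<in> m; x \<in> L\<rbrakk> \<Longrightarrow> r \<odot>\<^bsub>M\<^esub> x \<in> T"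
proof -
  obtain T where T: "submodule T R M" "N \<subseteq> T" "T \<subset> L"
    and max: "\<And>U. \<lbrakk>submodule U R M; T \<subset> U\<rbrakk> \<Longrightarrow> \<not> (N \<subseteq> U \<and> U \<subset> L)"
    using maximal_submodule[of N "\<lambda>U. N \<subseteq> U \<and> U \<subset> L"] assms by blast
  have "r \<odot>\<^bsub>M\<^esub> x \<in> T" if r: "r \<in> m" and x: "x \<in> L" for r x
  proof (rule ccontr)
    assume n: "r \<odot>\<^bsub>M\<^esub> x \<notin> T"
    have xc: "x \<in> carrier M" and rx: "r \<odot>\<^bsub>M\<^esub> x \<in> L" "r \<odot>\<^bsub>M\<^esub> x \<in> carrier M"
      using r x sm_carrier[OF L] sm_smult[OF L] m_carrier by auto
    let ?U = "T <+>\<^bsub>M\<^esub> span1 (r \<odot>\<^bsub>M\<^esub> x)"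
    have U: "submodule ?U R M" "T \<subseteq> ?U" "r \<odot>\<^bsub>M\<^esub> x \<in> ?U"
      using submodule_msum[OF T(1) submodule_span1] msum_upper1[OF T(1) submodule_span1]
        msum_upper2[OF T(1) submodule_span1] span1_self rx(2) by blast+
    moreover have "?U \<subseteq> L" using T rx by (intro msum_least span1_least L) auto
    ultimately have "?U = L" using max[of ?U] T n by blast
    then obtain t a where ta: "t \<in> T" "a \<in> carrier R" "x = t \<oplus>\<^bsub>M\<^esub> a \<odot>\<^bsub>M\<^esub> (r \<odot>\<^bsub>M\<^esub> x)"
      using x unfolding mem_msum_span1[symmetric] by (metis mem_msum_span1)
    then have "x = t \<oplus>\<^bsub>M\<^esub> (a \<otimes> r) \<odot>\<^bsub>M\<^esub> x" using smult_assoc1 r m_carrier xc by simp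
    then have "x \<in> T" using unit_cancel[OF m_lmult[OF r ta(2)] T(1) xc ta(1)] by blast
    then show False using n sm_smult[OF T(1)] r m_carrier by blast
  qed
  then show ?thesis using that T by blast
qed

text \<open>Each T strictly below L can be enlarged by some x outside T with m x inside T, that is,
  by a copy of the residue field. Noetherian induction along such enlargements reaches L. The
  exponent k in the hypothesis may depend on r.\<close>

lemma nilpotent_induct:
  assumes N: "submodule N R M" and L: "submodule L R M" and "N \<subseteq> L"
    and nilp: "\<And>r. r \<in> m \<Longrightarrow> \<exists>k::nat. \<forall>x\<in>L. (r [^] k) \<odot>\<^bsub>M\<^esub> x \<in> N"
    and base: "P L"
    and step: "\<And>T x. \<lbrakk>submodule T R M; N \<subseteq> T; T \<subseteq> L; x \<in> L; x \<notin> T; \<And>r. r \<in> m \<Longrightarrow> r \<odot>\<^bsub>M\<^esub> x \<in> T;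
        P (T <+>\<^bsub>M\<^esub> span1 x)\<rbrakk> \<Longrightarrow> P T"
  shows "P N"
proof -
  have "submodule T R M \<longrightarrow> N \<subseteq> T \<longrightarrow> T \<subseteq> L \<longrightarrow> P T" for T
  proof (rule wf_induct_rule[OF noeth_M[unfolded noetherian_module_def], of _ T], intro impI)
    fix T
    assume IH: "\<And>U. (U, T) \<in> {(A, B). submodule A R M \<and> submodule B R M \<and> B \<subset> A} \<Longrightarrow>
      submodule U R M \<longrightarrow> N \<subseteq> U \<longrightarrow> U \<subseteq> L \<longrightarrow> P U"
      and T: "submodule T R M" "N \<subseteq> T" "T \<subseteq> L"
    show "P T"
    proof (cases "T = L")
      case False
      define A where "A x = {a \<in> carrier R. a \<odot>\<^bsub>M\<^esub> x \<in> T}" for x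
      have ideal_A: "ideal (A x) R" if x: "x \<in> carrier M" for x
      proof (rule idealI)
        show "ring R" by (rule R.ring_axioms)
        show "subgroup (A x) (add_monoid R)"
        proof (rule R.add.subgroupI)
          have "\<zero> \<in> A x" unfolding A_def using x sm_zero[OF T(1)] by simp
          then show "A x \<noteq> {}" by blast
        next
          fix a assume "a \<in> A x"
          then show "\<ominus> a \<in> A x" unfolding A_def using sm_neg[OF T(1)] x by (auto simp: smult_l_minus)
        next
          fix a b assume "a \<in> A x" "b \<in> A x"
          then show "a \<oplus> b \<in> A x" unfolding A_def using sm_add[OF T(1)] x by (auto simp: smult_l_distr)
        qed (auto simp: A_def)
      next
        fix a b assume "a \<in> A x" "b \<in> carrier R"
        then show "b \<otimes> a \<in> A x" unfolding A_def using sm_smult[OF T(1)] x by (auto simp: smult_assoc1)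
        then show "a \<otimes> b \<in> A x" using \<open>a \<in> A x\<close> \<open>b \<in> carrier R\<close> by (simp add: A_def R.m_comm)
      qed
      from False T obtain x0 where "x0 \<in> L" "x0 \<notin> T" by blast
      then have "A x0 \<in> {A x | x. x \<in> L \<and> x \<notin> T}" by blast
      \<comment> \<open>As for associated primes, x is chosen outside T with maximal annihilator
        modulo T. If r x were also outside T, it would have the same annihilator, and a power of r
        that kills x modulo T could be lowered step by step to 1.\<close>
      from wfE_min[OF noetherian_ring_wf[OF noeth_R] this] obtain x where x: "x \<in> L" "x \<notin> T"
        and "\<And>J. (J, A x) \<in> {(I, J). ideal I R \<and> ideal J R \<and> J \<subset> I} \<Longrightarrow> J \<notin> {A x | x. x \<in> L \<and> x \<notin> T}"
        by (smt (verit, del_insts) mem_Collect_eq)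
      then have max: "A y = A x" if "y \<in> L" "y \<notin> T" "A x \<subseteq> A y" for y
        using ideal_A that sm_carrier[OF L] by blast
      have "r \<odot>\<^bsub>M\<^esub> x \<in> T" if r: "r \<in> m" for r
      proof (rule ccontr)
        assume n: "r \<odot>\<^bsub>M\<^esub> x \<notin> T"
        have rc: "r \<in> carrier R" and xc: "x \<in> carrier M" using r m_carrier x sm_carrier[OF L] by auto
        have "A x \<subseteq> A (r \<odot>\<^bsub>M\<^esub> x)"
        proof
          fix a assume "a \<in> A x"
          then have "a \<in> carrier R" "r \<odot>\<^bsub>M\<^esub> (a \<odot>\<^bsub>M\<^esub> x) \<in> T" using sm_smult[OF T(1) rc] by (auto simp: A_def)
          then show "a \<in> A (r \<odot>\<^bsub>M\<^esub> x)" unfolding A_def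
            using rc xc by (auto simp: smult_assoc1[symmetric] R.m_comm)
        qed
        then have eq: "A (r \<odot>\<^bsub>M\<^esub> x) = A x" using max n sm_smult[OF L rc x(1)] by blast
        have down: "r [^] k \<in> A x \<Longrightarrow> \<one> \<in> A x" for k :: nat
        proof (induction k)
          case (Suc k)
          then have "r [^] k \<in> A (r \<odot>\<^bsub>M\<^esub> x)" unfolding A_def
            using rc xc by (auto simp: smult_assoc1)
          then show ?case using eq Suc by blast
        qed simp
        obtain k :: nat where "\<forall>y\<in>L. (r [^] k) \<odot>\<^bsub>M\<^esub> y \<in> N" using nilp r by blast
        then have "r [^] k \<in> A x" unfolding A_def using x T rc by auto
        from down[OF this] show False using x xc unfolding A_def by simp
      qed
      moreover have "P (T <+>\<^bsub>M\<^esub> span1 x)"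
      proof -
        have xc: "x \<in> carrier M" using x sm_carrier[OF L] by auto
        note s = submodule_span1[OF xc]
        have "T \<subseteq> T <+>\<^bsub>M\<^esub> span1 x" "x \<in> T <+>\<^bsub>M\<^esub> span1 x" "submodule (T <+>\<^bsub>M\<^esub> span1 x) R M"
          "T <+>\<^bsub>M\<^esub> span1 x \<subseteq> L"
          using msum_upper1[OF T(1) s] msum_upper2[OF T(1) s] span1_self[OF xc] submodule_msum[OF T(1) s]
            msum_least[OF L T(3) span1_least[OF L x(1)]] by blast+
        then show ?thesis using IH T x by blast
      qed
      ultimately show ?thesis using step T x by blast
    qed (use base in simp)
  qed
  then show ?thesis using assms by blast
qed

text \<open>The quotient is generated by x and killed by m, hence a quotient of the residue field:
  any u = t + a x outside T has a unit a, and so generates everything together with T.\<close>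

lemma mlen_simple:
  assumes T: "submodule T R M" and x: "x \<in> carrier M" and mx: "\<And>r. r \<in> m \<Longrightarrow> r \<odot>\<^bsub>M\<^esub> x \<in> T"
  shows "mlen R M T (T <+>\<^bsub>M\<^esub> span1 x) \<le> 1"
proof (rule mlen_le)
  fix n assume n: "(T, T <+>\<^bsub>M\<^esub> span1 x) \<in> mstep R M ^^ n"
  have full: "U = T <+>\<^bsub>M\<^esub> span1 x" if U: "submodule U R M" "T \<subset> U" "U \<subseteq> T <+>\<^bsub>M\<^esub> span1 x" for U
  proof -
    from U obtain u where u: "u \<in> U" "u \<notin> T" by blast
    then obtain t a where ta: "t \<in> T" "a \<in> carrier R" "u = t \<oplus>\<^bsub>M\<^esub> a \<odot>\<^bsub>M\<^esub> x"
      using U(3) by (metis mem_msum_span1 subsetD)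
    have "a \<notin> m" using ta u mx sm_add[OF T] by blast
    then have a: "a \<in> Units R" using ta Units_m by blast
    have "a \<odot>\<^bsub>M\<^esub> x \<in> U" using sm_add_cancel(2)[OF U(1), of "a \<odot>\<^bsub>M\<^esub> x" t] ta u U(2) x by auto
    then have "inv a \<odot>\<^bsub>M\<^esub> (a \<odot>\<^bsub>M\<^esub> x) \<in> U" using sm_smult[OF U(1)] a by auto
    moreover have "inv a \<odot>\<^bsub>M\<^esub> (a \<odot>\<^bsub>M\<^esub> x) = x"
      using a x ta(2) by (subst smult_assoc1[symmetric]) auto
    ultimately have "x \<in> U" by simp
    then show ?thesis using U msum_least[OF U(1) _ span1_least[OF U(1)], of T x] by blast
  qed
  show "enat n \<le> 1"
  proof (rule ccontr)
    assume "\<not> enat n \<le> 1"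
    then obtain k where k: "n = Suc (Suc k)" by (metis One_nat_def enat_ord_simps(1) not_less_eq_eq one_enat_def Suc_le_D)
    then obtain V where V: "(T, V) \<in> mstep R M ^^ Suc k" "(V, T <+>\<^bsub>M\<^esub> span1 x) \<in> mstep R M" using n by auto
    from V(1) obtain W where "(T, W) \<in> mstep R M ^^ k" "(W, V) \<in> mstep R M" by auto
    then have "T \<noteq> V" using mstep_relpow_mono[of T W k] by (auto simp: mstep_def)
    moreover have "T \<subseteq> V" using V(1) mstep_relpow_mono by blast
    ultimately show False using full[of V] V(2) by (auto simp: mstep_def)
  qed
qed

lemma nilpotent_mlen_finite:
  assumes N: "submodule N R M" and L: "submodule L R M" and "N \<subseteq> L"
    and nilp: "\<And>r. r \<in> m \<Longrightarrow> \<exists>k::nat. \<forall>x\<in>L. (r [^] k) \<odot>\<^bsub>M\<^esub> x \<in> N"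
  shows "mlen R M N L \<noteq> \<infinity>"
proof (rule nilpotent_induct[OF assms])
  show "mlen R M L L \<noteq> \<infinity>" by simp
next
  fix T x assume T: "submodule T R M" and TL: "T \<subseteq> L" and x: "x \<in> L" and mx: "\<And>r. r \<in> m \<Longrightarrow> r \<odot>\<^bsub>M\<^esub> x \<in> T"
    and fin: "mlen R M (T <+>\<^bsub>M\<^esub> span1 x) L \<noteq> \<infinity>"
  have xc: "x \<in> carrier M" using x sm_carrier[OF L] by auto
  note s = submodule_span1[OF xc]
  have "mlen R M T L = mlen R M T (T <+>\<^bsub>M\<^esub> span1 x) + mlen R M (T <+>\<^bsub>M\<^esub> span1 x) L"
    by (intro mlen_add T L submodule_msum s msum_upper1 msum_least TL span1_least x)
  moreover have "mlen R M T (T <+>\<^bsub>M\<^esub> span1 x) \<noteq> \<infinity>" using mlen_simple[OF T xc mx]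
    by (cases "mlen R M T (T <+>\<^bsub>M\<^esub> span1 x)") auto
  ultimately show "mlen R M T L \<noteq> \<infinity>" using fin by auto
qed

text \<open>The form of Krull's intersection theorem used here. T is maximal among the submodules
  that contain N and avoid x, so every strictly larger submodule contains x, and m x lies in T. It
  remains to see that each r in m acts nilpotently modulo T.\<close>

lemma krull:
  assumes N: "submodule N R M" and x: "x \<in> carrier M" "x \<notin> N"
  obtains T where "submodule T R M" "N \<subseteq> T" "x \<notin> T"
    "\<And>r. r \<in> m \<Longrightarrow> \<exists>k::nat. \<forall>y\<in>carrier M. (r [^] k) \<odot>\<^bsub>M\<^esub> y \<in> T"
proof -
  obtain T where T: "submodule T R M" "N \<subseteq> T" "x \<notin> T"
    and max: "\<And>U. \<lbrakk>submodule U R M; T \<subset> U\<rbrakk> \<Longrightarrow> \<not> (N \<subseteq> U \<and> x \<notin> U)"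
    using maximal_submodule[of N "\<lambda>U. N \<subseteq> U \<and> x \<notin> U"] assms by blast
  have ess: "\<exists>t\<in>T. \<exists>a\<in>carrier R. x = t \<oplus>\<^bsub>M\<^esub> a \<odot>\<^bsub>M\<^esub> y" if y: "y \<in> carrier M" "y \<notin> T" for y
  proof -
    note s = submodule_span1[OF y(1)]
    have "T \<subset> T <+>\<^bsub>M\<^esub> span1 y"
      using msum_upper1[OF T(1) s] msum_upper2[OF T(1) s] span1_self[OF y(1)] y(2) by blast
    then have "x \<in> T <+>\<^bsub>M\<^esub> span1 y" using max[OF submodule_msum[OF T(1) s]] T(2) by blast
    then show ?thesis by (simp add: mem_msum_span1)
  qed
  have mx: "r \<odot>\<^bsub>M\<^esub> x \<in> T" if r: "r \<in> m" for r
  proof (rule ccontr)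
    assume n: "r \<odot>\<^bsub>M\<^esub> x \<notin> T"
    then obtain t a where ta: "t \<in> T" "a \<in> carrier R" "x = t \<oplus>\<^bsub>M\<^esub> a \<odot>\<^bsub>M\<^esub> (r \<odot>\<^bsub>M\<^esub> x)"
      using ess[of "r \<odot>\<^bsub>M\<^esub> x"] x r m_carrier by blast
    then have "x = t \<oplus>\<^bsub>M\<^esub> (a \<otimes> r) \<odot>\<^bsub>M\<^esub> x" using smult_assoc1 r m_carrier x by simp
    then have "x \<in> T" using unit_cancel[OF m_lmult[OF r ta(2)] T(1) x(1) ta(1)] by blast
    then show False using T by blast
  qed
  have "\<exists>k::nat. \<forall>y\<in>carrier M. (r [^] k) \<odot>\<^bsub>M\<^esub> y \<in> T" if r: "r \<in> m" for r
  proof -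
    have rc: "r \<in> carrier R" using r m_carrier by blast
    \<comment> \<open>The kernels of r^k modulo T stabilise. If r^k y is outside T, then x = t + a
      r^k y. As r x lies in T, a y lies in \<open>K (Suc k) = K k\<close>, which puts a r^k y, and
      hence x, into T.\<close>
    define K where "K k = {y \<in> carrier M. (r [^] (k::nat)) \<odot>\<^bsub>M\<^esub> y \<in> T}" for k
    have K: "submodule (K k) R M" for k
      unfolding submodule_iff K_def using rc sm_zero[OF T(1)] sm_add[OF T(1)] sm_smult[OF T(1)]
      by (auto simp: smult_r_distr) (metis R.m_comm R.nat_pow_closed smult_assoc1)
    have Kmono: "K k \<subseteq> K (Suc k)" for k
      unfolding K_def using rc sm_smult[OF T(1) rc] by (auto simp: R.m_comm[of _ r] smult_assoc1)
    obtain U where U: "\<exists>k. U = K k" and Umax: "\<And>V. \<lbrakk>submodule V R M; U \<subset> V\<rbrakk> \<Longrightarrow> \<not> (\<exists>k. V = K k)"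
      using maximal_submodule[of "K 0" "\<lambda>U. \<exists>k. U = K k"] K by blast
    then obtain k where k: "U = K k" by blast
    then have stable: "K (Suc k) = K k" using Umax[OF K, of "Suc k"] Kmono[of k] by blast
    have "(r [^] k) \<odot>\<^bsub>M\<^esub> y \<in> T" if y: "y \<in> carrier M" for y
    proof (rule ccontr)
      assume n: "(r [^] k) \<odot>\<^bsub>M\<^esub> y \<notin> T"
      then obtain t a where ta: "t \<in> T" "a \<in> carrier R" "x = t \<oplus>\<^bsub>M\<^esub> a \<odot>\<^bsub>M\<^esub> ((r [^] k) \<odot>\<^bsub>M\<^esub> y)"
        using ess[of "(r [^] k) \<odot>\<^bsub>M\<^esub> y"] y rc by blast
      define z where "z = a \<odot>\<^bsub>M\<^esub> ((r [^] k) \<odot>\<^bsub>M\<^esub> y)"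
      have zc: "z \<in> carrier M" unfolding z_def using ta y rc by simp
      have tc: "t \<in> carrier M" using ta sm_carrier[OF T(1)] by blast
      have "r \<odot>\<^bsub>M\<^esub> x = r \<odot>\<^bsub>M\<^esub> t \<oplus>\<^bsub>M\<^esub> r \<odot>\<^bsub>M\<^esub> z" unfolding ta(3) z_def[symmetric] using rc tc zc by (simp add: smult_r_distr)
      then have "r \<odot>\<^bsub>M\<^esub> z \<in> T" using mx[OF r] sm_add_cancel(2)[OF T(1), of "r \<odot>\<^bsub>M\<^esub> z" "r \<odot>\<^bsub>M\<^esub> t"]
          sm_smult[OF T(1) rc ta(1)] zc rc by simp
      moreover have z: "z = (r [^] k) \<odot>\<^bsub>M\<^esub> (a \<odot>\<^bsub>M\<^esub> y)"
        unfolding z_def using ta y rc by (simp add: smult_assoc1[symmetric] R.m_comm)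
      ultimately have "a \<odot>\<^bsub>M\<^esub> y \<in> K (Suc k)"
        unfolding K_def using ta y rc by (simp add: R.m_comm[of _ r] smult_assoc1)
      then have "(r [^] k) \<odot>\<^bsub>M\<^esub> (a \<odot>\<^bsub>M\<^esub> y) \<in> T" unfolding stable by (simp add: K_def)
      then have "z \<in> T" unfolding z .
      then have "x \<in> T" using ta z_def sm_add[OF T(1)] by simp
      then show False using T by blast
    qed
    then show ?thesis by blast
  qed
  then show ?thesis using that T by blast
qed

end

section \<open>Adic limits in finitely generated modules\<close>

text \<open>The submodule of all combinations of \<open>xs\<close> with coefficients in
  \<open>I\<close>; it is I M when \<open>xs\<close> generates M. The recursion over a list lets
  limits be taken one generator at a time.\<close>

primrec lspan :: "('r, 'm, 'c) module_scheme \<Rightarrow> 'r set \<Rightarrow> 'm list \<Rightarrow> 'm set"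
  where "lspan M I [] = {\<zero>\<^bsub>M\<^esub>}"
  | "lspan M I (x # xs) = {a \<odot>\<^bsub>M\<^esub> x \<oplus>\<^bsub>M\<^esub> y | a y. a \<in> I \<and> y \<in> lspan M I xs}"

lemma (in abelian_group) add_minus_cancel_left:
  assumes "x \<in> carrier G" "y \<in> carrier G" shows "(x \<oplus> y) \<ominus> x = y"
proof -
  have "(x \<oplus> y) \<ominus> x = (y \<oplus> x) \<ominus> x" using assms by (simp add: a_comm)
  then show ?thesis using assms by (simp add: minus_eq a_assoc r_neg)
qed

context module
begin

lemma submodule_lspan:
  assumes I: "ideal I R" and "set xs \<subseteq> carrier M"
  shows "submodule (lspan M I xs) R M"
  using assms(2)
proof (induction xs)
  case Nil
  then show ?case using submodule_zero by simp
next
  case (Cons x xs)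
  then have xs: "submodule (lspan M I xs) R M" and x: "x \<in> carrier M" by auto
  have Ic: "a \<in> carrier R" if "a \<in> I" for a using I that ideal.Icarr by metis
  have "(\<lambda>a. a \<odot>\<^bsub>M\<^esub> x) ` I <+>\<^bsub>M\<^esub> lspan M I xs = lspan M I (x # xs)"
    by (simp add: set_eq_iff mem_msum) blast
  moreover have "submodule ((\<lambda>a. a \<odot>\<^bsub>M\<^esub> x) ` I) R M"
    unfolding submodule_iff
  proof (intro conjI ballI)
    show "(\<lambda>a. a \<odot>\<^bsub>M\<^esub> x) ` I \<subseteq> carrier M" using Ic x by auto
    show "\<zero>\<^bsub>M\<^esub> \<in> (\<lambda>a. a \<odot>\<^bsub>M\<^esub> x) ` I"
      using additive_subgroup.zero_closed[OF ideal.axioms(1)[OF I]] x by (intro image_eqI[of _ _ \<zero>]) auto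
  next
    fix y z assume "y \<in> (\<lambda>a. a \<odot>\<^bsub>M\<^esub> x) ` I" "z \<in> (\<lambda>a. a \<odot>\<^bsub>M\<^esub> x) ` I"
    then obtain a b where ab: "a \<in> I" "b \<in> I" "y = a \<odot>\<^bsub>M\<^esub> x" "z = b \<odot>\<^bsub>M\<^esub> x" by auto
    have "a \<oplus> b \<in> I" using ab additive_subgroup.a_closed[OF ideal.axioms(1)[OF I]] by blast
    then show "y \<oplus>\<^bsub>M\<^esub> z \<in> (\<lambda>a. a \<odot>\<^bsub>M\<^esub> x) ` I"
      using ab Ic x by (intro image_eqI[of _ _ "a \<oplus> b"]) (auto simp: smult_l_distr)
  next
    fix c y assume c: "c \<in> carrier R" and "y \<in> (\<lambda>a. a \<odot>\<^bsub>M\<^esub> x) ` I"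
    then obtain a where a: "a \<in> I" "y = a \<odot>\<^bsub>M\<^esub> x" by auto
    have "c \<otimes> a \<in> I" using a c ideal.I_l_closed[OF I] by blast
    then show "c \<odot>\<^bsub>M\<^esub> y \<in> (\<lambda>a. a \<odot>\<^bsub>M\<^esub> x) ` I"
      using a c Ic x by (intro image_eqI[of _ _ "c \<otimes> a"]) (auto simp: smult_assoc1)
  qed
  ultimately show ?case using submodule_msum xs by metis
qed

lemma lspan_least:
  assumes "submodule T R M" "\<And>a x. \<lbrakk>a \<in> I; x \<in> set xs\<rbrakk> \<Longrightarrow> a \<odot>\<^bsub>M\<^esub> x \<in> T"
  shows "lspan M I xs \<subseteq> T"
  using assms(2) by (induction xs) (auto intro: sm_zero sm_add assms(1))

lemma lspan_mem:
  assumes I: "ideal I R" and "set xs \<subseteq> carrier M" "a \<in> I" "x \<in> set xs"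
  shows "a \<odot>\<^bsub>M\<^esub> x \<in> lspan M I xs"
  using assms(2,4)
proof (induction xs)
  case (Cons y xs)
  have ac: "a \<in> carrier R" using I assms(3) ideal.Icarr by metis
  have xs: "submodule (lspan M I xs) R M" using Cons by (intro submodule_lspan I) auto
  show ?case
  proof (cases "x = y")
    case True
    then have "a \<odot>\<^bsub>M\<^esub> x = a \<odot>\<^bsub>M\<^esub> y \<oplus>\<^bsub>M\<^esub> \<zero>\<^bsub>M\<^esub>" using ac Cons by simp
    then show ?thesis using sm_zero[OF xs] assms(3) by auto
  next
    case False
    then have "a \<odot>\<^bsub>M\<^esub> x \<in> lspan M I xs" using Cons by simp
    moreover have "a \<odot>\<^bsub>M\<^esub> x = \<zero> \<odot>\<^bsub>M\<^esub> y \<oplus>\<^bsub>M\<^esub> a \<odot>\<^bsub>M\<^esub> x" using ac Cons False by auto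
    ultimately show ?thesis
      using additive_subgroup.zero_closed[OF ideal.axioms(1)[OF I]] by auto
  qed
qed simp

lemma lspan_mono: "I \<subseteq> J \<Longrightarrow> lspan M I xs \<subseteq> lspan M J xs"
  by (induction xs) auto

lemma fg_lspan:
  assumes "finitely_generated_module R M"
  obtains xs where "set xs \<subseteq> carrier M" "lspan M (carrier R) xs = carrier M"
proof -
  obtain S where S: "finite S" "S \<subseteq> carrier M" "\<And>N. submodule N R M \<and> S \<subseteq> N \<Longrightarrow> N = carrier M"
    using assms unfolding finitely_generated_module_def by blast
  obtain xs where xs: "set xs = S" using finite_list S(1) by blast
  have "submodule (lspan M (carrier R) xs) R M" using S xs by (intro submodule_lspan R.oneideal) auto
  moreover have "S \<subseteq> lspan M (carrier R) xs"
  proof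
    fix x assume x: "x \<in> S"
    then have "\<one> \<odot>\<^bsub>M\<^esub> x \<in> lspan M (carrier R) xs" using S xs by (intro lspan_mem R.oneideal) auto
    then show "x \<in> lspan M (carrier R) xs" using x S by auto
  qed
  ultimately show ?thesis using that S xs by blast
qed

lemma smult_lspan:
  assumes I: "ideal I R" and J: "ideal J R" and xs: "set xs \<subseteq> carrier M"
    and "a \<in> J" "y \<in> lspan M I xs"
  shows "a \<odot>\<^bsub>M\<^esub> y \<in> lspan M (J \<cdot> I) xs"
proof -
  have JI: "ideal (J \<cdot> I) R" by (intro R.ideal_prod_is_ideal I J)
  note s = submodule_lspan[OF JI xs]
  have ac: "a \<in> carrier R" using J assms(4) ideal.Icarr by metis
  let ?T = "{y \<in> carrier M. a \<odot>\<^bsub>M\<^esub> y \<in> lspan M (J \<cdot> I) xs}"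
  have "lspan M I xs \<subseteq> ?T"
  proof (rule lspan_least)
    show "submodule ?T R M"
      unfolding submodule_iff using ac sm_zero[OF s] sm_add[OF s] sm_smult[OF s]
      by (auto simp: smult_r_distr) (metis R.m_comm smult_assoc1)
  next
    fix b x assume b: "b \<in> I" and x: "x \<in> set xs"
    have bc: "b \<in> carrier R" using I b ideal.Icarr by metis
    have "(a \<otimes> b) \<odot>\<^bsub>M\<^esub> x \<in> lspan M (J \<cdot> I) xs"
      using b assms(4) by (intro lspan_mem[OF JI xs _ x] ideal_prod.prod)
    then show "b \<odot>\<^bsub>M\<^esub> x \<in> ?T" using ac bc x xs by (auto simp: smult_assoc1)
  qed
  then show ?thesis using assms(5) by blast
qed

text \<open>An endomorphism preserves I M: it sends b x to b h(x), and h(x) is again a combination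
  of the generators.\<close>

lemma linear_lspan:
  assumes I: "ideal I R" and xs: "set xs \<subseteq> carrier M" "lspan M (carrier R) xs = carrier M"
    and h: "linear_map R M M h" and "y \<in> lspan M I xs"
  shows "h y \<in> lspan M I xs"
proof -
  note s = submodule_lspan[OF I xs(1)]
  have "lspan M I xs \<subseteq> {y \<in> carrier M. h y \<in> lspan M I xs}"
  proof (rule lspan_least)
    show "submodule {y \<in> carrier M. h y \<in> lspan M I xs} R M"
      by (rule submodule_preimage[OF module_axioms module_axioms h s])
  next
    fix b x assume b: "b \<in> I" and x: "x \<in> set xs"
    have bc: "b \<in> carrier R" using I b ideal.Icarr by metis
    have "h x \<in> lspan M (carrier R) xs" using x xs linear_mapD(1)[OF h] by auto
    then have "b \<odot>\<^bsub>M\<^esub> h x \<in> lspan M (I \<cdot> carrier R) xs" by (intro smult_lspan R.oneideal I xs b)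
    then have "h (b \<odot>\<^bsub>M\<^esub> x) \<in> lspan M (I \<cdot> carrier R) xs" using linear_mapD(3)[OF h bc] x xs by auto
    moreover have "I \<cdot> carrier R \<subseteq> I" using R.ideal_prod_inter[OF I R.oneideal] by blast
    ultimately show "b \<odot>\<^bsub>M\<^esub> x \<in> {y \<in> carrier M. h y \<in> lspan M I xs}"
      using lspan_mono bc x xs by blast
  qed
  then show ?thesis using assms(5) by blast
qed

lemma ideal_power:
  assumes "ideal m R" shows "ideal (m [^]\<^bsub>ideals_set R\<^esub> (n::nat)) R"
proof (induction n)
  case 0
  then show ?case using R.oneideal by (simp add: ideals_set_def)
next
  case (Suc n)
  then show ?case using R.ideal_prod_is_ideal[OF Suc assms] by (simp add: ideals_set_def nat_pow_def)
qed

lemma ideal_power_Suc: "m [^]\<^bsub>ideals_set R\<^esub> Suc n = (m [^]\<^bsub>ideals_set R\<^esub> (n::nat)) \<cdot> m"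
  by (simp add: ideals_set_def)

lemma ideal_power_0: "m [^]\<^bsub>ideals_set R\<^esub> (0::nat) = carrier R"
  by (simp add: ideals_set_def)

text \<open>Finitely generated modules inherit the existence of adic limits from R, by induction on
  the generators: the coefficient of x converges in R, the remainder by the induction
  hypothesis.\<close>

lemma lspan_complete:
  assumes "adically_complete R m" and m: "ideal m R"
    and "set xs \<subseteq> carrier M"
    and "\<And>n::nat. a n \<in> lspan M (carrier R) xs"
    and "\<And>n. a (Suc n) \<ominus>\<^bsub>M\<^esub> a n \<in> lspan M (m [^]\<^bsub>ideals_set R\<^esub> n) xs"
  shows "\<exists>y\<in>lspan M (carrier R) xs. \<forall>n. y \<ominus>\<^bsub>M\<^esub> a n \<in> lspan M (m [^]\<^bsub>ideals_set R\<^esub> n) xs"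
  using assms(3-5)
proof (induction xs arbitrary: a)
  case Nil
  then show ?case by (simp add: M.minus_eq)
next
  case (Cons x xs)
  let ?m = "\<lambda>n::nat. m [^]\<^bsub>ideals_set R\<^esub> n"
  note I = ideal_power[OF m]
  have mc: "c \<in> carrier R" if "c \<in> ?m n" for c n using I that ideal.Icarr by metis
  have x: "x \<in> carrier M" and xs: "set xs \<subseteq> carrier M" using Cons.prems by auto
  note sR = submodule_lspan[OF R.oneideal xs]
  have smc: "e \<in> carrier M" if "e \<in> lspan M (?m n) xs" for e n
    using sm_carrier[OF submodule_lspan[OF I xs]] that by blast
  have "\<exists>c e. c \<in> carrier R \<and> e \<in> lspan M (carrier R) xs \<and> a 0 = c \<odot>\<^bsub>M\<^esub> x \<oplus>\<^bsub>M\<^esub> e"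
    using Cons.prems(2)[of 0] by auto
  then obtain c0 e0 where ce0: "c0 \<in> carrier R" "e0 \<in> lspan M (carrier R) xs" "a 0 = c0 \<odot>\<^bsub>M\<^esub> x \<oplus>\<^bsub>M\<^esub> e0"
    by blast
  have "\<forall>n. \<exists>c e. c \<in> ?m n \<and> e \<in> lspan M (?m n) xs \<and> a (Suc n) \<ominus>\<^bsub>M\<^esub> a n = c \<odot>\<^bsub>M\<^esub> x \<oplus>\<^bsub>M\<^esub> e"
    using Cons.prems(3) by auto
  then obtain c e where ce: "\<And>n. c n \<in> ?m n" "\<And>n. e n \<in> lspan M (?m n) xs"
    "\<And>n. a (Suc n) \<ominus>\<^bsub>M\<^esub> a n = c n \<odot>\<^bsub>M\<^esub> x \<oplus>\<^bsub>M\<^esub> e n" by metis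
  \<comment> \<open>The generators need not be free, so coefficients chosen separately for every
    \<open>a n\<close> need not form a compatible sequence. They are chosen for \<open>a 0\<close>
    and for the differences, and then summed up.\<close>
  define C where "C = rec_nat c0 (\<lambda>n s. s \<oplus> c n)"
  define A where "A = rec_nat e0 (\<lambda>n s. s \<oplus>\<^bsub>M\<^esub> e n)"
  have C: "C 0 = c0" "C (Suc n) = C n \<oplus> c n" and A: "A 0 = e0" "A (Suc n) = A n \<oplus>\<^bsub>M\<^esub> e n" for n
    by (auto simp: C_def A_def)
  have Cc: "C n \<in> carrier R" for n
  proof (induction n)
    case (Suc n)
    then show ?case using C mc[OF ce(1)] by simp
  qed (use C ce0 in simp)
  have lsub: "lspan M (?m n) xs \<subseteq> lspan M (carrier R) xs" for n using lspan_mono mc by (metis subsetI)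
  have As: "A n \<in> lspan M (carrier R) xs" for n
  proof (induction n)
    case (Suc n)
    then show ?case using A sm_add[OF sR] ce(2)[of n] lsub[of n] by auto
  qed (use A ce0 in auto)
  have Ac: "A n \<in> carrier M" for n using As sm_carrier[OF sR] by blast
  have aeq: "a n = C n \<odot>\<^bsub>M\<^esub> x \<oplus>\<^bsub>M\<^esub> A n" for n
  proof (induction n)
    case (Suc n)
    have anc: "a k \<in> carrier M" for k
      using Cons.prems(2)[of k] sm_carrier[OF submodule_lspan[OF R.oneideal Cons.prems(1)]] by blast
    have ec: "e n \<in> carrier M" using ce(2) smc by blast
    have "a (Suc n) = a n \<oplus>\<^bsub>M\<^esub> (a (Suc n) \<ominus>\<^bsub>M\<^esub> a n)"
      using anc[of n] anc[of "Suc n"] by (simp add: M.minus_eq M.a_lcomm[of "a n"] M.r_neg)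
    also have "\<dots> = (C n \<odot>\<^bsub>M\<^esub> x \<oplus>\<^bsub>M\<^esub> A n) \<oplus>\<^bsub>M\<^esub> (c n \<odot>\<^bsub>M\<^esub> x \<oplus>\<^bsub>M\<^esub> e n)"
      by (simp only: ce(3)) (simp only: Suc)
    also have "\<dots> = (C n \<oplus> c n) \<odot>\<^bsub>M\<^esub> x \<oplus>\<^bsub>M\<^esub> (A n \<oplus>\<^bsub>M\<^esub> e n)"
      using Cc mc[OF ce(1)] x ec Ac by (simp add: smult_l_distr M.a_ac)
    finally show ?case using C A by simp
  qed (use C A ce0 in simp)
  have "C (Suc n) \<ominus> C n \<in> ?m n" for n
  proof -
    have "C (Suc n) \<ominus> C n = c n" using C Cc[of n] mc[OF ce(1)]
      by (simp add: R.add_minus_cancel_left)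
    then show ?thesis using ce by simp
  qed
  then have "\<exists>!y. y \<in> carrier R \<and> (\<forall>n. y \<ominus> C n \<in> ?m n)"
    using assms(1) Cc unfolding adically_complete_def by simp
  then obtain y where y: "y \<in> carrier R" "\<And>n. y \<ominus> C n \<in> ?m n" by blast
  have "A (Suc n) \<ominus>\<^bsub>M\<^esub> A n \<in> lspan M (?m n) xs" for n
  proof -
    have "A (Suc n) \<ominus>\<^bsub>M\<^esub> A n = e n" using A Ac[of n] smc[OF ce(2)]
      by (simp add: M.add_minus_cancel_left)
    then show ?thesis using ce by simp
  qed
  from Cons.IH[OF xs As this] obtain z where z: "z \<in> lspan M (carrier R) xs"
    "\<And>n. z \<ominus>\<^bsub>M\<^esub> A n \<in> lspan M (?m n) xs" by blast
  have zc: "z \<in> carrier M" using z sm_carrier[OF sR] by blast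
  have "(y \<odot>\<^bsub>M\<^esub> x \<oplus>\<^bsub>M\<^esub> z) \<ominus>\<^bsub>M\<^esub> a n \<in> lspan M (?m n) (x # xs)" for n
  proof -
    have "(y \<odot>\<^bsub>M\<^esub> x \<oplus>\<^bsub>M\<^esub> z) \<ominus>\<^bsub>M\<^esub> a n = (y \<ominus> C n) \<odot>\<^bsub>M\<^esub> x \<oplus>\<^bsub>M\<^esub> (z \<ominus>\<^bsub>M\<^esub> A n)"
      unfolding aeq using y(1) Cc[of n] Ac[of n] zc x
      by (simp add: M.minus_eq R.minus_eq smult_l_distr smult_l_minus M.minus_add M.a_ac)
    then show ?thesis using y(2) z(2) by auto
  qed
  moreover have "y \<odot>\<^bsub>M\<^esub> x \<oplus>\<^bsub>M\<^esub> z \<in> lspan M (carrier R) (x # xs)" using y z by auto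
  ultimately show ?case by blast
qed

end

text \<open>The Newton step e' = 3 e^2 - 2 e^3 for the equation e^2 = e, written as e + (1 - 2e) d
  with error d = e^2 - e. From t^2 = 1 + 4d the new error is d^2 (t^2 - 4), that is d^2 (4d -
  3).\<close>

lemma (in cring) newton_idempotent:
  assumes e: "e \<in> carrier R" and d: "d = e \<otimes> e \<ominus> e" and t: "t = \<one> \<ominus> (e \<oplus> e)"
    and e': "e' = e \<oplus> t \<otimes> d"
  shows "e' \<otimes> e' \<ominus> e' = (d \<otimes> d) \<otimes> (t \<otimes> t \<ominus> (\<one> \<oplus> \<one> \<oplus> \<one> \<oplus> \<one>))"
proof -
  have c: "d \<in> carrier R" "t \<in> carrier R" using e by (auto simp: d t)
  have ee: "e \<otimes> e = e \<oplus> d" using e unfolding d by algebra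
  have tt: "t \<otimes> t = \<one> \<oplus> (d \<oplus> d \<oplus> d \<oplus> d)" using e ee c(1) unfolding t by algebra
  have "e' \<otimes> e' \<ominus> e' = (e \<otimes> e \<ominus> e) \<oplus> (e \<oplus> e) \<otimes> (t \<otimes> d) \<oplus> (t \<otimes> t) \<otimes> (d \<otimes> d) \<ominus> t \<otimes> d"
    using e c unfolding e' by algebra
  also have "\<dots> = d \<oplus> (\<one> \<ominus> t) \<otimes> (t \<otimes> d) \<oplus> (t \<otimes> t) \<otimes> (d \<otimes> d) \<ominus> t \<otimes> d"
  proof -
    have "e \<oplus> e = \<one> \<ominus> t" using e unfolding t by algebra
    then show ?thesis using d by simp
  qed
  also have "\<dots> = d \<ominus> (t \<otimes> t) \<otimes> d \<oplus> (t \<otimes> t) \<otimes> (d \<otimes> d)" using c by algebra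
  also have "\<dots> = d \<ominus> (\<one> \<oplus> (d \<oplus> d \<oplus> d \<oplus> d)) \<otimes> d \<oplus> (t \<otimes> t) \<otimes> (d \<otimes> d)" using tt by simp
  also have "\<dots> = (d \<otimes> d) \<otimes> (t \<otimes> t \<ominus> (\<one> \<oplus> \<one> \<oplus> \<one> \<oplus> \<one>))" using c by algebra
  finally show ?thesis .
qed

section \<open>Algebras over complete local rings\<close>

text \<open>Meant for endomorphism rings: A is finite as a module over R but possibly
  noncommutative.\<close>

locale complete_local_algebra = local_noetherian_module R A m + A: ring A
  for R :: "('r, 'b) ring_scheme" (structure) and A :: "('r, 'm, 'c) module_scheme" (structure) and m +
  assumes smult_l: "\<lbrakk>a \<in> carrier R; x \<in> carrier A; y \<in> carrier A\<rbrakk>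
      \<Longrightarrow> (a \<odot>\<^bsub>A\<^esub> x) \<otimes>\<^bsub>A\<^esub> y = a \<odot>\<^bsub>A\<^esub> (x \<otimes>\<^bsub>A\<^esub> y)"
    and smult_r: "\<lbrakk>a \<in> carrier R; x \<in> carrier A; y \<in> carrier A\<rbrakk>
      \<Longrightarrow> x \<otimes>\<^bsub>A\<^esub> (a \<odot>\<^bsub>A\<^esub> y) = a \<odot>\<^bsub>A\<^esub> (x \<otimes>\<^bsub>A\<^esub> y)"
    and complete: "adically_complete R m"
    and fg: "finitely_generated_module R A"
begin

definition gens where "gens = (SOME xs. set xs \<subseteq> carrier A \<and> lspan A (carrier R) xs = carrier A)"

lemma gens: "set gens \<subseteq> carrier A" "lspan A (carrier R) gens = carrier A"
proof -
  obtain xs where "set xs \<subseteq> carrier A" "lspan A (carrier R) xs = carrier A" by (rule fg_lspan[OF fg])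
  then have "set gens \<subseteq> carrier A \<and> lspan A (carrier R) gens = carrier A"
    unfolding gens_def by (rule someI[where x = xs, OF conjI])
  then show "set gens \<subseteq> carrier A" "lspan A (carrier R) gens = carrier A" by auto
qed

text \<open>The adic filtration of A by the submodules m^n A.\<close>

definition F :: "nat \<Rightarrow> 'm set" where "F n = lspan A (m [^]\<^bsub>ideals_set R\<^esub> n) gens"

lemma F_submodule: "submodule (F n) R A"
  unfolding F_def by (intro submodule_lspan ideal_power ideal_m gens)

lemma F_0: "F 0 = carrier A"
  unfolding F_def ideal_power_0 by (rule gens)

lemma F_carrier: "x \<in> F n \<Longrightarrow> x \<in> carrier A"
  using sm_carrier[OF F_submodule] .

lemma F_Suc: "F (Suc n) \<subseteq> F n"
  unfolding F_def ideal_power_Suc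
  using R.ideal_prod_inter[OF ideal_power[OF ideal_m, of n] ideal_m] by (intro lspan_mono) auto

lemma F_le_1: "n \<ge> 1 \<Longrightarrow> F n \<subseteq> F 1"
  by (induction n rule: dec_induct) (use F_Suc in auto)

lemma linear_mult_l: "x \<in> carrier A \<Longrightarrow> linear_map R A A (\<lambda>y. x \<otimes>\<^bsub>A\<^esub> y)"
  unfolding linear_map_def by (auto simp: A.r_distr smult_r)

lemma linear_mult_r: "x \<in> carrier A \<Longrightarrow> linear_map R A A (\<lambda>y. y \<otimes>\<^bsub>A\<^esub> x)"
  unfolding linear_map_def by (auto simp: A.l_distr smult_l)

lemma F_mult_l: "\<lbrakk>x \<in> carrier A; y \<in> F n\<rbrakk> \<Longrightarrow> x \<otimes>\<^bsub>A\<^esub> y \<in> F n"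
  unfolding F_def by (rule linear_lspan[OF ideal_power[OF ideal_m] gens linear_mult_l])

lemma F_mult_r: "\<lbrakk>x \<in> carrier A; y \<in> F n\<rbrakk> \<Longrightarrow> y \<otimes>\<^bsub>A\<^esub> x \<in> F n"
  unfolding F_def by (rule linear_lspan[OF ideal_power[OF ideal_m] gens linear_mult_r])

text \<open>F (n + 1) is generated by m F(n). Inclusions of the filtration into other submodules are
  derived from this and not from the powers of m.\<close>

lemma F_Suc_least:
  assumes T: "submodule T R A" and "\<And>r y. \<lbrakk>r \<in> m; y \<in> F n\<rbrakk> \<Longrightarrow> r \<odot>\<^bsub>A\<^esub> y \<in> T"
  shows "F (Suc n) \<subseteq> T"
  unfolding F_def ideal_power_Suc
proof (rule lspan_least[OF T])
  fix a x assume "a \<in> (m [^]\<^bsub>ideals_set R\<^esub> n) \<cdot> m" and x: "x \<in> set gens"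
  have xc: "x \<in> carrier A" using x gens by blast
  note I = ideal_power[OF ideal_m, of n]
  have "a \<in> carrier R \<and> a \<odot>\<^bsub>A\<^esub> x \<in> T" using \<open>a \<in> _\<close>
  proof (induction a rule: ideal_prod.induct)
    case (prod i j)
    have ic: "i \<in> carrier R" "j \<in> carrier R" using I prod ideal.Icarr m_carrier by metis+
    have "i \<odot>\<^bsub>A\<^esub> x \<in> F n" unfolding F_def by (intro lspan_mem I gens x prod)
    then have "j \<odot>\<^bsub>A\<^esub> (i \<odot>\<^bsub>A\<^esub> x) \<in> T" using assms(2) prod by blast
    then show ?case using ic xc by (simp add: smult_assoc1[symmetric] R.m_comm)
  next
    case (sum a b)
    then show ?case using xc sm_add[OF T] by (simp add: smult_l_distr)
  qed
  then show "a \<odot>\<^bsub>A\<^esub> x \<in> T" by blast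
qed

lemma F_smult: "\<lbrakk>r \<in> m; y \<in> F n\<rbrakk> \<Longrightarrow> r \<odot>\<^bsub>A\<^esub> y \<in> F (Suc n)"
  using smult_lspan[OF ideal_power[OF ideal_m, of n] ideal_m gens(1), of r y]
    R.ideal_prod_commute[OF ideal_power[OF ideal_m, of n] ideal_m]
  unfolding F_def ideal_power_Suc by simp

lemma F_mult:
  assumes "x \<in> F n" "y \<in> F 1" shows "x \<otimes>\<^bsub>A\<^esub> y \<in> F (Suc n)"
  using assms
proof (induction n arbitrary: x)
  case 0
  then show ?case using F_0 F_mult_l by auto
next
  case (Suc n)
  have yc: "y \<in> carrier A" using Suc F_carrier by blast
  have "F (Suc n) \<subseteq> {x \<in> carrier A. x \<otimes>\<^bsub>A\<^esub> y \<in> F (Suc (Suc n))}"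
  proof (rule F_Suc_least)
    show "submodule {x \<in> carrier A. x \<otimes>\<^bsub>A\<^esub> y \<in> F (Suc (Suc n))} R A"
      by (rule submodule_preimage[OF module_axioms module_axioms linear_mult_r[OF yc] F_submodule])
    fix r x assume r: "r \<in> m" and x: "x \<in> F n"
    have "x \<otimes>\<^bsub>A\<^esub> y \<in> F (Suc n)" using Suc.IH x Suc.prems by blast
    then have "r \<odot>\<^bsub>A\<^esub> (x \<otimes>\<^bsub>A\<^esub> y) \<in> F (Suc (Suc n))" using F_smult r by blast
    then show "r \<odot>\<^bsub>A\<^esub> x \<in> {x \<in> carrier A. x \<otimes>\<^bsub>A\<^esub> y \<in> F (Suc (Suc n))}"
      using r m_carrier x F_carrier yc by (simp add: smult_l)
  qed
  then show ?case using Suc by blast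
qed

text \<open>A nonzero x is avoided by a submodule T on whose quotient m acts nilpotently, by
  \<open>krull\<close>. Descending along \<open>nilpotent_induct\<close>, each enlargement costs one
  further power of m, so some F(n) lies in T.\<close>

lemma F_separated:
  assumes "\<And>n. x \<in> F n" shows "x = \<zero>\<^bsub>A\<^esub>"
proof (rule ccontr)
  assume "x \<noteq> \<zero>\<^bsub>A\<^esub>"
  moreover have "x \<in> carrier A" using assms F_0 by blast
  ultimately obtain T where T: "submodule T R A" "{\<zero>\<^bsub>A\<^esub>} \<subseteq> T" "x \<notin> T"
    "\<And>r. r \<in> m \<Longrightarrow> \<exists>k::nat. \<forall>y\<in>carrier A. (r [^] k) \<odot>\<^bsub>A\<^esub> y \<in> T"
    using krull[OF submodule_zero, of x] by (metis singletonD)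
  have "\<exists>n. F n \<subseteq> T"
  proof (rule nilpotent_induct[where L = "carrier A" and N = T and P = "\<lambda>T. \<exists>n. F n \<subseteq> T"])
    show "\<exists>n. F n \<subseteq> carrier A" using F_0 by blast
  next
    fix U y assume U: "submodule U R A" and y: "y \<in> carrier A" and my: "\<And>r. r \<in> m \<Longrightarrow> r \<odot>\<^bsub>A\<^esub> y \<in> U"
      and "\<exists>n. F n \<subseteq> U <+>\<^bsub>A\<^esub> span1 y"
    then obtain n where n: "F n \<subseteq> U <+>\<^bsub>A\<^esub> span1 y" by blast
    have "F (Suc n) \<subseteq> U"
    proof (rule F_Suc_least[OF U])
      fix r z assume r: "r \<in> m" and "z \<in> F n"
      then obtain u a where ua: "u \<in> U" "a \<in> carrier R" "z = u \<oplus>\<^bsub>A\<^esub> a \<odot>\<^bsub>A\<^esub> y"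
        using n by (metis mem_msum_span1 subsetD)
      have rc: "r \<in> carrier R" using r m_carrier by blast
      have "r \<odot>\<^bsub>A\<^esub> z = r \<odot>\<^bsub>A\<^esub> u \<oplus>\<^bsub>A\<^esub> a \<odot>\<^bsub>A\<^esub> (r \<odot>\<^bsub>A\<^esub> y)"
        using ua rc y sm_carrier[OF U] by (simp add: smult_r_distr smult_assoc1[symmetric] R.m_comm)
      then show "r \<odot>\<^bsub>A\<^esub> z \<in> U" using ua rc my[OF r] sm_add[OF U] sm_smult[OF U] by simp
    qed
    then show "\<exists>n. F n \<subseteq> U" by blast
  qed (use T submodule_carrier sm_subset in auto)
  then show False using assms T by blast
qed

text \<open>Multiplication by 1 - z, on either side, is onto modulo m A and therefore onto by
  Nakayama; this yields a right and a left inverse.\<close>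

lemma one_minus_F1:
  assumes z: "z \<in> F 1" shows "\<one>\<^bsub>A\<^esub> \<ominus>\<^bsub>A\<^esub> z \<in> Units A"
proof -
  have zc: "z \<in> carrier A" using z F_carrier by blast
  have onto: "h ` carrier A = carrier A"
    if h: "linear_map R A A h" and near: "\<And>y. y \<in> carrier A \<Longrightarrow> \<exists>w\<in>F 1. y = h y \<oplus>\<^bsub>A\<^esub> w" for h
  proof (rule ccontr)
    assume "h ` carrier A \<noteq> carrier A"
    moreover have s: "submodule (h ` carrier A) R A"
      by (rule submodule_image[OF module_axioms module_axioms h submodule_carrier])
    ultimately obtain T where T: "submodule T R A" "h ` carrier A \<subseteq> T" "T \<subset> carrier A"
      "\<And>r x. \<lbrakk>r \<in> m; x \<in> carrier A\<rbrakk> \<Longrightarrow> r \<odot>\<^bsub>A\<^esub> x \<in> T"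
      using nakayama[OF s submodule_carrier] sm_subset[OF s] by blast
    have "F (Suc 0) \<subseteq> T" using F_Suc_least[OF T(1), of 0] T(4) F_0 by blast
    then have "carrier A \<subseteq> T"
      using near T(2) sm_add[OF T(1)] by (metis One_nat_def imageI subsetD subsetI)
    then show False using T(3) by blast
  qed
  have u: "\<one>\<^bsub>A\<^esub> \<ominus>\<^bsub>A\<^esub> z \<in> carrier A" using zc by simp
  have "(\<lambda>y. (\<one>\<^bsub>A\<^esub> \<ominus>\<^bsub>A\<^esub> z) \<otimes>\<^bsub>A\<^esub> y) ` carrier A = carrier A"
  proof (rule onto[OF linear_mult_l[OF u]])
    fix y assume y: "y \<in> carrier A"
    have "y = (\<one>\<^bsub>A\<^esub> \<ominus>\<^bsub>A\<^esub> z) \<otimes>\<^bsub>A\<^esub> y \<oplus>\<^bsub>A\<^esub> z \<otimes>\<^bsub>A\<^esub> y"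
      using y zc by (simp add: M.minus_eq A.l_distr A.l_minus M.a_assoc M.l_neg)
    then show "\<exists>w\<in>F 1. y = (\<one>\<^bsub>A\<^esub> \<ominus>\<^bsub>A\<^esub> z) \<otimes>\<^bsub>A\<^esub> y \<oplus>\<^bsub>A\<^esub> w" using F_mult_r[OF y z] by blast
  qed
  then obtain v where v: "v \<in> carrier A" "(\<one>\<^bsub>A\<^esub> \<ominus>\<^bsub>A\<^esub> z) \<otimes>\<^bsub>A\<^esub> v = \<one>\<^bsub>A\<^esub>"
    by (metis (no_types, lifting) A.one_closed imageE)
  have "(\<lambda>y. y \<otimes>\<^bsub>A\<^esub> (\<one>\<^bsub>A\<^esub> \<ominus>\<^bsub>A\<^esub> z)) ` carrier A = carrier A"
  proof (rule onto[OF linear_mult_r[OF u]])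
    fix y assume y: "y \<in> carrier A"
    have "y = y \<otimes>\<^bsub>A\<^esub> (\<one>\<^bsub>A\<^esub> \<ominus>\<^bsub>A\<^esub> z) \<oplus>\<^bsub>A\<^esub> y \<otimes>\<^bsub>A\<^esub> z"
      using y zc by (simp add: M.minus_eq A.r_distr A.r_minus M.a_assoc M.l_neg)
    then show "\<exists>w\<in>F 1. y = y \<otimes>\<^bsub>A\<^esub> (\<one>\<^bsub>A\<^esub> \<ominus>\<^bsub>A\<^esub> z) \<oplus>\<^bsub>A\<^esub> w" using F_mult_l[OF y z] by blast
  qed
  then obtain w where w: "w \<in> carrier A" "w \<otimes>\<^bsub>A\<^esub> (\<one>\<^bsub>A\<^esub> \<ominus>\<^bsub>A\<^esub> z) = \<one>\<^bsub>A\<^esub>"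
    by (metis (no_types, lifting) A.one_closed imageE)
  have "w = v" using u v w A.m_assoc[of w "\<one>\<^bsub>A\<^esub> \<ominus>\<^bsub>A\<^esub> z" v] by simp
  then show ?thesis using u v w unfolding Units_def by blast
qed

lemma unit_of_commuting_product:
  assumes "f \<in> carrier A" "w \<in> carrier A" "f \<otimes>\<^bsub>A\<^esub> w = w \<otimes>\<^bsub>A\<^esub> f" "f \<otimes>\<^bsub>A\<^esub> w \<in> Units A"
  shows "f \<in> Units A"
proof -
  let ?u = "inv\<^bsub>A\<^esub> (f \<otimes>\<^bsub>A\<^esub> w)"
  have u: "?u \<in> carrier A" "?u \<otimes>\<^bsub>A\<^esub> (w \<otimes>\<^bsub>A\<^esub> f) = \<one>\<^bsub>A\<^esub>" "(f \<otimes>\<^bsub>A\<^esub> w) \<otimes>\<^bsub>A\<^esub> ?u = \<one>\<^bsub>A\<^esub>"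
    using assms by (simp_all flip: assms(3))
  have l: "(?u \<otimes>\<^bsub>A\<^esub> w) \<otimes>\<^bsub>A\<^esub> f = \<one>\<^bsub>A\<^esub>" and r: "f \<otimes>\<^bsub>A\<^esub> (w \<otimes>\<^bsub>A\<^esub> ?u) = \<one>\<^bsub>A\<^esub>"
    using u assms(1,2) by (simp_all add: A.m_assoc)
  have "?u \<otimes>\<^bsub>A\<^esub> w = (?u \<otimes>\<^bsub>A\<^esub> w) \<otimes>\<^bsub>A\<^esub> (f \<otimes>\<^bsub>A\<^esub> (w \<otimes>\<^bsub>A\<^esub> ?u))" using r u assms(1,2) by simp
  also have "\<dots> = ((?u \<otimes>\<^bsub>A\<^esub> w) \<otimes>\<^bsub>A\<^esub> f) \<otimes>\<^bsub>A\<^esub> (w \<otimes>\<^bsub>A\<^esub> ?u)"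
    using u(1) assms(1,2) by (intro A.m_assoc[symmetric]) auto
  also have "\<dots> = w \<otimes>\<^bsub>A\<^esub> ?u" using l u assms(1,2) by simp
  finally show ?thesis using l r u assms(1,2) unfolding Units_def by auto
qed

text \<open>The double commutant of f: a commutative R-subalgebra of A that contains f. It allows
  commutative ring identities for f, while units and limits are still taken in A.\<close>

definition bicommutant :: "'m \<Rightarrow> 'm set" where
  "bicommutant f = {a \<in> carrier A. \<forall>b\<in>carrier A. b \<otimes>\<^bsub>A\<^esub> f = f \<otimes>\<^bsub>A\<^esub> b \<longrightarrow> a \<otimes>\<^bsub>A\<^esub> b = b \<otimes>\<^bsub>A\<^esub> a}"

lemma bicommutant_submodule: "submodule (bicommutant f) R A"
  unfolding submodule_iff bicommutant_def by (auto simp: A.l_distr A.r_distr smult_l smult_r)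

lemma bicommutant_cring:
  assumes f: "f \<in> carrier A" shows "cring (A\<lparr>carrier := bicommutant f\<rparr>)"
proof (rule cringI)
  interpret B: module R "A\<lparr>carrier := bicommutant f\<rparr>"
    by (rule submodule.submodule_is_module[OF bicommutant_submodule module_axioms])
  have sub: "a \<in> carrier A" if "a \<in> bicommutant f" for a using that by (simp add: bicommutant_def)
  have comm: "a \<otimes>\<^bsub>A\<^esub> b = b \<otimes>\<^bsub>A\<^esub> a" if a: "a \<in> bicommutant f" and b: "b \<in> bicommutant f" for a b
  proof -
    have "b \<otimes>\<^bsub>A\<^esub> f = f \<otimes>\<^bsub>A\<^esub> b" using b f by (auto simp: bicommutant_def)
    then show ?thesis using a sub[OF b] by (auto simp: bicommutant_def)
  qed
  have mult: "a \<otimes>\<^bsub>A\<^esub> b \<in> bicommutant f" if a: "a \<in> bicommutant f" and b: "b \<in> bicommutant f" for a b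
  proof -
    have "(a \<otimes>\<^bsub>A\<^esub> b) \<otimes>\<^bsub>A\<^esub> c = c \<otimes>\<^bsub>A\<^esub> (a \<otimes>\<^bsub>A\<^esub> b)" if c: "c \<in> carrier A" "c \<otimes>\<^bsub>A\<^esub> f = f \<otimes>\<^bsub>A\<^esub> c" for c
    proof -
      have "a \<otimes>\<^bsub>A\<^esub> c = c \<otimes>\<^bsub>A\<^esub> a" "b \<otimes>\<^bsub>A\<^esub> c = c \<otimes>\<^bsub>A\<^esub> b" using a b c by (auto simp: bicommutant_def)
      then have "(a \<otimes>\<^bsub>A\<^esub> b) \<otimes>\<^bsub>A\<^esub> c = a \<otimes>\<^bsub>A\<^esub> (c \<otimes>\<^bsub>A\<^esub> b)" using sub a b c by (simp add: A.m_assoc)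
      also have "\<dots> = (a \<otimes>\<^bsub>A\<^esub> c) \<otimes>\<^bsub>A\<^esub> b" using sub a b c by (simp add: A.m_assoc)
      also have "\<dots> = c \<otimes>\<^bsub>A\<^esub> (a \<otimes>\<^bsub>A\<^esub> b)" using \<open>a \<otimes>\<^bsub>A\<^esub> c = _\<close> sub a b c by (simp add: A.m_assoc)
      finally show ?thesis .
    qed
    moreover have "a \<otimes>\<^bsub>A\<^esub> b \<in> carrier A" using sub a b by simp
    ultimately show ?thesis unfolding bicommutant_def by blast
  qed
  show "abelian_group (A\<lparr>carrier := bicommutant f\<rparr>)" by (rule B.abelian_group_axioms)
  show "comm_monoid (A\<lparr>carrier := bicommutant f\<rparr>)"
  proof (rule comm_monoidI)
    fix x y assume "x \<in> carrier (A\<lparr>carrier := bicommutant f\<rparr>)" "y \<in> carrier (A\<lparr>carrier := bicommutant f\<rparr>)"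
    then show "x \<otimes>\<^bsub>A\<lparr>carrier := bicommutant f\<rparr>\<^esub> y = y \<otimes>\<^bsub>A\<lparr>carrier := bicommutant f\<rparr>\<^esub> x"
      using comm[of x y] by simp
  next
    show "\<one>\<^bsub>A\<lparr>carrier := bicommutant f\<rparr>\<^esub> \<in> carrier (A\<lparr>carrier := bicommutant f\<rparr>)"
      by (simp add: bicommutant_def)
  qed (auto simp: mult sub A.m_assoc)
  show "(x \<oplus>\<^bsub>A\<lparr>carrier := bicommutant f\<rparr>\<^esub> y) \<otimes>\<^bsub>A\<lparr>carrier := bicommutant f\<rparr>\<^esub> z =
      x \<otimes>\<^bsub>A\<lparr>carrier := bicommutant f\<rparr>\<^esub> z \<oplus>\<^bsub>A\<lparr>carrier := bicommutant f\<rparr>\<^esub> y \<otimes>\<^bsub>A\<lparr>carrier := bicommutant f\<rparr>\<^esub> z"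
    if "x \<in> carrier (A\<lparr>carrier := bicommutant f\<rparr>)" "y \<in> carrier (A\<lparr>carrier := bicommutant f\<rparr>)"
      "z \<in> carrier (A\<lparr>carrier := bicommutant f\<rparr>)" for x y z
    using that sub by (simp add: A.l_distr)
qed

lemma bicommutant_self: "f \<in> carrier A \<Longrightarrow> f \<in> bicommutant f"
  by (auto simp: bicommutant_def)

text \<open>Modulo m A the algebra has finite length, so Fitting's argument produces an idempotent
  e0 in f; Newton iteration lifts it to A. If the lift is 0, then f is nilpotent modulo m A and 1 -
  f is a unit; if it is 1, then f is a unit.\<close>

theorem local_of_trivial_idempotents:
  assumes idem: "\<And>e. \<lbrakk>e \<in> carrier A; e \<otimes>\<^bsub>A\<^esub> e = e\<rbrakk> \<Longrightarrow> e = \<zero>\<^bsub>A\<^esub> \<or> e = \<one>\<^bsub>A\<^esub>"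
    and f: "f \<in> carrier A"
  shows "f \<in> Units A \<or> \<one>\<^bsub>A\<^esub> \<ominus>\<^bsub>A\<^esub> f \<in> Units A"
proof -
  define B where "B = A\<lparr>carrier := bicommutant f\<rparr>"
  interpret B: cring B unfolding B_def by (rule bicommutant_cring[OF f])
  have BA: "x \<in> carrier A" if "x \<in> carrier B" for x using that by (simp add: B_def bicommutant_def)
  have ops: "\<zero>\<^bsub>B\<^esub> = \<zero>\<^bsub>A\<^esub>" "\<one>\<^bsub>B\<^esub> = \<one>\<^bsub>A\<^esub>" "x \<oplus>\<^bsub>B\<^esub> y = x \<oplus>\<^bsub>A\<^esub> y" "x \<otimes>\<^bsub>B\<^esub> y = x \<otimes>\<^bsub>A\<^esub> y" for x y
    by (simp_all add: B_def)
  have neg: "\<ominus>\<^bsub>B\<^esub> x = \<ominus>\<^bsub>A\<^esub> x" if "x \<in> carrier B" for x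
    using M.minus_equality[of "\<ominus>\<^bsub>B\<^esub> x" x] B.l_neg[OF that] BA[OF that] BA[of "\<ominus>\<^bsub>B\<^esub> x"] that by (simp add: ops)
  have minus: "x \<ominus>\<^bsub>B\<^esub> y = x \<ominus>\<^bsub>A\<^esub> y" if "y \<in> carrier B" for x y
    using neg[OF that] by (simp add: a_minus_def ops)
  have fB: "f \<in> carrier B" using bicommutant_self[OF f] by (simp add: B_def)
  have F_l: "x \<otimes>\<^bsub>B\<^esub> y \<in> F n" if "x \<in> carrier B" "y \<in> F n" for x y n using F_mult_l BA that by (simp add: ops)
  have F_add: "x \<oplus>\<^bsub>B\<^esub> y \<in> F n" if "x \<in> F n" "y \<in> F n" for x y n
    using sm_add[OF F_submodule] that by (simp add: ops)
  have F_neg: "\<ominus>\<^bsub>B\<^esub> x \<in> F n" if "x \<in> F n" "x \<in> carrier B" for x n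
    using sm_neg[OF F_submodule] that neg by simp
  have F_minus: "x \<ominus>\<^bsub>B\<^esub> y \<in> F n" if "x \<in> F n" "y \<in> F n" "y \<in> carrier B" for x y n
    using F_add F_neg that by (simp add: a_minus_def)
  have unit_B: "x \<in> Units A" if "x \<in> carrier B" "y \<in> carrier B" "x \<otimes>\<^bsub>B\<^esub> y \<in> Units A" for x y
    using unit_of_commuting_product[of x y] BA that B.m_comm[of x y] by (simp add: ops)
  \<comment> \<open>The descending chain f^n B + m A, with B the double commutant. It stabilises
    because A / m A has finite length; hence f^n = f^(n+1) a modulo m A for some a in B.\<close>
  define C where "C n = (\<lambda>a. f [^]\<^bsub>B\<^esub> n \<otimes>\<^bsub>B\<^esub> a) ` carrier B <+>\<^bsub>A\<^esub> F 1" for n :: nat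
  have lin: "linear_map R A A (\<lambda>a. f [^]\<^bsub>B\<^esub> n \<otimes>\<^bsub>B\<^esub> a)" for n :: nat
    using linear_mult_l[of "f [^]\<^bsub>B\<^esub> n"] fB BA by (simp add: ops)
  have imsub: "submodule ((\<lambda>a. f [^]\<^bsub>B\<^esub> n \<otimes>\<^bsub>B\<^esub> a) ` carrier B) R A" for n :: nat
    using submodule_image[OF module_axioms module_axioms lin bicommutant_submodule] by (simp add: B_def)
  have Csub: "submodule (C n) R A" for n unfolding C_def by (intro submodule_msum imsub F_submodule)
  have FC: "F 1 \<subseteq> C n" for n unfolding C_def by (intro msum_upper2 imsub F_submodule)
  have Cdec: "C (Suc n) \<subseteq> C n" for n unfolding C_def
  proof (rule msum_mono)
    show "(\<lambda>a. f [^]\<^bsub>B\<^esub> Suc n \<otimes>\<^bsub>B\<^esub> a) ` carrier B \<subseteq> (\<lambda>a. f [^]\<^bsub>B\<^esub> n \<otimes>\<^bsub>B\<^esub> a) ` carrier B"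
    proof clarify
      fix a assume a: "a \<in> carrier B"
      then have "f [^]\<^bsub>B\<^esub> Suc n \<otimes>\<^bsub>B\<^esub> a = f [^]\<^bsub>B\<^esub> n \<otimes>\<^bsub>B\<^esub> (f \<otimes>\<^bsub>B\<^esub> a)" using fB by (simp add: B.m_assoc)
      then show "f [^]\<^bsub>B\<^esub> Suc n \<otimes>\<^bsub>B\<^esub> a \<in> (\<lambda>a. f [^]\<^bsub>B\<^esub> n \<otimes>\<^bsub>B\<^esub> a) ` carrier B" using a fB by auto
    qed
  qed simp
  obtain n where n: "C (Suc n) = C n"
  proof (rule ccontr)
    assume no: "\<not> thesis"
    have "(C n, C 0) \<in> mstep R A ^^ n" for n
    proof (induction n)
      case (Suc n)
      have "(C (Suc n), C n) \<in> mstep R A" using no that Cdec[of n] Csub by (auto simp: mstep_def)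
      then show ?case using Suc relpow_Suc_I2 by metis
    qed simp
    then have "enat n \<le> mlen R A (F 1) (carrier A)" for n
    proof -
      assume *: "\<And>n. (C n, C 0) \<in> mstep R A ^^ n"
      have "enat n \<le> mlen R A (C n) (C 0)" using relpow_mlen * by blast
      also have "\<dots> \<le> mlen R A (F 1) (C 0)"
        using mlen_mono(2)[OF F_submodule Csub Csub FC mstep_relpow_mono[OF *]] .
      also have "\<dots> \<le> mlen R A (F 1) (carrier A)"
        using mlen_mono(1)[OF F_submodule Csub submodule_carrier FC sm_subset[OF Csub]] .
      finally show ?thesis .
    qed
    moreover have "mlen R A (F 1) (carrier A) \<noteq> \<infinity>"
    proof (rule nilpotent_mlen_finite[OF F_submodule submodule_carrier sm_subset[OF F_submodule]])
      fix r assume r: "r \<in> m"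
      have "\<forall>x\<in>carrier A. (r [^] (1::nat)) \<odot>\<^bsub>A\<^esub> x \<in> F 1"
        using F_smult[OF r, of _ 0] r m_carrier by (simp add: F_0)
      then show "\<exists>k::nat. \<forall>x\<in>carrier A. (r [^] k) \<odot>\<^bsub>A\<^esub> x \<in> F 1" by blast
    qed
    ultimately show False by (metis enat_ord_simps(1) not_infinity_eq not_less_eq_eq order_refl)
  qed
  have "f [^]\<^bsub>B\<^esub> n = f [^]\<^bsub>B\<^esub> n \<otimes>\<^bsub>B\<^esub> \<one>\<^bsub>B\<^esub>" using fB by simp
  then have "f [^]\<^bsub>B\<^esub> n \<in> C n"
    unfolding C_def using msum_upper1[OF imsub F_submodule] B.one_closed by (metis imageI subsetD)
  then obtain a z where a: "a \<in> carrier B" and z: "z \<in> F 1" and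
    "f [^]\<^bsub>B\<^esub> n = f [^]\<^bsub>B\<^esub> Suc n \<otimes>\<^bsub>B\<^esub> a \<oplus>\<^bsub>A\<^esub> z"
    unfolding n[symmetric] unfolding C_def mem_msum by auto
  then have fz: "f [^]\<^bsub>B\<^esub> n = f [^]\<^bsub>B\<^esub> Suc n \<otimes>\<^bsub>B\<^esub> a \<oplus>\<^bsub>A\<^esub> z" by blast
  have wB: "f [^]\<^bsub>B\<^esub> Suc n \<otimes>\<^bsub>B\<^esub> a \<in> carrier B" using fB a by simp
  have zeq: "z = f [^]\<^bsub>B\<^esub> n \<ominus>\<^bsub>B\<^esub> f [^]\<^bsub>B\<^esub> Suc n \<otimes>\<^bsub>B\<^esub> a"
    unfolding minus[OF wB] using M.add_minus_cancel_left[OF BA[OF wB] F_carrier[OF z]] by (simp only: fz[symmetric])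
  \<comment> \<open>The exponent is made positive so that f divides \<open>e0 = f^N a^N\<close> in
    the final case.\<close>
  define N where "N = Suc n"
  have start: "f [^]\<^bsub>B\<^esub> N \<ominus>\<^bsub>B\<^esub> f [^]\<^bsub>B\<^esub> Suc N \<otimes>\<^bsub>B\<^esub> a \<in> F 1"
  proof -
    have "f [^]\<^bsub>B\<^esub> N \<ominus>\<^bsub>B\<^esub> f [^]\<^bsub>B\<^esub> Suc N \<otimes>\<^bsub>B\<^esub> a = f \<otimes>\<^bsub>B\<^esub> z"
    proof -
      have "g \<in> carrier B \<Longrightarrow> g \<otimes>\<^bsub>B\<^esub> f \<ominus>\<^bsub>B\<^esub> g \<otimes>\<^bsub>B\<^esub> f \<otimes>\<^bsub>B\<^esub> f \<otimes>\<^bsub>B\<^esub> a = f \<otimes>\<^bsub>B\<^esub> (g \<ominus>\<^bsub>B\<^esub> g \<otimes>\<^bsub>B\<^esub> f \<otimes>\<^bsub>B\<^esub> a)" for g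
        using fB a by algebra
      then show ?thesis unfolding zeq N_def using fB by simp
    qed
    then show ?thesis using F_l fB z by simp
  qed
  \<comment> \<open>Replacing f^N by f^(N+1) a repeatedly gives f^N = f^N (f a)^k modulo m A. The
    case k = N reads f^N = f^N e0, and multiplication by a^N shows that e0 is idempotent modulo m
    A.\<close>
  have iter: "f [^]\<^bsub>B\<^esub> N \<ominus>\<^bsub>B\<^esub> f [^]\<^bsub>B\<^esub> N \<otimes>\<^bsub>B\<^esub> (f [^]\<^bsub>B\<^esub> k \<otimes>\<^bsub>B\<^esub> a [^]\<^bsub>B\<^esub> k) \<in> F 1" for k :: nat
  proof (induction k)
    case 0
    have "f [^]\<^bsub>B\<^esub> N \<ominus>\<^bsub>B\<^esub> f [^]\<^bsub>B\<^esub> N \<otimes>\<^bsub>B\<^esub> (f [^]\<^bsub>B\<^esub> (0::nat) \<otimes>\<^bsub>B\<^esub> a [^]\<^bsub>B\<^esub> (0::nat)) = \<zero>\<^bsub>A\<^esub>"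
      using fB by (simp add: B.minus_eq B.r_neg) (simp add: ops)
    then show ?case using sm_zero[OF F_submodule] by simp
  next
    case (Suc k)
    let ?g = "f [^]\<^bsub>B\<^esub> N" and ?h = "f [^]\<^bsub>B\<^esub> k" and ?c = "a [^]\<^bsub>B\<^esub> k"
    have c: "?g \<in> carrier B" "?h \<in> carrier B" "?c \<in> carrier B" using fB a by auto
    have "g \<ominus>\<^bsub>B\<^esub> g \<otimes>\<^bsub>B\<^esub> ((h \<otimes>\<^bsub>B\<^esub> f) \<otimes>\<^bsub>B\<^esub> (c \<otimes>\<^bsub>B\<^esub> a)) =
        (g \<ominus>\<^bsub>B\<^esub> g \<otimes>\<^bsub>B\<^esub> f \<otimes>\<^bsub>B\<^esub> a) \<oplus>\<^bsub>B\<^esub> (f \<otimes>\<^bsub>B\<^esub> a) \<otimes>\<^bsub>B\<^esub> (g \<ominus>\<^bsub>B\<^esub> g \<otimes>\<^bsub>B\<^esub> (h \<otimes>\<^bsub>B\<^esub> c))"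
      if "g \<in> carrier B" "h \<in> carrier B" "c \<in> carrier B" for g h c
      using that fB a by algebra
    from this[OF c] have "?g \<ominus>\<^bsub>B\<^esub> ?g \<otimes>\<^bsub>B\<^esub> (f [^]\<^bsub>B\<^esub> Suc k \<otimes>\<^bsub>B\<^esub> a [^]\<^bsub>B\<^esub> Suc k) =
        (?g \<ominus>\<^bsub>B\<^esub> f [^]\<^bsub>B\<^esub> Suc N \<otimes>\<^bsub>B\<^esub> a) \<oplus>\<^bsub>B\<^esub> (f \<otimes>\<^bsub>B\<^esub> a) \<otimes>\<^bsub>B\<^esub> (?g \<ominus>\<^bsub>B\<^esub> ?g \<otimes>\<^bsub>B\<^esub> (?h \<otimes>\<^bsub>B\<^esub> ?c))"
      by simp
    then show ?case using F_add[OF start F_l[OF _ Suc]] fB a by simp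
  qed
  define e0 where "e0 = f [^]\<^bsub>B\<^esub> N \<otimes>\<^bsub>B\<^esub> a [^]\<^bsub>B\<^esub> N"
  have e0B: "e0 \<in> carrier B" unfolding e0_def using fB a by simp
  have fe0: "f [^]\<^bsub>B\<^esub> N \<ominus>\<^bsub>B\<^esub> f [^]\<^bsub>B\<^esub> N \<otimes>\<^bsub>B\<^esub> e0 \<in> F 1" using iter[of N] by (simp add: e0_def)
  have e0idem: "e0 \<otimes>\<^bsub>B\<^esub> e0 \<ominus>\<^bsub>B\<^esub> e0 \<in> F 1"
  proof -
    let ?g = "f [^]\<^bsub>B\<^esub> N" and ?c = "a [^]\<^bsub>B\<^esub> N"
    have c: "?g \<in> carrier B" "?c \<in> carrier B" using fB a by auto
    have "(g \<otimes>\<^bsub>B\<^esub> c) \<otimes>\<^bsub>B\<^esub> e0 \<ominus>\<^bsub>B\<^esub> g \<otimes>\<^bsub>B\<^esub> c = (\<ominus>\<^bsub>B\<^esub> c) \<otimes>\<^bsub>B\<^esub> (g \<ominus>\<^bsub>B\<^esub> g \<otimes>\<^bsub>B\<^esub> e0)"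
      if "g \<in> carrier B" "c \<in> carrier B" for g c using that e0B by algebra
    from this[OF c] have "e0 \<otimes>\<^bsub>B\<^esub> e0 \<ominus>\<^bsub>B\<^esub> e0 = (\<ominus>\<^bsub>B\<^esub> ?c) \<otimes>\<^bsub>B\<^esub> (?g \<ominus>\<^bsub>B\<^esub> ?g \<otimes>\<^bsub>B\<^esub> e0)"
      unfolding e0_def[symmetric] .
    then show ?thesis using F_l[OF _ fe0] c by simp
  qed
  \<comment> \<open>The Newton sequence starting at e0. Its errors lie in F(j + 1) and control the
    differences of consecutive terms, so the sequence has a limit y in A.\<close>
  define G where "G = rec_nat e0 (\<lambda>_ e. e \<oplus>\<^bsub>B\<^esub> (\<one>\<^bsub>B\<^esub> \<ominus>\<^bsub>B\<^esub> (e \<oplus>\<^bsub>B\<^esub> e)) \<otimes>\<^bsub>B\<^esub> (e \<otimes>\<^bsub>B\<^esub> e \<ominus>\<^bsub>B\<^esub> e))"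
  have G0: "G 0 = e0" and GS: "G (Suc j) = G j \<oplus>\<^bsub>B\<^esub> (\<one>\<^bsub>B\<^esub> \<ominus>\<^bsub>B\<^esub> (G j \<oplus>\<^bsub>B\<^esub> G j)) \<otimes>\<^bsub>B\<^esub> (G j \<otimes>\<^bsub>B\<^esub> G j \<ominus>\<^bsub>B\<^esub> G j)" for j
    by (auto simp: G_def)
  have GB: "G j \<in> carrier B" for j
  proof (induction j)
    case (Suc j)
    then show ?case unfolding GS by simp
  qed (use e0B G0 in simp)
  have Gidem: "G j \<otimes>\<^bsub>B\<^esub> G j \<ominus>\<^bsub>B\<^esub> G j \<in> F (Suc j)" for j
  proof (induction j)
    case 0
    then show ?case using e0idem G0 by simp
  next
    case (Suc j)
    let ?d = "G j \<otimes>\<^bsub>B\<^esub> G j \<ominus>\<^bsub>B\<^esub> G j" and ?t = "\<one>\<^bsub>B\<^esub> \<ominus>\<^bsub>B\<^esub> (G j \<oplus>\<^bsub>B\<^esub> G j)"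
    have "?d \<in> F 1" using F_le_1[of "Suc j"] Suc by auto
    then have dd: "?d \<otimes>\<^bsub>B\<^esub> ?d \<in> F (Suc (Suc j))" using F_mult[OF Suc] by (simp add: ops)
    have "?t \<otimes>\<^bsub>B\<^esub> ?t \<ominus>\<^bsub>B\<^esub> (\<one>\<^bsub>B\<^esub> \<oplus>\<^bsub>B\<^esub> \<one>\<^bsub>B\<^esub> \<oplus>\<^bsub>B\<^esub> \<one>\<^bsub>B\<^esub> \<oplus>\<^bsub>B\<^esub> \<one>\<^bsub>B\<^esub>) \<in> carrier B" using GB[of j] by simp
    then have "(?d \<otimes>\<^bsub>B\<^esub> ?d) \<otimes>\<^bsub>B\<^esub> (?t \<otimes>\<^bsub>B\<^esub> ?t \<ominus>\<^bsub>B\<^esub> (\<one>\<^bsub>B\<^esub> \<oplus>\<^bsub>B\<^esub> \<one>\<^bsub>B\<^esub> \<oplus>\<^bsub>B\<^esub> \<one>\<^bsub>B\<^esub> \<oplus>\<^bsub>B\<^esub> \<one>\<^bsub>B\<^esub>)) \<in> F (Suc (Suc j))"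
      using F_mult_r[OF BA dd] by (simp add: ops)
    then show ?case using B.newton_idempotent[OF GB refl refl GS, of j] by simp
  qed
  have Gdiff: "G (Suc j) \<ominus>\<^bsub>B\<^esub> G j \<in> F (Suc j)" for j
  proof -
    have "g \<oplus>\<^bsub>B\<^esub> y \<ominus>\<^bsub>B\<^esub> g = y" if "g \<in> carrier B" "y \<in> carrier B" for g y using that by algebra
    then have "G (Suc j) \<ominus>\<^bsub>B\<^esub> G j = (\<one>\<^bsub>B\<^esub> \<ominus>\<^bsub>B\<^esub> (G j \<oplus>\<^bsub>B\<^esub> G j)) \<otimes>\<^bsub>B\<^esub> (G j \<otimes>\<^bsub>B\<^esub> G j \<ominus>\<^bsub>B\<^esub> G j)"
      unfolding GS[of j] using GB[of j] by simp
    then show ?thesis using F_l[OF _ Gidem[of j]] GB[of j] by simp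
  qed
  have "\<exists>y\<in>lspan A (carrier R) gens. \<forall>n. y \<ominus>\<^bsub>A\<^esub> G n \<in> lspan A (m [^]\<^bsub>ideals_set R\<^esub> n) gens"
  proof (rule lspan_complete[OF complete ideal_m gens(1)])
    show "G n \<in> lspan A (carrier R) gens" for n using GB BA gens by blast
    show "G (Suc n) \<ominus>\<^bsub>A\<^esub> G n \<in> lspan A (m [^]\<^bsub>ideals_set R\<^esub> n) gens" for n
      using Gdiff[of n] F_Suc minus[OF GB] unfolding F_def by fastforce
  qed
  then obtain y where y: "y \<in> carrier A" "\<And>n. y \<ominus>\<^bsub>A\<^esub> G n \<in> F n" unfolding F_def using gens by blast
  \<comment> \<open>The limit is only known to lie in A and not in the double commutant, so y^2 - y
    is expanded in terms of y - G(n) without commuting factors.\<close>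
  have "y \<otimes>\<^bsub>A\<^esub> y \<ominus>\<^bsub>A\<^esub> y = \<zero>\<^bsub>A\<^esub>"
  proof (rule F_separated)
    fix n
    have g: "G n \<in> carrier A" using GB BA by blast
    have 1: "y \<otimes>\<^bsub>A\<^esub> (y \<ominus>\<^bsub>A\<^esub> G n) \<in> F n" "(y \<ominus>\<^bsub>A\<^esub> G n) \<otimes>\<^bsub>A\<^esub> G n \<in> F n"
      using F_mult_l F_mult_r y g by auto
    have 2: "G n \<otimes>\<^bsub>A\<^esub> G n \<ominus>\<^bsub>A\<^esub> G n \<in> F n" using Gidem[of n] F_Suc minus[OF GB] by (auto simp: ops)
    have "y \<otimes>\<^bsub>A\<^esub> y \<ominus>\<^bsub>A\<^esub> y = (y \<otimes>\<^bsub>A\<^esub> (y \<ominus>\<^bsub>A\<^esub> G n) \<oplus>\<^bsub>A\<^esub> (y \<ominus>\<^bsub>A\<^esub> G n) \<otimes>\<^bsub>A\<^esub> G n) \<oplus>\<^bsub>A\<^esub>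
        (G n \<otimes>\<^bsub>A\<^esub> G n \<ominus>\<^bsub>A\<^esub> G n) \<ominus>\<^bsub>A\<^esub> (y \<ominus>\<^bsub>A\<^esub> G n)"
      using y(1) g by algebra
    then show "y \<otimes>\<^bsub>A\<^esub> y \<ominus>\<^bsub>A\<^esub> y \<in> F n"
      using 1 2 y(2)[of n] sm_add[OF F_submodule] sm_minus[OF F_submodule] by metis
  qed
  then have "y \<otimes>\<^bsub>A\<^esub> y = y" using y(1) by simp
  then consider "y = \<zero>\<^bsub>A\<^esub>" | "y = \<one>\<^bsub>A\<^esub>" using idem y(1) by blast
  moreover have ye0: "y \<ominus>\<^bsub>A\<^esub> e0 \<in> F 1"
  proof -
    have c: "G 0 \<in> carrier A" "G 1 \<in> carrier A" using GB BA by auto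
    have "y \<ominus>\<^bsub>A\<^esub> G 0 = (y \<ominus>\<^bsub>A\<^esub> G 1) \<oplus>\<^bsub>A\<^esub> (G 1 \<ominus>\<^bsub>A\<^esub> G 0)"
      using y(1) c by algebra
    moreover have "G 1 \<ominus>\<^bsub>A\<^esub> G 0 \<in> F 1" using Gdiff[of 0] minus[OF GB] by simp
    ultimately show ?thesis using y(2)[of 1] sm_add[OF F_submodule] G0 by metis
  qed
  ultimately show ?thesis
  proof cases
    case 1
    have e0F: "e0 \<in> F 1"
      using ye0 sm_neg[OF F_submodule ye0] e0B BA unfolding 1 by (simp add: M.minus_eq)
    have "f [^]\<^bsub>B\<^esub> N = (f [^]\<^bsub>B\<^esub> N \<ominus>\<^bsub>B\<^esub> f [^]\<^bsub>B\<^esub> N \<otimes>\<^bsub>B\<^esub> e0) \<oplus>\<^bsub>B\<^esub> f [^]\<^bsub>B\<^esub> N \<otimes>\<^bsub>B\<^esub> e0"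
      using fB e0B by (simp add: B.minus_eq B.a_assoc B.l_neg)
    then have fF: "f [^]\<^bsub>B\<^esub> N \<in> F 1" using F_add[OF fe0 F_l[OF _ e0F]] B.nat_pow_closed[OF fB] by metis
    \<comment> \<open>1 - f divides 1 - f^k; for k = N the latter is a unit because f^N lies in m
      A.\<close>
    have "\<exists>s\<in>carrier B. \<one>\<^bsub>B\<^esub> \<ominus>\<^bsub>B\<^esub> f [^]\<^bsub>B\<^esub> k = (\<one>\<^bsub>B\<^esub> \<ominus>\<^bsub>B\<^esub> f) \<otimes>\<^bsub>B\<^esub> s" for k :: nat
    proof (induction k)
      case 0
      then show ?case using fB by (intro bexI[of _ "\<zero>\<^bsub>B\<^esub>"]) (simp_all add: B.minus_eq B.r_neg)
    next
      case (Suc k)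
      then obtain s where s: "s \<in> carrier B" "\<one>\<^bsub>B\<^esub> \<ominus>\<^bsub>B\<^esub> f [^]\<^bsub>B\<^esub> k = (\<one>\<^bsub>B\<^esub> \<ominus>\<^bsub>B\<^esub> f) \<otimes>\<^bsub>B\<^esub> s" by blast
      have "\<one>\<^bsub>B\<^esub> \<ominus>\<^bsub>B\<^esub> g \<otimes>\<^bsub>B\<^esub> f = (\<one>\<^bsub>B\<^esub> \<ominus>\<^bsub>B\<^esub> f) \<oplus>\<^bsub>B\<^esub> (\<one>\<^bsub>B\<^esub> \<ominus>\<^bsub>B\<^esub> g) \<otimes>\<^bsub>B\<^esub> f" if "g \<in> carrier B" for g
        using that fB by algebra
      from this[of "f [^]\<^bsub>B\<^esub> k"] have "\<one>\<^bsub>B\<^esub> \<ominus>\<^bsub>B\<^esub> f [^]\<^bsub>B\<^esub> Suc k = (\<one>\<^bsub>B\<^esub> \<ominus>\<^bsub>B\<^esub> f) \<oplus>\<^bsub>B\<^esub> ((\<one>\<^bsub>B\<^esub> \<ominus>\<^bsub>B\<^esub> f) \<otimes>\<^bsub>B\<^esub> s) \<otimes>\<^bsub>B\<^esub> f"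
        using s fB by simp
      also have "\<dots> = (\<one>\<^bsub>B\<^esub> \<ominus>\<^bsub>B\<^esub> f) \<otimes>\<^bsub>B\<^esub> (\<one>\<^bsub>B\<^esub> \<oplus>\<^bsub>B\<^esub> s \<otimes>\<^bsub>B\<^esub> f)" using s fB by algebra
      finally show ?case using s fB by (intro bexI[of _ "\<one>\<^bsub>B\<^esub> \<oplus>\<^bsub>B\<^esub> s \<otimes>\<^bsub>B\<^esub> f"]) auto
    qed
    then obtain s where s: "s \<in> carrier B" "\<one>\<^bsub>B\<^esub> \<ominus>\<^bsub>B\<^esub> f [^]\<^bsub>B\<^esub> N = (\<one>\<^bsub>B\<^esub> \<ominus>\<^bsub>B\<^esub> f) \<otimes>\<^bsub>B\<^esub> s" by blast
    have "\<one>\<^bsub>B\<^esub> \<ominus>\<^bsub>B\<^esub> f [^]\<^bsub>B\<^esub> N \<in> Units A" using one_minus_F1[OF fF] minus[of "f [^]\<^bsub>B\<^esub> N"] fB by (simp add: ops)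
    then have "\<one>\<^bsub>B\<^esub> \<ominus>\<^bsub>B\<^esub> f \<in> Units A" using unit_B[OF _ s(1)] s(2) fB by simp
    then show ?thesis using minus[OF fB] by (simp add: ops)
  next
    case 2
    have "e0 = \<one>\<^bsub>A\<^esub> \<ominus>\<^bsub>A\<^esub> (\<one>\<^bsub>A\<^esub> \<ominus>\<^bsub>A\<^esub> e0)" using BA[OF e0B] A.one_closed by algebra
    then have "e0 \<in> Units A" using one_minus_F1[OF ye0[unfolded 2]] by simp
    moreover have "e0 = f \<otimes>\<^bsub>B\<^esub> (f [^]\<^bsub>B\<^esub> n \<otimes>\<^bsub>B\<^esub> a [^]\<^bsub>B\<^esub> N)"
      unfolding e0_def N_def using fB a by (simp add: B.m_ac)
    ultimately show ?thesis using unit_B[OF fB, of "f [^]\<^bsub>B\<^esub> n \<otimes>\<^bsub>B\<^esub> a [^]\<^bsub>B\<^esub> N"] fB a by simp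
  qed
qed

end

section \<open>Linear categories\<close>

lemma (in abelian_group) minus_self: "x \<in> carrier G \<Longrightarrow> x \<ominus> x = \<zero>"
  by (simp add: minus_eq r_neg)

lemma (in abelian_group) minus_zero_right: "x \<in> carrier G \<Longrightarrow> x \<ominus> \<zero> = x"
  using add.inv_one by (simp add: minus_eq)

lemma (in abelian_group) add_minus_cancel:
  assumes "x \<in> carrier G" "y \<in> carrier G" shows "x \<oplus> (y \<ominus> x) = y" "(y \<ominus> x) \<oplus> x = y" "(y \<oplus> x) \<ominus> x = y"
    "y \<ominus> (y \<ominus> x) = x"
proof -
  show 1: "(y \<ominus> x) \<oplus> x = y" "(y \<oplus> x) \<ominus> x = y" using assms by (simp_all add: minus_eq a_assoc l_neg r_neg)
  then show 2: "x \<oplus> (y \<ominus> x) = y" using assms by (simp add: a_comm)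
  have "(x \<oplus> (y \<ominus> x)) \<ominus> (y \<ominus> x) = x" using assms by (simp add: minus_eq a_assoc r_neg)
  then show "y \<ominus> (y \<ominus> x) = x" using 2 by simp
qed

context lin_category
begin

lemma hom_group: "\<lbrakk>X \<in> Ob C; Y \<in> Ob C\<rbrakk> \<Longrightarrow> abelian_group (Hom C X Y)"
  using Hom_module module.axioms(2) by blast

lemma hom_closed [simp, intro]:
  assumes "X \<in> Ob C" "Y \<in> Ob C"
  shows "zmor C X Y \<in> Mor C X Y"
    "\<lbrakk>f \<in> Mor C X Y; g \<in> Mor C X Y\<rbrakk> \<Longrightarrow> f \<oplus>\<^bsub>Hom C X Y\<^esub> g \<in> Mor C X Y"
    "\<lbrakk>f \<in> Mor C X Y; g \<in> Mor C X Y\<rbrakk> \<Longrightarrow> f \<ominus>\<^bsub>Hom C X Y\<^esub> g \<in> Mor C X Y"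
    "f \<in> Mor C X Y \<Longrightarrow> \<ominus>\<^bsub>Hom C X Y\<^esub> f \<in> Mor C X Y"
    "\<lbrakk>r \<in> carrier R; f \<in> Mor C X Y\<rbrakk> \<Longrightarrow> r \<odot>\<^bsub>Hom C X Y\<^esub> f \<in> Mor C X Y"
proof -
  interpret H: module R "Hom C X Y" using assms by (rule Hom_module)
  show "zmor C X Y \<in> Mor C X Y"
    "\<lbrakk>f \<in> Mor C X Y; g \<in> Mor C X Y\<rbrakk> \<Longrightarrow> f \<oplus>\<^bsub>Hom C X Y\<^esub> g \<in> Mor C X Y"
    "\<lbrakk>f \<in> Mor C X Y; g \<in> Mor C X Y\<rbrakk> \<Longrightarrow> f \<ominus>\<^bsub>Hom C X Y\<^esub> g \<in> Mor C X Y"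
    "f \<in> Mor C X Y \<Longrightarrow> \<ominus>\<^bsub>Hom C X Y\<^esub> f \<in> Mor C X Y"
    "\<lbrakk>r \<in> carrier R; f \<in> Mor C X Y\<rbrakk> \<Longrightarrow> r \<odot>\<^bsub>Hom C X Y\<^esub> f \<in> Mor C X Y"
    by auto
qed

lemma hom_simps [simp]:
  assumes "X \<in> Ob C" "Y \<in> Ob C" "f \<in> Mor C X Y"
  shows "zmor C X Y \<oplus>\<^bsub>Hom C X Y\<^esub> f = f" "f \<oplus>\<^bsub>Hom C X Y\<^esub> zmor C X Y = f"
    "f \<ominus>\<^bsub>Hom C X Y\<^esub> f = zmor C X Y" "f \<ominus>\<^bsub>Hom C X Y\<^esub> zmor C X Y = f"
proof -
  interpret H: module R "Hom C X Y" using assms(1,2) by (rule Hom_module)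
  show "zmor C X Y \<oplus>\<^bsub>Hom C X Y\<^esub> f = f" "f \<oplus>\<^bsub>Hom C X Y\<^esub> zmor C X Y = f"
    "f \<ominus>\<^bsub>Hom C X Y\<^esub> f = zmor C X Y" "f \<ominus>\<^bsub>Hom C X Y\<^esub> zmor C X Y = f"
    using assms(3) H.minus_self H.minus_zero_right by auto
qed

lemma hom_add_minus_cancel:
  assumes "X \<in> Ob C" "Y \<in> Ob C" "f \<in> Mor C X Y" "g \<in> Mor C X Y"
  shows "f \<oplus>\<^bsub>Hom C X Y\<^esub> (g \<ominus>\<^bsub>Hom C X Y\<^esub> f) = g" "(g \<ominus>\<^bsub>Hom C X Y\<^esub> f) \<oplus>\<^bsub>Hom C X Y\<^esub> f = g"
    "(g \<oplus>\<^bsub>Hom C X Y\<^esub> f) \<ominus>\<^bsub>Hom C X Y\<^esub> f = g" "g \<ominus>\<^bsub>Hom C X Y\<^esub> (g \<ominus>\<^bsub>Hom C X Y\<^esub> f) = f"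
    "(f \<oplus>\<^bsub>Hom C X Y\<^esub> g) \<ominus>\<^bsub>Hom C X Y\<^esub> f = g"
proof -
  interpret H: module R "Hom C X Y" using assms(1,2) by (rule Hom_module)
  show "f \<oplus>\<^bsub>Hom C X Y\<^esub> (g \<ominus>\<^bsub>Hom C X Y\<^esub> f) = g" "(g \<ominus>\<^bsub>Hom C X Y\<^esub> f) \<oplus>\<^bsub>Hom C X Y\<^esub> f = g"
    "(g \<oplus>\<^bsub>Hom C X Y\<^esub> f) \<ominus>\<^bsub>Hom C X Y\<^esub> f = g" "g \<ominus>\<^bsub>Hom C X Y\<^esub> (g \<ominus>\<^bsub>Hom C X Y\<^esub> f) = f"
    "(f \<oplus>\<^bsub>Hom C X Y\<^esub> g) \<ominus>\<^bsub>Hom C X Y\<^esub> f = g"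
    using assms(3,4) H.M.add_minus_cancel H.M.add_minus_cancel_left by auto
qed

lemma linear_postcomp:
  "\<lbrakk>X \<in> Ob C; Y \<in> Ob C; Z \<in> Ob C; g \<in> Mor C Y Z\<rbrakk>
    \<Longrightarrow> linear_map R (Hom C X Y) (Hom C X Z) (\<lambda>f. Cmp C X Y Z g f)"
  unfolding linear_map_def by (auto simp: Cmp_closed Cmp_add_right Cmp_smult_right)

lemma linear_precomp:
  "\<lbrakk>X \<in> Ob C; Y \<in> Ob C; Z \<in> Ob C; f \<in> Mor C X Y\<rbrakk>
    \<Longrightarrow> linear_map R (Hom C Y Z) (Hom C X Z) (\<lambda>g. Cmp C X Y Z g f)"
  unfolding linear_map_def by (auto simp: Cmp_closed Cmp_add_left Cmp_smult_left)

lemma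
  assumes "X \<in> Ob C" "Y \<in> Ob C" "Z \<in> Ob C"
  shows Cmp_zero_right [simp]: "g \<in> Mor C Y Z \<Longrightarrow> Cmp C X Y Z g (zmor C X Y) = zmor C X Z"
    and Cmp_zero_left [simp]: "f \<in> Mor C X Y \<Longrightarrow> Cmp C X Y Z (zmor C Y Z) f = zmor C X Z"
    and Cmp_minus_right: "\<lbrakk>g \<in> Mor C Y Z; f \<in> Mor C X Y; f' \<in> Mor C X Y\<rbrakk>
      \<Longrightarrow> Cmp C X Y Z g (f \<ominus>\<^bsub>Hom C X Y\<^esub> f') = Cmp C X Y Z g f \<ominus>\<^bsub>Hom C X Z\<^esub> Cmp C X Y Z g f'"
    and Cmp_minus_left: "\<lbrakk>f \<in> Mor C X Y; g \<in> Mor C Y Z; g' \<in> Mor C Y Z\<rbrakk>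
      \<Longrightarrow> Cmp C X Y Z (g \<ominus>\<^bsub>Hom C Y Z\<^esub> g') f = Cmp C X Y Z g f \<ominus>\<^bsub>Hom C X Z\<^esub> Cmp C X Y Z g' f"
  using linear_map_zero[OF _ _ linear_postcomp] linear_map_zero[OF _ _ linear_precomp]
    linear_map_minus[OF _ _ linear_postcomp] linear_map_minus[OF _ _ linear_precomp] Hom_module assms
  by auto

lemmas Cmp_simps [simp] = Cmp_closed Idm_closed Cmp_Idm_left Cmp_Idm_right

definition retract :: "'o \<Rightarrow> 'o \<Rightarrow> bool"
  where "retract A X \<longleftrightarrow> A \<in> Ob C \<and> X \<in> Ob C \<and>
    (\<exists>s\<in>Mor C A X. \<exists>r\<in>Mor C X A. Cmp C A X A r s = Idm C A)"

lemma retract_refl: "X \<in> Ob C \<Longrightarrow> retract X X"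
  unfolding retract_def by (auto intro!: bexI[of _ "Idm C X"])

lemma retract_trans:
  assumes "retract A B" "retract B X" shows "retract A X"
proof -
  from assms obtain s r where 1: "A \<in> Ob C" "B \<in> Ob C" "s \<in> Mor C A B" "r \<in> Mor C B A" "Cmp C A B A r s = Idm C A"
    unfolding retract_def by blast
  from assms obtain s' r' where 2: "X \<in> Ob C" "s' \<in> Mor C B X" "r' \<in> Mor C X B" "Cmp C B X B r' s' = Idm C B"
    unfolding retract_def by blast
  have "Cmp C A X A (Cmp C X B A r r') (Cmp C A B X s' s) = Cmp C A B A (Cmp C B B A r (Cmp C B X B r' s')) s"
    using 1(1-4) 2(1-3) by (simp add: Cmp_assoc)
  also have "\<dots> = Idm C A" using 1 2 by simp
  finally show ?thesis unfolding retract_def using 1 2 Cmp_closed by blast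
qed

lemma is_isoI: "\<lbrakk>f \<in> Mor C X Y; g \<in> Mor C Y X; Cmp C X Y X g f = Idm C X; Cmp C Y X Y f g = Idm C Y\<rbrakk> \<Longrightarrow> is_iso C X Y f"
  unfolding is_iso_def by blast

lemma is_iso_Idm: "X \<in> Ob C \<Longrightarrow> is_iso C X X (Idm C X)"
  by (rule is_isoI[of _ _ _ "Idm C X"]) auto

lemma is_iso_Cmp:
  assumes "X \<in> Ob C" "Y \<in> Ob C" "Z \<in> Ob C" "is_iso C X Y f" "is_iso C Y Z g"
  shows "is_iso C X Z (Cmp C X Y Z g f)"
proof -
  from assms obtain f' g' where *: "f \<in> Mor C X Y" "f' \<in> Mor C Y X" "Cmp C X Y X f' f = Idm C X" "Cmp C Y X Y f f' = Idm C Y"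
    "g \<in> Mor C Y Z" "g' \<in> Mor C Z Y" "Cmp C Y Z Y g' g = Idm C Y" "Cmp C Z Y Z g g' = Idm C Z"
    unfolding is_iso_def by blast
  have "Cmp C X Z X (Cmp C Z Y X f' g') (Cmp C X Y Z g f) = Cmp C X Y X (Cmp C Y Y X f' (Cmp C Y Z Y g' g)) f"
    using *(1,2,5,6) assms(1-3) by (simp add: Cmp_assoc)
  moreover have "Cmp C Z X Z (Cmp C X Y Z g f) (Cmp C Z Y X f' g') = Cmp C Z Y Z (Cmp C Y Y Z g (Cmp C Y X Y f f')) g'"
    using *(1,2,5,6) assms(1-3) by (simp add: Cmp_assoc)
  ultimately show ?thesis using * assms(1-3) by (intro is_isoI[of _ _ _ "Cmp C Z Y X f' g'"]) auto
qed

lemma isomorphic_sym: "isomorphic C X Y \<Longrightarrow> isomorphic C Y X"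
  unfolding isomorphic_def is_iso_def by blast

lemma isomorphic_trans:
  "\<lbrakk>X \<in> Ob C; Y \<in> Ob C; Z \<in> Ob C; isomorphic C X Y; isomorphic C Y Z\<rbrakk> \<Longrightarrow> isomorphic C X Z"
  unfolding isomorphic_def using is_iso_Cmp by blast

lemma isomorphic_refl: "X \<in> Ob C \<Longrightarrow> isomorphic C X X"
  unfolding isomorphic_def using is_iso_Idm by blast

lemma iso_class_eq:
  "\<lbrakk>X \<in> Ob C; Y \<in> Ob C; isomorphic C X Y\<rbrakk> \<Longrightarrow> iso_class C X = iso_class C Y"
  unfolding iso_class_def using isomorphic_sym isomorphic_trans by blast

lemma iso_class_eq_iff:
  "\<lbrakk>X \<in> Ob C; Y \<in> Ob C\<rbrakk> \<Longrightarrow> iso_class C X = iso_class C Y \<longleftrightarrow> isomorphic C X Y"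
  using iso_class_eq isomorphic_refl isomorphic_sym unfolding iso_class_def by blast

lemma isomorphic_retract: "\<lbrakk>X \<in> Ob C; Y \<in> Ob C; isomorphic C X Y\<rbrakk> \<Longrightarrow> retract X Y"
  unfolding isomorphic_def is_iso_def retract_def by blast

text \<open>If u is inverse to 1 - h s, then 1 + s u h is inverse to 1 - s h. This makes the
  radical, defined by endomorphisms of the source, accessible from the target.\<close>

lemma is_iso_one_minus_swap:
  assumes X: "X \<in> Ob C" and Y: "Y \<in> Ob C" and s: "s \<in> Mor C X Y" and h: "h \<in> Mor C Y X"
    and iso: "is_iso C X X (Idm C X \<ominus>\<^bsub>Hom C X X\<^esub> Cmp C X Y X h s)"
  shows "is_iso C Y Y (Idm C Y \<ominus>\<^bsub>Hom C Y Y\<^esub> Cmp C Y X Y s h)"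
proof -
  let ?hs = "Cmp C X Y X h s" and ?sh = "Cmp C Y X Y s h"
  obtain u where u: "u \<in> Mor C X X"
    and 1: "Cmp C X X X u (Idm C X \<ominus>\<^bsub>Hom C X X\<^esub> ?hs) = Idm C X"
    and 2: "Cmp C X X X (Idm C X \<ominus>\<^bsub>Hom C X X\<^esub> ?hs) u = Idm C X"
    using iso unfolding is_iso_def by blast
  have hu1: "u \<ominus>\<^bsub>Hom C X X\<^esub> Cmp C X X X u ?hs = Idm C X"
    using 1 X Y u s h by (simp add: Cmp_minus_right)
  have hu2: "u \<ominus>\<^bsub>Hom C X X\<^esub> Cmp C X X X ?hs u = Idm C X"
    using 2 X Y u s h by (simp add: Cmp_minus_left)
  define A where "A = Cmp C Y X Y s (Cmp C Y X X u h)"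
  have A: "A \<in> Mor C Y Y" unfolding A_def using X Y u s h by simp
  have a1: "A \<ominus>\<^bsub>Hom C Y Y\<^esub> Cmp C Y Y Y A ?sh = ?sh"
  proof -
    have "Cmp C Y X Y s (Cmp C Y X X (u \<ominus>\<^bsub>Hom C X X\<^esub> Cmp C X X X u ?hs) h) = A \<ominus>\<^bsub>Hom C Y Y\<^esub> Cmp C Y Y Y A ?sh"
      unfolding A_def using X Y u s h by (simp add: Cmp_minus_left Cmp_minus_right Cmp_assoc)
    then show ?thesis unfolding hu1 using X Y h by simp
  qed
  have a2: "A \<ominus>\<^bsub>Hom C Y Y\<^esub> Cmp C Y Y Y ?sh A = ?sh"
  proof -
    have "Cmp C Y X Y s (Cmp C Y X X (u \<ominus>\<^bsub>Hom C X X\<^esub> Cmp C X X X ?hs u) h) = A \<ominus>\<^bsub>Hom C Y Y\<^esub> Cmp C Y Y Y ?sh A"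
      unfolding A_def using X Y u s h by (simp add: Cmp_minus_left Cmp_minus_right Cmp_assoc)
    then show ?thesis unfolding hu2 using X Y h by simp
  qed
  have sh: "?sh \<in> Mor C Y Y" using X Y s h by simp
  have b1: "?sh \<oplus>\<^bsub>Hom C Y Y\<^esub> Cmp C Y Y Y A ?sh = A"
    using hom_add_minus_cancel(2)[of Y Y "Cmp C Y Y Y A ?sh" A] a1 Y A sh by simp
  have b2: "?sh \<oplus>\<^bsub>Hom C Y Y\<^esub> Cmp C Y Y Y ?sh A = A"
    using hom_add_minus_cancel(2)[of Y Y "Cmp C Y Y Y ?sh A" A] a2 Y A sh by simp
  have c1: "Cmp C Y Y Y (Idm C Y \<oplus>\<^bsub>Hom C Y Y\<^esub> A) (Idm C Y \<ominus>\<^bsub>Hom C Y Y\<^esub> ?sh) = Idm C Y"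
    using Y A sh b1 hom_add_minus_cancel(3)[of Y Y A "Idm C Y"]
    by (subst Cmp_minus_right) (simp_all add: Cmp_add_left)
  have c2: "Cmp C Y Y Y (Idm C Y \<ominus>\<^bsub>Hom C Y Y\<^esub> ?sh) (Idm C Y \<oplus>\<^bsub>Hom C Y Y\<^esub> A) = Idm C Y"
    using Y A sh b2 hom_add_minus_cancel(3)[of Y Y A "Idm C Y"]
    by (subst Cmp_minus_left) (simp_all add: Cmp_add_right)
  show ?thesis by (rule is_isoI[OF _ _ c1 c2]) (use Y A sh in auto)
qed

lemma zero_object_iff: "zero_object C X \<longleftrightarrow> X \<in> Ob C \<and> (\<forall>Y\<in>Ob C. Mor C X Y = {zmor C X Y} \<and> Mor C Y X = {zmor C Y X})"
proof
  assume z: "zero_object C X"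
  then have X: "X \<in> Ob C" "Idm C X = zmor C X X" by (auto simp: zero_object_def)
  have "f = zmor C X Y" if "Y \<in> Ob C" "f \<in> Mor C X Y" for f Y
    using Cmp_Idm_right[of X Y f] X that by simp
  moreover have "f = zmor C Y X" if "Y \<in> Ob C" "f \<in> Mor C Y X" for f Y
    using Cmp_Idm_left[of Y X f] X that by simp
  ultimately show "X \<in> Ob C \<and> (\<forall>Y\<in>Ob C. Mor C X Y = {zmor C X Y} \<and> Mor C Y X = {zmor C Y X})"
    using X by blast
next
  assume "X \<in> Ob C \<and> (\<forall>Y\<in>Ob C. Mor C X Y = {zmor C X Y} \<and> Mor C Y X = {zmor C Y X})"
  then show "zero_object C X" unfolding zero_object_def using Idm_closed by blast
qed

definition biproduct :: "'o \<Rightarrow> 'o \<Rightarrow> 'o \<Rightarrow> 'm \<Rightarrow> 'm \<Rightarrow> 'm \<Rightarrow> 'm \<Rightarrow> bool"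
  where "biproduct A B X i1 i2 p1 p2 \<longleftrightarrow> A \<in> Ob C \<and> B \<in> Ob C \<and> X \<in> Ob C \<and>
    i1 \<in> Mor C A X \<and> i2 \<in> Mor C B X \<and> p1 \<in> Mor C X A \<and> p2 \<in> Mor C X B \<and>
    Cmp C A X A p1 i1 = Idm C A \<and> Cmp C B X B p2 i2 = Idm C B \<and>
    Cmp C B X A p1 i2 = zmor C B A \<and> Cmp C A X B p2 i1 = zmor C A B \<and>
    Cmp C X A X i1 p1 \<oplus>\<^bsub>Hom C X X\<^esub> Cmp C X B X i2 p2 = Idm C X"

lemma finsum_two:
  assumes "abelian_group G" "f 0 \<in> carrier G" "f 1 \<in> carrier G"
  shows "finsum G f {..<2::nat} = f 0 \<oplus>\<^bsub>G\<^esub> f 1"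
proof -
  interpret abelian_group G by fact
  have "{..<2::nat} = {0, 1}" by auto
  then show ?thesis using assms(2,3) by (auto simp: Pi_def)
qed

lemma direct_sum_pair_iff:
  "direct_sum C [A, B] X \<longleftrightarrow> (\<exists>i1 i2 p1 p2. biproduct A B X i1 i2 p1 p2)"
proof
  assume ds: "direct_sum C [A, B] X"
  have 2: "length [A, B] = 2" by simp
  have o: "X \<in> Ob C" "A \<in> Ob C" "B \<in> Ob C" using ds by (auto simp: direct_sum_def)
  from ds obtain \<iota> \<pi> where m: "\<forall>k<2. \<iota> k \<in> Mor C ([A, B] ! k) X \<and> \<pi> k \<in> Mor C X ([A, B] ! k)"
    and d: "\<forall>j<2. \<forall>k<2. Cmp C ([A, B] ! k) X ([A, B] ! j) (\<pi> j) (\<iota> k) =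
          (if j = k then Idm C ([A, B] ! k) else zmor C ([A, B] ! k) ([A, B] ! j))"
    and s: "finsum (Hom C X X) (\<lambda>k. Cmp C X ([A, B] ! k) X (\<iota> k) (\<pi> k)) {..<2} = Idm C X"
    unfolding direct_sum_def 2 by blast
  have s': "Cmp C X A X (\<iota> 0) (\<pi> 0) \<oplus>\<^bsub>Hom C X X\<^esub> Cmp C X B X (\<iota> 1) (\<pi> 1) = Idm C X"
    using s o m[rule_format, of 0] m[rule_format, of 1]
    by (subst (asm) finsum_two) (auto intro: hom_group)
  have "biproduct A B X (\<iota> 0) (\<iota> 1) (\<pi> 0) (\<pi> 1)"
    unfolding biproduct_def using o m[rule_format, of 0] m[rule_format, of 1] d[rule_format, of 0 0]
      d[rule_format, of 0 1] d[rule_format, of 1 0] d[rule_format, of 1 1] s' by simp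
  then show "\<exists>i1 i2 p1 p2. biproduct A B X i1 i2 p1 p2" by blast
next
  assume "\<exists>i1 i2 p1 p2. biproduct A B X i1 i2 p1 p2"
  then obtain i1 i2 p1 p2 where b: "biproduct A B X i1 i2 p1 p2" by blast
  define \<iota> \<pi> where "\<iota> = (\<lambda>k::nat. if k = 0 then i1 else i2)" and "\<pi> = (\<lambda>k::nat. if k = 0 then p1 else p2)"
  have 2: "length [A, B] = 2" by simp
  have k2: "k < 2 \<longleftrightarrow> k = 0 \<or> k = 1" for k :: nat by auto
  have "finsum (Hom C X X) (\<lambda>k. Cmp C X ([A, B] ! k) X (\<iota> k) (\<pi> k)) {..<2} = Idm C X"
    using b by (subst finsum_two) (auto simp: biproduct_def \<iota>_def \<pi>_def intro: hom_group)
  moreover have "(\<forall>k<2. \<iota> k \<in> Mor C ([A, B] ! k) X \<and> \<pi> k \<in> Mor C X ([A, B] ! k)) \<and>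
      (\<forall>j<2. \<forall>k<2. Cmp C ([A, B] ! k) X ([A, B] ! j) (\<pi> j) (\<iota> k) =
        (if j = k then Idm C ([A, B] ! k) else zmor C ([A, B] ! k) ([A, B] ! j)))"
    using b by (auto simp: biproduct_def \<iota>_def \<pi>_def k2)
  moreover have "X \<in> Ob C" "set [A, B] \<subseteq> Ob C" using b by (auto simp: biproduct_def)
  ultimately show "direct_sum C [A, B] X"
    unfolding direct_sum_def 2 by blast
qed

lemma biproduct_retract: "biproduct A B X i1 i2 p1 p2 \<Longrightarrow> retract A X" "biproduct A B X i1 i2 p1 p2 \<Longrightarrow> retract B X"
  unfolding biproduct_def retract_def by blast+

section \<open>The radical and endomorphism rings\<close>

lemma jacobson_closed: "f \<in> jacobson_radical C X Y \<Longrightarrow> f \<in> Mor C X Y"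
  by (simp add: jacobson_radical_def)

lemma jacobson_postcomp:
  assumes "X \<in> Ob C" "Y \<in> Ob C" "Z \<in> Ob C" "f \<in> jacobson_radical C X Y" "g \<in> Mor C Y Z"
  shows "Cmp C X Y Z g f \<in> jacobson_radical C X Z"
  unfolding jacobson_radical_def
proof (intro CollectI conjI ballI)
  fix h assume h: "h \<in> Mor C Z X"
  have "Cmp C X Z X h (Cmp C X Y Z g f) = Cmp C X Y X (Cmp C Y Z X h g) f"
    using assms h jacobson_closed by (simp add: Cmp_assoc)
  then show "is_iso C X X (Idm C X \<ominus>\<^bsub>Hom C X X\<^esub> Cmp C X Z X h (Cmp C X Y Z g f))"
    using assms h by (simp add: jacobson_radical_def)
qed (use assms jacobson_closed in auto)

lemma submodule_jacobson:
  assumes X: "X \<in> Ob C" and Y: "Y \<in> Ob C"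
  shows "submodule (jacobson_radical C X Y) R (Hom C X Y)"
proof -
  interpret H: module R "Hom C X Y" using X Y by (rule Hom_module)
  interpret HX: module R "Hom C X X" using X X by (rule Hom_module)
  interpret R: cring R by (rule cring_R)
  show ?thesis unfolding H.submodule_iff
  proof (intro conjI ballI)
    show "jacobson_radical C X Y \<subseteq> Mor C X Y" using jacobson_closed by blast
    show "zmor C X Y \<in> jacobson_radical C X Y"
      unfolding jacobson_radical_def using X Y is_iso_Idm by simp
  next
    fix f f' assume f: "f \<in> jacobson_radical C X Y" and f': "f' \<in> jacobson_radical C X Y"
    have fc: "f \<in> Mor C X Y" "f' \<in> Mor C X Y" using f f' jacobson_closed by auto
    show "f \<oplus>\<^bsub>Hom C X Y\<^esub> f' \<in> jacobson_radical C X Y" unfolding jacobson_radical_def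
    proof (intro CollectI conjI ballI)
      fix g assume g: "g \<in> Mor C Y X"
      \<comment> \<open>With u = 1 - g f and its inverse v, the factorisation 1 - g (f + f') = u (1
        - v g f') reduces the sum to the two given conditions.\<close>
      define u where "u = Idm C X \<ominus>\<^bsub>Hom C X X\<^esub> Cmp C X Y X g f"
      have uc: "u \<in> Mor C X X" unfolding u_def using X Y g fc by simp
      have iu: "is_iso C X X u" using f g by (simp add: jacobson_radical_def u_def)
      then obtain v where v: "v \<in> Mor C X X" "Cmp C X X X u v = Idm C X" unfolding is_iso_def by blast
      define w where "w = Idm C X \<ominus>\<^bsub>Hom C X X\<^esub> Cmp C X Y X (Cmp C Y X X v g) f'"
      have iw: "is_iso C X X w" using f' g v X Y by (simp add: jacobson_radical_def w_def)
      have "Cmp C X X X u w = u \<ominus>\<^bsub>Hom C X X\<^esub> Cmp C X Y X (Cmp C Y X X (Cmp C X X X u v) g) f'"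
        unfolding w_def using X Y uc v(1) g fc by (simp add: Cmp_minus_right Cmp_assoc)
      also have "\<dots> = u \<ominus>\<^bsub>Hom C X X\<^esub> Cmp C X Y X g f'" unfolding v(2) using X Y g by simp
      also have "\<dots> = Idm C X \<ominus>\<^bsub>Hom C X X\<^esub> Cmp C X Y X g (f \<oplus>\<^bsub>Hom C X Y\<^esub> f')"
        unfolding u_def using X Y g fc by (simp add: Cmp_add_right HX.minus_eq HX.minus_add HX.a_assoc)
      finally show "is_iso C X X (Idm C X \<ominus>\<^bsub>Hom C X X\<^esub> Cmp C X Y X g (f \<oplus>\<^bsub>Hom C X Y\<^esub> f'))"
        using is_iso_Cmp[OF X X X iw iu] by simp
    qed (use fc in simp)
  next
    fix a f assume a: "a \<in> carrier R" and f: "f \<in> jacobson_radical C X Y"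
    have fc: "f \<in> Mor C X Y" using f jacobson_closed by auto
    show "a \<odot>\<^bsub>Hom C X Y\<^esub> f \<in> jacobson_radical C X Y" unfolding jacobson_radical_def
    proof (intro CollectI conjI ballI)
      fix g assume g: "g \<in> Mor C Y X"
      have "Cmp C X Y X g (a \<odot>\<^bsub>Hom C X Y\<^esub> f) = Cmp C X Y X (a \<odot>\<^bsub>Hom C Y X\<^esub> g) f"
        using X Y a fc g by (simp add: Cmp_smult_left Cmp_smult_right)
      then show "is_iso C X X (Idm C X \<ominus>\<^bsub>Hom C X X\<^esub> Cmp C X Y X g (a \<odot>\<^bsub>Hom C X Y\<^esub> f))"
        using f g a X Y by (simp add: jacobson_radical_def)
    qed (use fc a X Y in simp)
  qed
qed

text \<open>The \<open>mult\<close> and \<open>one\<close> fields of a Hom record carry no meaning,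
  so they are overwritten by composition and identity; the module structure is kept.\<close>

definition End_ring :: "'o \<Rightarrow> ('r, 'm) module"
  where "End_ring X = (Hom C X X)\<lparr>mult := Cmp C X X X, one := Idm C X\<rparr>"

lemma End_ring_simps [simp]:
  "carrier (End_ring X) = Mor C X X" "mult (End_ring X) = Cmp C X X X" "\<one>\<^bsub>End_ring X\<^esub> = Idm C X"
  "\<zero>\<^bsub>End_ring X\<^esub> = zmor C X X" "add (End_ring X) = add (Hom C X X)" "smult (End_ring X) = smult (Hom C X X)"
  by (simp_all add: End_ring_def)

lemma End_ring_minus [simp]: "x \<ominus>\<^bsub>End_ring X\<^esub> y = x \<ominus>\<^bsub>Hom C X X\<^esub> y"
  by (simp add: a_minus_def a_inv_def)

lemma ring_End:
  assumes "X \<in> Ob C" shows "ring (End_ring X)"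
proof (rule ringI)
  interpret H: module R "Hom C X X" using assms assms by (rule Hom_module)
  show "abelian_group (End_ring X)"
    using H.abelian_group_axioms
    unfolding abelian_group_def abelian_monoid_def abelian_group_axioms_def by simp
  show "monoid (End_ring X)" by (rule monoidI) (use assms in \<open>auto simp: Cmp_assoc\<close>)
qed (use assms in \<open>auto simp: Cmp_add_left Cmp_add_right\<close>)

lemma module_End:
  assumes "X \<in> Ob C" shows "module R (End_ring X)"
proof -
  interpret H: module R "Hom C X X" using assms assms by (rule Hom_module)
  interpret E: ring "End_ring X" by (rule ring_End[OF assms])
  show ?thesis
    by (rule moduleI) (auto simp: H.smult_l_distr H.smult_r_distr H.smult_assoc1 H.R.cring_axioms E.abelian_group_axioms cring_R)
qed

lemma Units_End: "f \<in> Units (End_ring X) \<longleftrightarrow> is_iso C X X f"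
  unfolding Units_def is_iso_def by auto

end

section \<open>Direct sums\<close>

lemma (in module) finsum_submodule:
  assumes N: "submodule N R M" and "finite S" "\<And>k. k \<in> S \<Longrightarrow> f k \<in> N"
  shows "finsum M f S \<in> N"
  using assms(2,3)
proof (induction S)
  case empty
  then show ?case using sm_zero[OF N] by simp
next
  case (insert k S)
  then have "f \<in> S \<rightarrow> carrier M" "f k \<in> carrier M" using sm_carrier[OF N] by auto
  then show ?case using insert sm_add[OF N] by simp
qed

lemma linear_map_finsum:
  assumes M: "module R M" and N: "module R N" and h: "linear_map R M N h"
    and "finite S" "f \<in> S \<rightarrow> carrier M"
  shows "h (finsum M f S) = finsum N (\<lambda>k. h (f k)) S"
proof -
  interpret M: module R M by fact
  interpret N: module R N by fact
  show ?thesis using assms(4,5)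
  proof (induction S)
    case empty
    then show ?case using linear_map_zero[OF M N h] by simp
  next
    case (insert k S)
    have "f \<in> S \<rightarrow> carrier M" "f k \<in> carrier M" using insert.prems by auto
    moreover then have "(\<lambda>k. h (f k)) \<in> S \<rightarrow> carrier N" "h (f k) \<in> carrier N"
      using linear_mapD(1)[OF h] by auto
    ultimately show ?case using insert linear_mapD(2)[OF h] by simp
  qed
qed

context lin_category
begin

lemma direct_sumE:
  assumes "direct_sum C Xs X"
  obtains \<iota> \<pi> where "X \<in> Ob C" "\<And>k. k < length Xs \<Longrightarrow> Xs ! k \<in> Ob C"
    "\<And>k. k < length Xs \<Longrightarrow> \<iota> k \<in> Mor C (Xs ! k) X" "\<And>k. k < length Xs \<Longrightarrow> \<pi> k \<in> Mor C X (Xs ! k)"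
    "\<And>j k. \<lbrakk>j < length Xs; k < length Xs\<rbrakk> \<Longrightarrow> Cmp C (Xs ! k) X (Xs ! j) (\<pi> j) (\<iota> k) =
          (if j = k then Idm C (Xs ! k) else zmor C (Xs ! k) (Xs ! j))"
    "finsum (Hom C X X) (\<lambda>k. Cmp C X (Xs ! k) X (\<iota> k) (\<pi> k)) {..<length Xs} = Idm C X"
proof -
  have "X \<in> Ob C" "set Xs \<subseteq> Ob C" using assms by (auto simp: direct_sum_def)
  moreover obtain \<iota> \<pi> where "\<forall>k<length Xs. \<iota> k \<in> Mor C (Xs ! k) X \<and> \<pi> k \<in> Mor C X (Xs ! k)"
    "\<forall>j<length Xs. \<forall>k<length Xs. Cmp C (Xs ! k) X (Xs ! j) (\<pi> j) (\<iota> k) =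
          (if j = k then Idm C (Xs ! k) else zmor C (Xs ! k) (Xs ! j))"
    "finsum (Hom C X X) (\<lambda>k. Cmp C X (Xs ! k) X (\<iota> k) (\<pi> k)) {..<length Xs} = Idm C X"
    using assms unfolding direct_sum_def by blast
  ultimately show thesis by (intro that[of \<iota> \<pi>]) auto
qed

lemma direct_sum_mem:
  assumes U: "U \<in> Ob C" and X: "X \<in> Ob C" and Xs: "\<And>k. k < n \<Longrightarrow> A k \<in> Ob C"
    and i: "\<And>k. k < n \<Longrightarrow> \<iota> k \<in> Mor C (A k) X" and p: "\<And>k. k < n \<Longrightarrow> \<pi> k \<in> Mor C X (A k)"
    and s: "finsum (Hom C X X) (\<lambda>k. Cmp C X (A k) X (\<iota> k) (\<pi> k)) {..<n} = Idm C X"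
    and N: "submodule N R (Hom C U X)" and h: "h \<in> Mor C U X"
    and hN: "\<And>k. k < (n::nat) \<Longrightarrow> Cmp C U (A k) X (\<iota> k) (Cmp C U X (A k) (\<pi> k) h) \<in> N"
  shows "h \<in> N"
proof -
  interpret UX: module R "Hom C U X" using U X by (rule Hom_module)
  have "h = Cmp C U X X (finsum (Hom C X X) (\<lambda>k. Cmp C X (A k) X (\<iota> k) (\<pi> k)) {..<n}) h"
    unfolding s using U X h by simp
  also have "\<dots> = finsum (Hom C U X) (\<lambda>k. Cmp C U X X (Cmp C X (A k) X (\<iota> k) (\<pi> k)) h) {..<n}"
    using linear_map_finsum[OF Hom_module[OF X X] Hom_module[OF U X] linear_precomp[OF U X X h], of "{..<n}"]
      Xs i p X by auto
  also have "\<dots> \<in> N"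
  proof (rule UX.finsum_submodule[OF N])
    fix k assume "k \<in> {..<n}"
    then show "Cmp C U X X (Cmp C X (A k) X (\<iota> k) (\<pi> k)) h \<in> N"
      using hN[of k] Xs[of k] i[of k] p[of k] U X h by (simp add: Cmp_assoc)
  qed simp
  finally show ?thesis .
qed

text \<open>D is a subfunctor of Hom(U, -), so the length of Hom(U, -) / D is additive on direct
  sums. It is applied to the multiples by the maximal ideal, to the radical, and to the maps that
  extend to a projective.\<close>

lemma additive_mlen:
  assumes U: "U \<in> Ob C"
    and D: "\<And>X. X \<in> Ob C \<Longrightarrow> submodule (D X) R (Hom C U X)"
    and nat: "\<And>X Y s f. \<lbrakk>X \<in> Ob C; Y \<in> Ob C; s \<in> Mor C X Y; f \<in> D X\<rbrakk> \<Longrightarrow> Cmp C U X Y s f \<in> D Y"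
    and ds: "direct_sum C Xs X"
  shows "mlen R (Hom C U X) (D X) (Mor C U X) = (\<Sum>Y\<leftarrow>Xs. mlen R (Hom C U Y) (D Y) (Mor C U Y))"
proof -
  from ds obtain \<iota> \<pi> where X: "X \<in> Ob C" and Xs: "\<And>k. k < length Xs \<Longrightarrow> Xs ! k \<in> Ob C"
    and i: "\<And>k. k < length Xs \<Longrightarrow> \<iota> k \<in> Mor C (Xs ! k) X" and p: "\<And>k. k < length Xs \<Longrightarrow> \<pi> k \<in> Mor C X (Xs ! k)"
    and d: "\<And>j k. \<lbrakk>j < length Xs; k < length Xs\<rbrakk> \<Longrightarrow> Cmp C (Xs ! k) X (Xs ! j) (\<pi> j) (\<iota> k) =
          (if j = k then Idm C (Xs ! k) else zmor C (Xs ! k) (Xs ! j))"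
    and s: "finsum (Hom C X X) (\<lambda>k. Cmp C X (Xs ! k) X (\<iota> k) (\<pi> k)) {..<length Xs} = Idm C X"
    by (rule direct_sumE) blast
  interpret UX: module R "Hom C U X" using U X by (rule Hom_module)
  let ?n = "length Xs"
  \<comment> \<open>A filtration from D(X) to Hom(U, X): \<open>N j\<close> leaves the components
    below j free and keeps the others in D. The step from j to j + 1 contributes exactly the j-th
    summand.\<close>
  define N where "N j = {h \<in> Mor C U X. \<forall>k. j \<le> k \<longrightarrow> k < ?n \<longrightarrow> Cmp C U X (Xs ! k) (\<pi> k) h \<in> D (Xs ! k)}" for j
  have subN: "submodule (N j) R (Hom C U X)" for j
  proof -
    have *: "submodule {h \<in> Mor C U X. Cmp C U X (Xs ! k) (\<pi> k) h \<in> D (Xs ! k)} R (Hom C U X)" if "k < ?n" for k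
      by (rule submodule_preimage[OF Hom_module Hom_module linear_postcomp D])
        (use that U X Xs p in auto)
    show ?thesis unfolding UX.submodule_iff N_def
      using *[unfolded UX.submodule_iff] by auto
  qed
  have Nmono: "N j \<subseteq> N (Suc j)" for j unfolding N_def by auto
  have step: "mlen R (Hom C U X) (N j) (N (Suc j)) = mlen R (Hom C U (Xs ! j)) (D (Xs ! j)) (Mor C U (Xs ! j))"
    if j: "j < ?n" for j
  proof -
    let ?h = "\<lambda>f. Cmp C U X (Xs ! j) (\<pi> j) f"
    note oj = Xs[OF j] i[OF j] p[OF j]
    interpret Uj: module R "Hom C U (Xs ! j)" using U oj(1) by (rule Hom_module)
    have lift: "Cmp C U (Xs ! j) X (\<iota> j) f \<in> N (Suc j)" "?h (Cmp C U (Xs ! j) X (\<iota> j) f) = f"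
      if f: "f \<in> Mor C U (Xs ! j)" for f
    proof -
      have "Cmp C U X (Xs ! k) (\<pi> k) (Cmp C U (Xs ! j) X (\<iota> j) f) = (if k = j then f else zmor C U (Xs ! k))"
        if k: "k < ?n" for k
        using d[OF k j] Xs[OF k] p[OF k] oj f U X by (simp add: Cmp_assoc)
      then show "Cmp C U (Xs ! j) X (\<iota> j) f \<in> N (Suc j)" "?h (Cmp C U (Xs ! j) X (\<iota> j) f) = f"
        unfolding N_def using f oj U X j module.sm_zero[OF Hom_module[OF U] D] Xs by auto
    qed
    have im1: "?h ` N (Suc j) = Mor C U (Xs ! j)"
    proof
      show "?h ` N (Suc j) \<subseteq> Mor C U (Xs ! j)" unfolding N_def using oj U X by auto
      show "Mor C U (Xs ! j) \<subseteq> ?h ` N (Suc j)" using lift by (metis image_eqI subsetI)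
    qed
    have im0: "?h ` N j = D (Xs ! j)"
    proof
      show "?h ` N j \<subseteq> D (Xs ! j)" unfolding N_def using j by auto
      show "D (Xs ! j) \<subseteq> ?h ` N j"
      proof
        fix f assume f: "f \<in> D (Xs ! j)"
        then have fc: "f \<in> Mor C U (Xs ! j)" using Uj.sm_carrier[OF D] oj by blast
        have "Cmp C U (Xs ! j) X (\<iota> j) f \<in> N j" unfolding N_def
        proof (intro CollectI conjI allI impI)
          fix k assume "j \<le> k" "k < ?n"
          then show "Cmp C U X (Xs ! k) (\<pi> k) (Cmp C U (Xs ! j) X (\<iota> j) f) \<in> D (Xs ! k)"
            using lift[OF fc] f unfolding N_def by (cases "k = j") auto
        qed (use fc oj U X in simp)
        then show "f \<in> ?h ` N j" using lift(2)[OF fc] by (metis image_eqI)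
      qed
    qed
    have "mlen R (Hom C U (Xs ! j)) (?h ` N j) (?h ` N (Suc j)) = mlen R (Hom C U X) (N j) (N (Suc j))"
    proof (rule mlen_image[OF Hom_module Hom_module linear_postcomp subN subN Nmono])
      fix x assume x: "x \<in> N (Suc j)" and x0: "?h x = zmor C U (Xs ! j)"
      show "x \<in> N j" unfolding N_def
      proof (intro CollectI conjI allI impI)
        fix k assume "j \<le> k" "k < ?n"
        then show "Cmp C U X (Xs ! k) (\<pi> k) x \<in> D (Xs ! k)"
          using x x0 Uj.sm_zero[OF D[OF oj(1)]] unfolding N_def by (cases "k = j") auto
      qed (use x in \<open>simp add: N_def\<close>)
    qed (use oj U X in auto)
    then show ?thesis unfolding im0 im1 by simp
  qed
  have N_le: "N 0 \<subseteq> N j" for j unfolding N_def by auto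
  have partial: "mlen R (Hom C U X) (N 0) (N j) = (\<Sum>k<j. mlen R (Hom C U (Xs ! k)) (D (Xs ! k)) (Mor C U (Xs ! k)))"
    if "j \<le> ?n" for j using that
  proof (induction j)
    case (Suc j)
    then show ?case using UX.mlen_add[OF subN subN subN N_le Nmono, of j] step[of j] by simp
  qed simp
  have "N ?n = Mor C U X" unfolding N_def by auto
  moreover have "N 0 = D X"
  proof
    show "D X \<subseteq> N 0" unfolding N_def using nat X Xs p UX.sm_carrier[OF D[OF X]] by auto
    show "N 0 \<subseteq> D X"
    proof
      fix h assume h: "h \<in> N 0"
      show "h \<in> D X"
      proof (rule direct_sum_mem[OF U X Xs i p s D[OF X]])
        show "h \<in> Mor C U X" using h by (simp add: N_def)
        fix k assume k: "k < ?n"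
        then show "Cmp C U (Xs ! k) X (\<iota> k) (Cmp C U X (Xs ! k) (\<pi> k) h) \<in> D X"
          using h k by (intro nat[OF Xs[OF k] X i[OF k]]) (auto simp: N_def)
      qed
    qed
  qed
  ultimately show ?thesis using partial[of ?n] by (simp add: sum_list_sum_nth atLeast0LessThan)
qed

lemma direct_sum_single:
  assumes "X \<in> Ob C" "Y \<in> Ob C" "isomorphic C Y X" shows "direct_sum C [Y] X"
proof -
  obtain f g where fg: "f \<in> Mor C Y X" "g \<in> Mor C X Y" "Cmp C Y X Y g f = Idm C Y" "Cmp C X Y X f g = Idm C X"
    using assms(3) unfolding isomorphic_def is_iso_def by blast
  interpret XX: module R "Hom C X X" using assms(1,1) by (rule Hom_module)
  have "finsum (Hom C X X) (\<lambda>k. Cmp C X ([Y] ! k) X f g) {..<length [Y]} = Idm C X"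
    using assms fg by (simp add: lessThan_Suc)
  then show ?thesis unfolding direct_sum_def using assms fg
    by - (intro conjI; (rule exI[of _ "\<lambda>_. f"], rule exI[of _ "\<lambda>_. g"])?; auto)
qed

lemma direct_sum_empty: "zero_object C X \<Longrightarrow> direct_sum C [] X"
proof -
  assume z: "zero_object C X"
  then have X: "X \<in> Ob C" "Idm C X = zmor C X X" by (auto simp: zero_object_def)
  interpret XX: module R "Hom C X X" using X(1,1) by (rule Hom_module)
  show ?thesis unfolding direct_sum_def using X by simp
qed

lemma direct_sum_append:
  assumes "direct_sum C As A" "direct_sum C Bs B" "direct_sum C [A, B] X"
  shows "direct_sum C (As @ Bs) X"
proof -
  from assms(1) obtain iA pA where A: "A \<in> Ob C" and As: "\<And>k. k < length As \<Longrightarrow> As ! k \<in> Ob C"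
    and iA: "\<And>k. k < length As \<Longrightarrow> iA k \<in> Mor C (As ! k) A" and pA: "\<And>k. k < length As \<Longrightarrow> pA k \<in> Mor C A (As ! k)"
    and dA: "\<And>j k. \<lbrakk>j < length As; k < length As\<rbrakk> \<Longrightarrow> Cmp C (As ! k) A (As ! j) (pA j) (iA k) =
          (if j = k then Idm C (As ! k) else zmor C (As ! k) (As ! j))"
    and sA: "finsum (Hom C A A) (\<lambda>k. Cmp C A (As ! k) A (iA k) (pA k)) {..<length As} = Idm C A"
    by (rule direct_sumE) blast
  from assms(2) obtain iB pB where B: "B \<in> Ob C" and Bs: "\<And>k. k < length Bs \<Longrightarrow> Bs ! k \<in> Ob C"
    and iB: "\<And>k. k < length Bs \<Longrightarrow> iB k \<in> Mor C (Bs ! k) B" and pB: "\<And>k. k < length Bs \<Longrightarrow> pB k \<in> Mor C B (Bs ! k)"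
    and dB: "\<And>j k. \<lbrakk>j < length Bs; k < length Bs\<rbrakk> \<Longrightarrow> Cmp C (Bs ! k) B (Bs ! j) (pB j) (iB k) =
          (if j = k then Idm C (Bs ! k) else zmor C (Bs ! k) (Bs ! j))"
    and sB: "finsum (Hom C B B) (\<lambda>k. Cmp C B (Bs ! k) B (iB k) (pB k)) {..<length Bs} = Idm C B"
    by (rule direct_sumE) blast
  from assms(3) obtain i1 i2 p1 p2 where "biproduct A B X i1 i2 p1 p2" unfolding direct_sum_pair_iff by blast
  then have X: "X \<in> Ob C" and m: "i1 \<in> Mor C A X" "i2 \<in> Mor C B X" "p1 \<in> Mor C X A" "p2 \<in> Mor C X B"
    and r: "Cmp C A X A p1 i1 = Idm C A" "Cmp C B X B p2 i2 = Idm C B"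
    "Cmp C B X A p1 i2 = zmor C B A" "Cmp C A X B p2 i1 = zmor C A B"
    and s: "Cmp C X A X i1 p1 \<oplus>\<^bsub>Hom C X X\<^esub> Cmp C X B X i2 p2 = Idm C X"
    unfolding biproduct_def by blast+
  interpret XX: module R "Hom C X X" using X X by (rule Hom_module)
  let ?a = "length As" and ?b = "length Bs" and ?L = "As @ Bs"
  define \<iota> where "\<iota> k = (if k < ?a then Cmp C (As ! k) A X i1 (iA k) else Cmp C (Bs ! (k - ?a)) B X i2 (iB (k - ?a)))" for k
  define \<pi> where "\<pi> k = (if k < ?a then Cmp C X A (As ! k) (pA k) p1 else Cmp C X B (Bs ! (k - ?a)) (pB (k - ?a)) p2)" for k
  have L1: "?L ! k = As ! k" if "k < ?a" for k using that by (simp add: nth_append)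
  have L2: "?L ! (k + ?a) = Bs ! k" for k by (simp add: nth_append)
  have mor: "\<iota> k \<in> Mor C (?L ! k) X \<and> \<pi> k \<in> Mor C X (?L ! k)" if "k < length ?L" for k
    using that As[of k] iA[of k] pA[of k] Bs[of "k - ?a"] iB[of "k - ?a"] pB[of "k - ?a"] m A B X
    by (auto simp: \<iota>_def \<pi>_def nth_append)
  have comp: "Cmp C D X D' (Cmp C X E D' b p) (Cmp C D F X i a) = Cmp C D F D' (Cmp C F E D' b (Cmp C F X E p i)) a"
    if "D \<in> Ob C" "D' \<in> Ob C" "E \<in> Ob C" "F \<in> Ob C" "b \<in> Mor C E D'" "p \<in> Mor C X E" "i \<in> Mor C F X" "a \<in> Mor C D F"
    for D D' E F b p i a
    using that X by (simp add: Cmp_assoc)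
  have orth: "Cmp C (?L ! k) X (?L ! j) (\<pi> j) (\<iota> k) = (if j = k then Idm C (?L ! k) else zmor C (?L ! k) (?L ! j))"
    if j: "j < length ?L" and k: "k < length ?L" for j k
  proof (cases "k < ?a")
    case k1: True
    note ok = As[OF k1] iA[OF k1]
    show ?thesis
    proof (cases "j < ?a")
      case True
      then show ?thesis using comp[OF ok(1) As[OF True] A A pA[OF True] m(3) m(1) ok(2)] r(1) dA[OF True k1] k1 ok A
          pA[OF True] As[OF True] by (simp add: \<iota>_def \<pi>_def nth_append)
    next
      case False
      then have j': "j - ?a < ?b" using j by auto
      then show ?thesis using comp[OF ok(1) Bs[OF j'] B A pB[OF j'] m(4) m(1) ok(2)] r(4) False k1 ok A B
          pB[OF j'] Bs[OF j'] by (auto simp add: \<iota>_def \<pi>_def nth_append)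
    qed
  next
    case k2: False
    then have k': "k - ?a < ?b" using k by auto
    note ok = Bs[OF k'] iB[OF k']
    show ?thesis
    proof (cases "j < ?a")
      case True
      then show ?thesis using comp[OF ok(1) As[OF True] A B pA[OF True] m(3) m(2) ok(2)] r(3) k2 ok A B
          pA[OF True] As[OF True] by (auto simp add: \<iota>_def \<pi>_def nth_append)
    next
      case False
      then have j': "j - ?a < ?b" using j by auto
      have "j - ?a = k - ?a \<longleftrightarrow> j = k" using False k2 by auto
      then show ?thesis using comp[OF ok(1) Bs[OF j'] B B pB[OF j'] m(4) m(2) ok(2)] r(2) dB[OF j' k'] False k2 ok B
          pB[OF j'] Bs[OF j'] by (auto simp add: \<iota>_def \<pi>_def nth_append)
    qed
  qed
  have half: "finsum (Hom C X X) (\<lambda>k. Cmp C X (Ds k) X (Cmp C (Ds k) D X i (iD k)) (Cmp C X D (Ds k) (pD k) p)) {..<n} = Cmp C X D X i p"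
    if D: "D \<in> Ob C" and Ds: "\<And>k. k < n \<Longrightarrow> Ds k \<in> Ob C" and iD: "\<And>k. k < n \<Longrightarrow> iD k \<in> Mor C (Ds k) D"
      and pD: "\<And>k. k < n \<Longrightarrow> pD k \<in> Mor C D (Ds k)" and i: "i \<in> Mor C D X" and p: "p \<in> Mor C X D"
      and sD: "finsum (Hom C D D) (\<lambda>k. Cmp C D (Ds k) D (iD k) (pD k)) {..<n} = Idm C D" for D Ds iD pD i p and n :: nat
  proof -
    have in1: "(\<lambda>k. Cmp C D (Ds k) D (iD k) (pD k)) \<in> {..<n} \<rightarrow> Mor C D D" using D Ds iD pD by auto
    have in2: "(\<lambda>k. Cmp C D D X i (Cmp C D (Ds k) D (iD k) (pD k))) \<in> {..<n} \<rightarrow> Mor C D X" using D X i Ds iD pD by auto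
    have "Cmp C X D X i p = Cmp C X D X (Cmp C D D X i (finsum (Hom C D D) (\<lambda>k. Cmp C D (Ds k) D (iD k) (pD k)) {..<n})) p"
      unfolding sD using D X i by simp
    also have "\<dots> = finsum (Hom C X X) (\<lambda>k. Cmp C X D X (Cmp C D D X i (Cmp C D (Ds k) D (iD k) (pD k))) p) {..<n}"
      using linear_map_finsum[OF Hom_module[OF D D] Hom_module[OF D X] linear_postcomp[OF D D X i] _ in1]
        linear_map_finsum[OF Hom_module[OF D X] Hom_module[OF X X] linear_precomp[OF X D X p] _ in2] by simp
    also have "\<dots> = finsum (Hom C X X) (\<lambda>k. Cmp C X (Ds k) X (Cmp C (Ds k) D X i (iD k)) (Cmp C X D (Ds k) (pD k) p)) {..<n}"
      by (rule XX.finsum_cong') (use D Ds iD pD i p X in \<open>auto simp: Cmp_assoc\<close>)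
    finally show ?thesis by simp
  qed
  let ?f = "\<lambda>k. Cmp C X (?L ! k) X (\<iota> k) (\<pi> k)"
  have LO: "?L ! k \<in> Ob C" if "k < length ?L" for k
    using that As[of k] Bs[of "k - ?a"] by (auto simp: nth_append)
  have fm: "?f k \<in> Mor C X X" if "k < length ?L" for k using mor[OF that] LO[OF that] X by simp
  have split: "{..<length ?L} = {..<?a} \<union> (\<lambda>k. k + ?a) ` {..<?b}"
  proof
    show "{..<length ?L} \<subseteq> {..<?a} \<union> (\<lambda>k. k + ?a) ` {..<?b}"
    proof
      fix k assume k: "k \<in> {..<length ?L}"
      show "k \<in> {..<?a} \<union> (\<lambda>k. k + ?a) ` {..<?b}"
      proof (cases "k < ?a")
        case False
        then have "k = (k - ?a) + ?a" "k - ?a < ?b" using k by auto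
        then show ?thesis by blast
      qed simp
    qed
  qed auto
  have "finsum (Hom C X X) ?f {..<length ?L} = finsum (Hom C X X) ?f {..<?a} \<oplus>\<^bsub>Hom C X X\<^esub> finsum (Hom C X X) ?f ((\<lambda>k. k + ?a) ` {..<?b})"
    unfolding split by (rule XX.finsum_Un_disjoint) (use fm in auto)
  also have "finsum (Hom C X X) ?f ((\<lambda>k. k + ?a) ` {..<?b}) = finsum (Hom C X X) (\<lambda>k. ?f (k + ?a)) {..<?b}"
    by (rule XX.finsum_reindex) (use fm in \<open>auto simp: inj_on_def\<close>)
  also have "\<dots> = finsum (Hom C X X) (\<lambda>k. Cmp C X (Bs ! k) X (Cmp C (Bs ! k) B X i2 (iB k)) (Cmp C X B (Bs ! k) (pB k) p2)) {..<?b}"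
    by (rule XX.finsum_cong') (use B Bs iB pB m X in \<open>auto simp: \<iota>_def \<pi>_def L2\<close>)
  also have "\<dots> = Cmp C X B X i2 p2" by (rule half[OF B Bs iB pB m(2) m(4) sB])
  also have "finsum (Hom C X X) ?f {..<?a} = finsum (Hom C X X) (\<lambda>k. Cmp C X (As ! k) X (Cmp C (As ! k) A X i1 (iA k)) (Cmp C X A (As ! k) (pA k) p1)) {..<?a}"
    by (rule XX.finsum_cong') (use A As iA pA m X in \<open>auto simp: \<iota>_def \<pi>_def L1\<close>)
  also have "\<dots> = Cmp C X A X i1 p1" by (rule half[OF A As iA pA m(1) m(3) sA])
  also note s
  finally have sum: "finsum (Hom C X X) ?f {..<length ?L} = Idm C X" .
  have "set ?L \<subseteq> Ob C" using assms(1,2) by (auto simp: direct_sum_def)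
  then show ?thesis unfolding direct_sum_def using X mor orth sum by blast
qed

end

section \<open>The Krull-Schmidt property\<close>

lemma complete_local_ring_maximal:
  fixes R (structure)
  assumes "complete_noetherian_local_ring R"
  obtains m where "ideal m R" "\<one> \<notin> m" "\<And>r. \<lbrakk>r \<in> carrier R; r \<notin> m\<rbrakk> \<Longrightarrow> r \<in> Units R"
    "adically_complete R m"
proof -
  have R: "cring R" "noetherian_ring R" using assms by (auto simp: complete_noetherian_local_ring_def)
  interpret cring R by (rule R)
  obtain m where m: "maximalideal m R" and uniq: "\<And>m'. maximalideal m' R \<Longrightarrow> m' = m"
    using assms unfolding complete_noetherian_local_ring_def by blast
  have id: "ideal m R" using m maximalideal.axioms(1) by blast
  have one: "\<one> \<notin> m" using m id ideal.one_imp_carrier maximalideal.I_notcarr by metis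
  have "r \<in> Units R" if r: "r \<in> carrier R" "r \<notin> m" for r
  proof (rule ccontr)
    assume nu: "r \<notin> Units R"
    have "PIdl r \<noteq> carrier R"
    proof
      assume "PIdl r = carrier R"
      then obtain x where "x \<in> carrier R" "\<one> = x \<otimes> r" by (auto simp: cgenideal_def)
      then show False using nu r m_comm unfolding Units_def by fastforce
    qed
    then have "PIdl r \<in> {I. ideal I R \<and> r \<in> I \<and> I \<noteq> carrier R}"
      using cgenideal_ideal[OF r(1)] cgenideal_self[OF r(1)] by simp
    from wfE_min[OF noetherian_ring_wf[OF R(2)] this] obtain I
      where I: "I \<in> {I. ideal I R \<and> r \<in> I \<and> I \<noteq> carrier R}"
        and max: "\<And>J. (J, I) \<in> {(I, J). ideal I R \<and> ideal J R \<and> J \<subset> I} \<Longrightarrow> J \<notin> {I. ideal I R \<and> r \<in> I \<and> I \<noteq> carrier R}"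
      by blast
    have "maximalideal I R"
    proof (rule maximalidealI)
      show "ideal I R" "carrier R \<noteq> I" using I by auto
      fix J assume "ideal J R" "I \<subseteq> J" "J \<subseteq> carrier R"
      then show "J = I \<or> J = carrier R" using max[of J] I by auto
    qed
    then show False using uniq I r by blast
  qed
  moreover have "adically_complete R m" using assms m by (auto simp: complete_noetherian_local_ring_def)
  ultimately show ?thesis using that id one by blast
qed

locale hom_noetherian_category = additive_category R C
  for R :: "('r, 'b) ring_scheme" and C :: "('r, 'o, 'm, 'z) lincat_scheme" +
  assumes complete_R: "complete_noetherian_local_ring R"
    and hom_noetherian: "hom_noetherian R C"
    and idempotent_complete: "idempotent_complete C"
begin

definition maxid :: "'r set"
  where "maxid = (SOME m. ideal m R \<and> \<one>\<^bsub>R\<^esub> \<notin> m \<and> (\<forall>r\<in>carrier R. r \<notin> m \<longrightarrow> r \<in> Units R) \<and> adically_complete R m)"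

lemma maxid: "ideal maxid R" "\<one>\<^bsub>R\<^esub> \<notin> maxid" "\<lbrakk>r \<in> carrier R; r \<notin> maxid\<rbrakk> \<Longrightarrow> r \<in> Units R"
  "adically_complete R maxid"
proof -
  have "\<exists>m. ideal m R \<and> \<one>\<^bsub>R\<^esub> \<notin> m \<and> (\<forall>r\<in>carrier R. r \<notin> m \<longrightarrow> r \<in> Units R) \<and> adically_complete R m"
    by (rule complete_local_ring_maximal[OF complete_R]) blast
  from someI_ex[OF this] show "ideal maxid R" "\<one>\<^bsub>R\<^esub> \<notin> maxid" "\<lbrakk>r \<in> carrier R; r \<notin> maxid\<rbrakk> \<Longrightarrow> r \<in> Units R"
    "adically_complete R maxid" unfolding maxid_def[symmetric] by blast+
qed

lemma noetherian_R: "noetherian_ring R"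
  using complete_R by (simp add: complete_noetherian_local_ring_def)

lemma fg_hom: "\<lbrakk>X \<in> Ob C; Y \<in> Ob C\<rbrakk> \<Longrightarrow> finitely_generated_module R (Hom C X Y)"
  using hom_noetherian by (simp add: hom_noetherian_def)

lemma local_noetherian_hom:
  assumes "X \<in> Ob C" "Y \<in> Ob C" shows "local_noetherian_module R (Hom C X Y) maxid"
  by (intro local_noetherian_module.intro local_noetherian_module_axioms.intro Hom_module assms maxid
    noetherian_R fg_imp_noetherian_module fg_hom)

lemma submodule_End:
  assumes "X \<in> Ob C" shows "submodule N R (End_ring X) \<longleftrightarrow> submodule N R (Hom C X X)"
  using module.submodule_iff[OF module_End[OF assms]] module.submodule_iff[OF Hom_module[OF assms assms]]
  by simp

lemma End_algebra:
  assumes X: "X \<in> Ob C" shows "complete_local_algebra R (End_ring X) maxid"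
proof -
  have fg: "finitely_generated_module R (End_ring X)"
    using fg_hom[OF X X] submodule_End[OF X] unfolding finitely_generated_module_def by simp
  show ?thesis
    by (intro complete_local_algebra.intro local_noetherian_module.intro local_noetherian_module_axioms.intro
        complete_local_algebra_axioms.intro module_End ring_End maxid noetherian_R fg_imp_noetherian_module X fg)
      (use X in \<open>simp_all add: Cmp_smult_left Cmp_smult_right\<close>)
qed

lemma retract_biproduct:
  assumes A: "A \<in> Ob C" and X: "X \<in> Ob C" and s: "s \<in> Mor C A X" and r: "r \<in> Mor C X A"
    and rs: "Cmp C A X A r s = Idm C A"
  shows "\<exists>B i p. biproduct A B X s i r p"
proof -
  \<comment> \<open>The complement of A is obtained by splitting the idempotent 1 - s r.\<close>
  define e where "e = Idm C X \<ominus>\<^bsub>Hom C X X\<^esub> Cmp C X A X s r"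
  have e: "e \<in> Mor C X X" unfolding e_def using A X s r by simp
  have re: "Cmp C X X A r e = zmor C X A"
  proof -
    have "Cmp C X X A r e = r \<ominus>\<^bsub>Hom C X A\<^esub> Cmp C X A A (Cmp C A X A r s) r"
      unfolding e_def using A X s r by (simp add: Cmp_minus_right Cmp_assoc)
    then show ?thesis unfolding rs using A X r by simp
  qed
  have es: "Cmp C A X X e s = zmor C A X"
  proof -
    have "Cmp C A X X e s = s \<ominus>\<^bsub>Hom C A X\<^esub> Cmp C A A X s (Cmp C A X A r s)"
      unfolding e_def using A X s r by (simp add: Cmp_minus_left Cmp_assoc)
    then show ?thesis unfolding rs using A X s by simp
  qed
  have "Cmp C X X X e e = e \<ominus>\<^bsub>Hom C X X\<^esub> Cmp C X A X s (Cmp C X X A r e)"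
    unfolding e_def[of] using A X s r e unfolding e_def by (subst Cmp_minus_left) (simp_all add: Cmp_assoc)
  then have "Cmp C X X X e e = e" unfolding re using A X s e by simp
  then obtain Y r' s' where Y: "Y \<in> Ob C" "r' \<in> Mor C X Y" "s' \<in> Mor C Y X"
    and sr': "Cmp C X Y X s' r' = e" and rs': "Cmp C Y X Y r' s' = Idm C Y"
    using idempotent_complete X e unfolding idempotent_complete_def by blast
  have "Cmp C Y X A r s' = Cmp C Y X A r (Cmp C Y Y X s' (Cmp C Y X Y r' s'))" unfolding rs' using Y X A by simp
  also have "\<dots> = Cmp C Y X A (Cmp C X X A r (Cmp C X Y X s' r')) s'" using Y X A r by (simp add: Cmp_assoc)
  also have "\<dots> = zmor C Y A" unfolding sr' re using Y X A by simp
  finally have z1: "Cmp C Y X A r s' = zmor C Y A" .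
  have "Cmp C A X Y r' s = Cmp C A X Y (Cmp C X Y Y (Cmp C Y X Y r' s') r') s" unfolding rs' using Y X A s by simp
  also have "\<dots> = Cmp C A X Y r' (Cmp C A X X (Cmp C X Y X s' r') s)" using Y X A s by (simp add: Cmp_assoc)
  also have "\<dots> = zmor C A Y" unfolding sr' es using Y X A by simp
  finally have z2: "Cmp C A X Y r' s = zmor C A Y" .
  have "Cmp C X A X s r \<oplus>\<^bsub>Hom C X X\<^esub> Cmp C X Y X s' r' = Idm C X"
    unfolding sr' e_def using A X s r by (intro hom_add_minus_cancel) auto
  then have "biproduct A Y X s s' r r'" unfolding biproduct_def using A X Y s r rs rs' z1 z2 by simp
  then show ?thesis by blast
qed

lemma zero_object_sum: "\<lbrakk>biproduct A B X i1 i2 p1 p2; zero_object C B\<rbrakk> \<Longrightarrow> is_iso C A X i1 \<and> is_iso C X A p1"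
proof -
  assume b: "biproduct A B X i1 i2 p1 p2" and z: "zero_object C B"
  then have "i2 = zmor C B X" using zero_object_iff[of B] unfolding biproduct_def by blast
  then have "Cmp C X A X i1 p1 = Idm C X" using b unfolding biproduct_def by auto
  then show ?thesis using b unfolding biproduct_def is_iso_def by blast
qed

lemma not_zero_object_Idm: "\<lbrakk>X \<in> Ob C; \<not> zero_object C X\<rbrakk> \<Longrightarrow> Idm C X \<noteq> zmor C X X"
  by (simp add: zero_object_def)

lemma indecomposable_retract:
  assumes X: "indecomposable C X" and A: "A \<in> Ob C" "\<not> zero_object C A"
    and s: "s \<in> Mor C A X" and r: "r \<in> Mor C X A" and rs: "Cmp C A X A r s = Idm C A"
  shows "is_iso C A X s \<and> is_iso C X A r"
proof -
  have XO: "X \<in> Ob C" using X by (simp add: indecomposable_def)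
  obtain B i p where b: "biproduct A B X s i r p" using retract_biproduct[OF A(1) XO s r rs] by blast
  then have "zero_object C B" using X A direct_sum_pair_iff unfolding indecomposable_def by blast
  then show ?thesis using zero_object_sum b by blast
qed

lemma indecomposable_retract_isomorphic:
  "\<lbrakk>indecomposable C X; \<not> zero_object C A; retract A X\<rbrakk> \<Longrightarrow> isomorphic C A X"
  using indecomposable_retract unfolding retract_def isomorphic_def by blast

text \<open>An idempotent of End(X) splits through some Y, a direct summand of X; so Y is zero or
  isomorphic to X, and the idempotent is 0 or 1.\<close>

lemma indecomposable_local:
  assumes X: "indecomposable C X" and f: "f \<in> Mor C X X"
  shows "is_iso C X X f \<or> is_iso C X X (Idm C X \<ominus>\<^bsub>Hom C X X\<^esub> f)"
proof -
  have XO: "X \<in> Ob C" using X by (simp add: indecomposable_def)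
  interpret A: complete_local_algebra R "End_ring X" maxid by (rule End_algebra[OF XO])
  have "f \<in> Units (End_ring X) \<or> \<one>\<^bsub>End_ring X\<^esub> \<ominus>\<^bsub>End_ring X\<^esub> f \<in> Units (End_ring X)"
  proof (rule A.local_of_trivial_idempotents)
    fix e assume "e \<in> carrier (End_ring X)" "e \<otimes>\<^bsub>End_ring X\<^esub> e = e"
    then have e: "e \<in> Mor C X X" "Cmp C X X X e e = e" by simp_all
    then obtain Y r s where Y: "Y \<in> Ob C" "r \<in> Mor C X Y" "s \<in> Mor C Y X" "Cmp C X Y X s r = e" "Cmp C Y X Y r s = Idm C Y"
      using idempotent_complete XO unfolding idempotent_complete_def by blast
    show "e = \<zero>\<^bsub>End_ring X\<^esub> \<or> e = \<one>\<^bsub>End_ring X\<^esub>"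
    proof (cases "zero_object C Y")
      case True
      then have "r = zmor C X Y" using zero_object_iff[of Y] XO Y by blast
      then show ?thesis using Y XO by auto
    next
      case False
      then have "is_iso C Y X s" using indecomposable_retract[OF X Y(1) False Y(3,2,5)] by blast
      then obtain t where t: "t \<in> Mor C X Y" "Cmp C X Y X s t = Idm C X" unfolding is_iso_def by blast
      have "Cmp C X X X e (Cmp C X Y X s t) = Cmp C X Y X (Cmp C Y Y X s (Cmp C Y X Y r s)) t"
        unfolding Y(4)[symmetric] using Y(1-3) XO t(1) by (simp add: Cmp_assoc)
      then have "e = Idm C X" unfolding t(2) Y(5) using Y XO t e by simp
      then show ?thesis by simp
    qed
  qed (use f in simp)
  then show ?thesis by (simp add: Units_End)
qed

text \<open>Being outside the radical gives g with 1 - g h not invertible on X. Then 1 - h g is not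
  invertible on Z either, and since End(Z) is local, h g is.\<close>

lemma nonradical_to_indecomposable:
  assumes Z: "indecomposable C Z" and X: "X \<in> Ob C" and h: "h \<in> Mor C X Z" "h \<notin> jacobson_radical C X Z"
  shows "\<exists>s\<in>Mor C Z X. Cmp C Z X Z h s = Idm C Z"
proof -
  have ZO: "Z \<in> Ob C" using Z by (simp add: indecomposable_def)
  obtain g where g: "g \<in> Mor C Z X" "\<not> is_iso C X X (Idm C X \<ominus>\<^bsub>Hom C X X\<^esub> Cmp C X Z X g h)"
    using h unfolding jacobson_radical_def by blast
  then have "\<not> is_iso C Z Z (Idm C Z \<ominus>\<^bsub>Hom C Z Z\<^esub> Cmp C Z X Z h g)"
    using is_iso_one_minus_swap[OF ZO X g(1) h(1)] by blast
  then have "is_iso C Z Z (Cmp C Z X Z h g)" using indecomposable_local[OF Z, of "Cmp C Z X Z h g"] g(1) h(1) X ZO by auto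
  then obtain u where "u \<in> Mor C Z Z" "Cmp C Z Z Z (Cmp C Z X Z h g) u = Idm C Z" unfolding is_iso_def by blast
  then show ?thesis using g(1) h(1) X ZO by (intro bexI[of _ "Cmp C Z Z X g u"]) (simp_all add: Cmp_assoc)
qed

lemma nonradical_from_indecomposable:
  assumes X: "indecomposable C X" and Y: "Y \<in> Ob C" and h: "h \<in> Mor C X Y" "h \<notin> jacobson_radical C X Y"
  shows "\<exists>r\<in>Mor C Y X. Cmp C X Y X r h = Idm C X"
proof -
  have XO: "X \<in> Ob C" using X by (simp add: indecomposable_def)
  obtain g where g: "g \<in> Mor C Y X" "\<not> is_iso C X X (Idm C X \<ominus>\<^bsub>Hom C X X\<^esub> Cmp C X Y X g h)"
    using h unfolding jacobson_radical_def by blast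
  then have "is_iso C X X (Cmp C X Y X g h)" using indecomposable_local[OF X, of "Cmp C X Y X g h"] h(1) Y XO by auto
  then obtain u where "u \<in> Mor C X X" "Cmp C X X X u (Cmp C X Y X g h) = Idm C X" unfolding is_iso_def by blast
  then show ?thesis using g(1) h(1) Y XO by (intro bexI[of _ "Cmp C Y X X u g"]) (simp_all add: Cmp_assoc)
qed

lemma Idm_not_radical:
  assumes "X \<in> Ob C" "\<not> zero_object C X" shows "Idm C X \<notin> jacobson_radical C X X"
proof
  assume "Idm C X \<in> jacobson_radical C X X"
  then have "is_iso C X X (Idm C X \<ominus>\<^bsub>Hom C X X\<^esub> Cmp C X X X (Idm C X) (Idm C X))"
    using assms unfolding jacobson_radical_def by blast
  then have "is_iso C X X (zmor C X X)" using assms by simp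
  then obtain u where "u \<in> Mor C X X" "Cmp C X X X u (zmor C X X) = Idm C X" unfolding is_iso_def by blast
  then show False using assms not_zero_object_Idm[of X] by simp
qed

lemma maxid_smult_radical:
  assumes X: "X \<in> Ob C" and Y: "Y \<in> Ob C" and r: "r \<in> maxid" and f: "f \<in> Mor C X Y"
  shows "r \<odot>\<^bsub>Hom C X Y\<^esub> f \<in> jacobson_radical C X Y"
  unfolding jacobson_radical_def
proof (intro CollectI conjI ballI)
  interpret A: complete_local_algebra R "End_ring X" maxid by (rule End_algebra[OF X])
  have rc: "r \<in> carrier R" using r A.m_carrier by blast
  show "r \<odot>\<^bsub>Hom C X Y\<^esub> f \<in> Mor C X Y" using rc X Y f by simp
  fix g assume g: "g \<in> Mor C Y X"
  have "r \<odot>\<^bsub>End_ring X\<^esub> Cmp C X Y X g f \<in> A.F 1"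
    using A.F_smult[OF r, of _ 0] A.F_0 g f X Y by simp
  then have "\<one>\<^bsub>End_ring X\<^esub> \<ominus>\<^bsub>End_ring X\<^esub> (r \<odot>\<^bsub>End_ring X\<^esub> Cmp C X Y X g f) \<in> Units (End_ring X)"
    by (rule A.one_minus_F1)
  then show "is_iso C X X (Idm C X \<ominus>\<^bsub>Hom C X X\<^esub> Cmp C X Y X g (r \<odot>\<^bsub>Hom C X Y\<^esub> f))"
    using rc X Y f g by (simp add: Units_End Cmp_smult_right)
qed

text \<open>This is m Hom(T, X), given as the intersection of all submodules that contain the
  products r g. In this form functoriality in X and properness by Nakayama are immediate.\<close>

definition hom_max :: "'o \<Rightarrow> 'o \<Rightarrow> 'm set"
  where "hom_max T X = {f \<in> Mor C T X. \<forall>N. submodule N R (Hom C T X) \<longrightarrow>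
    (\<forall>r\<in>maxid. \<forall>g\<in>Mor C T X. r \<odot>\<^bsub>Hom C T X\<^esub> g \<in> N) \<longrightarrow> f \<in> N}"

lemma submodule_hom_max:
  assumes "T \<in> Ob C" "X \<in> Ob C" shows "submodule (hom_max T X) R (Hom C T X)"
proof -
  interpret H: module R "Hom C T X" using assms by (rule Hom_module)
  show ?thesis unfolding H.submodule_iff hom_max_def
    using H.sm_zero H.sm_add H.sm_smult by auto
qed

lemma hom_max_smult:
  "\<lbrakk>T \<in> Ob C; X \<in> Ob C; r \<in> maxid; g \<in> Mor C T X\<rbrakk> \<Longrightarrow> r \<odot>\<^bsub>Hom C T X\<^esub> g \<in> hom_max T X"
  unfolding hom_max_def using maxid(1) ideal.Icarr by fastforce

lemma hom_max_postcomp: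
  assumes T: "T \<in> Ob C" and X: "X \<in> Ob C" and Y: "Y \<in> Ob C" and s: "s \<in> Mor C X Y" and f: "f \<in> hom_max T X"
  shows "Cmp C T X Y s f \<in> hom_max T Y"
proof -
  have fc: "f \<in> Mor C T X" using f by (simp add: hom_max_def)
  have mc: "r \<in> carrier R" if "r \<in> maxid" for r using maxid(1) that ideal.Icarr by metis
  have "submodule {f \<in> Mor C T X. Cmp C T X Y s f \<in> hom_max T Y} R (Hom C T X)"
    using submodule_preimage[OF Hom_module[OF T X] Hom_module[OF T Y] linear_postcomp[OF T X Y s] submodule_hom_max[OF T Y]] .
  moreover have "\<forall>r\<in>maxid. \<forall>g\<in>Mor C T X. r \<odot>\<^bsub>Hom C T X\<^esub> g \<in> {f \<in> Mor C T X. Cmp C T X Y s f \<in> hom_max T Y}"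
    using hom_max_smult[OF T Y] mc T X Y s by (simp add: Cmp_smult_right)
  ultimately show ?thesis using f unfolding hom_max_def[of T X] by blast
qed

lemma hom_max_proper:
  assumes T: "T \<in> Ob C" and X: "X \<in> Ob C" and n: "Mor C T X \<noteq> {zmor C T X}"
  shows "hom_max T X \<noteq> Mor C T X"
proof -
  interpret H: local_noetherian_module R "Hom C T X" maxid using T X by (rule local_noetherian_hom)
  have "{zmor C T X} \<subset> Mor C T X" using n T X by auto
  then obtain N where N: "submodule N R (Hom C T X)" "N \<subset> Mor C T X"
    "\<And>r x. \<lbrakk>r \<in> maxid; x \<in> Mor C T X\<rbrakk> \<Longrightarrow> r \<odot>\<^bsub>Hom C T X\<^esub> x \<in> N"
    using H.nakayama[OF H.submodule_zero H.submodule_carrier] by metis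
  then have "hom_max T X \<subseteq> N" unfolding hom_max_def by blast
  then show ?thesis using N by blast
qed

lemma hom_max_finite:
  assumes T: "T \<in> Ob C" and X: "X \<in> Ob C"
  shows "mlen R (Hom C T X) (hom_max T X) (Mor C T X) \<noteq> \<infinity>"
proof -
  interpret H: local_noetherian_module R "Hom C T X" maxid using T X by (rule local_noetherian_hom)
  show ?thesis
  proof (rule H.nilpotent_mlen_finite[OF submodule_hom_max[OF T X] H.submodule_carrier])
    show "hom_max T X \<subseteq> Mor C T X" by (auto simp: hom_max_def)
    fix r assume "r \<in> maxid"
    then have "\<forall>x\<in>Mor C T X. (r [^]\<^bsub>R\<^esub> (1::nat)) \<odot>\<^bsub>Hom C T X\<^esub> x \<in> hom_max T X"
      using hom_max_smult[OF T X] H.m_carrier by simp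
    then show "\<exists>k::nat. \<forall>x\<in>Mor C T X. (r [^]\<^bsub>R\<^esub> k) \<odot>\<^bsub>Hom C T X\<^esub> x \<in> hom_max T X" by blast
  qed
qed

text \<open>Induction over the direct summands X of the fixed object T, measured by the length of
  Hom(T, X) / m Hom(T, X). It is finite, additive and, by Nakayama, nonzero on nonzero summands, so
  both parts of a proper decomposition are smaller.\<close>

lemma krull_schmidt_induct [consumes 1, case_names zero indecomposable sum]:
  assumes T: "T \<in> Ob C"
    and zero: "\<And>X. zero_object C X \<Longrightarrow> P X"
    and indec: "\<And>X. indecomposable C X \<Longrightarrow> P X"
    and sum: "\<And>A B X. \<lbrakk>direct_sum C [A, B] X; P A; P B\<rbrakk> \<Longrightarrow> P X"
  shows "P T"
proof -
  define L where "L X = mlen R (Hom C T X) (hom_max T X) (Mor C T X)" for X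
  have "P X" if "retract X T" "L X = enat n" for X n
    using that
  proof (induction n arbitrary: X rule: less_induct)
    case (less n)
    have X: "X \<in> Ob C" using less.prems by (simp add: retract_def)
    show ?case
    proof (cases "zero_object C X \<or> indecomposable C X")
      case True
      then show ?thesis using zero indec by blast
    next
      case False
      then obtain A B where ds: "direct_sum C [A, B] X" and nz: "\<not> zero_object C A" "\<not> zero_object C B"
        using X unfolding indecomposable_def by blast
      then obtain i1 i2 p1 p2 where b: "biproduct A B X i1 i2 p1 p2" using direct_sum_pair_iff by blast
      have ret: "retract A T" "retract B T" using biproduct_retract[OF b] less.prems(1) retract_trans by blast+
      have pos: "L D \<noteq> 0" if D: "retract D T" "\<not> zero_object C D" for D
      proof -
        obtain s r where sr: "D \<in> Ob C" "s \<in> Mor C D T" "r \<in> Mor C T D" "Cmp C D T D r s = Idm C D"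
          using D unfolding retract_def by blast
        have "r \<noteq> zmor C T D" using sr T not_zero_object_Idm[OF sr(1) D(2)] by auto
        then have "hom_max T D \<noteq> Mor C T D" using sr by (intro hom_max_proper[OF T]) auto
        then show ?thesis unfolding L_def
          using module.mlen_eq_0_iff[OF Hom_module[OF T sr(1)] submodule_hom_max[OF T sr(1)]
              module.submodule_carrier[OF Hom_module[OF T sr(1)]]] by (auto simp: hom_max_def)
      qed
      have sumL: "L X = L A + L B"
        unfolding L_def using additive_mlen[OF T submodule_hom_max[OF T] hom_max_postcomp[OF T] ds] by simp
      have fin: "L D \<noteq> \<infinity>" if "D \<in> Ob C" for D unfolding L_def using hom_max_finite[OF T that] .
      have AB: "A \<in> Ob C" "B \<in> Ob C" using b by (auto simp: biproduct_def)
      then obtain a b where ab: "L A = enat a" "L B = enat b" using fin by (metis enat.exhaust)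
      then have "a + b = n" "a \<noteq> 0" "b \<noteq> 0"
        using sumL less.prems(2) pos[OF ret(1) nz(1)] pos[OF ret(2) nz(2)] by (auto simp: zero_enat_def)
      then have "a < n" "b < n" by auto
      then show ?thesis using sum[OF ds] less.IH ret ab by blast
    qed
  qed
  moreover obtain n where "L T = enat n" using hom_max_finite[OF T T] unfolding L_def by (metis enat.exhaust)
  ultimately show ?thesis using retract_refl[OF T] by blast
qed

lemma krull_schmidt_exists:
  assumes "X \<in> Ob C"
  shows "\<exists>Xs. (\<forall>Y\<in>set Xs. indecomposable C Y) \<and> direct_sum C Xs X"
  using assms
proof (induction X rule: krull_schmidt_induct)
  case (zero X)
  then show ?case using direct_sum_empty by (intro exI[of _ "[]"]) simp
next
  case (indecomposable X)
  then have "X \<in> Ob C" by (simp add: indecomposable_def)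
  then show ?case using direct_sum_single[of X X] isomorphic_refl indecomposable by (intro exI[of _ "[X]"]) simp
next
  case (sum A B X)
  then obtain As Bs where "\<forall>Y\<in>set As. indecomposable C Y" "direct_sum C As A"
    "\<forall>Y\<in>set Bs. indecomposable C Y" "direct_sum C Bs B" by blast
  then show ?case using direct_sum_append sum(1) by (intro exI[of _ "As @ Bs"]) auto
qed

lemma additive_mlen_isomorphic:
  assumes U: "U \<in> Ob C"
    and D: "\<And>X. X \<in> Ob C \<Longrightarrow> submodule (D X) R (Hom C U X)"
    and nat: "\<And>X Y s f. \<lbrakk>X \<in> Ob C; Y \<in> Ob C; s \<in> Mor C X Y; f \<in> D X\<rbrakk> \<Longrightarrow> Cmp C U X Y s f \<in> D Y"
    and "X \<in> Ob C" "Y \<in> Ob C" "isomorphic C X Y"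
  shows "mlen R (Hom C U X) (D X) (Mor C U X) = mlen R (Hom C U Y) (D Y) (Mor C U Y)"
  using additive_mlen[OF U D nat direct_sum_single[of Y X]] assms(4-6) by simp

text \<open>Counts multiplicities: for indecomposable W it equals \<open>rad_len W W\<close> times
  the number of summands of X isomorphic to W.\<close>

definition rad_len :: "'o \<Rightarrow> 'o \<Rightarrow> enat"
  where "rad_len W X = mlen R (Hom C W X) (jacobson_radical C W X) (Mor C W X)"

lemma rad_len_sum:
  assumes "W \<in> Ob C" "direct_sum C Xs X"
  shows "rad_len W X = (\<Sum>Y\<leftarrow>Xs. rad_len W Y)"
  unfolding rad_len_def
  using additive_mlen[OF assms(1) submodule_jacobson[OF assms(1)] jacobson_postcomp[OF assms(1)] assms(2)] by blast

lemma rad_len_indecomposable: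
  assumes W: "indecomposable C W" and Y: "indecomposable C Y"
  shows "rad_len W Y = (if iso_class C Y = iso_class C W then rad_len W W else 0)"
proof -
  have O: "W \<in> Ob C" "Y \<in> Ob C" using W Y by (auto simp: indecomposable_def)
  show ?thesis
  proof (cases "isomorphic C Y W")
    case True
    have "rad_len W Y = rad_len W W" unfolding rad_len_def
      using additive_mlen_isomorphic[OF O(1) submodule_jacobson[OF O(1)] jacobson_postcomp[OF O(1)] O(2) O(1) True] by blast
    then show ?thesis using True O iso_class_eq by simp
  next
    case False
    have "jacobson_radical C W Y = Mor C W Y"
    proof (rule ccontr)
      assume "jacobson_radical C W Y \<noteq> Mor C W Y"
      then obtain h where "h \<in> Mor C W Y" "h \<notin> jacobson_radical C W Y" using jacobson_closed by blast
      then have "retract W Y" using nonradical_from_indecomposable[OF W O(2)] O unfolding retract_def by blast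
      then have "isomorphic C W Y" using indecomposable_retract_isomorphic[OF Y] W by (simp add: indecomposable_def)
      then show False using False isomorphic_sym by blast
    qed
    then have "rad_len W Y = 0" unfolding rad_len_def using module.mlen_refl[OF Hom_module[OF O]] by simp
    then show ?thesis using False iso_class_eq_iff O by auto
  qed
qed

lemma rad_len_self:
  assumes W: "indecomposable C W" shows "rad_len W W \<noteq> 0" "rad_len W W \<noteq> \<infinity>"
proof -
  have O: "W \<in> Ob C" "\<not> zero_object C W" using W by (auto simp: indecomposable_def)
  interpret H: local_noetherian_module R "Hom C W W" maxid using O(1,1) by (rule local_noetherian_hom)
  have sub: "jacobson_radical C W W \<subseteq> Mor C W W" using jacobson_closed by blast
  have "jacobson_radical C W W \<noteq> Mor C W W" using Idm_not_radical[OF O] Idm_closed[OF O(1)] by metis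
  then show "rad_len W W \<noteq> 0" unfolding rad_len_def
    using H.mlen_eq_0_iff[OF submodule_jacobson[OF O(1,1)] H.submodule_carrier sub] by simp
  show "rad_len W W \<noteq> \<infinity>" unfolding rad_len_def
  proof (rule H.nilpotent_mlen_finite[OF submodule_jacobson[OF O(1,1)] H.submodule_carrier sub])
    fix r assume "r \<in> maxid"
    then have "\<forall>x\<in>Mor C W W. (r [^]\<^bsub>R\<^esub> (1::nat)) \<odot>\<^bsub>Hom C W W\<^esub> x \<in> jacobson_radical C W W"
      using maxid_smult_radical[OF O(1,1)] H.m_carrier by simp
    then show "\<exists>k::nat. \<forall>x\<in>Mor C W W. (r [^]\<^bsub>R\<^esub> k) \<odot>\<^bsub>Hom C W W\<^esub> x \<in> jacobson_radical C W W" by blast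
  qed
qed

lemma rad_len_count:
  assumes W: "indecomposable C W" and Xs: "\<forall>Y\<in>set Xs. indecomposable C Y" and ds: "direct_sum C Xs X"
  shows "rad_len W X = enat (length (filter (\<lambda>Y. iso_class C Y = iso_class C W) Xs)) * rad_len W W"
proof -
  have "(\<Sum>Y\<leftarrow>Xs. rad_len W Y) = enat (length (filter (\<lambda>Y. iso_class C Y = iso_class C W) Xs)) * rad_len W W"
    using Xs
  proof (induction Xs)
    case Nil
    then show ?case by (simp add: zero_enat_def[symmetric])
  next
    case (Cons Y Xs)
    then show ?case using rad_len_indecomposable[OF W, of Y]
      by (auto simp: eSuc_enat[symmetric] distrib_right eSuc_plus_1 add.commute)
  qed
  then show ?thesis using rad_len_sum[OF _ ds] W by (simp add: indecomposable_def)
qed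

lemma lookup_class_sum:
  "Poly_Mapping.lookup (\<Sum>Y\<leftarrow>Xs. frag_of (iso_class C Y)) c = int (length (filter (\<lambda>Y. iso_class C Y = c) Xs))"
  by (induction Xs) (auto simp: lookup_add)

text \<open>The multiplicity of each W is recovered from \<open>rad_len W X\<close>, because
  \<open>rad_len W W\<close> is finite and nonzero. This justifies the definite description in
  \<open>K0_class\<close>.\<close>

lemma krull_schmidt_unique:
  assumes Xs: "\<forall>Y\<in>set Xs. indecomposable C Y" "direct_sum C Xs X"
    and Ys: "\<forall>Y\<in>set Ys. indecomposable C Y" "direct_sum C Ys X"
  shows "(\<Sum>Y\<leftarrow>Xs. frag_of (iso_class C Y)) = (\<Sum>Y\<leftarrow>Ys. frag_of (iso_class C Y))"
proof (rule poly_mapping_eqI)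
  fix c
  show "Poly_Mapping.lookup (\<Sum>Y\<leftarrow>Xs. frag_of (iso_class C Y)) c = Poly_Mapping.lookup (\<Sum>Y\<leftarrow>Ys. frag_of (iso_class C Y)) c"
  proof (cases "\<exists>W. indecomposable C W \<and> c = iso_class C W")
    case True
    then obtain W where W: "indecomposable C W" "c = iso_class C W" by blast
    obtain d where d: "rad_len W W = enat d" "d \<noteq> 0"
      using rad_len_self[OF W(1)] by (metis enat.exhaust zero_enat_def)
    have "enat (length (filter (\<lambda>Y. iso_class C Y = c) Xs)) * enat d = enat (length (filter (\<lambda>Y. iso_class C Y = c) Ys)) * enat d"
      using rad_len_count[OF W(1) Xs] rad_len_count[OF W(1) Ys] d W(2) by simp
    then show ?thesis using d by (simp add: lookup_class_sum)
  next
    case False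
    then have "filter (\<lambda>Y. iso_class C Y = c) Xs = []" "filter (\<lambda>Y. iso_class C Y = c) Ys = []"
      using Xs Ys by (auto simp: filter_empty_conv)
    then show ?thesis by (simp add: lookup_class_sum)
  qed
qed

lemma K0_class_eq:
  assumes "\<forall>Y\<in>set Xs. indecomposable C Y" "direct_sum C Xs X"
  shows "K0_class C X = (\<Sum>Y\<leftarrow>Xs. frag_of (iso_class C Y))"
  unfolding K0_class_def
proof (rule the_equality)
  show "\<exists>Ys. (\<forall>Y\<in>set Ys. indecomposable C Y) \<and> direct_sum C Ys X \<and>
      (\<Sum>Y\<leftarrow>Xs. frag_of (iso_class C Y)) = (\<Sum>Y\<leftarrow>Ys. frag_of (iso_class C Y))"
    using assms by blast
qed (use krull_schmidt_unique assms in blast)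

end

section \<open>Long exact sequences\<close>

context exact_category
begin

lemma conflation_mono:
  assumes c: "conflation E X f Y g Z" and "W \<in> Ob E" "u \<in> Mor E W X" "v \<in> Mor E W X"
    and "Cmp E W X Y f u = Cmp E W X Y f v"
  shows "u = v"
proof -
  have o: "X \<in> Ob E" "Y \<in> Ob E" "Z \<in> Ob E" "f \<in> Mor E X Y" "g \<in> Mor E Y Z"
    using conflation_objects[OF c] conflation_morphisms[OF c] by auto
  have "Cmp E X Y Z g f = zmor E X Z" using conflation_kernel[OF c] by (simp add: is_kernel_def)
  then have "Cmp E W Y Z g (Cmp E W X Y f v) = zmor E W Z" using o assms(2-4) by (simp add: Cmp_assoc)
  then have "\<exists>!w. w \<in> Mor E W X \<and> Cmp E W X Y f w = Cmp E W X Y f v"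
    using conflation_kernel[OF c] o assms(2-4) unfolding is_kernel_def by simp
  then show ?thesis using assms(3-5) by blast
qed

lemma conflation_epi:
  assumes c: "conflation E X f Y g Z" and "W \<in> Ob E" "u \<in> Mor E Z W" "v \<in> Mor E Z W"
    and "Cmp E Y Z W u g = Cmp E Y Z W v g"
  shows "u = v"
proof -
  have o: "X \<in> Ob E" "Y \<in> Ob E" "Z \<in> Ob E" "f \<in> Mor E X Y" "g \<in> Mor E Y Z"
    using conflation_objects[OF c] conflation_morphisms[OF c] by auto
  have "Cmp E X Y Z g f = zmor E X Z" using conflation_kernel[OF c] by (simp add: is_kernel_def)
  then have "Cmp E X Y W (Cmp E Y Z W v g) f = zmor E X W" using o assms(2-4) by (simp add: Cmp_assoc[symmetric])
  then have "\<exists>!w. w \<in> Mor E Z W \<and> Cmp E Y Z W w g = Cmp E Y Z W v g"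
    using conflation_cokernel[OF c] o assms(2-4) unfolding is_cokernel_def by simp
  then show ?thesis using assms(3-5) by blast
qed

lemma conflation_zero: "conflation E X f Y g Z \<Longrightarrow> Cmp E X Y Z g f = zmor E X Z"
  using conflation_kernel by (simp add: is_kernel_def)

lemma conflation_lift:
  "\<lbrakk>conflation E X f Y g Z; W \<in> Ob E; h \<in> Mor E W Y; Cmp E W Y Z g h = zmor E W Z\<rbrakk>
    \<Longrightarrow> \<exists>u\<in>Mor E W X. Cmp E W X Y f u = h"
  using conflation_kernel unfolding is_kernel_def by blast

lemma conflation_extend:
  "\<lbrakk>conflation E X f Y g Z; W \<in> Ob E; h \<in> Mor E Y W; Cmp E X Y W h f = zmor E X W\<rbrakk>
    \<Longrightarrow> \<exists>u\<in>Mor E Z W. Cmp E Y Z W u g = h"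
  using conflation_cokernel unfolding is_cokernel_def by blast

lemma projective_lift:
  "\<lbrakk>projective E Q; conflation E X f Y g Z; h \<in> Mor E Q Z\<rbrakk> \<Longrightarrow> \<exists>u\<in>Mor E Q Y. Cmp E Q Y Z g u = h"
  unfolding projective_def deflation_def by blast

text \<open>For a conflation 0 \<rightarrow> U \<rightarrow> Q \<rightarrow> V \<rightarrow> 0 with
  Q projective, Hom(U, X) modulo these maps is Ext^1(V, X), so no separate construction of Ext is
  made.\<close>

definition ext_rel :: "'o \<Rightarrow> 'm \<Rightarrow> 'o \<Rightarrow> 'o \<Rightarrow> 'm set"
  where "ext_rel U i Q X = (\<lambda>b. Cmp E U Q X b i) ` Mor E Q X"

text \<open>For a deflation g, Hom(W, Z) modulo these maps is the value at W of the effaceable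
  functor presented by g.\<close>

definition image_of :: "'o \<Rightarrow> 'm \<Rightarrow> 'o \<Rightarrow> 'o \<Rightarrow> 'm set"
  where "image_of Y g Z W = Cmp E W Y Z g ` Mor E W Y"

lemma submodule_ext_rel:
  assumes "U \<in> Ob E" "Q \<in> Ob E" "i \<in> Mor E U Q" "X \<in> Ob E"
  shows "submodule (ext_rel U i Q X) R (Hom E U X)"
  unfolding ext_rel_def
  using submodule_image[OF Hom_module Hom_module linear_precomp module.submodule_carrier[OF Hom_module]] assms by blast

lemma submodule_image_of:
  assumes "W \<in> Ob E" "Y \<in> Ob E" "Z \<in> Ob E" "g \<in> Mor E Y Z"
  shows "submodule (image_of Y g Z W) R (Hom E W Z)"
  unfolding image_of_def
  using submodule_image[OF Hom_module Hom_module linear_postcomp module.submodule_carrier[OF Hom_module]] assms by blast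

lemma ext_rel_postcomp:
  assumes U: "U \<in> Ob E" "Q \<in> Ob E" "i \<in> Mor E U Q" and X: "X \<in> Ob E" "Y \<in> Ob E" "s \<in> Mor E X Y"
    and f: "f \<in> ext_rel U i Q X"
  shows "Cmp E U X Y s f \<in> ext_rel U i Q Y"
proof -
  obtain b where b: "b \<in> Mor E Q X" "f = Cmp E U Q X b i" using f unfolding ext_rel_def by blast
  then have "Cmp E U X Y s f = Cmp E U Q Y (Cmp E Q X Y s b) i" using U X by (simp add: Cmp_assoc)
  then show ?thesis unfolding ext_rel_def using b U X by (intro image_eqI) auto
qed

text \<open>If \<open>0 \<rightarrow> U \<rightarrow> Q \<rightarrow> V \<rightarrow> 0\<close> is a conflation with \<open>Q\<close> projective, this is the length of
  \<open>Ext\<^sup>1(V, X)\<close>.\<close>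

definition ext_len :: "'o \<Rightarrow> 'm \<Rightarrow> 'o \<Rightarrow> 'o \<Rightarrow> enat"
  where "ext_len U i Q X = mlen R (Hom E U X) (ext_rel U i Q X) (Mor E U X)"

definition coker_len :: "'o \<Rightarrow> 'm \<Rightarrow> 'o \<Rightarrow> 'o \<Rightarrow> enat"
  where "coker_len Y g Z W = mlen R (Hom E W Z) (image_of Y g Z W) (Mor E W Z)"

text \<open>The Euler characteristic of the long exact sequence of \<open>Ext(V, -)\<close>, which is cut off at
  \<open>Ext\<^sup>2(V, X) = Ext\<^sup>1(U, X)\<close>.\<close>

lemma ext_len_conflation:
  assumes Q: "projective E Q" and c: "conflation E U i Q p V" and d: "conflation E X f Y g Z"
  shows "ext_len U i Q X + ext_len U i Q Z = ext_len U i Q Y + coker_len Y g Z V + coker_len Y g Z U"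
proof -
  have O: "U \<in> Ob E" "Q \<in> Ob E" "V \<in> Ob E" "X \<in> Ob E" "Y \<in> Ob E" "Z \<in> Ob E"
    using conflation_objects[OF c] conflation_objects[OF d] by auto
  have M: "i \<in> Mor E U Q" "p \<in> Mor E Q V" "f \<in> Mor E X Y" "g \<in> Mor E Y Z"
    using conflation_morphisms[OF c] conflation_morphisms[OF d] by auto
  note pi = conflation_zero[OF c] and gf = conflation_zero[OF d]
  interpret UX: module R "Hom E U X" using O by (intro Hom_module)
  interpret UY: module R "Hom E U Y" using O by (intro Hom_module)
  interpret UZ: module R "Hom E U Z" using O by (intro Hom_module)
  interpret QY: module R "Hom E Q Y" using O by (intro Hom_module)
  interpret QZ: module R "Hom E Q Z" using O by (intro Hom_module)
  interpret VZ: module R "Hom E V Z" using O by (intro Hom_module)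
  define DX DY DZ where "DX = ext_rel U i Q X" and "DY = ext_rel U i Q Y" and "DZ = ext_rel U i Q Z"
  have sD: "submodule DX R (Hom E U X)" "submodule DY R (Hom E U Y)" "submodule DZ R (Hom E U Z)"
    unfolding DX_def DY_def DZ_def using submodule_ext_rel O M by blast+
  define GU GV where "GU = image_of Y g Z U" and "GV = image_of Y g Z V"
  have sG: "submodule GU R (Hom E U Z)" "submodule GV R (Hom E V Z)"
    unfolding GU_def GV_def using submodule_image_of O M by blast+
  define FA where "FA = Cmp E U X Y f ` Mor E U X"
  have sFA: "submodule FA R (Hom E U Y)" unfolding FA_def
    using submodule_image[OF Hom_module Hom_module linear_postcomp UX.submodule_carrier] O M by blast
  have lin_g: "linear_map R (Hom E U Y) (Hom E U Z) (Cmp E U Y Z g)"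
    "linear_map R (Hom E Q Y) (Hom E Q Z) (Cmp E Q Y Z g)" using linear_postcomp O M by blast+
  have lin_f: "linear_map R (Hom E U X) (Hom E U Y) (Cmp E U X Y f)" using linear_postcomp O M by blast
  have lin_i: "linear_map R (Hom E Q Y) (Hom E U Y) (\<lambda>b. Cmp E U Q Y b i)" using linear_precomp O M by blast
  have lin_p: "linear_map R (Hom E V Z) (Hom E Q Z) (\<lambda>b. Cmp E Q V Z b p)" using linear_precomp O M by blast
  have gD: "Cmp E U Y Z g ` DY = DZ"
  proof
    show "Cmp E U Y Z g ` DY \<subseteq> DZ" unfolding DY_def DZ_def using ext_rel_postcomp O M by blast
    show "DZ \<subseteq> Cmp E U Y Z g ` DY"
    proof
      fix z assume "z \<in> DZ"
      then obtain b where b: "b \<in> Mor E Q Z" "z = Cmp E U Q Z b i" unfolding DZ_def ext_rel_def by blast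
      obtain b' where b': "b' \<in> Mor E Q Y" "Cmp E Q Y Z g b' = b" using projective_lift[OF Q d b(1)] by blast
      then have "z = Cmp E U Y Z g (Cmp E U Q Y b' i)" using b O M by (auto simp: Cmp_assoc)
      then show "z \<in> Cmp E U Y Z g ` DY" unfolding DY_def ext_rel_def using b' by blast
    qed
  qed
  have gFA: "Cmp E U Y Z g y = zmor E U Z" if y: "y \<in> FA" for y
  proof -
    obtain a where a: "a \<in> Mor E U X" "y = Cmp E U X Y f a" using y unfolding FA_def by blast
    then have "Cmp E U Y Z g y = Cmp E U X Z (Cmp E X Y Z g f) a" using O M by (simp add: Cmp_assoc)
    then show ?thesis unfolding gf using a O by simp
  qed
  have kerFA: "y \<in> FA" if "y \<in> Mor E U Y" "Cmp E U Y Z g y = zmor E U Z" for y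
    using conflation_lift[OF d O(1) that] unfolding FA_def by blast
  \<comment> \<open>DZ \<subseteq> GU \<subseteq> Hom(U, Z) splits Ext^1(V, Z) into the image of
    Ext^1(V, Y) and a remainder of the length of M(U). Since g maps DY onto DZ and has kernel FA,
    \<open>?S\<close> is the preimage of DZ in Hom(U, Y).\<close>
  let ?S = "DY <+>\<^bsub>Hom E U Y\<^esub> FA"
  have sS: "submodule ?S R (Hom E U Y)" by (rule UY.submodule_msum[OF sD(2) sFA])
  have gS: "Cmp E U Y Z g ` ?S = DZ"
  proof
    show "DZ \<subseteq> Cmp E U Y Z g ` ?S" using gD UY.msum_upper1[OF sD(2) sFA] by blast
    show "Cmp E U Y Z g ` ?S \<subseteq> DZ"
    proof
      fix z assume "z \<in> Cmp E U Y Z g ` ?S"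
      then obtain y y' where y: "y \<in> DY" "y' \<in> FA" "z = Cmp E U Y Z g (y \<oplus>\<^bsub>Hom E U Y\<^esub> y')"
        by (auto simp: UY.mem_msum)
      then have yc: "y \<in> Mor E U Y" "y' \<in> Mor E U Y" using UY.sm_carrier sD sFA by auto
      then have "z = Cmp E U Y Z g y" using y gFA[OF y(2)] O M by (simp add: Cmp_add_right)
      then show "z \<in> DZ" using gD y by blast
    qed
  qed
  have sub: "DX \<subseteq> Mor E U X" "DY \<subseteq> Mor E U Y" "DZ \<subseteq> Mor E U Z" "FA \<subseteq> Mor E U Y" "GU \<subseteq> Mor E U Z" "GV \<subseteq> Mor E V Z"
    "?S \<subseteq> Mor E U Y"
    by (fact UX.sm_subset[OF sD(1)] UY.sm_subset[OF sD(2)] UZ.sm_subset[OF sD(3)] UY.sm_subset[OF sFA]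
        UZ.sm_subset[OF sG(1)] VZ.sm_subset[OF sG(2)] UY.sm_subset[OF sS])+
  have GUim: "GU = Cmp E U Y Z g ` Mor E U Y" by (simp add: GU_def image_of_def)
  have DZGU: "DZ \<subseteq> GU" using gD sub(2) GUim by blast
  have e1: "ext_len U i Q Z = mlen R (Hom E U Z) DZ GU + coker_len Y g Z U"
    unfolding ext_len_def coker_len_def DZ_def[symmetric] GU_def[symmetric]
    by (rule UZ.mlen_add[OF sD(3) sG(1) UZ.submodule_carrier DZGU sub(5)])
  have e2: "mlen R (Hom E U Z) DZ GU = mlen R (Hom E U Y) ?S (Mor E U Y)"
    unfolding gS[symmetric] GUim
  proof (rule mlen_image[OF Hom_module Hom_module lin_g(1) sS UY.submodule_carrier sub(7)])
    fix x assume "x \<in> Mor E U Y" "Cmp E U Y Z g x = zmor E U Z"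
    then show "x \<in> ?S" using kerFA UY.msum_upper2[OF sD(2) sFA] by blast
  qed (use O in auto)
  have e3: "ext_len U i Q Y = mlen R (Hom E U Y) DY ?S + mlen R (Hom E U Y) ?S (Mor E U Y)"
    unfolding ext_len_def DY_def[symmetric]
    by (rule UY.mlen_add[OF sD(2) sS UY.submodule_carrier UY.msum_upper1[OF sD(2) sFA] sub(7)])
  have e4: "mlen R (Hom E U Y) DY ?S = mlen R (Hom E U Y) (DY \<inter> FA) FA"
    by (rule UY.mlen_second_iso[OF sD(2) sFA, symmetric])
  let ?fDX = "Cmp E U X Y f ` DX"
  have sfDX: "submodule ?fDX R (Hom E U Y)"
    using submodule_image[OF Hom_module Hom_module lin_f sD(1)] O by blast
  have fDX: "?fDX \<subseteq> DY \<inter> FA"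
    using ext_rel_postcomp[OF O(1,2) M(1) O(4,5) M(3)] sub(1) unfolding DX_def DY_def FA_def by blast
  have sDF: "submodule (DY \<inter> FA) R (Hom E U Y)" by (rule UY.submodule_Int[OF sD(2) sFA])
  have e5: "ext_len U i Q X = mlen R (Hom E U Y) ?fDX FA"
    unfolding ext_len_def DX_def[symmetric] FA_def
  proof (rule mlen_image[OF Hom_module Hom_module lin_f sD(1) UX.submodule_carrier sub(1), symmetric])
    fix x assume x: "x \<in> Mor E U X" "Cmp E U X Y f x = zmor E U Y"
    then have "x = zmor E U X" using conflation_mono[OF d O(1) x(1), of "zmor E U X"] O M by simp
    then show "x \<in> DX" using UX.sm_zero[OF sD(1)] by simp
  qed (use O in auto)
  have e6: "mlen R (Hom E U Y) ?fDX FA = mlen R (Hom E U Y) ?fDX (DY \<inter> FA) + mlen R (Hom E U Y) (DY \<inter> FA) FA"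
    by (rule UY.mlen_add[OF sfDX sDF sFA fDX]) auto
  \<comment> \<open>As f is mono, Ext^1(V, X) has the length of FA modulo f DX, and (DY \<inter> FA)
    / f DX is the kernel of its map to Ext^1(V, Y). This kernel is matched with M(V) inside Hom(Q,
    Y): maps in K restrict along i to DY \<inter> FA, and composed with g they become exactly the
    maps Q \<rightarrow> Z that factor through p.\<close>
  define K where "K = {b \<in> Mor E Q Y. Cmp E U Q Y b i \<in> FA}"
  have sK: "submodule K R (Hom E Q Y)" unfolding K_def
    using submodule_preimage[OF Hom_module Hom_module lin_i sFA] O by blast
  define FQ where "FQ = Cmp E Q X Y f ` Mor E Q X"
  define PV where "PV = (\<lambda>b. Cmp E Q V Y b p) ` Mor E V Y"
  have sFQ: "submodule FQ R (Hom E Q Y)" unfolding FQ_def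
    using submodule_image[OF Hom_module Hom_module linear_postcomp module.submodule_carrier[OF Hom_module]] O M by blast
  have sPV: "submodule PV R (Hom E Q Y)" unfolding PV_def
    using submodule_image[OF Hom_module Hom_module linear_precomp module.submodule_carrier[OF Hom_module]] O M by blast
  define K0 where "K0 = FQ <+>\<^bsub>Hom E Q Y\<^esub> PV"
  have sK0: "submodule K0 R (Hom E Q Y)" unfolding K0_def by (rule QY.submodule_msum[OF sFQ sPV])
  have FQK: "Cmp E U Q Y b i \<in> ?fDX" if b: "b \<in> FQ" for b
  proof -
    obtain a where a: "a \<in> Mor E Q X" "b = Cmp E Q X Y f a" using b unfolding FQ_def by blast
    then have "Cmp E U Q Y b i = Cmp E U X Y f (Cmp E U Q X a i)" using O M by (simp add: Cmp_assoc)
    then show ?thesis using a unfolding DX_def ext_rel_def by blast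
  qed
  have PVK: "Cmp E U Q Y b i = zmor E U Y" if b: "b \<in> PV" for b
  proof -
    obtain a where a: "a \<in> Mor E V Y" "b = Cmp E Q V Y a p" using b unfolding PV_def by blast
    then have "Cmp E U Q Y b i = Cmp E U V Y a (Cmp E U Q V p i)" using O M by (simp add: Cmp_assoc)
    then show ?thesis unfolding pi using a O by simp
  qed
  have FQc: "b \<in> Mor E Q Y" if "b \<in> FQ" for b using QY.sm_carrier[OF sFQ that] .
  have PVc: "b \<in> Mor E Q Y" if "b \<in> PV" for b using QY.sm_carrier[OF sPV that] .
  have fDXFA: "?fDX \<subseteq> FA" using fDX by blast
  have K0i: "Cmp E U Q Y (a \<oplus>\<^bsub>Hom E Q Y\<^esub> b) i = Cmp E U Q Y a i" if "a \<in> FQ" "b \<in> PV" for a b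
    using that FQc PVc PVK O M by (simp add: Cmp_add_left)
  have K0K: "K0 \<subseteq> K"
  proof
    fix x assume "x \<in> K0"
    then obtain a b where ab: "a \<in> FQ" "b \<in> PV" "x = a \<oplus>\<^bsub>Hom E Q Y\<^esub> b" unfolding K0_def QY.mem_msum by blast
    then show "x \<in> K" unfolding K_def using K0i[OF ab(1,2)] FQK[OF ab(1)] fDXFA FQc PVc O by auto
  qed
  have iK: "(\<lambda>b. Cmp E U Q Y b i) ` K = DY \<inter> FA"
    unfolding K_def DY_def ext_rel_def by auto
  have iK0: "(\<lambda>b. Cmp E U Q Y b i) ` K0 = ?fDX"
  proof
    show "(\<lambda>b. Cmp E U Q Y b i) ` K0 \<subseteq> ?fDX"
    proof clarify
      fix x assume "x \<in> K0"
      then obtain a b where ab: "a \<in> FQ" "b \<in> PV" "x = a \<oplus>\<^bsub>Hom E Q Y\<^esub> b" unfolding K0_def QY.mem_msum by blast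
      then show "Cmp E U Q Y x i \<in> ?fDX" using K0i[OF ab(1,2)] FQK[OF ab(1)] by simp
    qed
    show "?fDX \<subseteq> (\<lambda>b. Cmp E U Q Y b i) ` K0"
    proof clarify
      fix a assume "a \<in> DX"
      then obtain b where b: "b \<in> Mor E Q X" "a = Cmp E U Q X b i" unfolding DX_def ext_rel_def by blast
      have "Cmp E Q X Y f b \<in> K0" using b(1) QY.msum_upper1[OF sFQ sPV] unfolding K0_def FQ_def by blast
      moreover have "Cmp E U X Y f a = Cmp E U Q Y (Cmp E Q X Y f b) i" using b O M by (simp add: Cmp_assoc)
      ultimately show "Cmp E U X Y f a \<in> (\<lambda>b. Cmp E U Q Y b i) ` K0" by blast
    qed
  qed
  have PVK0: "PV \<subseteq> K0" and FQK0: "FQ \<subseteq> K0" unfolding K0_def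
    using QY.msum_upper1[OF sFQ sPV] QY.msum_upper2[OF sFQ sPV] by blast+
  have e7: "mlen R (Hom E U Y) ?fDX (DY \<inter> FA) = mlen R (Hom E Q Y) K0 K"
    unfolding iK[symmetric] iK0[symmetric]
  proof (rule mlen_image[OF Hom_module Hom_module lin_i sK0 sK K0K])
    fix x assume x: "x \<in> K" "Cmp E U Q Y x i = zmor E U Y"
    then have "x \<in> PV" using conflation_extend[OF c O(5)] unfolding PV_def K_def by blast
    then show "x \<in> K0" using PVK0 by blast
  qed (use O in auto)
  let ?PZ = "\<lambda>S. (\<lambda>b. Cmp E Q V Z b p) ` S"
  have gK: "Cmp E Q Y Z g ` K = ?PZ (Mor E V Z)"
  proof
    show "Cmp E Q Y Z g ` K \<subseteq> ?PZ (Mor E V Z)"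
    proof clarify
      fix b assume "b \<in> K"
      then have b: "b \<in> Mor E Q Y" "Cmp E U Q Y b i \<in> FA" by (auto simp: K_def)
      have "Cmp E U Q Z (Cmp E Q Y Z g b) i = zmor E U Z" using gFA[OF b(2)] b(1) O M by (simp add: Cmp_assoc)
      then have "\<exists>c\<in>Mor E V Z. Cmp E Q V Z c p = Cmp E Q Y Z g b"
        using b O M by (intro conflation_extend[OF c]) auto
      then show "Cmp E Q Y Z g b \<in> ?PZ (Mor E V Z)" by (metis image_eqI)
    qed
    show "?PZ (Mor E V Z) \<subseteq> Cmp E Q Y Z g ` K"
    proof clarify
      fix h assume h: "h \<in> Mor E V Z"
      then obtain b where b: "b \<in> Mor E Q Y" "Cmp E Q Y Z g b = Cmp E Q V Z h p"
        using projective_lift[OF Q d, of "Cmp E Q V Z h p"] O M by auto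
      have "Cmp E U Y Z g (Cmp E U Q Y b i) = Cmp E U Q Z (Cmp E Q Y Z g b) i" using b(1) O M by (simp add: Cmp_assoc)
      also have "\<dots> = Cmp E U V Z h (Cmp E U Q V p i)" unfolding b(2) using h O M by (simp add: Cmp_assoc)
      also have "\<dots> = zmor E U Z" unfolding pi using h O by simp
      finally have "b \<in> K" unfolding K_def using kerFA b O M by simp
      then show "Cmp E Q V Z h p \<in> Cmp E Q Y Z g ` K" using b(2) by (metis image_eqI)
    qed
  qed
  have gFQ: "Cmp E Q Y Z g b = zmor E Q Z" if b: "b \<in> FQ" for b
  proof -
    obtain a where a: "a \<in> Mor E Q X" "b = Cmp E Q X Y f a" using b unfolding FQ_def by blast
    then have "Cmp E Q Y Z g b = Cmp E Q X Z (Cmp E X Y Z g f) a" using O M by (simp add: Cmp_assoc)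
    then show ?thesis unfolding gf using a O by simp
  qed
  have gK0: "Cmp E Q Y Z g ` K0 = ?PZ GV"
  proof
    have assoc: "Cmp E Q Y Z g (Cmp E Q V Y a p) = Cmp E Q V Z (Cmp E V Y Z g a) p" if "a \<in> Mor E V Y" for a
      using that O M by (simp add: Cmp_assoc)
    show "Cmp E Q Y Z g ` K0 \<subseteq> ?PZ GV"
    proof clarify
      fix x assume "x \<in> K0"
      then obtain a b where ab: "a \<in> FQ" "b \<in> PV" "x = a \<oplus>\<^bsub>Hom E Q Y\<^esub> b" unfolding K0_def QY.mem_msum by blast
      then have "Cmp E Q Y Z g x = Cmp E Q Y Z g b" using gFQ[OF ab(1)] FQc PVc O M by (simp add: Cmp_add_right)
      moreover obtain a' where "a' \<in> Mor E V Y" "b = Cmp E Q V Y a' p" using ab(2) unfolding PV_def by blast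
      ultimately show "Cmp E Q Y Z g x \<in> ?PZ GV" unfolding GV_def image_of_def using assoc by auto
    qed
    show "?PZ GV \<subseteq> Cmp E Q Y Z g ` K0"
    proof clarify
      fix h assume "h \<in> GV"
      then obtain a where a: "a \<in> Mor E V Y" "h = Cmp E V Y Z g a" unfolding GV_def image_of_def by blast
      have "Cmp E Q V Y a p \<in> K0" using PVK0 a(1) unfolding PV_def by blast
      then show "Cmp E Q V Z h p \<in> Cmp E Q Y Z g ` K0" using assoc[OF a(1)] a(2) by (metis image_eqI)
    qed
  qed
  have e8: "mlen R (Hom E Q Y) K0 K = mlen R (Hom E Q Z) (?PZ GV) (?PZ (Mor E V Z))"
    unfolding gK[symmetric] gK0[symmetric]
  proof (rule mlen_image[OF Hom_module Hom_module lin_g(2) sK0 sK K0K, symmetric])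
    fix x assume x: "x \<in> K" "Cmp E Q Y Z g x = zmor E Q Z"
    then have "x \<in> FQ" using conflation_lift[OF d O(2)] unfolding FQ_def K_def by blast
    then show "x \<in> K0" using FQK0 by blast
  qed (use O in auto)
  have e9: "mlen R (Hom E Q Z) (?PZ GV) (?PZ (Mor E V Z)) = coker_len Y g Z V"
    unfolding coker_len_def GV_def[symmetric]
  proof (rule mlen_image[OF Hom_module Hom_module lin_p sG(2) VZ.submodule_carrier sub(6)])
    fix x assume x: "x \<in> Mor E V Z" "Cmp E Q V Z x p = zmor E Q Z"
    then have "x = zmor E V Z" using conflation_epi[OF c O(6) x(1), of "zmor E V Z"] O M by simp
    then show "x \<in> GV" using VZ.sm_zero[OF sG(2)] by simp
  qed (use O in auto)
  show ?thesis
    unfolding e1 e2 e3 e4 e5 e6 e7 e8 e9 by (simp add: ac_simps)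
qed

lemma injective_ext_len:
  assumes c: "conflation E U i Q p V" and X: "injective E X"
  shows "ext_len U i Q X = 0"
proof -
  have O: "U \<in> Ob E" "Q \<in> Ob E" "X \<in> Ob E" "i \<in> Mor E U Q"
    using conflation_objects[OF c] conflation_morphisms[OF c] X by (auto simp: injective_def)
  have "inflation E U i Q" using c unfolding inflation_def by blast
  then have "\<exists>u\<in>Mor E Q X. Cmp E U Q X u i = h" if "h \<in> Mor E U X" for h
    using X that unfolding injective_def by blast
  then have "Mor E U X \<subseteq> ext_rel U i Q X" unfolding ext_rel_def by (metis image_eqI subsetI)
  moreover have "ext_rel U i Q X \<subseteq> Mor E U X" unfolding ext_rel_def using O by auto
  ultimately have "ext_rel U i Q X = Mor E U X" by blast
  then show ?thesis unfolding ext_len_def using module.mlen_refl[OF Hom_module[OF O(1,3)]] by simp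
qed

end

section \<open>AR conflations and Grothendieck groups\<close>

definition weigh :: "('a \<Rightarrow> rat) \<Rightarrow> ('a \<Rightarrow>\<^sub>0 rat) \<Rightarrow> rat"
  where "weigh w v = (\<Sum>c\<in>Poly_Mapping.keys v. Poly_Mapping.lookup v c * w c)"

lemma weigh_superset:
  "\<lbrakk>finite S; Poly_Mapping.keys v \<subseteq> S\<rbrakk> \<Longrightarrow> weigh w v = (\<Sum>c\<in>S. Poly_Mapping.lookup v c * w c)"
  unfolding weigh_def by (rule sum.mono_neutral_left) (auto simp: in_keys_iff)

lemma weigh_add: "weigh w (u + v) = weigh w u + weigh w v"
proof -
  let ?S = "Poly_Mapping.keys u \<union> Poly_Mapping.keys v"
  have "Poly_Mapping.keys (u + v) \<subseteq> ?S" by (rule Poly_Mapping.keys_add)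
  then show ?thesis
    using weigh_superset[of ?S u w] weigh_superset[of ?S v w] weigh_superset[of ?S "u + v" w]
    by (simp add: lookup_add distrib_right sum.distrib)
qed

lemma weigh_0: "weigh w 0 = 0"
  by (simp add: weigh_def)

lemma weigh_sum: "weigh w (\<Sum>a\<in>S. f a) = (\<Sum>a\<in>S. weigh w (f a))"
  by (induction S rule: infinite_finite_induct) (auto simp: weigh_add weigh_0)

lemma lookup_pure_tensor: "Poly_Mapping.lookup (pure_tensor a q) c = of_int (Poly_Mapping.lookup a c) * q"
  unfolding pure_tensor_def by (simp add: map.rep_eq when_def)

definition iweigh :: "('a \<Rightarrow> rat) \<Rightarrow> ('a \<Rightarrow>\<^sub>0 int) \<Rightarrow> rat"
  where "iweigh w a = weigh w (pure_tensor a 1)"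

lemma iweigh_add: "iweigh w (a + b) = iweigh w a + iweigh w b"
proof -
  have "pure_tensor (a + b) 1 = pure_tensor a 1 + pure_tensor b 1"
    by (rule poly_mapping_eqI) (simp add: lookup_pure_tensor lookup_add)
  then show ?thesis by (simp add: iweigh_def weigh_add)
qed

lemma iweigh_0: "iweigh w 0 = 0"
  using iweigh_add[of w 0 0] by simp

lemma iweigh_uminus: "iweigh w (- a) = - iweigh w a"
  using iweigh_add[of w a "- a"] iweigh_0[of w] by simp

lemma iweigh_diff: "iweigh w (a - b) = iweigh w a - iweigh w b"
  using iweigh_add[of w a "- b"] by (simp add: iweigh_uminus)

lemma iweigh_frag_of: "iweigh w (frag_of c) = w c"
proof -
  have "Poly_Mapping.keys (pure_tensor (frag_of c) 1) \<subseteq> {c}"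
    by (auto simp: in_keys_iff lookup_pure_tensor lookup_frag_of split: if_splits)
  then show ?thesis unfolding iweigh_def by (subst weigh_superset[of "{c}"]) (auto simp: lookup_pure_tensor)
qed

lemma iweigh_sum_list: "iweigh w (\<Sum>Y\<leftarrow>Ys. frag_of (f Y)) = (\<Sum>Y\<leftarrow>Ys. w (f Y))"
  by (induction Ys) (auto simp: iweigh_0 iweigh_add iweigh_frag_of)

lemma weigh_pure_tensor: "weigh w (pure_tensor a q) = q * iweigh w a"
proof -
  have "Poly_Mapping.keys (pure_tensor a r) \<subseteq> Poly_Mapping.keys a" for r
    by (auto simp: in_keys_iff lookup_pure_tensor)
  then show ?thesis unfolding iweigh_def
    using weigh_superset[of "Poly_Mapping.keys a" "pure_tensor a q" w]
      weigh_superset[of "Poly_Mapping.keys a" "pure_tensor a 1" w]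
    by (simp add: lookup_pure_tensor sum_distrib_left ac_simps)
qed

text \<open>All that is remembered of an expression of a by generators is a finite set T of them:
  every functional that vanishes on T vanishes at a.\<close>

lemma generate_iweigh:
  assumes "a \<in> generate (free_Abelian_group S) H" and H: "\<And>h. h \<in> H \<Longrightarrow> Poly_Mapping.keys h \<subseteq> S"
  shows "\<exists>T. finite T \<and> T \<subseteq> H \<and> (\<forall>w. (\<forall>h\<in>T. iweigh w h = 0) \<longrightarrow> iweigh w a = 0)"
  using assms(1)
proof (induction a rule: generate.induct)
  case one
  then show ?case by (intro exI[of _ "{}"]) (simp add: iweigh_0)
next
  case (incl h)
  then show ?case by (intro exI[of _ "{h}"]) simp
next
  case (inv h)
  \<comment> \<open>The inverse in \<open>free_Abelian_group S\<close> becomes a negative for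
    elements supported on S; the support condition \<open>H\<close> provides this.\<close>
  then show ?case using H[OF inv] by (intro exI[of _ "{h}"]) (simp add: iweigh_uminus)
next
  case (eng a b)
  then obtain T T' where "finite T" "T \<subseteq> H" "\<forall>w. (\<forall>h\<in>T. iweigh w h = 0) \<longrightarrow> iweigh w a = 0"
    "finite T'" "T' \<subseteq> H" "\<forall>w. (\<forall>h\<in>T'. iweigh w h = 0) \<longrightarrow> iweigh w b = 0" by blast
  then show ?case by (intro exI[of _ "T \<union> T'"]) (auto simp: iweigh_add)
qed

text \<open>Functionals with rational values extend to the tensor product, so rational coefficients
  are absorbed and the generators behind the finitely many pure tensors suffice.\<close>

lemma tensor_rat_iweigh:
  assumes "x \<in> A" and "tensor_rat (generate (free_Abelian_group S) H) = tensor_rat A"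
    and H: "\<And>h. h \<in> H \<Longrightarrow> Poly_Mapping.keys h \<subseteq> S"
  shows "\<exists>T. finite T \<and> T \<subseteq> H \<and> (\<forall>w. (\<forall>h\<in>T. iweigh w h = 0) \<longrightarrow> iweigh w x = 0)"
proof -
  have "pure_tensor x 1 \<in> tensor_rat A" unfolding tensor_rat_def
    using assms(1) by (intro CollectI exI[of _ "{x}"] exI[of _ "\<lambda>_. 1"]) simp
  then have "pure_tensor x 1 \<in> tensor_rat (generate (free_Abelian_group S) H)" by (simp only: assms(2))
  then obtain B q where B: "finite B" "B \<subseteq> generate (free_Abelian_group S) H"
    and x: "pure_tensor x 1 = (\<Sum>a\<in>B. pure_tensor a (q a))"
    unfolding tensor_rat_def by blast
  have "\<forall>a\<in>B. \<exists>T. finite T \<and> T \<subseteq> H \<and> (\<forall>w. (\<forall>h\<in>T. iweigh w h = 0) \<longrightarrow> iweigh w a = 0)"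
    using generate_iweigh[OF _ H] B by blast
  then obtain T where T: "\<And>a. a \<in> B \<Longrightarrow> finite (T a) \<and> T a \<subseteq> H \<and> (\<forall>w. (\<forall>h\<in>T a. iweigh w h = 0) \<longrightarrow> iweigh w a = 0)"
    by metis
  have "iweigh w x = 0" if "\<forall>h\<in>\<Union>(T ` B). iweigh w h = 0" for w
  proof -
    have "iweigh w a = 0" if "a \<in> B" for a using T \<open>\<forall>h\<in>\<Union>(T ` B). iweigh w h = 0\<close> that by blast
    then show ?thesis using x by (simp add: iweigh_def[of w x] weigh_sum weigh_pure_tensor)
  qed
  then show ?thesis using T B(1) by (intro exI[of _ "\<Union>(T ` B)"]) auto
qed

section \<open>AR conflations and the finiteness of Ext\<close>

locale ar_category = exact_category R E + hom_noetherian_category R E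
  for R :: "('r, 'b) ring_scheme" and E :: "('r, 'o, 'm, 'z) excat_scheme" +
  assumes ar: "has_AR_conflations E"
    and enough_proj: "enough_projectives E"
begin

lemma projective_cover:
  assumes "V \<in> Ob E" obtains U i Q p where "projective E Q" "conflation E U i Q p V"
  using assms enough_proj unfolding enough_projectives_def deflation_def by blast

lemma AR_conflationD:
  assumes "AR_conflation E X f Y g Z"
  shows "conflation E X f Y g Z" "indecomposable E X" "indecomposable E Z" "f \<in> jacobson_radical E X Y"
    "g \<in> jacobson_radical E Y Z"
    "\<And>W h. \<lbrakk>W \<in> Ob E; h \<in> jacobson_radical E X W\<rbrakk> \<Longrightarrow> \<exists>u\<in>Mor E Y W. h = Cmp E X Y W u f"
    "\<And>W h. \<lbrakk>W \<in> Ob E; h \<in> jacobson_radical E W Z\<rbrakk> \<Longrightarrow> \<exists>u\<in>Mor E W Y. h = Cmp E W Y Z g u"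
  using assms unfolding AR_conflation_def left_almost_split_def right_almost_split_def by blast+

text \<open>As g is radical, 1 - s g would be invertible; but (1 - s g) s = s - s = 0, so s = 0 and
  Z would be zero.\<close>

lemma AR_not_split:
  assumes ar: "AR_conflation E X f Y g Z" and s: "s \<in> Mor E Z Y" and gs: "Cmp E Z Y Z g s = Idm E Z"
  shows False
proof -
  note d = AR_conflationD[OF ar]
  have O: "Y \<in> Ob E" "Z \<in> Ob E" "g \<in> Mor E Y Z" using conflation_objects[OF d(1)] conflation_morphisms[OF d(1)] by auto
  have nz: "\<not> zero_object E Z" using d(3) by (simp add: indecomposable_def)
  let ?e = "Idm E Y \<ominus>\<^bsub>Hom E Y Y\<^esub> Cmp E Y Z Y s g"
  have "is_iso E Y Y ?e" using d(5) s unfolding jacobson_radical_def by blast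
  then obtain u where u: "u \<in> Mor E Y Y" "Cmp E Y Y Y u ?e = Idm E Y" unfolding is_iso_def by blast
  have "Cmp E Z Y Y ?e s = s \<ominus>\<^bsub>Hom E Z Y\<^esub> Cmp E Z Z Y s (Cmp E Z Y Z g s)"
    using O s by (simp add: Cmp_minus_left Cmp_assoc)
  then have es: "Cmp E Z Y Y ?e s = zmor E Z Y" unfolding gs using O s by simp
  have "s = Cmp E Z Y Y (Cmp E Y Y Y u ?e) s" unfolding u(2) using O s by simp
  also have "\<dots> = Cmp E Z Y Y u (Cmp E Z Y Y ?e s)" using O s u(1) by (simp add: Cmp_assoc)
  also have "\<dots> = zmor E Z Y" unfolding es using O u(1) by simp
  finally have "Idm E Z = zmor E Z Z" using gs O by simp
  then show False using not_zero_object_Idm[OF O(2) nz] by simp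
qed

lemma AR_end_not_projective: "AR_conflation E X f Y g Z \<Longrightarrow> \<not> projective E Z"
  using AR_not_split projective_lift[OF _ AR_conflationD(1), of Z X f Y g Z "Idm E Z"]
    AR_conflationD(1) conflation_objects Idm_closed by metis

text \<open>The map a represents the AR conflation as a class in Ext^1(Z, X). If a extended to Q',
  correcting b by f times the extension would give a section of g.\<close>

lemma AR_connecting:
  assumes ar: "AR_conflation E X f Y g Z" and Q: "projective E Q" and c: "conflation E U i Q p Z"
  obtains a b where "a \<in> Mor E U X" "a \<notin> ext_rel U i Q X" "b \<in> Mor E Q Y" "Cmp E Q Y Z g b = p"
    "Cmp E U X Y f a = Cmp E U Q Y b i"
proof -
  note d = AR_conflationD(1)[OF ar]
  have O: "U \<in> Ob E" "Q \<in> Ob E" "X \<in> Ob E" "Y \<in> Ob E" "Z \<in> Ob E" using conflation_objects[OF c] conflation_objects[OF d] by auto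
  have M: "i \<in> Mor E U Q" "p \<in> Mor E Q Z" "f \<in> Mor E X Y" "g \<in> Mor E Y Z"
    using conflation_morphisms[OF c] conflation_morphisms[OF d] by auto
  obtain b where b: "b \<in> Mor E Q Y" "Cmp E Q Y Z g b = p" using projective_lift[OF Q d M(2)] by blast
  have "Cmp E U Y Z g (Cmp E U Q Y b i) = Cmp E U Q Z (Cmp E Q Y Z g b) i" using b(1) O M by (simp add: Cmp_assoc)
  also have "\<dots> = zmor E U Z" unfolding b(2) by (rule conflation_zero[OF c])
  finally obtain a where a: "a \<in> Mor E U X" "Cmp E U X Y f a = Cmp E U Q Y b i"
    using conflation_lift[OF d O(1), of "Cmp E U Q Y b i"] b(1) O M by auto
  have "a \<notin> ext_rel U i Q X"
  proof
    assume "a \<in> ext_rel U i Q X"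
    then obtain e where e: "e \<in> Mor E Q X" "a = Cmp E U Q X e i" unfolding ext_rel_def by blast
    let ?b = "b \<ominus>\<^bsub>Hom E Q Y\<^esub> Cmp E Q X Y f e"
    have bc: "?b \<in> Mor E Q Y" using b(1) e(1) O M by simp
    have "Cmp E U Q Y ?b i = Cmp E U Q Y b i \<ominus>\<^bsub>Hom E U Y\<^esub> Cmp E U X Y f a"
      unfolding e(2) using b(1) e(1) O M by (simp add: Cmp_minus_left Cmp_assoc)
    then have "Cmp E U Q Y ?b i = zmor E U Y" unfolding a(2) using b(1) O M by simp
    then obtain s where s: "s \<in> Mor E Z Y" "Cmp E Q Z Y s p = ?b"
      using conflation_extend[OF c O(4) bc] by blast
    have "Cmp E Q Z Z (Cmp E Z Y Z g s) p = Cmp E Q Y Z g ?b" unfolding s(2)[symmetric] using s(1) O M by (simp add: Cmp_assoc)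
    also have "\<dots> = Cmp E Q Y Z g b \<ominus>\<^bsub>Hom E Q Z\<^esub> Cmp E Q X Z (Cmp E X Y Z g f) e"
      using b(1) e(1) O M by (simp add: Cmp_minus_right Cmp_assoc)
    also have "\<dots> = Cmp E Q Z Z (Idm E Z) p" unfolding b(2) conflation_zero[OF d] using e(1) O M by simp
    finally have "Cmp E Z Y Z g s = Idm E Z" using conflation_epi[OF c O(5)] s(1) O M by simp
    then show False using AR_not_split[OF ar s(1)] by blast
  qed
  then show ?thesis using that a b by blast
qed

text \<open>Every nonzero class in \<open>Ext\<^sup>1(V, X)\<close> pulls back to the class of the AR conflation starting
  at \<open>X\<close>.\<close>

lemma AR_socle:
  assumes ar: "AR_conflation E X f Y g Z"
    and Q: "projective E Q" and c: "conflation E U i Q p V"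
    and Q': "projective E Q'" and c': "conflation E U' i' Q' p' Z"
    and b: "b \<in> Mor E Q' Y" "Cmp E Q' Y Z g b = p'" and a: "a \<in> Mor E U' X" "Cmp E U' X Y f a = Cmp E U' Q' Y b i'"
    and x: "x \<in> Mor E U X" "x \<notin> ext_rel U i Q X"
  obtains w where "w \<in> Mor E U' U" "Cmp E U' U X x w \<ominus>\<^bsub>Hom E U' X\<^esub> a \<in> ext_rel U' i' Q' X"
proof -
  note d = AR_conflationD[OF ar]
  have O: "U \<in> Ob E" "Q \<in> Ob E" "V \<in> Ob E" "X \<in> Ob E" "Y \<in> Ob E" "Z \<in> Ob E" "U' \<in> Ob E" "Q' \<in> Ob E"
    using conflation_objects[OF c] conflation_objects[OF d(1)] conflation_objects[OF c'] by auto
  have M: "i \<in> Mor E U Q" "p \<in> Mor E Q V" "f \<in> Mor E X Y" "g \<in> Mor E Y Z" "i' \<in> Mor E U' Q'" "p' \<in> Mor E Q' Z"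
    using conflation_morphisms[OF c] conflation_morphisms[OF d(1)] conflation_morphisms[OF c'] by auto
  note pi = conflation_zero[OF c] and gf = conflation_zero[OF d(1)] and pi' = conflation_zero[OF c']
  have "inflation E U i Q" using c unfolding inflation_def by blast
  \<comment> \<open>The pushout N of i along x is the extension of V by X with class x; q below is
    its projection to V.\<close>
  from inflation_pushout[OF this O(4) x(1)] obtain N h n where N: "N \<in> Ob E" and po: "is_pushout E U i Q x X h n N"
    and inf: "inflation E X n N" by blast
  have hn: "h \<in> Mor E Q N" "n \<in> Mor E X N" "Cmp E U Q N h i = Cmp E U X N n x"
    using po by (auto simp: is_pushout_def)
  have pouniv: "\<exists>!w. w \<in> Mor E N W \<and> Cmp E Q N W w h = u \<and> Cmp E X N W w n = v"
    if "W \<in> Ob E" "u \<in> Mor E Q W" "v \<in> Mor E X W" "Cmp E U Q W u i = Cmp E U X W v x" for W u v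
    using po that unfolding is_pushout_def by blast
  obtain q' V' where cN: "conflation E X n N q' V'" using inf unfolding inflation_def by blast
  have V': "V' \<in> Ob E" "q' \<in> Mor E N V'" using conflation_objects[OF cN] conflation_morphisms[OF cN] by auto
  have "\<exists>!w. w \<in> Mor E N V \<and> Cmp E Q N V w h = p \<and> Cmp E X N V w n = zmor E X V"
    by (rule pouniv) (use O M x pi in simp_all)
  then obtain q where q: "q \<in> Mor E N V" "Cmp E Q N V q h = p" "Cmp E X N V q n = zmor E X V" by blast
  \<comment> \<open>n is a kernel of q: the cokernel q' of n factors as e q, so whatever q kills is
    killed by q' and lifts through n.\<close>
  have qker: "\<exists>t\<in>Mor E W X. Cmp E W X N n t = y" if W: "W \<in> Ob E" and y: "y \<in> Mor E W N" "Cmp E W N V q y = zmor E W V" for W y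
  proof (rule conflation_lift[OF cN W y(1)])
    have "Cmp E U Q V' (Cmp E Q N V' q' h) i = Cmp E U N V' q' (Cmp E U Q N h i)" using O M hn(1) V' N by (simp add: Cmp_assoc)
    also have "\<dots> = Cmp E U X V' (Cmp E X N V' q' n) x" unfolding hn(3) using O x hn(2) V' N by (simp add: Cmp_assoc)
    also have "\<dots> = zmor E U V'" unfolding conflation_zero[OF cN] using O x V' by simp
    finally have qh: "Cmp E U Q V' (Cmp E Q N V' q' h) i = zmor E U V'" .
    then obtain e where e: "e \<in> Mor E V V'" "Cmp E Q V V' e p = Cmp E Q N V' q' h"
      using conflation_extend[OF c V'(1), of "Cmp E Q N V' q' h"] O hn(1) V' N by auto
    have "\<exists>!w. w \<in> Mor E N V' \<and> Cmp E Q N V' w h = Cmp E Q N V' q' h \<and> Cmp E X N V' w n = zmor E X V'"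
      by (rule pouniv) (use O M x V' N hn in \<open>simp_all add: qh\<close>)
    moreover have "Cmp E Q N V' (Cmp E N V V' e q) h = Cmp E Q V V' e (Cmp E Q N V q h)"
      "Cmp E X N V' (Cmp E N V V' e q) n = Cmp E X V V' e (Cmp E X N V q n)"
      using O e(1) q(1) hn(1,2) V' N by (simp_all add: Cmp_assoc)
    then have "Cmp E Q N V' (Cmp E N V V' e q) h = Cmp E Q N V' q' h" "Cmp E X N V' (Cmp E N V V' e q) n = zmor E X V'"
      unfolding q(2,3) e(2) using O e(1) V' by simp_all
    ultimately have eq: "Cmp E N V V' e q = q'"
      using conflation_zero[OF cN] O N V' e(1) q(1) Cmp_closed by metis
    have "Cmp E W N V' q' y = Cmp E W V V' e (Cmp E W N V q y)"
      unfolding eq[symmetric] using W y(1) O N V' e(1) q(1) by (simp add: Cmp_assoc)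
    then show "Cmp E W N V' q' y = zmor E W V'" unfolding y(2) using W O V' e(1) by simp
  qed
  \<comment> \<open>Otherwise n has a retraction r, and r h extends x along i, against the choice of
    x. Being radical, n factors through the left almost split f.\<close>
  have "n \<in> jacobson_radical E X N"
  proof (rule ccontr)
    assume "n \<notin> jacobson_radical E X N"
    then obtain r where r: "r \<in> Mor E N X" "Cmp E X N X r n = Idm E X"
      using nonradical_from_indecomposable[OF d(2) N hn(2)] by blast
    have "Cmp E U Q X (Cmp E Q N X r h) i = Cmp E U N X r (Cmp E U Q N h i)" using O M hn(1) r(1) N by (simp add: Cmp_assoc)
    also have "\<dots> = Cmp E U X X (Cmp E X N X r n) x" unfolding hn(3) using O x hn(2) r(1) N by (simp add: Cmp_assoc)
    also have "\<dots> = x" unfolding r(2) using O x by simp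
    finally have "x = Cmp E U Q X (Cmp E Q N X r h) i" by simp
    moreover have "Cmp E Q N X r h \<in> Mor E Q X" using O N r(1) hn(1) by simp
    ultimately have "x \<in> ext_rel U i Q X" unfolding ext_rel_def by blast
    then show False using x by blast
  qed
  then obtain u where u: "u \<in> Mor E Y N" "n = Cmp E X Y N u f" using d(6)[OF N] by blast
  have "Cmp E X Y V (Cmp E Y N V q u) f = Cmp E X N V q (Cmp E X Y N u f)" using O M N q(1) u(1) by (simp add: Cmp_assoc)
  then have "Cmp E X Y V (Cmp E Y N V q u) f = zmor E X V" unfolding u(2)[symmetric] q(3) .
  then obtain k where k: "k \<in> Mor E Z V" "Cmp E Y Z V k g = Cmp E Y N V q u"
    using conflation_extend[OF d(1) O(3), of "Cmp E Y N V q u"] O N q(1) u(1) by auto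
  obtain t where t: "t \<in> Mor E Q' Q" "Cmp E Q' Q V p t = Cmp E Q' Z V k p'"
    using projective_lift[OF Q' c, of "Cmp E Q' Z V k p'"] O M k(1) by auto
  have "Cmp E U' Q V p (Cmp E U' Q' Q t i') = Cmp E U' Q' V (Cmp E Q' Q V p t) i'" using O M t(1) by (simp add: Cmp_assoc)
  also have "\<dots> = Cmp E U' Z V k (Cmp E U' Q' Z p' i')" unfolding t(2) using O M k(1) by (simp add: Cmp_assoc)
  also have "\<dots> = zmor E U' V" unfolding pi' using O k(1) by simp
  finally obtain w where w: "w \<in> Mor E U' U" "Cmp E U' U Q i w = Cmp E U' Q' Q t i'"
    using conflation_lift[OF c O(7), of "Cmp E U' Q' Q t i'"] O M t(1) by auto
  \<comment> \<open>h t and u b are two lifts to N of the same map k p' into V, so their difference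
    factors through n. Restricted along i' this says that x w and a have the same class.\<close>
  let ?y = "Cmp E Q' Q N h t \<ominus>\<^bsub>Hom E Q' N\<^esub> Cmp E Q' Y N u b"
  have yc: "?y \<in> Mor E Q' N" using O N hn(1) t(1) u(1) b(1) by simp
  have "Cmp E Q' N V q ?y = Cmp E Q' Q V (Cmp E Q N V q h) t \<ominus>\<^bsub>Hom E Q' V\<^esub> Cmp E Q' Y V (Cmp E Y N V q u) b"
    using O N hn(1) t(1) u(1) b(1) q(1) by (simp add: Cmp_minus_right Cmp_assoc)
  also have "\<dots> = Cmp E Q' Z V k p' \<ominus>\<^bsub>Hom E Q' V\<^esub> Cmp E Q' Z V k (Cmp E Q' Y Z g b)"
    unfolding q(2) k(2)[symmetric] t(2) using O M k(1) b(1) by (simp add: Cmp_assoc)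
  also have "\<dots> = zmor E Q' V" unfolding b(2) using O M k(1) by simp
  finally obtain e where e: "e \<in> Mor E Q' X" "Cmp E Q' X N n e = ?y" using qker[OF O(8) yc] by blast
  have "Cmp E U' X N n (Cmp E U' U X x w \<ominus>\<^bsub>Hom E U' X\<^esub> a) = Cmp E U' U N (Cmp E U X N n x) w \<ominus>\<^bsub>Hom E U' N\<^esub> Cmp E U' X N n a"
    using O N x hn(2) w(1) a(1) by (simp add: Cmp_minus_right Cmp_assoc)
  also have "Cmp E U' X N n a = Cmp E U' Y N u (Cmp E U' X Y f a)" unfolding u(2) using O M N u(1) a(1) by (simp add: Cmp_assoc)
  also have "\<dots> = Cmp E U' Q' N (Cmp E Q' Y N u b) i'" unfolding a(2) using O M N u(1) b(1) by (simp add: Cmp_assoc)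
  also have "Cmp E U' U N (Cmp E U X N n x) w = Cmp E U' Q N h (Cmp E U' U Q i w)"
    unfolding hn(3)[symmetric] using O M N hn(1) w(1) by (simp add: Cmp_assoc)
  also have "\<dots> = Cmp E U' Q' N (Cmp E Q' Q N h t) i'" unfolding w(2) using O M N hn(1) t(1) by (simp add: Cmp_assoc)
  also have "\<dots> \<ominus>\<^bsub>Hom E U' N\<^esub> Cmp E U' Q' N (Cmp E Q' Y N u b) i' = Cmp E U' Q' N ?y i'"
    using O M N hn(1) t(1) u(1) b(1) by (simp add: Cmp_minus_left)
  also have "\<dots> = Cmp E U' X N n (Cmp E U' Q' X e i')" unfolding e(2)[symmetric] using O M N hn(2) e(1) by (simp add: Cmp_assoc)
  finally have "Cmp E U' U X x w \<ominus>\<^bsub>Hom E U' X\<^esub> a = Cmp E U' Q' X e i'"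
    by (rule conflation_mono[OF cN O(7), rotated 2]) (use O M x w(1) a(1) e(1) in auto)
  then show ?thesis using that w(1) e(1) unfolding ext_rel_def by blast
qed

lemma ext_len_sum:
  assumes c: "conflation E U i Q p V" and "direct_sum E Xs X"
  shows "ext_len U i Q X = (\<Sum>Y\<leftarrow>Xs. ext_len U i Q Y)"
proof -
  have O: "U \<in> Ob E" "Q \<in> Ob E" "i \<in> Mor E U Q"
    using conflation_objects[OF c] conflation_morphisms[OF c] by auto
  show ?thesis unfolding ext_len_def
    by (rule additive_mlen[OF O(1) submodule_ext_rel[OF O] _ assms(2)])
      (assumption, rule ext_rel_postcomp[OF O], assumption+)
qed

lemma ext_len_isomorphic:
  assumes c: "conflation E U i Q p V" and "X \<in> Ob E" "Y \<in> Ob E" "isomorphic E X Y"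
  shows "ext_len U i Q X = ext_len U i Q Y"
  using ext_len_sum[OF c direct_sum_single[of Y X]] assms(2-4) by simp

text \<open>By additivity X may be taken indecomposable, and injective objects contribute 0. In the
  remaining case an AR conflation starts at X, and its class bounds the nilpotency of m on Ext^1(V,
  X).\<close>

lemma ext_len_finite:
  assumes Q: "projective E Q" and c: "conflation E U i Q p V" and X: "X \<in> Ob E"
  shows "ext_len U i Q X \<noteq> \<infinity>"
  using X
proof (induction X rule: krull_schmidt_induct)
  have O: "U \<in> Ob E" "Q \<in> Ob E" "V \<in> Ob E" and M: "i \<in> Mor E U Q"
    using conflation_objects[OF c] conflation_morphisms[OF c] by auto
  note add = ext_len_sum[OF c]
  {
    case (zero X)
    then show ?case using add[OF direct_sum_empty] by simp
  next
    case (sum A B X)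
    then show ?case using add[OF sum(1)]
      by (cases "ext_len U i Q A"; cases "ext_len U i Q B") auto
  next
    case (indecomposable X)
    then have X: "X \<in> Ob E" by (simp add: indecomposable_def)
    show ?case
    proof (cases "injective E X")
      case True
      then show ?thesis using injective_ext_len[OF c] by simp
    next
      case False
      then obtain f Y g Z where ar: "AR_conflation E X f Y g Z"
        using ar indecomposable unfolding has_AR_conflations_def by blast
      have Z: "Z \<in> Ob E" using conflation_objects[OF AR_conflationD(1)[OF ar]] by blast
      obtain U' i' Q' p' where Q': "projective E Q'" and c': "conflation E U' i' Q' p' Z"
        by (rule projective_cover[OF Z])
      have O': "U' \<in> Ob E" "Q' \<in> Ob E" "i' \<in> Mor E U' Q'" using conflation_objects[OF c'] conflation_morphisms[OF c'] by auto
      obtain a b where a: "a \<in> Mor E U' X" "a \<notin> ext_rel U' i' Q' X" and b: "b \<in> Mor E Q' Y" "Cmp E Q' Y Z g b = p'"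
        and fa: "Cmp E U' X Y f a = Cmp E U' Q' Y b i'"
        by (rule AR_connecting[OF ar Q' c'])
      interpret H: local_noetherian_module R "Hom E U X" maxid using O(1) X by (rule local_noetherian_hom)
      interpret H': local_noetherian_module R "Hom E U' X" maxid using O'(1) X by (rule local_noetherian_hom)
      \<comment> \<open>T separates the AR class a from zero in Ext^1(Z, X), while a power r^k maps
        all of Hom(U', X) into T. The exponent is fixed before x: a nonzero class r^k x would pull
        back to a, but its pullback r^k (x w) lies in T.\<close>
      obtain T where T: "submodule T R (Hom E U' X)" "ext_rel U' i' Q' X \<subseteq> T" "a \<notin> T"
        and nil: "\<And>r. r \<in> maxid \<Longrightarrow> \<exists>k::nat. \<forall>y\<in>Mor E U' X. (r [^]\<^bsub>R\<^esub> k) \<odot>\<^bsub>Hom E U' X\<^esub> y \<in> T"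
        by (rule H'.krull[OF submodule_ext_rel[OF O' X] a]) blast
      show ?thesis unfolding ext_len_def
      proof (rule H.nilpotent_mlen_finite[OF submodule_ext_rel[OF O(1,2) M X] H.submodule_carrier])
        show "ext_rel U i Q X \<subseteq> Mor E U X" unfolding ext_rel_def using O X M by auto
        fix r assume r: "r \<in> maxid"
        then obtain k :: nat where k: "\<forall>y\<in>Mor E U' X. (r [^]\<^bsub>R\<^esub> k) \<odot>\<^bsub>Hom E U' X\<^esub> y \<in> T" using nil by blast
        have rk: "r [^]\<^bsub>R\<^esub> k \<in> carrier R" using H.m_carrier[OF r] by simp
        have "(r [^]\<^bsub>R\<^esub> k) \<odot>\<^bsub>Hom E U X\<^esub> x \<in> ext_rel U i Q X" if x: "x \<in> Mor E U X" for x
        proof (rule ccontr)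
          assume n: "(r [^]\<^bsub>R\<^esub> k) \<odot>\<^bsub>Hom E U X\<^esub> x \<notin> ext_rel U i Q X"
          have rx: "(r [^]\<^bsub>R\<^esub> k) \<odot>\<^bsub>Hom E U X\<^esub> x \<in> Mor E U X" using rk x by simp
          obtain w where w: "w \<in> Mor E U' U"
            "Cmp E U' U X ((r [^]\<^bsub>R\<^esub> k) \<odot>\<^bsub>Hom E U X\<^esub> x) w \<ominus>\<^bsub>Hom E U' X\<^esub> a \<in> ext_rel U' i' Q' X"
            by (rule AR_socle[OF ar Q c Q' c' b a(1) fa rx n])
          have "Cmp E U' U X ((r [^]\<^bsub>R\<^esub> k) \<odot>\<^bsub>Hom E U X\<^esub> x) w \<in> T"
            using k w(1) x rk O O' X by (simp add: Cmp_smult_left)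
          then have "a \<in> T" using w(2) T(2) H'.sm_add_cancel(4)[OF T(1) a(1)] by blast
          then show False using T by blast
        qed
        then show "\<exists>k::nat. \<forall>x\<in>Mor E U X. (r [^]\<^bsub>R\<^esub> k) \<odot>\<^bsub>Hom E U X\<^esub> x \<in> ext_rel U i Q X" by blast
      qed
    qed
  }
qed

section \<open>Ext lengths as functionals and the detection of summands\<close>

lemma keys_K0_class: "X \<in> Ob E \<Longrightarrow> Poly_Mapping.keys (K0_class E X) \<subseteq> ind E"
proof -
  assume "X \<in> Ob E"
  then obtain Xs where Xs: "\<forall>Y\<in>set Xs. indecomposable E Y" "direct_sum E Xs X" using krull_schmidt_exists by blast
  have "Poly_Mapping.keys (\<Sum>Y\<leftarrow>Xs. frag_of (iso_class E Y)) \<subseteq> ind E" using Xs(1)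
  proof (induction Xs)
    case (Cons Y Xs)
    then show ?case using Poly_Mapping.keys_add[of "frag_of (iso_class E Y)" "\<Sum>Y\<leftarrow>Xs. frag_of (iso_class E Y)"]
      by (auto simp: ind_def keys_frag_of)
  qed simp
  then show ?thesis using K0_class_eq[OF Xs] by simp
qed

text \<open>The length is invariant under isomorphism, so the representative does not matter, and
  \<open>the_enat\<close> is harmless because the lengths are finite.\<close>

definition ext_weight :: "'o \<Rightarrow> 'm \<Rightarrow> 'o \<Rightarrow> 'o set \<Rightarrow> rat"
  where "ext_weight U i Q c = of_nat (the_enat (ext_len U i Q (SOME Y. Y \<in> c)))"

lemma iweigh_ext_weight:
  assumes Q: "projective E Q" and c: "conflation E U i Q p V" and X: "X \<in> Ob E"
  shows "iweigh (ext_weight U i Q) (K0_class E X) = of_nat (the_enat (ext_len U i Q X))"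
proof -
  have O: "U \<in> Ob E" "Q \<in> Ob E" "V \<in> Ob E" and M: "i \<in> Mor E U Q"
    using conflation_objects[OF c] conflation_morphisms[OF c] by auto
  note add = ext_len_sum[OF c]
  note iso = ext_len_isomorphic[OF c]
  have w: "ext_weight U i Q (iso_class E Y) = of_nat (the_enat (ext_len U i Q Y))" if Y: "Y \<in> Ob E" for Y
  proof -
    have "Y \<in> iso_class E Y" using Y isomorphic_refl by (simp add: iso_class_def)
    then have "(SOME Z. Z \<in> iso_class E Y) \<in> iso_class E Y" by (rule someI)
    then have "(SOME Z. Z \<in> iso_class E Y) \<in> Ob E" "isomorphic E Y (SOME Z. Z \<in> iso_class E Y)" by (auto simp: iso_class_def)
    then show ?thesis unfolding ext_weight_def using iso[OF Y] by simp
  qed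
  obtain Xs where Xs: "\<forall>Y\<in>set Xs. indecomposable E Y" "direct_sum E Xs X" using krull_schmidt_exists[OF X] by blast
  have "iweigh (ext_weight U i Q) (K0_class E X) = (\<Sum>Y\<leftarrow>Xs. ext_weight U i Q (iso_class E Y))"
    unfolding K0_class_eq[OF Xs] by (rule iweigh_sum_list)
  also have "\<dots> = of_nat (the_enat (\<Sum>Y\<leftarrow>Xs. ext_len U i Q Y))" using Xs(1)
  proof (induction Xs)
    case (Cons Y Xs)
    have Y: "Y \<in> Ob E" using Cons.prems by (simp add: indecomposable_def)
    have fin: "sum_list xs \<noteq> \<infinity>" if "\<infinity> \<notin> set xs" for xs :: "enat list"
      using that
    proof (induction xs)
      case (Cons x xs)
      then show ?case by (cases x) auto
    qed simp
    have "\<infinity> \<notin> ext_len U i Q ` set Xs"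
      using ext_len_finite[OF Q c] Cons.prems unfolding indecomposable_def by force
    then have "(\<Sum>Y\<leftarrow>Xs. ext_len U i Q Y) \<noteq> \<infinity>" by (intro fin) simp
    then obtain a b where "(\<Sum>Y\<leftarrow>Xs. ext_len U i Q Y) = enat a" "ext_len U i Q Y = enat b"
      using ext_len_finite[OF Q c Y] by auto
    then show ?case using Cons w[OF Y] by simp
  qed (simp add: zero_enat_def)
  also have "\<dots> = of_nat (the_enat (ext_len U i Q X))" using add[OF Xs(2)] by simp
  finally show ?thesis .
qed

text \<open>The value is the length of M(V) plus that of M(U); both are nonnegative, so it vanishes
  only if both do.\<close>

lemma iweigh_conflation:
  assumes Q: "projective E Q" and c: "conflation E U i Q p V" and d: "conflation E X f Y g Z"
  shows "iweigh (ext_weight U i Q) (K0_class E X - K0_class E Y + K0_class E Z) = 0 \<longleftrightarrow>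
    coker_len Y g Z V = 0 \<and> coker_len Y g Z U = 0"
proof -
  have O: "X \<in> Ob E" "Y \<in> Ob E" "Z \<in> Ob E" using conflation_objects[OF d] by auto
  obtain x y z where xyz: "ext_len U i Q X = enat x" "ext_len U i Q Y = enat y" "ext_len U i Q Z = enat z"
    using ext_len_finite[OF Q c] O by (metis enat.exhaust)
  have eq: "enat (x + z) = enat y + coker_len Y g Z V + coker_len Y g Z U"
    using ext_len_conflation[OF Q c d] xyz by simp
  then obtain a b where ab: "coker_len Y g Z V = enat a" "coker_len Y g Z U = enat b"
    by (cases "coker_len Y g Z V"; cases "coker_len Y g Z U") auto
  then have n: "x + z = y + a + b" using eq by simp
  then have "(of_nat x + of_nat z :: rat) = of_nat y + of_nat a + of_nat b" by (metis of_nat_add)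
  then have "iweigh (ext_weight U i Q) (K0_class E X - K0_class E Y + K0_class E Z) = of_nat (a + b)"
    unfolding iweigh_add iweigh_diff using iweigh_ext_weight[OF Q c] O xyz by simp
  then have "iweigh (ext_weight U i Q) (K0_class E X - K0_class E Y + K0_class E Z) = 0 \<longleftrightarrow> a + b = 0"
    by (simp only: of_nat_eq_0_iff)
  then show ?thesis using ab by (simp add: zero_enat_def)
qed

lemma coker_len_zero_iff:
  assumes "conflation E X f Y g Z" "W \<in> Ob E"
  shows "coker_len Y g Z W = 0 \<longleftrightarrow> image_of Y g Z W = Mor E W Z"
proof -
  have O: "Y \<in> Ob E" "Z \<in> Ob E" "g \<in> Mor E Y Z" using conflation_objects conflation_morphisms assms(1) by auto
  have s: "submodule (image_of Y g Z W) R (Hom E W Z)" using submodule_image_of[OF assms(2) O] .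
  interpret H: module R "Hom E W Z" using assms(2) O by (intro Hom_module)
  show ?thesis unfolding coker_len_def using H.mlen_eq_0_iff[OF s H.submodule_carrier H.sm_subset[OF s]] .
qed

text \<open>The functor of an AR conflation vanishes away from its end term W: a map V \<rightarrow>
  W that is not a split epimorphism is radical and factors through g.\<close>

lemma AR_coker_retract:
  assumes ar: "AR_conflation E X f Y g W" and V: "V \<in> Ob E" and n: "coker_len Y g W V \<noteq> 0"
  shows "retract W V"
proof (rule ccontr)
  assume nr: "\<not> retract W V"
  note d = AR_conflationD[OF ar]
  have O: "Y \<in> Ob E" "W \<in> Ob E" "g \<in> Mor E Y W" using conflation_objects[OF d(1)] conflation_morphisms[OF d(1)] by auto
  have "h \<in> image_of Y g W V" if h: "h \<in> Mor E V W" for h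
  proof -
    have "h \<in> jacobson_radical E V W"
      using nonradical_to_indecomposable[OF d(3) V h] nr h V O unfolding retract_def by blast
    then show ?thesis using d(7)[OF V] unfolding image_of_def by blast
  qed
  moreover have "image_of Y g W V \<subseteq> Mor E V W" unfolding image_of_def using O V by auto
  ultimately show False using n coker_len_zero_iff[OF d(1) V] by blast
qed

text \<open>The order of quantifiers is the point: S comes from an expression of the given
  conflation by AR conflations, before any V is chosen, and then serves the functionals of all V at
  once.\<close>

lemma finite_detection:
  assumes tensor: "tensor_rat (AR_group E) = tensor_rat (Ex_group E)" and d: "conflation E X f Y g Z"
  shows "\<exists>S. finite S \<and> (\<forall>W\<in>S. indecomposable E W \<and> \<not> projective E W) \<and>
    (\<forall>U i Q p V. projective E Q \<longrightarrow> conflation E U i Q p V \<longrightarrow> image_of Y g Z U \<noteq> Mor E U Z \<longrightarrow>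
      (\<exists>W\<in>S. retract W V \<or> retract W U))"
proof -
  define H where "H = {K0_class E X - K0_class E Y + K0_class E Z | X f Y g Z. AR_conflation E X f Y g Z}"
  let ?x = "K0_class E X - K0_class E Y + K0_class E Z"
  have x: "?x \<in> Ex_group E" unfolding Ex_group_def by (rule generate.incl) (use d in blast)
  have keys: "Poly_Mapping.keys h \<subseteq> ind E" if h: "h \<in> H" for h
  proof -
    obtain X f Y g Z where hh: "h = K0_class E X - K0_class E Y + K0_class E Z" "AR_conflation E X f Y g Z"
      using h unfolding H_def by blast
    then have o: "X \<in> Ob E" "Y \<in> Ob E" "Z \<in> Ob E" using conflation_objects AR_conflationD(1) by metis+
    show ?thesis unfolding hh(1)
      using Poly_Mapping.keys_add[of "K0_class E X - K0_class E Y" "K0_class E Z"]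
        keys_diff[of "K0_class E X" "K0_class E Y"] keys_K0_class[OF o(1)] keys_K0_class[OF o(2)] keys_K0_class[OF o(3)]
      by blast
  qed
  have "tensor_rat (generate (free_Abelian_group (ind E)) H) = tensor_rat (Ex_group E)"
    using tensor unfolding AR_group_def K0_split_def H_def .
  from tensor_rat_iweigh[OF x this keys] obtain T where T: "finite T" "T \<subseteq> H"
    and det: "\<And>w. \<forall>h\<in>T. iweigh w h = 0 \<Longrightarrow> iweigh w ?x = 0" by blast
  have "\<forall>h\<in>T. \<exists>W X f Y g. h = K0_class E X - K0_class E Y + K0_class E W \<and> AR_conflation E X f Y g W"
    using T(2) unfolding H_def by blast
  then obtain W where W: "\<And>h. h \<in> T \<Longrightarrow> \<exists>X f Y g. h = K0_class E X - K0_class E Y + K0_class E (W h) \<and> AR_conflation E X f Y g (W h)"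
    by metis
  have "\<exists>W'\<in>W ` T. retract W' V \<or> retract W' U"
    if Q: "projective E Q" and c: "conflation E U i Q p V" and n: "image_of Y g Z U \<noteq> Mor E U Z" for U i Q p V
  proof -
    have O: "U \<in> Ob E" "V \<in> Ob E" using conflation_objects[OF c] by auto
    have "coker_len Y g Z U \<noteq> 0" using n coker_len_zero_iff[OF d O(1)] by blast
    then have "iweigh (ext_weight U i Q) ?x \<noteq> 0" using iweigh_conflation[OF Q c d] by blast
    then obtain h where h: "h \<in> T" "iweigh (ext_weight U i Q) h \<noteq> 0" using det by blast
    then obtain X' f' Y' g' where hh: "h = K0_class E X' - K0_class E Y' + K0_class E (W h)" "AR_conflation E X' f' Y' g' (W h)"
      using W by blast
    then have "coker_len Y' g' (W h) V \<noteq> 0 \<or> coker_len Y' g' (W h) U \<noteq> 0"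
      using h(2) iweigh_conflation[OF Q c AR_conflationD(1)[OF hh(2)]] by metis
    then have "retract (W h) V \<or> retract (W h) U" using AR_coker_retract[OF hh(2)] O by blast
    then show ?thesis using h(1) by blast
  qed
  moreover have "\<forall>W'\<in>W ` T. indecomposable E W' \<and> \<not> projective E W'"
    using W AR_conflationD(3) AR_end_not_projective by blast
  ultimately show ?thesis using T(1) by (intro exI[of _ "W ` T"]) blast
qed

end

section \<open>Stable retracts and syzygies\<close>

context ar_category
begin

abbreviation projI :: "'o \<Rightarrow> 'o \<Rightarrow> 'm set"
  where "projI \<equiv> projective_ideal E"

section \<open>Projective objects and the ideal they generate\<close>

lemma projective_Ob: "projective E Q \<Longrightarrow> Q \<in> Ob E"
  by (simp add: projective_def)

lemma projective_retract:
  assumes "retract A Q" "projective E Q" shows "projective E A"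
  unfolding projective_def
proof (intro conjI allI impI ballI)
  show A: "A \<in> Ob E" using assms(1) by (simp add: retract_def)
  obtain s r where sr: "Q \<in> Ob E" "s \<in> Mor E A Q" "r \<in> Mor E Q A" "Cmp E A Q A r s = Idm E A"
    using assms(1) unfolding retract_def by blast
  fix Y g Z h assume "deflation E Y g Z" and h: "h \<in> Mor E A Z"
  then obtain X f where c: "conflation E X f Y g Z" unfolding deflation_def by blast
  have O: "Y \<in> Ob E" "Z \<in> Ob E" "g \<in> Mor E Y Z" using conflation_objects[OF c] conflation_morphisms[OF c] by auto
  obtain u where u: "u \<in> Mor E Q Y" "Cmp E Q Y Z g u = Cmp E Q A Z h r"
    using projective_lift[OF assms(2) c, of "Cmp E Q A Z h r"] h A sr O by auto
  have "Cmp E A Y Z g (Cmp E A Q Y u s) = Cmp E A Q Z (Cmp E Q Y Z g u) s" using A sr(1,2) O u(1) by (simp add: Cmp_assoc)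
  also have "\<dots> = Cmp E A A Z h (Cmp E A Q A r s)" unfolding u(2) using A sr(1-3) O h by (simp add: Cmp_assoc)
  also have "\<dots> = h" unfolding sr(4) using A O h by simp
  finally show "\<exists>u\<in>Mor E A Y. Cmp E A Y Z g u = h" using A sr(1,2) O u(1) by (metis Cmp_closed)
qed

lemma projective_biproduct:
  assumes b: "biproduct A B X i1 i2 p1 p2" and "projective E A" "projective E B"
  shows "projective E X"
  unfolding projective_def
proof (intro conjI allI impI ballI)
  have O: "A \<in> Ob E" "B \<in> Ob E" "X \<in> Ob E" and M: "i1 \<in> Mor E A X" "i2 \<in> Mor E B X" "p1 \<in> Mor E X A" "p2 \<in> Mor E X B"
    and s: "Cmp E X A X i1 p1 \<oplus>\<^bsub>Hom E X X\<^esub> Cmp E X B X i2 p2 = Idm E X"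
    using b by (auto simp: biproduct_def)
  show "X \<in> Ob E" by (rule O)
  fix Y g Z h assume "deflation E Y g Z" and h: "h \<in> Mor E X Z"
  then obtain K f where c: "conflation E K f Y g Z" unfolding deflation_def by blast
  have OY: "Y \<in> Ob E" "Z \<in> Ob E" "g \<in> Mor E Y Z" using conflation_objects[OF c] conflation_morphisms[OF c] by auto
  obtain u where u: "u \<in> Mor E A Y" "Cmp E A Y Z g u = Cmp E A X Z h i1"
    using projective_lift[OF assms(2) c, of "Cmp E A X Z h i1"] h O M OY by auto
  obtain v where v: "v \<in> Mor E B Y" "Cmp E B Y Z g v = Cmp E B X Z h i2"
    using projective_lift[OF assms(3) c, of "Cmp E B X Z h i2"] h O M OY by auto
  let ?w = "Cmp E X A Y u p1 \<oplus>\<^bsub>Hom E X Y\<^esub> Cmp E X B Y v p2"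
  have "Cmp E X Y Z g ?w = Cmp E X A Z (Cmp E A Y Z g u) p1 \<oplus>\<^bsub>Hom E X Z\<^esub> Cmp E X B Z (Cmp E B Y Z g v) p2"
    using O M OY u(1) v(1) by (simp add: Cmp_add_right Cmp_assoc)
  also have "\<dots> = Cmp E X X Z h (Cmp E X A X i1 p1 \<oplus>\<^bsub>Hom E X X\<^esub> Cmp E X B X i2 p2)"
    unfolding u(2) v(2) using O M OY h by (simp add: Cmp_add_right Cmp_assoc)
  also have "\<dots> = h" unfolding s using O OY h by simp
  finally show "\<exists>u\<in>Mor E X Y. Cmp E X Y Z g u = h" using O M OY u(1) v(1) by (intro bexI[of _ ?w]) auto
qed

lemma biproduct_exists:
  assumes "A \<in> Ob E" "B \<in> Ob E" obtains X i1 i2 p1 p2 where "biproduct A B X i1 i2 p1 p2"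
  using has_direct_sums[of "[A, B]"] assms direct_sum_pair_iff by auto

lemma projI_iff: "f \<in> projI X Y \<longleftrightarrow> f \<in> Mor E X Y \<and>
    (\<exists>Q. projective E Q \<and> (\<exists>a\<in>Mor E X Q. \<exists>b\<in>Mor E Q Y. f = Cmp E X Q Y b a))"
  by (simp add: projective_ideal_def)

lemma projI_I:
  "\<lbrakk>projective E Q; X \<in> Ob E; Y \<in> Ob E; a \<in> Mor E X Q; b \<in> Mor E Q Y\<rbrakk> \<Longrightarrow> Cmp E X Q Y b a \<in> projI X Y"
  unfolding projI_iff using projective_Ob by (auto intro!: Cmp_closed)

lemma submodule_projI:
  assumes X: "X \<in> Ob E" and Y: "Y \<in> Ob E" shows "submodule (projI X Y) R (Hom E X Y)"
proof -
  interpret H: module R "Hom E X Y" using X Y by (rule Hom_module)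
  show ?thesis unfolding H.submodule_iff
  proof (intro conjI ballI)
    show "projI X Y \<subseteq> Mor E X Y" by (auto simp: projI_iff)
    obtain Q where Q: "projective E Q" using enough_proj X unfolding enough_projectives_def by blast
    have "Cmp E X Q Y (zmor E Q Y) (zmor E X Q) \<in> projI X Y" using X Y projective_Ob[OF Q] by (intro projI_I[OF Q]) auto
    then show "zmor E X Y \<in> projI X Y" using X Y projective_Ob[OF Q] by simp
  next
    fix f f' assume "f \<in> projI X Y" "f' \<in> projI X Y"
    then obtain Q a b Q' a' b' where Q: "projective E Q" "a \<in> Mor E X Q" "b \<in> Mor E Q Y" "f = Cmp E X Q Y b a"
      and Q': "projective E Q'" "a' \<in> Mor E X Q'" "b' \<in> Mor E Q' Y" "f' = Cmp E X Q' Y b' a'"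
      unfolding projI_iff by blast
    have O: "Q \<in> Ob E" "Q' \<in> Ob E" using Q Q' projective_Ob by auto
    \<comment> \<open>The sum of a map through Q and a map through Q' passes through the projective
      object Q \<oplus> Q'.\<close>
    obtain W i1 i2 p1 p2 where w: "biproduct Q Q' W i1 i2 p1 p2" by (rule biproduct_exists[OF O])
    then have W: "W \<in> Ob E" and M: "i1 \<in> Mor E Q W" "i2 \<in> Mor E Q' W" "p1 \<in> Mor E W Q" "p2 \<in> Mor E W Q'"
      and r: "Cmp E Q W Q p1 i1 = Idm E Q" "Cmp E Q' W Q' p2 i2 = Idm E Q'"
        "Cmp E Q' W Q p1 i2 = zmor E Q' Q" "Cmp E Q W Q' p2 i1 = zmor E Q Q'"
      by (auto simp: biproduct_def)
    let ?A = "Cmp E X Q W i1 a \<oplus>\<^bsub>Hom E X W\<^esub> Cmp E X Q' W i2 a'"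
    have A: "?A \<in> Mor E X W" using O W M X Q Q' by simp
    have "Cmp E X W Q p1 ?A = Cmp E X Q Q (Cmp E Q W Q p1 i1) a \<oplus>\<^bsub>Hom E X Q\<^esub> Cmp E X Q' Q (Cmp E Q' W Q p1 i2) a'"
      using O W M X Q(2) Q'(2) by (simp add: Cmp_add_right Cmp_assoc)
    then have p1A: "Cmp E X W Q p1 ?A = a" unfolding r using O X Q Q' by simp
    have "Cmp E X W Q' p2 ?A = Cmp E X Q Q' (Cmp E Q W Q' p2 i1) a \<oplus>\<^bsub>Hom E X Q'\<^esub> Cmp E X Q' Q' (Cmp E Q' W Q' p2 i2) a'"
      using O W M X Q(2) Q'(2) by (simp add: Cmp_add_right Cmp_assoc)
    then have p2A: "Cmp E X W Q' p2 ?A = a'" unfolding r using O X Q Q' by simp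
    have "Cmp E X W Y (Cmp E W Q Y b p1 \<oplus>\<^bsub>Hom E W Y\<^esub> Cmp E W Q' Y b' p2) ?A =
        Cmp E X Q Y b (Cmp E X W Q p1 ?A) \<oplus>\<^bsub>Hom E X Y\<^esub> Cmp E X Q' Y b' (Cmp E X W Q' p2 ?A)"
      using O W M X Y Q(2,3) Q'(2,3) A by (subst Cmp_add_left) (simp_all add: Cmp_assoc)
    also have "\<dots> = f \<oplus>\<^bsub>Hom E X Y\<^esub> f'" unfolding p1A p2A Q(4) Q'(4) ..
    finally show "f \<oplus>\<^bsub>Hom E X Y\<^esub> f' \<in> projI X Y"
      using projI_I[OF projective_biproduct[OF w Q(1) Q'(1)] X Y A, of "Cmp E W Q Y b p1 \<oplus>\<^bsub>Hom E W Y\<^esub> Cmp E W Q' Y b' p2"]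
        O W M X Y Q(2,3) Q'(2,3) by simp
  next
    fix c f assume c: "c \<in> carrier R" and "f \<in> projI X Y"
    then obtain Q a b where Q: "projective E Q" "a \<in> Mor E X Q" "b \<in> Mor E Q Y" "f = Cmp E X Q Y b a"
      unfolding projI_iff by blast
    have "c \<odot>\<^bsub>Hom E X Y\<^esub> f = Cmp E X Q Y (c \<odot>\<^bsub>Hom E Q Y\<^esub> b) a"
      using Q(2-4) c X Y projective_Ob[OF Q(1)] by (simp add: Cmp_smult_left)
    then show "c \<odot>\<^bsub>Hom E X Y\<^esub> f \<in> projI X Y"
      using projI_I[OF Q(1) X Y Q(2), of "c \<odot>\<^bsub>Hom E Q Y\<^esub> b"] Q(3) c Y projective_Ob[OF Q(1)] by simp
  qed
qed

lemma projI_postcomp: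
  assumes "X \<in> Ob E" "Y \<in> Ob E" "Z \<in> Ob E" "f \<in> projI X Y" "g \<in> Mor E Y Z"
  shows "Cmp E X Y Z g f \<in> projI X Z"
proof -
  obtain Q a b where Q: "projective E Q" "a \<in> Mor E X Q" "b \<in> Mor E Q Y" "f = Cmp E X Q Y b a"
    using assms(4) unfolding projI_iff by blast
  then have "Cmp E X Y Z g f = Cmp E X Q Z (Cmp E Q Y Z g b) a" using assms projective_Ob[OF Q(1)] by (simp add: Cmp_assoc)
  then show ?thesis using projI_I[OF Q(1) assms(1,3) Q(2), of "Cmp E Q Y Z g b"] Q(3) assms projective_Ob[OF Q(1)] by simp
qed

lemma projI_precomp:
  assumes "X \<in> Ob E" "Y \<in> Ob E" "Z \<in> Ob E" "f \<in> Mor E X Y" "g \<in> projI Y Z"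
  shows "Cmp E X Y Z g f \<in> projI X Z"
proof -
  obtain Q a b where Q: "projective E Q" "a \<in> Mor E Y Q" "b \<in> Mor E Q Z" "g = Cmp E Y Q Z b a"
    using assms(5) unfolding projI_iff by blast
  then have "Cmp E X Y Z g f = Cmp E X Q Z b (Cmp E X Y Q a f)" using assms projective_Ob[OF Q(1)] by (simp add: Cmp_assoc)
  then show ?thesis using projI_I[OF Q(1) assms(1,3) _ Q(3), of "Cmp E X Y Q a f"] Q(2) assms projective_Ob[OF Q(1)] by simp
qed

lemma Idm_projI_iff: "X \<in> Ob E \<Longrightarrow> Idm E X \<in> projI X X \<longleftrightarrow> projective E X"
proof
  assume X: "X \<in> Ob E" and "Idm E X \<in> projI X X"
  then obtain Q a b where Q: "projective E Q" "a \<in> Mor E X Q" "b \<in> Mor E Q X" "Cmp E X Q X b a = Idm E X"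
    unfolding projI_iff by metis
  then have "retract X Q" unfolding retract_def using X projective_Ob by blast
  then show "projective E X" using projective_retract Q(1) by blast
next
  assume X: "X \<in> Ob E" and "projective E X"
  then have "Cmp E X X X (Idm E X) (Idm E X) \<in> projI X X" by (intro projI_I) auto
  then show "Idm E X \<in> projI X X" using X by simp
qed

lemma projI_image_of:
  assumes d: "conflation E X f Y g Z" and W: "W \<in> Ob E" and h: "h \<in> projI W Z"
  shows "h \<in> image_of Y g Z W"
proof -
  have O: "Y \<in> Ob E" "Z \<in> Ob E" "g \<in> Mor E Y Z" using conflation_objects[OF d] conflation_morphisms[OF d] by auto
  obtain Q a b where Q: "projective E Q" "a \<in> Mor E W Q" "b \<in> Mor E Q Z" "h = Cmp E W Q Z b a"
    using h unfolding projI_iff by blast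
  obtain u where u: "u \<in> Mor E Q Y" "Cmp E Q Y Z g u = b" using projective_lift[OF Q(1) d Q(3)] by blast
  have "h = Cmp E W Y Z g (Cmp E W Q Y u a)" unfolding Q(4) u(2)[symmetric] using O W Q(2) u(1) projective_Ob[OF Q(1)]
    by (simp add: Cmp_assoc)
  then show ?thesis unfolding image_of_def using O W Q(2) u(1) projective_Ob[OF Q(1)] by (intro image_eqI) auto
qed

lemma image_of_precomp:
  assumes "Y \<in> Ob E" "Z \<in> Ob E" "g \<in> Mor E Y Z" "V \<in> Ob E" "W \<in> Ob E" "u \<in> Mor E V W" "h \<in> image_of Y g Z W"
  shows "Cmp E V W Z h u \<in> image_of Y g Z V"
proof -
  obtain y where y: "y \<in> Mor E W Y" "h = Cmp E W Y Z g y" using assms(7) unfolding image_of_def by blast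
  then have "Cmp E V W Z h u = Cmp E V Y Z g (Cmp E V W Y y u)" using assms by (simp add: Cmp_assoc)
  then show ?thesis unfolding image_of_def using assms y by (intro image_eqI) auto
qed

text \<open>The functor presented by g kills maps through projectives, so an endomorphism that is
  stably the identity acts as the identity on its value at W.\<close>

lemma image_of_projI_cong:
  assumes d: "conflation E X f Y g Z" and W: "W \<in> Ob E" and u: "u \<in> Mor E W W" "u \<ominus>\<^bsub>Hom E W W\<^esub> Idm E W \<in> projI W W"
    and h: "h \<in> Mor E W Z" and hu: "Cmp E W W Z h u \<in> image_of Y g Z W"
  shows "h \<in> image_of Y g Z W"
proof -
  have O: "Y \<in> Ob E" "Z \<in> Ob E" "g \<in> Mor E Y Z" using conflation_objects[OF d] conflation_morphisms[OF d] by auto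
  interpret H: module R "Hom E W Z" using W O by (intro Hom_module)
  have s: "submodule (image_of Y g Z W) R (Hom E W Z)" using submodule_image_of[OF W O] .
  have "Cmp E W W Z h (u \<ominus>\<^bsub>Hom E W W\<^esub> Idm E W) = Cmp E W W Z h u \<ominus>\<^bsub>Hom E W Z\<^esub> h"
    using W O u(1) h by (simp add: Cmp_minus_right)
  then have "Cmp E W W Z h u \<ominus>\<^bsub>Hom E W Z\<^esub> h \<in> image_of Y g Z W"
    using projI_image_of[OF d W projI_postcomp[OF W W O(2) u(2) h]] by simp
  then show ?thesis using H.sm_add_cancel(4)[OF s h hu] by blast
qed

text \<open>Retracts in the stable category, phrased by representatives so that they can be combined
  with honest retracts.\<close>

definition stable_retract :: "'o \<Rightarrow> 'o \<Rightarrow> bool"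
  where "stable_retract A X \<longleftrightarrow> A \<in> Ob E \<and> X \<in> Ob E \<and>
    (\<exists>s\<in>Mor E A X. \<exists>r\<in>Mor E X A. Cmp E A X A r s \<ominus>\<^bsub>Hom E A A\<^esub> Idm E A \<in> projI A A)"

lemma retract_imp_stable: "retract A X \<Longrightarrow> stable_retract A X"
proof -
  assume a: "retract A X"
  then obtain s r where sr: "A \<in> Ob E" "X \<in> Ob E" "s \<in> Mor E A X" "r \<in> Mor E X A" "Cmp E A X A r s = Idm E A"
    unfolding retract_def by blast
  have "zmor E A A \<in> projI A A" using module.sm_zero[OF Hom_module submodule_projI] sr by blast
  then have "Cmp E A X A r s \<ominus>\<^bsub>Hom E A A\<^esub> Idm E A \<in> projI A A" using sr by simp
  then show ?thesis unfolding stable_retract_def using sr by blast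
qed

lemma stable_retract_trans:
  assumes "stable_retract A B" "stable_retract B X" shows "stable_retract A X"
proof -
  from assms obtain s r where 1: "A \<in> Ob E" "B \<in> Ob E" "s \<in> Mor E A B" "r \<in> Mor E B A"
    and rs: "Cmp E A B A r s \<ominus>\<^bsub>Hom E A A\<^esub> Idm E A \<in> projI A A"
    unfolding stable_retract_def by blast
  from assms obtain s' r' where 2: "X \<in> Ob E" "s' \<in> Mor E B X" "r' \<in> Mor E X B"
    and rs': "Cmp E B X B r' s' \<ominus>\<^bsub>Hom E B B\<^esub> Idm E B \<in> projI B B"
    unfolding stable_retract_def by blast
  interpret H: module R "Hom E A A" using 1 by (intro Hom_module)
  let ?c = "Cmp E A X A (Cmp E X B A r r') (Cmp E A B X s' s)" and ?d = "Cmp E A B A r s"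
  have cd: "?c \<in> Mor E A A" "?d \<in> Mor E A A" using 1 2 by simp_all
  have "Cmp E A B A r (Cmp E A B B (Cmp E B X B r' s' \<ominus>\<^bsub>Hom E B B\<^esub> Idm E B) s) = ?c \<ominus>\<^bsub>Hom E A A\<^esub> ?d"
    using 1 2 by (simp add: Cmp_minus_left Cmp_minus_right Cmp_assoc)
  moreover have "Cmp E A B A r (Cmp E A B B (Cmp E B X B r' s' \<ominus>\<^bsub>Hom E B B\<^esub> Idm E B) s) \<in> projI A A"
    using projI_postcomp[OF 1(1,2,1) projI_precomp[OF 1(1,2,2,3) rs'] 1(4)] .
  ultimately have "(?c \<ominus>\<^bsub>Hom E A A\<^esub> ?d) \<oplus>\<^bsub>Hom E A A\<^esub> (?d \<ominus>\<^bsub>Hom E A A\<^esub> Idm E A) \<in> projI A A"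
    using rs H.sm_add[OF submodule_projI[OF 1(1,1)]] by simp
  moreover have "(?c \<ominus>\<^bsub>Hom E A A\<^esub> ?d) \<oplus>\<^bsub>Hom E A A\<^esub> (?d \<ominus>\<^bsub>Hom E A A\<^esub> Idm E A) = ?c \<ominus>\<^bsub>Hom E A A\<^esub> Idm E A"
    using cd 1(1) by (simp add: H.minus_eq H.a_assoc H.r_neg1 H.r_neg2)
  ultimately have "?c \<ominus>\<^bsub>Hom E A A\<^esub> Idm E A \<in> projI A A" by simp
  then show ?thesis unfolding stable_retract_def using 1 2 Cmp_closed by blast
qed

lemma stable_retract_projective:
  assumes "stable_retract A X" "projective E X" shows "projective E A"
proof -
  obtain s r where 1: "A \<in> Ob E" "X \<in> Ob E" "s \<in> Mor E A X" "r \<in> Mor E X A"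
    and rs: "Cmp E A X A r s \<ominus>\<^bsub>Hom E A A\<^esub> Idm E A \<in> projI A A"
    using assms(1) unfolding stable_retract_def by blast
  have "Cmp E A X A r s \<in> projI A A" using projI_I[OF assms(2) 1(1,1,3,4)] .
  from module.sm_add_cancel(4)[OF Hom_module[OF 1(1,1)] submodule_projI[OF 1(1,1)] Idm_closed[OF 1(1)] this] rs
  have "Idm E A \<in> projI A A" by (rule iffD1)
  then show ?thesis using Idm_projI_iff 1 by blast
qed

text \<open>If \<open>r s = 1 + b a\<close> with \<open>a\<close>, \<open>b\<close> passing through a projective \<open>Q\<close>, then \<open>(s, a)\<close> and \<open>(r, -b)\<close>
  make \<open>A\<close> an honest retract of \<open>X \<oplus> Q\<close>.\<close>

lemma stable_retract_biproduct:
  assumes "stable_retract A X"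
  obtains Q Y i1 i2 p1 p2 where "projective E Q" "biproduct X Q Y i1 i2 p1 p2" "retract A Y"
proof -
  obtain s r where 1: "A \<in> Ob E" "X \<in> Ob E" "s \<in> Mor E A X" "r \<in> Mor E X A"
    and rs: "Cmp E A X A r s \<ominus>\<^bsub>Hom E A A\<^esub> Idm E A \<in> projI A A"
    using assms(1) unfolding stable_retract_def by blast
  then obtain Q a b where Q: "projective E Q" "a \<in> Mor E A Q" "b \<in> Mor E Q A"
    and ba: "Cmp E A X A r s \<ominus>\<^bsub>Hom E A A\<^esub> Idm E A = Cmp E A Q A b a"
    unfolding projI_iff by blast
  have QO: "Q \<in> Ob E" using Q projective_Ob by blast
  obtain Y i1 i2 p1 p2 where w: "biproduct X Q Y i1 i2 p1 p2" by (rule biproduct_exists[OF 1(2) QO])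
  then have Y: "Y \<in> Ob E" and M: "i1 \<in> Mor E X Y" "i2 \<in> Mor E Q Y" "p1 \<in> Mor E Y X" "p2 \<in> Mor E Y Q"
    and e: "Cmp E X Y X p1 i1 = Idm E X" "Cmp E Q Y Q p2 i2 = Idm E Q"
      "Cmp E Q Y X p1 i2 = zmor E Q X" "Cmp E X Y Q p2 i1 = zmor E X Q"
    by (auto simp: biproduct_def)
  let ?s = "Cmp E A X Y i1 s \<oplus>\<^bsub>Hom E A Y\<^esub> Cmp E A Q Y i2 a"
  let ?r = "Cmp E Y X A r p1 \<ominus>\<^bsub>Hom E Y A\<^esub> Cmp E Y Q A b p2"
  have s: "?s \<in> Mor E A Y" and r: "?r \<in> Mor E Y A" using 1 QO Y M Q by simp_all
  have "Cmp E A Y X p1 ?s = Cmp E A X X (Cmp E X Y X p1 i1) s \<oplus>\<^bsub>Hom E A X\<^esub> Cmp E A Q X (Cmp E Q Y X p1 i2) a"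
    using 1(1-3) QO Y M Q(2) by (simp add: Cmp_add_right Cmp_assoc)
  then have p1: "Cmp E A Y X p1 ?s = s" unfolding e using 1 QO Q by simp
  have "Cmp E A Y Q p2 ?s = Cmp E A X Q (Cmp E X Y Q p2 i1) s \<oplus>\<^bsub>Hom E A Q\<^esub> Cmp E A Q Q (Cmp E Q Y Q p2 i2) a"
    using 1(1-3) QO Y M Q(2) by (simp add: Cmp_add_right Cmp_assoc)
  then have p2: "Cmp E A Y Q p2 ?s = a" unfolding e using 1 QO Q by simp
  have "Cmp E A Y A ?r ?s = Cmp E A X A r (Cmp E A Y X p1 ?s) \<ominus>\<^bsub>Hom E A A\<^esub> Cmp E A Q A b (Cmp E A Y Q p2 ?s)"
    using 1 QO Y M Q(2,3) s by (subst Cmp_minus_left) (simp_all add: Cmp_assoc)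
  also have "\<dots> = Cmp E A X A r s \<ominus>\<^bsub>Hom E A A\<^esub> (Cmp E A X A r s \<ominus>\<^bsub>Hom E A A\<^esub> Idm E A)" unfolding p1 p2 ba ..
  also have "\<dots> = Idm E A" using 1 by (intro hom_add_minus_cancel(4)) simp_all
  finally have "retract A Y" unfolding retract_def using 1 Y s r by blast
  then show ?thesis using that Q w by blast
qed

section \<open>Comparison of syzygies\<close>

lemma syzygy_lift:
  assumes Q: "projective E Q" and c: "conflation E U i Q p V" and c': "conflation E U' i' Q' p' V'"
    and h: "h \<in> Mor E V V'"
  obtains t w where "t \<in> Mor E Q Q'" "w \<in> Mor E U U'" "Cmp E Q Q' V' p' t = Cmp E Q V V' h p"
    "Cmp E U U' Q' i' w = Cmp E U Q Q' t i"
proof -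
  have O: "U \<in> Ob E" "Q \<in> Ob E" "V \<in> Ob E" "U' \<in> Ob E" "Q' \<in> Ob E" "V' \<in> Ob E"
    using conflation_objects[OF c] conflation_objects[OF c'] by auto
  have M: "i \<in> Mor E U Q" "p \<in> Mor E Q V" "i' \<in> Mor E U' Q'" "p' \<in> Mor E Q' V'"
    using conflation_morphisms[OF c] conflation_morphisms[OF c'] by auto
  obtain t where t: "t \<in> Mor E Q Q'" "Cmp E Q Q' V' p' t = Cmp E Q V V' h p"
    using projective_lift[OF Q c', of "Cmp E Q V V' h p"] O M h by auto
  have "Cmp E U Q' V' p' (Cmp E U Q Q' t i) = Cmp E U Q V' (Cmp E Q Q' V' p' t) i" using O M t(1) by (simp add: Cmp_assoc)
  also have "\<dots> = Cmp E U V V' h (Cmp E U Q V p i)" unfolding t(2) using O M h by (simp add: Cmp_assoc)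
  also have "\<dots> = zmor E U V'" unfolding conflation_zero[OF c] using O h by simp
  finally obtain w where "w \<in> Mor E U U'" "Cmp E U U' Q' i' w = Cmp E U Q Q' t i"
    using conflation_lift[OF c' O(1), of "Cmp E U Q Q' t i"] O M t(1) by auto
  then show ?thesis using that t by blast
qed

text \<open>The uniqueness half of the comparison theorem: a lift t of the zero map on V factors as
  i e, and cancelling the mono i gives w = e i. Applied to differences, it makes syzygies functorial
  up to maps through projectives.\<close>

lemma syzygy_null:
  assumes Q: "projective E Q" and c: "conflation E U i Q p V"
    and t: "t \<in> Mor E Q Q" "Cmp E Q Q V p t = zmor E Q V" and w: "w \<in> Mor E U U" "Cmp E U U Q i w = Cmp E U Q Q t i"
  shows "w \<in> projI U U"
proof -
  have O: "U \<in> Ob E" "Q \<in> Ob E" "V \<in> Ob E" using conflation_objects[OF c] by auto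
  have M: "i \<in> Mor E U Q" "p \<in> Mor E Q V" using conflation_morphisms[OF c] by auto
  obtain e where e: "e \<in> Mor E Q U" "Cmp E Q U Q i e = t" using conflation_lift[OF c O(2) t] by blast
  have "Cmp E U U Q i w = Cmp E U U Q i (Cmp E U Q U e i)" unfolding w(2) e(2)[symmetric] using O M e(1) by (simp add: Cmp_assoc)
  then have "w = Cmp E U Q U e i" using conflation_mono[OF c O(1) w(1)] O M e(1) by simp
  then show ?thesis using projI_I[OF Q O(1,1) M(1) e(1)] by simp
qed

text \<open>Lift section and retraction to the two resolutions. The composite of the lifts differs
  from the identity by a lift of zero, to which \<open>syzygy_null\<close> applies.\<close>

lemma syzygy_retract:
  assumes Q: "projective E Q" and c: "conflation E U i Q p V" and Q': "projective E Q'" and c': "conflation E U' i' Q' p' V'"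
    and "retract V' V"
  shows "stable_retract U' U"
proof -
  have O: "U \<in> Ob E" "Q \<in> Ob E" "V \<in> Ob E" "U' \<in> Ob E" "Q' \<in> Ob E" "V' \<in> Ob E"
    using conflation_objects[OF c] conflation_objects[OF c'] by auto
  have M: "i \<in> Mor E U Q" "p \<in> Mor E Q V" "i' \<in> Mor E U' Q'" "p' \<in> Mor E Q' V'"
    using conflation_morphisms[OF c] conflation_morphisms[OF c'] by auto
  obtain s r where sr: "s \<in> Mor E V' V" "r \<in> Mor E V V'" "Cmp E V' V V' r s = Idm E V'"
    using assms(5) unfolding retract_def by blast
  obtain t w where t: "t \<in> Mor E Q' Q" "w \<in> Mor E U' U" and pt: "Cmp E Q' Q V p t = Cmp E Q' V' V s p'"
    and iw: "Cmp E U' U Q i w = Cmp E U' Q' Q t i'" by (rule syzygy_lift[OF Q' c' c sr(1)])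
  obtain t' w' where t': "t' \<in> Mor E Q Q'" "w' \<in> Mor E U U'" and pt': "Cmp E Q Q' V' p' t' = Cmp E Q V V' r p"
    and iw': "Cmp E U U' Q' i' w' = Cmp E U Q Q' t' i" by (rule syzygy_lift[OF Q c c' sr(2)])
  let ?t = "Cmp E Q' Q Q' t' t \<ominus>\<^bsub>Hom E Q' Q'\<^esub> Idm E Q'" and ?w = "Cmp E U' U U' w' w \<ominus>\<^bsub>Hom E U' U'\<^esub> Idm E U'"
  have "Cmp E Q' Q' V' p' ?t = Cmp E Q' Q V' (Cmp E Q Q' V' p' t') t \<ominus>\<^bsub>Hom E Q' V'\<^esub> p'"
    using O M t(1) t'(1) by (simp add: Cmp_minus_right Cmp_assoc)
  also have "Cmp E Q' Q V' (Cmp E Q Q' V' p' t') t = Cmp E Q' V V' r (Cmp E Q' Q V p t)"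
    unfolding pt' using O M t(1) sr(1,2) by (simp add: Cmp_assoc)
  also have "\<dots> = Cmp E Q' V' V' (Cmp E V' V V' r s) p'" unfolding pt using O M sr(1,2) by (simp add: Cmp_assoc)
  also have "\<dots> \<ominus>\<^bsub>Hom E Q' V'\<^esub> p' = zmor E Q' V'" unfolding sr(3) using O M by simp
  finally have pt0: "Cmp E Q' Q' V' p' ?t = zmor E Q' V'" .
  have "Cmp E U' U' Q' i' ?w = Cmp E U' U Q' (Cmp E U U' Q' i' w') w \<ominus>\<^bsub>Hom E U' Q'\<^esub> i'"
    using O M t(2) t'(2) by (simp add: Cmp_minus_right Cmp_assoc)
  also have "Cmp E U' U Q' (Cmp E U U' Q' i' w') w = Cmp E U' Q Q' t' (Cmp E U' U Q i w)"
    unfolding iw' using O M t(2) t'(1) by (simp add: Cmp_assoc)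
  also have "\<dots> = Cmp E U' Q' Q' (Cmp E Q' Q Q' t' t) i'" unfolding iw using O M t(1) t'(1) by (simp add: Cmp_assoc)
  also have "\<dots> \<ominus>\<^bsub>Hom E U' Q'\<^esub> i' = Cmp E U' Q' Q' ?t i'" using O M t(1) t'(1) by (simp add: Cmp_minus_left)
  finally have "?w \<in> projI U' U'" using syzygy_null[OF Q' c' _ pt0] O t t' by simp
  then show ?thesis unfolding stable_retract_def using O t(2) t'(2) by blast
qed

text \<open>Lifting the biproduct maps writes the identity of U, up to maps through projectives, as
  a sum of maps through U1 and U2. If the functor vanished at both, every h : U \<rightarrow> Z
  would represent zero.\<close>

lemma syzygy_biproduct:
  assumes b: "biproduct V1 V2 V s1 s2 r1 r2"
    and Q: "projective E Q" and c: "conflation E U i Q p V"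
    and Q1: "projective E Q1" and c1: "conflation E U1 i1 Q1 p1 V1"
    and Q2: "projective E Q2" and c2: "conflation E U2 i2 Q2 p2 V2"
    and d: "conflation E X f Y g Z" and n: "image_of Y g Z U \<noteq> Mor E U Z"
  shows "image_of Y g Z U1 \<noteq> Mor E U1 Z \<or> image_of Y g Z U2 \<noteq> Mor E U2 Z"
proof (rule ccontr)
  assume "\<not> ?thesis"
  then have im: "image_of Y g Z U1 = Mor E U1 Z" "image_of Y g Z U2 = Mor E U2 Z" by auto
  have O: "U \<in> Ob E" "Q \<in> Ob E" "V \<in> Ob E" "U1 \<in> Ob E" "Q1 \<in> Ob E" "V1 \<in> Ob E" "U2 \<in> Ob E" "Q2 \<in> Ob E" "V2 \<in> Ob E"
    "Y \<in> Ob E" "Z \<in> Ob E"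
    using conflation_objects[OF c] conflation_objects[OF c1] conflation_objects[OF c2] conflation_objects[OF d] by auto
  have M: "i \<in> Mor E U Q" "p \<in> Mor E Q V" "i1 \<in> Mor E U1 Q1" "p1 \<in> Mor E Q1 V1" "i2 \<in> Mor E U2 Q2" "p2 \<in> Mor E Q2 V2"
    "g \<in> Mor E Y Z"
    using conflation_morphisms[OF c] conflation_morphisms[OF c1] conflation_morphisms[OF c2] conflation_morphisms[OF d] by auto
  have B: "s1 \<in> Mor E V1 V" "s2 \<in> Mor E V2 V" "r1 \<in> Mor E V V1" "r2 \<in> Mor E V V2"
    and sum: "Cmp E V V1 V s1 r1 \<oplus>\<^bsub>Hom E V V\<^esub> Cmp E V V2 V s2 r2 = Idm E V"
    using b by (auto simp: biproduct_def)
  obtain t1 w1 where t1: "t1 \<in> Mor E Q1 Q" "w1 \<in> Mor E U1 U" and pt1: "Cmp E Q1 Q V p t1 = Cmp E Q1 V1 V s1 p1"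
    and iw1: "Cmp E U1 U Q i w1 = Cmp E U1 Q1 Q t1 i1" by (rule syzygy_lift[OF Q1 c1 c B(1)])
  obtain t2 w2 where t2: "t2 \<in> Mor E Q2 Q" "w2 \<in> Mor E U2 U" and pt2: "Cmp E Q2 Q V p t2 = Cmp E Q2 V2 V s2 p2"
    and iw2: "Cmp E U2 U Q i w2 = Cmp E U2 Q2 Q t2 i2" by (rule syzygy_lift[OF Q2 c2 c B(2)])
  obtain t1' w1' where t1': "t1' \<in> Mor E Q Q1" "w1' \<in> Mor E U U1" and pt1': "Cmp E Q Q1 V1 p1 t1' = Cmp E Q V V1 r1 p"
    and iw1': "Cmp E U U1 Q1 i1 w1' = Cmp E U Q Q1 t1' i" by (rule syzygy_lift[OF Q c c1 B(3)])
  obtain t2' w2' where t2': "t2' \<in> Mor E Q Q2" "w2' \<in> Mor E U U2" and pt2': "Cmp E Q Q2 V2 p2 t2' = Cmp E Q V V2 r2 p"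
    and iw2': "Cmp E U U2 Q2 i2 w2' = Cmp E U Q Q2 t2' i" by (rule syzygy_lift[OF Q c c2 B(4)])
  have half_p: "Cmp E Q Q V p (Cmp E Q Q' Q t t') = Cmp E Q V V (Cmp E V V' V s r) p"
    if "Q' \<in> Ob E" "V' \<in> Ob E" "t \<in> Mor E Q' Q" "t' \<in> Mor E Q Q'" "s \<in> Mor E V' V" "r \<in> Mor E V V'" "p' \<in> Mor E Q' V'"
      and 1: "Cmp E Q' Q V p t = Cmp E Q' V' V s p'" and 2: "Cmp E Q Q' V' p' t' = Cmp E Q V V' r p" for Q' V' t t' s r p'
  proof -
    have "Cmp E Q Q V p (Cmp E Q Q' Q t t') = Cmp E Q Q' V (Cmp E Q' Q V p t) t'" using O M that(1-7) by (simp add: Cmp_assoc)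
    also have "\<dots> = Cmp E Q V' V s (Cmp E Q Q' V' p' t')" unfolding 1 using O M that(1-7) by (simp add: Cmp_assoc)
    also have "\<dots> = Cmp E Q V V (Cmp E V V' V s r) p" unfolding 2 using O M that(1-7) by (simp add: Cmp_assoc)
    finally show ?thesis .
  qed
  have half_i: "Cmp E U U Q i (Cmp E U U' U w w') = Cmp E U Q Q (Cmp E Q Q' Q t t') i"
    if "Q' \<in> Ob E" "U' \<in> Ob E" "t \<in> Mor E Q' Q" "t' \<in> Mor E Q Q'" "w \<in> Mor E U' U" "w' \<in> Mor E U U'" "i' \<in> Mor E U' Q'"
      and 1: "Cmp E U' U Q i w = Cmp E U' Q' Q t i'" and 2: "Cmp E U U' Q' i' w' = Cmp E U Q Q' t' i" for Q' U' t t' w w' i'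
  proof -
    have "Cmp E U U Q i (Cmp E U U' U w w') = Cmp E U U' Q (Cmp E U' U Q i w) w'" using O M that(1-7) by (simp add: Cmp_assoc)
    also have "\<dots> = Cmp E U Q' Q t (Cmp E U U' Q' i' w')" unfolding 1 using O M that(1-7) by (simp add: Cmp_assoc)
    also have "\<dots> = Cmp E U Q Q (Cmp E Q Q' Q t t') i" unfolding 2 using O M that(1-7) by (simp add: Cmp_assoc)
    finally show ?thesis .
  qed
  let ?T = "Cmp E Q Q1 Q t1 t1' \<oplus>\<^bsub>Hom E Q Q\<^esub> Cmp E Q Q2 Q t2 t2'" and ?W = "Cmp E U U1 U w1 w1' \<oplus>\<^bsub>Hom E U U\<^esub> Cmp E U U2 U w2 w2'"
  have TW: "?T \<in> Mor E Q Q" "?W \<in> Mor E U U" using O t1 t2 t1' t2' by simp_all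
  have "Cmp E Q Q V p ?T = Cmp E Q V V (Cmp E V V1 V s1 r1 \<oplus>\<^bsub>Hom E V V\<^esub> Cmp E V V2 V s2 r2) p"
    using half_p[OF O(5,6) t1(1) t1'(1) B(1,3) M(4) pt1 pt1'] half_p[OF O(8,9) t2(1) t2'(1) B(2,4) M(6) pt2 pt2']
      O M t1 t2 t1' t2' B by (simp add: Cmp_add_right Cmp_add_left)
  then have "Cmp E Q Q V p ?T = p" unfolding sum using O M by simp
  then have pT: "Cmp E Q Q V p (?T \<ominus>\<^bsub>Hom E Q Q\<^esub> Idm E Q) = zmor E Q V"
    using O M TW by (simp add: Cmp_minus_right)
  have "Cmp E U U Q i ?W = Cmp E U Q Q ?T i"
    using half_i[OF O(5,4) t1(1) t1'(1) t1(2) t1'(2) M(3) iw1 iw1'] half_i[OF O(8,7) t2(1) t2'(1) t2(2) t2'(2) M(5) iw2 iw2']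
      O M t1 t2 t1' t2' by (simp add: Cmp_add_right Cmp_add_left)
  then have "Cmp E U U Q i (?W \<ominus>\<^bsub>Hom E U U\<^esub> Idm E U) = Cmp E U Q Q (?T \<ominus>\<^bsub>Hom E Q Q\<^esub> Idm E Q) i"
    using O M TW by (simp add: Cmp_minus_right Cmp_minus_left)
  then have WI: "?W \<ominus>\<^bsub>Hom E U U\<^esub> Idm E U \<in> projI U U" using syzygy_null[OF Q c _ pT] O TW by simp
  have sub: "submodule (image_of Y g Z U) R (Hom E U Z)" using submodule_image_of[OF O(1,10,11) M(7)] .
  have all: "h \<in> image_of Y g Z U" if h: "h \<in> Mor E U Z" for h
  proof (rule image_of_projI_cong[OF d O(1) TW(2) WI h])
    have a: "Cmp E U U1 Z (Cmp E U1 U Z h w1) w1' \<in> image_of Y g Z U"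
      using image_of_precomp[OF O(10,11) M(7) O(1,4) t1'(2)] im(1) O h t1 by simp
    have b: "Cmp E U U2 Z (Cmp E U2 U Z h w2) w2' \<in> image_of Y g Z U"
      using image_of_precomp[OF O(10,11) M(7) O(1,7) t2'(2)] im(2) O h t2 by simp
    have "Cmp E U U Z h ?W = Cmp E U U1 Z (Cmp E U1 U Z h w1) w1' \<oplus>\<^bsub>Hom E U Z\<^esub> Cmp E U U2 Z (Cmp E U2 U Z h w2) w2'"
      using O h t1 t2 t1' t2' by (simp add: Cmp_add_right Cmp_assoc)
    then show "Cmp E U U Z h ?W \<in> image_of Y g Z U"
      using module.sm_add[OF Hom_module[OF O(1,11)] sub a b] by simp
  qed
  have "image_of Y g Z U \<subseteq> Mor E U Z" unfolding image_of_def using O M by auto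
  then have "image_of Y g Z U = Mor E U Z" using all by (metis subsetI subset_antisym)
  then show False using n by contradiction
qed

lemma projective_image_of:
  assumes d: "conflation E X f Y g Z" and U: "projective E U" shows "image_of Y g Z U = Mor E U Z"
proof
  have O: "Y \<in> Ob E" "Z \<in> Ob E" "g \<in> Mor E Y Z" "U \<in> Ob E"
    using conflation_objects[OF d] conflation_morphisms[OF d] projective_Ob[OF U] by auto
  show "image_of Y g Z U \<subseteq> Mor E U Z" unfolding image_of_def using O by auto
  show "Mor E U Z \<subseteq> image_of Y g Z U"
  proof
    fix h assume h: "h \<in> Mor E U Z"
    then have "Cmp E U U Z h (Idm E U) \<in> projI U Z" using O by (intro projI_I[OF U]) auto
    then show "h \<in> image_of Y g Z U" using projI_image_of[OF d O(4)] h O by simp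
  qed
qed

text \<open>Passing from V to U = \<Omega>V: the test objects are the detecting W and one syzygy of
  each. Krull-Schmidt induction on V reduces to indecomposable V, where a summand W of V is all of
  V. The found A is required to be nonprojective so that it is nonzero in the stable
  category.\<close>

lemma finite_test_set:
  assumes tensor: "tensor_rat (AR_group E) = tensor_rat (Ex_group E)" and d: "conflation E X f Y g Z"
  shows "\<exists>T. finite T \<and> T \<subseteq> Ob E \<and>
    (\<forall>U i Q p V. projective E Q \<longrightarrow> conflation E U i Q p V \<longrightarrow> image_of Y g Z U \<noteq> Mor E U Z \<longrightarrow>
      (\<exists>A\<in>T. \<not> projective E A \<and> stable_retract A U))"
proof -
  obtain S where S: "finite S" "\<And>W. W \<in> S \<Longrightarrow> indecomposable E W" "\<And>W. W \<in> S \<Longrightarrow> \<not> projective E W"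
    and det: "\<And>U i Q p V. \<lbrakk>projective E Q; conflation E U i Q p V; image_of Y g Z U \<noteq> Mor E U Z\<rbrakk> \<Longrightarrow>
      \<exists>W\<in>S. retract W V \<or> retract W U"
    using finite_detection[OF tensor d] by blast
  have SO: "S \<subseteq> Ob E" using S(2) by (auto simp: indecomposable_def)
  have "\<forall>W\<in>Ob E. \<exists>U. \<exists>i Q p. projective E Q \<and> conflation E U i Q p W" using projective_cover by metis
  then obtain om where om: "\<And>W. W \<in> Ob E \<Longrightarrow> \<exists>i Q p. projective E Q \<and> conflation E (om W) i Q p W" by metis
  define T where "T = S \<union> om ` S"
  have TO: "T \<subseteq> Ob E" unfolding T_def using SO om conflation_objects by blast
  have main: "\<forall>U i Q p. projective E Q \<longrightarrow> conflation E U i Q p V \<longrightarrow> image_of Y g Z U \<noteq> Mor E U Z \<longrightarrow>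
      (\<exists>A\<in>T. \<not> projective E A \<and> stable_retract A U)" if "V \<in> Ob E" for V
    using that
  proof (induction V rule: krull_schmidt_induct)
    case (zero V)
    show ?case
    proof (intro allI impI)
      fix U i Q p assume Q: "projective E Q" and c: "conflation E U i Q p V" and n: "image_of Y g Z U \<noteq> Mor E U Z"
      have O: "U \<in> Ob E" "Q \<in> Ob E" "V \<in> Ob E" "i \<in> Mor E U Q" "p \<in> Mor E Q V"
        using conflation_objects[OF c] conflation_morphisms[OF c] by auto
      \<comment> \<open>As p = 0, the identity of Q lifts through its kernel i, so U is a summand of
        Q, hence projective, and the functor vanishes there.\<close>
      have "p = zmor E Q V" using zero O zero_object_iff by blast
      then obtain e where e: "e \<in> Mor E Q U" "Cmp E Q U Q i e = Idm E Q"
        using conflation_lift[OF c O(2), of "Idm E Q"] O by auto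
      have "Cmp E U U Q i (Cmp E U Q U e i) = Cmp E U Q Q (Cmp E Q U Q i e) i" using O e(1) by (simp add: Cmp_assoc)
      then have "Cmp E U U Q i (Cmp E U Q U e i) = Cmp E U U Q i (Idm E U)" unfolding e(2) using O by simp
      then have "Cmp E U Q U e i = Idm E U" using conflation_mono[OF c O(1)] O e(1) by simp
      then have "retract U Q" unfolding retract_def using O e(1) by blast
      then have "projective E U" using projective_retract Q by blast
      then show "\<exists>A\<in>T. \<not> projective E A \<and> stable_retract A U" using projective_image_of[OF d] n by blast
    qed
  next
    case (indecomposable V)
    show ?case
    proof (intro allI impI)
      fix U i Q p assume Q: "projective E Q" and c: "conflation E U i Q p V" and n: "image_of Y g Z U \<noteq> Mor E U Z"
      obtain W where W: "W \<in> S" "retract W V \<or> retract W U" using det[OF Q c n] by blast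
      show "\<exists>A\<in>T. \<not> projective E A \<and> stable_retract A U"
      proof (cases "retract W U")
        case True
        then show ?thesis using W S(3) retract_imp_stable unfolding T_def by blast
      next
        case False
        then have WV: "retract W V" using W by blast
        have nz: "\<not> zero_object E W" using S(2)[OF W(1)] by (simp add: indecomposable_def)
        have OW: "W \<in> Ob E" "V \<in> Ob E" using WV by (auto simp: retract_def)
        have "isomorphic E W V" using indecomposable_retract_isomorphic[OF indecomposable nz WV] .
        then have VW: "retract V W" using isomorphic_retract OW isomorphic_sym by blast
        obtain i' Q' p' where Q': "projective E Q'" and c': "conflation E (om W) i' Q' p' W" using om OW by blast
        have 1: "stable_retract (om W) U" by (rule syzygy_retract[OF Q c Q' c' WV])
        have 2: "stable_retract U (om W)" by (rule syzygy_retract[OF Q' c' Q c VW])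
        \<comment> \<open>The functor vanishes on projectives, so U is not projective; as U is also
          a stable retract of \<open>om W\<close>, the test object \<open>om W\<close> is not
          projective either.\<close>
        have "\<not> projective E U" using projective_image_of[OF d] n by blast
        then have "\<not> projective E (om W)" using stable_retract_projective[OF 2] by blast
        then show ?thesis using 1 W unfolding T_def by blast
      qed
    qed
  next
    case (sum V1 V2 V)
    show ?case
    proof (intro allI impI)
      fix U i Q p assume Q: "projective E Q" and c: "conflation E U i Q p V" and n: "image_of Y g Z U \<noteq> Mor E U Z"
      obtain s1 s2 r1 r2 where b: "biproduct V1 V2 V s1 s2 r1 r2" using sum(1) direct_sum_pair_iff by blast
      then have OV: "V1 \<in> Ob E" "V2 \<in> Ob E" by (auto simp: biproduct_def)
      obtain i1 Q1 p1 where 1: "projective E Q1" "conflation E (om V1) i1 Q1 p1 V1" using om OV by blast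
      obtain i2 Q2 p2 where 2: "projective E Q2" "conflation E (om V2) i2 Q2 p2 V2" using om OV by blast
      have "stable_retract (om V1) U" "stable_retract (om V2) U"
        using syzygy_retract[OF Q c 1 biproduct_retract(1)[OF b]] syzygy_retract[OF Q c 2 biproduct_retract(2)[OF b]] .
      moreover have "image_of Y g Z (om V1) \<noteq> Mor E (om V1) Z \<or> image_of Y g Z (om V2) \<noteq> Mor E (om V2) Z"
        by (rule syzygy_biproduct[OF b Q c 1 2 d n])
      ultimately show "\<exists>A\<in>T. \<not> projective E A \<and> stable_retract A U"
        using sum(2,3) 1 2 stable_retract_trans by blast
    qed
  qed
  show ?thesis
  proof (intro exI[of _ T] conjI allI impI)
    show "finite T" unfolding T_def using S(1) by simp
    fix U i Q p V assume "projective E Q" and c: "conflation E U i Q p V" and "image_of Y g Z U \<noteq> Mor E U Z"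
    then show "\<exists>A\<in>T. \<not> projective E A \<and> stable_retract A U" using main conflation_objects[OF c] by metis
  qed (rule TO)
qed

end

section \<open>The stable category\<close>

context module
begin

lemma coset_mem:
  assumes N: "submodule N R M" and f: "f \<in> carrier M"
  shows "x \<in> N +>\<^bsub>M\<^esub> f \<longleftrightarrow> x \<in> carrier M \<and> x \<ominus>\<^bsub>M\<^esub> f \<in> N"
proof
  assume "x \<in> N +>\<^bsub>M\<^esub> f"
  then obtain n where n: "n \<in> N" "x = n \<oplus>\<^bsub>M\<^esub> f" by (auto simp: a_r_coset_def')
  then have "n \<in> carrier M" using sm_carrier[OF N] by blast
  then show "x \<in> carrier M \<and> x \<ominus>\<^bsub>M\<^esub> f \<in> N" using n f M.add_minus_cancel(3)[of f n] by simp
next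
  assume x: "x \<in> carrier M \<and> x \<ominus>\<^bsub>M\<^esub> f \<in> N"
  then have "x = (x \<ominus>\<^bsub>M\<^esub> f) \<oplus>\<^bsub>M\<^esub> f" using f M.add_minus_cancel(2)[of f x] by simp
  then show "x \<in> N +>\<^bsub>M\<^esub> f" unfolding a_r_coset_def' using x by blast
qed

lemma minus_chain:
  assumes "x \<in> carrier M" "y \<in> carrier M" "z \<in> carrier M"
  shows "(x \<ominus>\<^bsub>M\<^esub> y) \<oplus>\<^bsub>M\<^esub> (y \<ominus>\<^bsub>M\<^esub> z) = x \<ominus>\<^bsub>M\<^esub> z"
  using assms by (simp add: M.minus_eq M.a_assoc M.r_neg1 M.r_neg2)

lemma minus_swap: "\<lbrakk>x \<in> carrier M; y \<in> carrier M\<rbrakk> \<Longrightarrow> \<ominus>\<^bsub>M\<^esub> (x \<ominus>\<^bsub>M\<^esub> y) = y \<ominus>\<^bsub>M\<^esub> x"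
  by (simp add: M.minus_eq M.minus_add M.a_comm)

lemma coset_self: "\<lbrakk>submodule N R M; f \<in> carrier M\<rbrakk> \<Longrightarrow> f \<in> N +>\<^bsub>M\<^esub> f"
  by (simp add: coset_mem M.minus_self sm_zero)

lemma coset_eq_iff:
  assumes N: "submodule N R M" and f: "f \<in> carrier M" and g: "g \<in> carrier M"
  shows "N +>\<^bsub>M\<^esub> f = N +>\<^bsub>M\<^esub> g \<longleftrightarrow> f \<ominus>\<^bsub>M\<^esub> g \<in> N"
proof
  assume "N +>\<^bsub>M\<^esub> f = N +>\<^bsub>M\<^esub> g"
  then show "f \<ominus>\<^bsub>M\<^esub> g \<in> N" using coset_self[OF N f] coset_mem[OF N g] by blast
next
  assume fg: "f \<ominus>\<^bsub>M\<^esub> g \<in> N"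
  then have gf: "g \<ominus>\<^bsub>M\<^esub> f \<in> N" using sm_neg[OF N fg] minus_swap[OF f g] by simp
  have "x \<ominus>\<^bsub>M\<^esub> f \<in> N \<longleftrightarrow> x \<ominus>\<^bsub>M\<^esub> g \<in> N" if x: "x \<in> carrier M" for x
    using minus_chain[OF x f g] minus_chain[OF x g f] fg gf sm_add[OF N] by metis
  then show "N +>\<^bsub>M\<^esub> f = N +>\<^bsub>M\<^esub> g" using coset_mem[OF N f] coset_mem[OF N g] by blast
qed

lemma coset_add:
  assumes N: "submodule N R M" and f: "f \<in> carrier M" and g: "g \<in> carrier M"
  shows "(N +>\<^bsub>M\<^esub> f) <+>\<^bsub>M\<^esub> (N +>\<^bsub>M\<^esub> g) = N +>\<^bsub>M\<^esub> (f \<oplus>\<^bsub>M\<^esub> g)"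
proof
  have *: "(x \<oplus>\<^bsub>M\<^esub> y) \<ominus>\<^bsub>M\<^esub> (f \<oplus>\<^bsub>M\<^esub> g) = (x \<ominus>\<^bsub>M\<^esub> f) \<oplus>\<^bsub>M\<^esub> (y \<ominus>\<^bsub>M\<^esub> g)" if "x \<in> carrier M" "y \<in> carrier M" for x y
    using that f g by (simp add: M.minus_eq M.minus_add M.a_ac)
  show "(N +>\<^bsub>M\<^esub> f) <+>\<^bsub>M\<^esub> (N +>\<^bsub>M\<^esub> g) \<subseteq> N +>\<^bsub>M\<^esub> (f \<oplus>\<^bsub>M\<^esub> g)"
  proof
    fix z assume "z \<in> (N +>\<^bsub>M\<^esub> f) <+>\<^bsub>M\<^esub> (N +>\<^bsub>M\<^esub> g)"
    then obtain x y where xy: "x \<in> N +>\<^bsub>M\<^esub> f" "y \<in> N +>\<^bsub>M\<^esub> g" "z = x \<oplus>\<^bsub>M\<^esub> y" unfolding mem_msum by blast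
    then have "x \<in> carrier M" "y \<in> carrier M" "x \<ominus>\<^bsub>M\<^esub> f \<in> N" "y \<ominus>\<^bsub>M\<^esub> g \<in> N"
      using coset_mem[OF N f] coset_mem[OF N g] by blast+
    then show "z \<in> N +>\<^bsub>M\<^esub> (f \<oplus>\<^bsub>M\<^esub> g)" using coset_mem[OF N, of "f \<oplus>\<^bsub>M\<^esub> g" z] f g *[of x y] sm_add[OF N] xy(3) by simp
  qed
  show "N +>\<^bsub>M\<^esub> (f \<oplus>\<^bsub>M\<^esub> g) \<subseteq> (N +>\<^bsub>M\<^esub> f) <+>\<^bsub>M\<^esub> (N +>\<^bsub>M\<^esub> g)"
  proof
    fix z assume "z \<in> N +>\<^bsub>M\<^esub> (f \<oplus>\<^bsub>M\<^esub> g)"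
    then obtain n where n: "n \<in> N" "z = n \<oplus>\<^bsub>M\<^esub> (f \<oplus>\<^bsub>M\<^esub> g)" by (auto simp: a_r_coset_def')
    then have nc: "n \<in> carrier M" using sm_carrier[OF N] by blast
    have "z = (n \<oplus>\<^bsub>M\<^esub> f) \<oplus>\<^bsub>M\<^esub> g" using n nc f g by (simp add: M.a_assoc)
    moreover have "n \<oplus>\<^bsub>M\<^esub> f \<in> N +>\<^bsub>M\<^esub> f" using n by (auto simp: a_r_coset_def')
    ultimately show "z \<in> (N +>\<^bsub>M\<^esub> f) <+>\<^bsub>M\<^esub> (N +>\<^bsub>M\<^esub> g)" unfolding mem_msum using coset_self[OF N g] by blast
  qed
qed

lemma coset_zero: "submodule N R M \<Longrightarrow> N +>\<^bsub>M\<^esub> \<zero>\<^bsub>M\<^esub> = N"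
  using coset_mem[of N "\<zero>\<^bsub>M\<^esub>"] sm_carrier M.minus_zero_right by auto

definition quotient_smult :: "'c set \<Rightarrow> 'a \<Rightarrow> 'c set \<Rightarrow> 'c set"
  where "quotient_smult N r A = (\<Union>a\<in>A. N +>\<^bsub>M\<^esub> (r \<odot>\<^bsub>M\<^esub> a))"

lemma coset_smult:
  assumes N: "submodule N R M" and f: "f \<in> carrier M" and r: "r \<in> carrier R"
  shows "quotient_smult N r (N +>\<^bsub>M\<^esub> f) = N +>\<^bsub>M\<^esub> (r \<odot>\<^bsub>M\<^esub> f)"
proof -
  have "N +>\<^bsub>M\<^esub> (r \<odot>\<^bsub>M\<^esub> a) = N +>\<^bsub>M\<^esub> (r \<odot>\<^bsub>M\<^esub> f)" if a: "a \<in> N +>\<^bsub>M\<^esub> f" for a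
  proof -
    have a: "a \<in> carrier M" "a \<ominus>\<^bsub>M\<^esub> f \<in> N" using coset_mem[OF N f] a by blast+
    have "r \<odot>\<^bsub>M\<^esub> a \<ominus>\<^bsub>M\<^esub> r \<odot>\<^bsub>M\<^esub> f = r \<odot>\<^bsub>M\<^esub> (a \<ominus>\<^bsub>M\<^esub> f)"
      using a(1) f r by (simp add: M.minus_eq smult_r_distr smult_r_minus)
    then show ?thesis using coset_eq_iff[OF N, of "r \<odot>\<^bsub>M\<^esub> a" "r \<odot>\<^bsub>M\<^esub> f"] a f r sm_smult[OF N r a(2)] by simp
  qed
  then show ?thesis unfolding quotient_smult_def using coset_self[OF N f] by blast
qed

lemma rcosets_iff: "A \<in> a_rcosets\<^bsub>M\<^esub> N \<longleftrightarrow> (\<exists>f\<in>carrier M. A = N +>\<^bsub>M\<^esub> f)"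
  by (auto simp: A_RCOSETS_def')

text \<open>Q is described by its fields because the Hom records of \<open>quotient_category\<close>
  leave \<open>mult\<close> and \<open>one\<close> undefined.\<close>

lemma quotient_module:
  assumes N: "submodule N R M"
    and Q: "carrier Q = a_rcosets\<^bsub>M\<^esub> N" "\<zero>\<^bsub>Q\<^esub> = N" "ring.add Q = (\<lambda>A B. A <+>\<^bsub>M\<^esub> B)" "smult Q = quotient_smult N"
  shows "module R Q"
proof -
  have rep: "\<exists>f\<in>carrier M. A = N +>\<^bsub>M\<^esub> f" if "A \<in> carrier Q" for A using that Q(1) rcosets_iff by simp
  have cl: "N +>\<^bsub>M\<^esub> f \<in> carrier Q" if "f \<in> carrier M" for f using that Q(1) rcosets_iff by auto
  have zero: "\<zero>\<^bsub>Q\<^esub> = N +>\<^bsub>M\<^esub> \<zero>\<^bsub>M\<^esub>" using Q(2) coset_zero[OF N] by simp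
  have add: "(N +>\<^bsub>M\<^esub> f) \<oplus>\<^bsub>Q\<^esub> (N +>\<^bsub>M\<^esub> g) = N +>\<^bsub>M\<^esub> (f \<oplus>\<^bsub>M\<^esub> g)" if "f \<in> carrier M" "g \<in> carrier M" for f g
    using Q(3) coset_add[OF N that] by simp
  have sm: "r \<odot>\<^bsub>Q\<^esub> (N +>\<^bsub>M\<^esub> f) = N +>\<^bsub>M\<^esub> (r \<odot>\<^bsub>M\<^esub> f)" if "f \<in> carrier M" "r \<in> carrier R" for f r
    using Q(4) coset_smult[OF N that] by simp
  have ag: "abelian_group Q"
  proof (rule abelian_groupI)
    fix A B assume A: "A \<in> carrier Q" and B: "B \<in> carrier Q"
    obtain f g where fg: "f \<in> carrier M" "g \<in> carrier M" "A = N +>\<^bsub>M\<^esub> f" "B = N +>\<^bsub>M\<^esub> g" using rep A B by blast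
    show "A \<oplus>\<^bsub>Q\<^esub> B \<in> carrier Q" using fg add cl by simp
    show "A \<oplus>\<^bsub>Q\<^esub> B = B \<oplus>\<^bsub>Q\<^esub> A" using fg add M.a_comm by simp
    fix D assume "D \<in> carrier Q"
    then obtain h where h: "h \<in> carrier M" "D = N +>\<^bsub>M\<^esub> h" using rep by blast
    show "A \<oplus>\<^bsub>Q\<^esub> B \<oplus>\<^bsub>Q\<^esub> D = A \<oplus>\<^bsub>Q\<^esub> (B \<oplus>\<^bsub>Q\<^esub> D)" using fg h add M.a_assoc by simp
  next
    show "\<zero>\<^bsub>Q\<^esub> \<in> carrier Q" using zero cl by simp
    fix A assume A: "A \<in> carrier Q"
    obtain f where f: "f \<in> carrier M" "A = N +>\<^bsub>M\<^esub> f" using rep A by blast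
    show "\<zero>\<^bsub>Q\<^esub> \<oplus>\<^bsub>Q\<^esub> A = A" using f zero add by simp
    have "(N +>\<^bsub>M\<^esub> (\<ominus>\<^bsub>M\<^esub> f)) \<oplus>\<^bsub>Q\<^esub> A = \<zero>\<^bsub>Q\<^esub>" using f zero add by (simp add: M.l_neg)
    then show "\<exists>B\<in>carrier Q. B \<oplus>\<^bsub>Q\<^esub> A = \<zero>\<^bsub>Q\<^esub>" using cl f by blast
  qed
  show ?thesis
  proof (rule moduleI[OF R.cring_axioms ag])
    fix r A assume r: "r \<in> carrier R" and A: "A \<in> carrier Q"
    obtain f where f: "f \<in> carrier M" "A = N +>\<^bsub>M\<^esub> f" using rep A by blast
    show "r \<odot>\<^bsub>Q\<^esub> A \<in> carrier Q" using f sm r cl by simp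
    fix s assume s: "s \<in> carrier R"
    show "(r \<oplus> s) \<odot>\<^bsub>Q\<^esub> A = r \<odot>\<^bsub>Q\<^esub> A \<oplus>\<^bsub>Q\<^esub> s \<odot>\<^bsub>Q\<^esub> A" using f sm r s add by (simp add: smult_l_distr)
    show "(r \<otimes> s) \<odot>\<^bsub>Q\<^esub> A = r \<odot>\<^bsub>Q\<^esub> (s \<odot>\<^bsub>Q\<^esub> A)" using f sm r s by (simp add: smult_assoc1)
  next
    fix r A B assume r: "r \<in> carrier R" and A: "A \<in> carrier Q" and B: "B \<in> carrier Q"
    obtain f g where fg: "f \<in> carrier M" "g \<in> carrier M" "A = N +>\<^bsub>M\<^esub> f" "B = N +>\<^bsub>M\<^esub> g" using rep A B by blast
    show "r \<odot>\<^bsub>Q\<^esub> (A \<oplus>\<^bsub>Q\<^esub> B) = r \<odot>\<^bsub>Q\<^esub> A \<oplus>\<^bsub>Q\<^esub> r \<odot>\<^bsub>Q\<^esub> B" using fg sm r add by (simp add: smult_r_distr)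
  next
    fix A assume A: "A \<in> carrier Q"
    obtain f where f: "f \<in> carrier M" "A = N +>\<^bsub>M\<^esub> f" using rep A by blast
    show "\<one> \<odot>\<^bsub>Q\<^esub> A = A" using f sm by simp
  qed
qed

end

section \<open>Stable morphisms as cosets, and stable summands\<close>

context ar_category
begin

abbreviation st where "st \<equiv> stable_category E"

definition cl :: "'o \<Rightarrow> 'o \<Rightarrow> 'm \<Rightarrow> 'm set"
  where "cl X Y f = projI X Y +>\<^bsub>Hom E X Y\<^esub> f"

lemma st_Ob [simp]: "Ob st = Ob E"
  by (simp add: stable_category_def quotient_category_def)

lemma st_zero: "zmor st X Y = projI X Y"
  by (simp add: stable_category_def quotient_category_def)

lemma st_Idm: "Idm st X = cl X X (Idm E X)"
  by (simp add: stable_category_def quotient_category_def cl_def)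

lemma module_st_Hom: "\<lbrakk>X \<in> Ob E; Y \<in> Ob E\<rbrakk> \<Longrightarrow> module R (Hom st X Y)"
proof -
  assume O: "X \<in> Ob E" "Y \<in> Ob E"
  show "module R (Hom st X Y)"
  proof (rule module.quotient_module[OF Hom_module[OF O] submodule_projI[OF O]])
    show "ring.add (Hom st X Y) = (\<lambda>A B. A <+>\<^bsub>Hom E X Y\<^esub> B)"
      by (simp add: stable_category_def quotient_category_def)
    show "smult (Hom st X Y) = module.quotient_smult (Hom E X Y) (projI X Y)"
      unfolding module.quotient_smult_def[OF Hom_module[OF O], abs_def]
      by (simp add: stable_category_def quotient_category_def)
  qed (simp_all add: stable_category_def quotient_category_def)
qed

lemma st_Mor: "\<lbrakk>X \<in> Ob E; Y \<in> Ob E\<rbrakk> \<Longrightarrow> Mor st X Y = cl X Y ` Mor E X Y"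
  by (auto simp: stable_category_def quotient_category_def cl_def A_RCOSETS_def')

lemma st_cl: "\<lbrakk>X \<in> Ob E; Y \<in> Ob E; f \<in> Mor E X Y\<rbrakk> \<Longrightarrow> cl X Y f \<in> Mor st X Y"
  by (simp add: st_Mor)

lemma cl_eq_iff:
  "\<lbrakk>X \<in> Ob E; Y \<in> Ob E; f \<in> Mor E X Y; g \<in> Mor E X Y\<rbrakk> \<Longrightarrow> cl X Y f = cl X Y g \<longleftrightarrow> f \<ominus>\<^bsub>Hom E X Y\<^esub> g \<in> projI X Y"
  unfolding cl_def using module.coset_eq_iff[OF Hom_module submodule_projI] by blast

lemma cl_zero: "\<lbrakk>X \<in> Ob E; Y \<in> Ob E\<rbrakk> \<Longrightarrow> cl X Y (zmor E X Y) = zmor st X Y"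
  unfolding cl_def st_zero using module.coset_zero[OF Hom_module submodule_projI] by blast

lemma cl_eq_zero_iff:
  "\<lbrakk>X \<in> Ob E; Y \<in> Ob E; f \<in> Mor E X Y\<rbrakk> \<Longrightarrow> cl X Y f = zmor st X Y \<longleftrightarrow> f \<in> projI X Y"
  using cl_eq_iff[of X Y f "zmor E X Y"] cl_zero by simp

lemma cl_add:
  "\<lbrakk>X \<in> Ob E; Y \<in> Ob E; f \<in> Mor E X Y; g \<in> Mor E X Y\<rbrakk>
    \<Longrightarrow> cl X Y f \<oplus>\<^bsub>Hom st X Y\<^esub> cl X Y g = cl X Y (f \<oplus>\<^bsub>Hom E X Y\<^esub> g)"
  unfolding cl_def using module.coset_add[OF Hom_module submodule_projI]
  by (simp add: stable_category_def quotient_category_def)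

lemma cl_smult:
  "\<lbrakk>X \<in> Ob E; Y \<in> Ob E; f \<in> Mor E X Y; r \<in> carrier R\<rbrakk>
    \<Longrightarrow> r \<odot>\<^bsub>Hom st X Y\<^esub> cl X Y f = cl X Y (r \<odot>\<^bsub>Hom E X Y\<^esub> f)"
  unfolding cl_def using module.coset_smult[OF Hom_module submodule_projI]
  by (simp add: stable_category_def quotient_category_def module.quotient_smult_def[OF Hom_module])

lemma cl_Cmp:
  assumes O: "X \<in> Ob E" "Y \<in> Ob E" "Z \<in> Ob E" and f: "f \<in> Mor E X Y" and g: "g \<in> Mor E Y Z"
  shows "Cmp st X Y Z (cl Y Z g) (cl X Y f) = cl X Z (Cmp E X Y Z g f)"
proof -
  interpret XZ: module R "Hom E X Z" using O by (intro Hom_module)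
  have "cl X Z (Cmp E X Y Z b a) = cl X Z (Cmp E X Y Z g f)" if b: "b \<in> cl Y Z g" and a: "a \<in> cl X Y f" for b a
  proof -
    have b: "b \<in> Mor E Y Z" "b \<ominus>\<^bsub>Hom E Y Z\<^esub> g \<in> projI Y Z"
      using b module.coset_mem[OF Hom_module submodule_projI] O g unfolding cl_def by blast+
    have a: "a \<in> Mor E X Y" "a \<ominus>\<^bsub>Hom E X Y\<^esub> f \<in> projI X Y"
      using a module.coset_mem[OF Hom_module submodule_projI] O f unfolding cl_def by blast+
    have "Cmp E X Y Z b a \<ominus>\<^bsub>Hom E X Z\<^esub> Cmp E X Y Z g a \<in> projI X Z"
      using projI_precomp[OF O a(1) b(2)] O a(1) b(1) g by (simp add: Cmp_minus_left)
    moreover have "Cmp E X Y Z g a \<ominus>\<^bsub>Hom E X Z\<^esub> Cmp E X Y Z g f \<in> projI X Z"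
      using projI_postcomp[OF O a(2) g] O a(1) f g by (simp add: Cmp_minus_right)
    ultimately have "(Cmp E X Y Z b a \<ominus>\<^bsub>Hom E X Z\<^esub> Cmp E X Y Z g a) \<oplus>\<^bsub>Hom E X Z\<^esub>
        (Cmp E X Y Z g a \<ominus>\<^bsub>Hom E X Z\<^esub> Cmp E X Y Z g f) \<in> projI X Z"
      by (rule XZ.sm_add[OF submodule_projI[OF O(1,3)]])
    then have "Cmp E X Y Z b a \<ominus>\<^bsub>Hom E X Z\<^esub> Cmp E X Y Z g f \<in> projI X Z"
      using XZ.minus_chain[of "Cmp E X Y Z b a" "Cmp E X Y Z g a" "Cmp E X Y Z g f"] O a(1) b(1) f g by simp
    then show ?thesis using cl_eq_iff O a(1) b(1) f g by simp
  qed
  moreover have "g \<in> cl Y Z g" "f \<in> cl X Y f"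
    unfolding cl_def using module.coset_self[OF Hom_module submodule_projI] O f g by blast+
  ultimately have "(\<Union>b\<in>cl Y Z g. \<Union>a\<in>cl X Y f. cl X Z (Cmp E X Y Z b a)) = cl X Z (Cmp E X Y Z g f)" by blast
  then show ?thesis by (simp add: stable_category_def quotient_category_def cl_def)
qed

lemma st_rep:
  assumes "X \<in> Ob E" "Y \<in> Ob E" "F \<in> Mor st X Y" obtains f where "f \<in> Mor E X Y" "F = cl X Y f"
  using assms st_Mor by blast

lemma lin_category_st: "lin_category R st"
proof (rule lin_category.intro)
  show "cring R" by (rule cring_R)
  show "module R (Hom st X Y)" if "X \<in> Ob st" "Y \<in> Ob st" for X Y using that module_st_Hom by simp
  show "Idm st X \<in> Mor st X X" if "X \<in> Ob st" for X using that by (simp add: st_Idm st_cl)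
next
  fix X Y Z F G assume O: "X \<in> Ob st" "Y \<in> Ob st" "Z \<in> Ob st" and F: "F \<in> Mor st X Y" and G: "G \<in> Mor st Y Z"
  then have O: "X \<in> Ob E" "Y \<in> Ob E" "Z \<in> Ob E" by simp_all
  obtain f where f: "f \<in> Mor E X Y" "F = cl X Y f" using F O st_rep by blast
  obtain g where g: "g \<in> Mor E Y Z" "G = cl Y Z g" using G O st_rep by blast
  show "Cmp st X Y Z G F \<in> Mor st X Z" using O f g by (simp add: cl_Cmp st_cl)
  {
    fix W H assume "W \<in> Ob st" and H: "H \<in> Mor st Z W"
    then have W: "W \<in> Ob E" by simp
    obtain h where h: "h \<in> Mor E Z W" "H = cl Z W h" using H O W st_rep by blast
    show "Cmp st X Z W H (Cmp st X Y Z G F) = Cmp st X Y W (Cmp st Y Z W H G) F"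
      using O W f g h by (simp add: cl_Cmp Cmp_assoc)
  }
  {
    fix G' assume G': "G' \<in> Mor st Y Z"
    obtain g' where g': "g' \<in> Mor E Y Z" "G' = cl Y Z g'" using G' O st_rep by blast
    show "Cmp st X Y Z (G \<oplus>\<^bsub>Hom st Y Z\<^esub> G') F = Cmp st X Y Z G F \<oplus>\<^bsub>Hom st X Z\<^esub> Cmp st X Y Z G' F"
      using O f g g' by (simp add: cl_Cmp cl_add Cmp_add_left)
  }
  {
    fix F' assume F': "F' \<in> Mor st X Y"
    obtain f' where f': "f' \<in> Mor E X Y" "F' = cl X Y f'" using F' O st_rep by blast
    show "Cmp st X Y Z G (F \<oplus>\<^bsub>Hom st X Y\<^esub> F') = Cmp st X Y Z G F \<oplus>\<^bsub>Hom st X Z\<^esub> Cmp st X Y Z G F'"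
      using O f f' g by (simp add: cl_Cmp cl_add Cmp_add_right)
  }
  {
    fix r assume r: "r \<in> carrier R"
    show "Cmp st X Y Z (r \<odot>\<^bsub>Hom st Y Z\<^esub> G) F = r \<odot>\<^bsub>Hom st X Z\<^esub> Cmp st X Y Z G F"
      using O f g r by (simp add: cl_Cmp cl_smult Cmp_smult_left)
    show "Cmp st X Y Z G (r \<odot>\<^bsub>Hom st X Y\<^esub> F) = r \<odot>\<^bsub>Hom st X Z\<^esub> Cmp st X Y Z G F"
      using O f g r by (simp add: cl_Cmp cl_smult Cmp_smult_right)
  }
next
  fix X Y F assume O: "X \<in> Ob st" "Y \<in> Ob st" and F: "F \<in> Mor st X Y"
  then have O: "X \<in> Ob E" "Y \<in> Ob E" by simp_all
  obtain f where f: "f \<in> Mor E X Y" "F = cl X Y f" using F O st_rep by blast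
  show "Cmp st X X Y F (Idm st X) = F" "Cmp st X Y Y (Idm st Y) F = F"
    using O f by (simp_all add: st_Idm cl_Cmp)
qed

lemma st_zero_object_iff: "zero_object st X \<longleftrightarrow> projective E X"
proof
  assume z: "zero_object st X"
  then have "X \<in> Ob E" by (simp add: zero_object_def)
  then show "projective E X" using z cl_eq_zero_iff[of X X "Idm E X"] Idm_projI_iff by (simp add: zero_object_def st_Idm)
next
  assume p: "projective E X"
  then have "X \<in> Ob E" by (rule projective_Ob)
  then show "zero_object st X" using p cl_eq_zero_iff[of X X "Idm E X"] Idm_projI_iff by (simp add: zero_object_def st_Idm)
qed

lemma st_isomorphic_retract:
  assumes "X \<in> Ob E" "Y \<in> Ob E" "isomorphic st X Y" shows "stable_retract X Y"
proof -
  obtain F G where FG: "F \<in> Mor st X Y" "G \<in> Mor st Y X" "Cmp st X Y X G F = Idm st X"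
    using assms(3) unfolding isomorphic_def is_iso_def by blast
  obtain f g where f: "f \<in> Mor E X Y" "F = cl X Y f" and g: "g \<in> Mor E Y X" "G = cl Y X g"
    using FG st_rep assms by metis
  have "cl X X (Cmp E X Y X g f) = cl X X (Idm E X)" using FG(3) f g assms by (simp add: cl_Cmp st_Idm)
  then show ?thesis unfolding stable_retract_def using f g assms cl_eq_iff[of X X "Cmp E X Y X g f" "Idm E X"] by auto
qed

text \<open>Since Q is stably zero, i1 and p1 are mutually inverse in the stable category between X
  and Y = X \<oplus> Q. A decomposition of Y in the exact category therefore becomes a stable
  decomposition of X.\<close>

lemma st_biproduct:
  assumes Q: "projective E Q" and w: "biproduct X Q Y i1 i2 p1 p2" and b: "biproduct A B Y j1 j2 q1 q2"
  shows "lin_category.biproduct st A B X (cl A X (Cmp E A Y X p1 j1)) (cl B X (Cmp E B Y X p1 j2))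
    (cl X A (Cmp E X Y A q1 i1)) (cl X B (Cmp E X Y B q2 i1))"
proof -
  interpret S: lin_category R st by (rule lin_category_st)
  have QO: "Q \<in> Ob E" by (rule projective_Ob[OF Q])
  have O: "X \<in> Ob E" "Y \<in> Ob E" "A \<in> Ob E" "B \<in> Ob E" and M: "i1 \<in> Mor E X Y" "i2 \<in> Mor E Q Y" "p1 \<in> Mor E Y X" "p2 \<in> Mor E Y Q"
    "j1 \<in> Mor E A Y" "j2 \<in> Mor E B Y" "q1 \<in> Mor E Y A" "q2 \<in> Mor E Y B"
    and e: "Cmp E X Y X p1 i1 = Idm E X"
    and sumQ: "Cmp E Y X Y i1 p1 \<oplus>\<^bsub>Hom E Y Y\<^esub> Cmp E Y Q Y i2 p2 = Idm E Y"
    and r: "Cmp E A Y A q1 j1 = Idm E A" "Cmp E B Y B q2 j2 = Idm E B" "Cmp E B Y A q1 j2 = zmor E B A"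
      "Cmp E A Y B q2 j1 = zmor E A B"
    and sum: "Cmp E Y A Y j1 q1 \<oplus>\<^bsub>Hom E Y Y\<^esub> Cmp E Y B Y j2 q2 = Idm E Y"
    using w b by (auto simp: biproduct_def)
  \<comment> \<open>Inserting i1 p1 between q and j changes q j only by a map through Q, because i1
    p1 + i2 p2 is the identity.\<close>
  have key: "Cmp st D X D' (cl X D' (Cmp E X Y D' q i1)) (cl D X (Cmp E D Y X p1 j)) = cl D D' (Cmp E D Y D' q j)"
    if D: "D \<in> Ob E" "D' \<in> Ob E" "j \<in> Mor E D Y" "q \<in> Mor E Y D'" for D D' j q
  proof -
    let ?c = "Cmp E D X D' (Cmp E X Y D' q i1) (Cmp E D Y X p1 j)"
    have cc: "?c \<in> Mor E D D'" using D O M by simp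
    interpret DD: module R "Hom E D D'" using D by (intro Hom_module)
    have "Cmp E D Y D' q (Cmp E D Y Y (Cmp E Y X Y i1 p1 \<oplus>\<^bsub>Hom E Y Y\<^esub> Cmp E Y Q Y i2 p2) j) =
        ?c \<oplus>\<^bsub>Hom E D D'\<^esub> Cmp E D Q D' (Cmp E Q Y D' q i2) (Cmp E D Y Q p2 j)"
      using D O QO M by (simp add: Cmp_add_left Cmp_add_right Cmp_assoc)
    then have "Cmp E D Y D' q j = ?c \<oplus>\<^bsub>Hom E D D'\<^esub> Cmp E D Q D' (Cmp E Q Y D' q i2) (Cmp E D Y Q p2 j)"
      unfolding sumQ using D O by simp
    then have "Cmp E D Y D' q j \<ominus>\<^bsub>Hom E D D'\<^esub> ?c = Cmp E D Q D' (Cmp E Q Y D' q i2) (Cmp E D Y Q p2 j)"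
      using hom_add_minus_cancel(5)[OF D(1,2) cc] D QO O M by simp
    then have "Cmp E D Y D' q j \<ominus>\<^bsub>Hom E D D'\<^esub> ?c \<in> projI D D'"
      using projI_I[OF Q D(1,2), of "Cmp E D Y Q p2 j" "Cmp E Q Y D' q i2"] D QO O M by simp
    then have "cl D D' (Cmp E D Y D' q j) = cl D D' ?c" using cl_eq_iff D O cc by simp
    then show ?thesis using D O M by (simp add: cl_Cmp)
  qed
  have "Cmp st X A X (cl A X (Cmp E A Y X p1 j1)) (cl X A (Cmp E X Y A q1 i1)) \<oplus>\<^bsub>Hom st X X\<^esub>
      Cmp st X B X (cl B X (Cmp E B Y X p1 j2)) (cl X B (Cmp E X Y B q2 i1)) =
      cl X X (Cmp E X Y X p1 (Cmp E X Y Y (Cmp E Y A Y j1 q1 \<oplus>\<^bsub>Hom E Y Y\<^esub> Cmp E Y B Y j2 q2) i1))"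
    using O M by (simp add: cl_Cmp cl_add Cmp_add_left Cmp_add_right Cmp_assoc)
  also have "\<dots> = Idm st X" unfolding sum st_Idm using O M e by simp
  finally have "Cmp st X A X (cl A X (Cmp E A Y X p1 j1)) (cl X A (Cmp E X Y A q1 i1)) \<oplus>\<^bsub>Hom st X X\<^esub>
      Cmp st X B X (cl B X (Cmp E B Y X p1 j2)) (cl X B (Cmp E X Y B q2 i1)) = Idm st X" .
  then show ?thesis unfolding S.biproduct_def
    using O M r key[of A A j1 q1] key[of B B j2 q2] key[of B A j2 q1] key[of A B j1 q2]
    by (simp add: st_cl st_Idm cl_zero)
qed

text \<open>A is an honest summand of X \<oplus> Q, where the complement B comes from splitting an
  idempotent in the exact category. The resulting stable decomposition X = A \<oplus> B forces B to
  be stably zero, as A is not.\<close>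

lemma st_indecomposable_retract:
  assumes X: "indecomposable st X" and "stable_retract A X" and A: "\<not> projective E A"
  shows "isomorphic st A X"
proof -
  interpret S: lin_category R st by (rule lin_category_st)
  obtain Q Y i1 i2 p1 p2 where Q: "projective E Q" and w: "biproduct X Q Y i1 i2 p1 p2" and AY: "retract A Y"
    by (rule stable_retract_biproduct[OF assms(2)])
  obtain s r where sr: "A \<in> Ob E" "Y \<in> Ob E" "s \<in> Mor E A Y" "r \<in> Mor E Y A" "Cmp E A Y A r s = Idm E A"
    using AY unfolding retract_def by blast
  obtain B j2 q2 where b: "biproduct A B Y s j2 r q2" using retract_biproduct[OF sr] by blast
  define I1 I2 P1 P2 where "I1 = cl A X (Cmp E A Y X p1 s)" and "I2 = cl B X (Cmp E B Y X p1 j2)"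
    and "P1 = cl X A (Cmp E X Y A r i1)" and "P2 = cl X B (Cmp E X Y B q2 i1)"
  have sb: "S.biproduct A B X I1 I2 P1 P2" unfolding I1_def I2_def P1_def P2_def by (rule st_biproduct[OF Q w b])
  then have "direct_sum st [A, B] X" using S.direct_sum_pair_iff by blast
  then have zB: "zero_object st B" using X A st_zero_object_iff unfolding indecomposable_def by blast
  have O: "X \<in> Ob st" "B \<in> Ob st" using sb by (auto simp: S.biproduct_def)
  have "I2 = zmor st B X" using zB S.zero_object_iff O sb by (auto simp: S.biproduct_def)
  then have "Cmp st X A X I1 P1 = Idm st X" using sb unfolding S.biproduct_def by auto
  then show ?thesis unfolding isomorphic_def is_iso_def using sb unfolding S.biproduct_def by blast
qed

text \<open>Each class in question is shown to be the stable class of some test object A: the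
  functor is nonzero at a syzygy W stably isomorphic to the given indecomposable object, A is a
  stable retract of W, and \<open>st_indecomposable_retract\<close> makes it isomorphic to that
  object.\<close>

theorem finite_support:
  assumes tensor: "tensor_rat (AR_group E) = tensor_rat (Ex_group E)" and M: "M \<in> eff E"
  shows "finite (supp E M \<inter> ind (Omega_stable E))"
proof -
  interpret S: lin_category R st by (rule lin_category_st)
  have add: "M \<in> additive_functors E" using M by (simp add: eff_def)
  from M obtain Y g Z \<eta> where defl: "deflation E Y g Z"
    and onto: "\<forall>W\<in>Ob E. \<eta> W ` Mor E W Z = carrier (FOb M W)"
    and ker: "\<forall>W\<in>Ob E. kernel (add_monoid (Hom E W Z)) (FOb M W) (\<eta> W) = Cmp E W Y Z g ` Mor E W Y"
    unfolding eff_def by (elim CollectE conjE exE) (rule that, assumption+)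
  obtain X f where d: "conflation E X f Y g Z" using defl unfolding deflation_def by blast
  have O: "Y \<in> Ob E" "Z \<in> Ob E" "g \<in> Mor E Y Z" using conflation_objects[OF d] conflation_morphisms[OF d] by auto
  obtain T where T: "finite T" "T \<subseteq> Ob E"
    and test: "\<And>U i Q p V. \<lbrakk>projective E Q; conflation E U i Q p V; image_of Y g Z U \<noteq> Mor E U Z\<rbrakk> \<Longrightarrow>
      \<exists>A\<in>T. \<not> projective E A \<and> stable_retract A U"
    using finite_test_set[OF tensor d] by blast
  have "supp E M \<inter> ind (Omega_stable E) \<subseteq> iso_class st ` T"
  proof
    fix c assume "c \<in> supp E M \<inter> ind (Omega_stable E)"
    then have c: "c \<in> ind st" "\<exists>V\<in>c. \<not> trivial_group (FOb M V)" "c \<in> ind (Omega_stable E)" by (auto simp: supp_def)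
    then obtain X1 where X1: "indecomposable st X1" "c = iso_class st X1" unfolding ind_def by blast
    then have OX1: "X1 \<in> Ob E" by (simp add: indecomposable_def)
    obtain V where V: "V \<in> c" "\<not> trivial_group (FOb M V)" using c by blast
    then have OV: "V \<in> Ob E" "isomorphic st X1 V" using X1(2) by (auto simp: iso_class_def)
    \<comment> \<open>A class formed inside \<open>Omega_stable E\<close> consists of objects of
      that subcategory, so the representative V with M(V) \<noteq> 0 is itself stably isomorphic to
      a syzygy.\<close>
    have "c \<subseteq> Ob (Omega_stable E)" using c(3) unfolding ind_def iso_class_def by blast
    then have "V \<in> Ob (Omega_stable E)" using V by blast
    then obtain V0 W where W: "is_syzygy E V0 W" "isomorphic st W V"
      unfolding Omega_stable_def full_subcategory_def by auto
    then obtain Q i p where Q: "projective E Q" and sy: "conflation E W i Q p V0" unfolding is_syzygy_def by blast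
    have OW: "W \<in> Ob E" using conflation_objects[OF sy] by blast
    have grp: "group (FOb M V)" using add OV(1) unfolding additive_functors_def by (auto simp: comm_group_def)
    then have "carrier (FOb M V) \<noteq> {\<one>\<^bsub>FOb M V\<^esub>}" using V(2) by (simp add: trivial_group_def)
    moreover have "\<one>\<^bsub>FOb M V\<^esub> \<in> carrier (FOb M V)" using grp by (simp add: group.is_monoid)
    ultimately obtain x where x: "x \<in> carrier (FOb M V)" "x \<noteq> \<one>\<^bsub>FOb M V\<^esub>" by blast
    have "x \<in> \<eta> V ` Mor E V Z" unfolding onto[rule_format, OF OV(1)] by (rule x(1))
    then obtain h where h: "h \<in> Mor E V Z" "\<eta> V h = x" by blast
    then have hV: "h \<notin> image_of Y g Z V" using ker[rule_format, OF OV(1)] x(2) unfolding kernel_def image_of_def by auto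
    have VW: "stable_retract V W" using st_isomorphic_retract OW OV S.isomorphic_sym W(2) by blast
    obtain s r where sr: "s \<in> Mor E V W" "r \<in> Mor E W V" "Cmp E V W V r s \<ominus>\<^bsub>Hom E V V\<^esub> Idm E V \<in> projI V V"
      using VW unfolding stable_retract_def by blast
    \<comment> \<open>The element h of M(V) stays nonzero when transported to W along r, because
      pulling it back along s returns the class of h.\<close>
    have "Cmp E W V Z h r \<notin> image_of Y g Z W"
    proof
      assume "Cmp E W V Z h r \<in> image_of Y g Z W"
      then have "Cmp E V W Z (Cmp E W V Z h r) s \<in> image_of Y g Z V"
        using image_of_precomp[OF O OV(1) OW sr(1)] by blast
      then have "Cmp E V V Z h (Cmp E V W V r s) \<in> image_of Y g Z V" using O OV OW sr h by (simp add: Cmp_assoc)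
      then show False using image_of_projI_cong[OF d OV(1) _ sr(3) h(1)] hV OV OW sr by simp
    qed
    moreover have "Cmp E W V Z h r \<in> Mor E W Z" using h OV OW O sr by simp
    ultimately have "image_of Y g Z W \<noteq> Mor E W Z" by blast
    then obtain A where A: "A \<in> T" "\<not> projective E A" "stable_retract A W" using test[OF Q sy] by blast
    have "stable_retract W V" using st_isomorphic_retract OW OV W(2) by blast
    moreover have "stable_retract V X1" using st_isomorphic_retract OX1 OV S.isomorphic_sym by blast
    ultimately have "stable_retract A X1" using A(3) stable_retract_trans by blast
    then have "isomorphic st A X1" using st_indecomposable_retract X1(1) A(2) by blast
    then have "c = iso_class st A" using X1(2) S.iso_class_eq[of A X1] A(1) T(2) OX1 by auto
    then show "c \<in> iso_class st ` T" using A(1) by blast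
  qed
  then show ?thesis using T(1) finite_subset by blast
qed

end

section \<open>Objects embedding into projectives\<close>

context ar_category
begin

section \<open>Objects embedding into projectives: summands and sums\<close>

lemma pushout_unique:
  assumes po: "is_pushout E X f Y h X' h' f' Y'"
    and O: "X \<in> Ob E" "Y \<in> Ob E" "X' \<in> Ob E" "Y' \<in> Ob E" "W \<in> Ob E" and M: "f \<in> Mor E X Y" "h \<in> Mor E X X'"
    and w: "w \<in> Mor E Y' W" "v \<in> Mor E Y' W" "Cmp E Y Y' W w h' = Cmp E Y Y' W v h'" "Cmp E X' Y' W w f' = Cmp E X' Y' W v f'"
  shows "w = v"
proof -
  have m: "h' \<in> Mor E Y Y'" "f' \<in> Mor E X' Y'" and c: "Cmp E X Y Y' h' f = Cmp E X X' Y' f' h"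
    using po by (auto simp: is_pushout_def)
  have "Cmp E X Y W (Cmp E Y Y' W v h') f = Cmp E X Y' W v (Cmp E X Y Y' h' f)" using O M m w(2) by (simp add: Cmp_assoc)
  also have "\<dots> = Cmp E X X' W (Cmp E X' Y' W v f') h" unfolding c using O M m w(2) by (simp add: Cmp_assoc)
  finally have "\<exists>!u. u \<in> Mor E Y' W \<and> Cmp E Y Y' W u h' = Cmp E Y Y' W v h' \<and> Cmp E X' Y' W u f' = Cmp E X' Y' W v f'"
    using po O m w(2) unfolding is_pushout_def by simp
  then show ?thesis using w by blast
qed

lemma zero_object_projective: "zero_object E X \<Longrightarrow> projective E X"
proof -
  assume z: "zero_object E X"
  then have X: "X \<in> Ob E" by (simp add: zero_object_def)
  show ?thesis unfolding projective_def
  proof (intro conjI allI impI ballI X)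
    fix Y g Z h assume "deflation E Y g Z" and h: "h \<in> Mor E X Z"
    then obtain K f where c: "conflation E K f Y g Z" unfolding deflation_def by blast
    have O: "Y \<in> Ob E" "Z \<in> Ob E" "g \<in> Mor E Y Z" using conflation_objects[OF c] conflation_morphisms[OF c] by auto
    have "h = zmor E X Z" using z h O zero_object_iff by blast
    then show "\<exists>u\<in>Mor E X Y. Cmp E X Y Z g u = h" using X O by (intro bexI[of _ "zmor E X Y"]) auto
  qed
qed

definition syzygies :: "'o set"
  where "syzygies = {X \<in> Ob E. \<exists>Q f. projective E Q \<and> inflation E X f Q}"

lemma syzygies_Ob: "X \<in> syzygies \<Longrightarrow> X \<in> Ob E"
  by (simp add: syzygies_def)

lemma projective_syzygies: "projective E Q \<Longrightarrow> Q \<in> syzygies"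
  unfolding syzygies_def using projective_Ob inflation_Idm by blast

text \<open>The coproduct of A and B is the pushout of 0 \<rightarrow> B along 0 \<rightarrow> A.
  Thus the inclusion of A is, up to isomorphism, the pushout of an inflation.\<close>

lemma biproduct_inflation:
  assumes b: "biproduct A B X i1 i2 p1 p2" shows "inflation E A i1 X"
proof -
  have O: "A \<in> Ob E" "B \<in> Ob E" "X \<in> Ob E" and M: "i1 \<in> Mor E A X" "i2 \<in> Mor E B X" "p1 \<in> Mor E X A" "p2 \<in> Mor E X B"
    and r: "Cmp E A X A p1 i1 = Idm E A" "Cmp E B X B p2 i2 = Idm E B" "Cmp E B X A p1 i2 = zmor E B A"
      "Cmp E A X B p2 i1 = zmor E A B"
    and s: "Cmp E X A X i1 p1 \<oplus>\<^bsub>Hom E X X\<^esub> Cmp E X B X i2 p2 = Idm E X"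
    using b by (auto simp: biproduct_def)
  \<comment> \<open>The zero inflation into B is extracted from the axiom that the identity of B is
    a deflation: its kernel K is a zero object.\<close>
  obtain K k where c: "conflation E K k B (Idm E B) B" using deflation_Idm[OF O(2)] unfolding deflation_def by blast
  have K: "K \<in> Ob E" "k \<in> Mor E K B" using conflation_objects[OF c] conflation_morphisms[OF c] by auto
  have k0: "k = zmor E K B" using conflation_zero[OF c] K O by simp
  have "Idm E K = zmor E K K" using conflation_mono[OF c K(1), of "Idm E K" "zmor E K K"] K O k0 by simp
  then have zK: "zero_object E K" using K by (simp add: zero_object_def)
  have "inflation E K k B" using c unfolding inflation_def by blast
  from inflation_pushout[OF this O(1), of "zmor E K A"] obtain N h n where N: "N \<in> Ob E"
    and po: "is_pushout E K k B (zmor E K A) A h n N" and inf: "inflation E A n N" using K O by auto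
  have hn: "h \<in> Mor E B N" "n \<in> Mor E A N" using po by (auto simp: is_pushout_def)
  have "\<exists>!w. w \<in> Mor E N X \<and> Cmp E B N X w h = i2 \<and> Cmp E A N X w n = i1"
    using po O K M k0 unfolding is_pushout_def by simp
  then obtain w where w: "w \<in> Mor E N X" "Cmp E B N X w h = i2" "Cmp E A N X w n = i1" by blast
  define v where "v = Cmp E X A N n p1 \<oplus>\<^bsub>Hom E X N\<^esub> Cmp E X B N h p2"
  have v: "v \<in> Mor E X N" unfolding v_def using O N M hn by simp
  have "Cmp E A X N v i1 = Cmp E A A N n (Cmp E A X A p1 i1) \<oplus>\<^bsub>Hom E A N\<^esub> Cmp E A B N h (Cmp E A X B p2 i1)"
    unfolding v_def using O N M hn by (simp add: Cmp_add_left Cmp_assoc)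
  then have vi1: "Cmp E A X N v i1 = n" unfolding r using O N hn by simp
  have "Cmp E B X N v i2 = Cmp E B A N n (Cmp E B X A p1 i2) \<oplus>\<^bsub>Hom E B N\<^esub> Cmp E B B N h (Cmp E B X B p2 i2)"
    unfolding v_def using O N M hn by (simp add: Cmp_add_left Cmp_assoc)
  then have vi2: "Cmp E B X N v i2 = h" unfolding r using O N hn by simp
  have "Cmp E X N X w v = Cmp E X A X (Cmp E A N X w n) p1 \<oplus>\<^bsub>Hom E X X\<^esub> Cmp E X B X (Cmp E B N X w h) p2"
    unfolding v_def using O N M hn w(1) by (simp add: Cmp_add_right Cmp_assoc)
  then have wv: "Cmp E X N X w v = Idm E X" unfolding w(2,3) s .
  have "Cmp E N X N v w = Idm E N"
  proof (rule pushout_unique[OF po K(1) O(2,1) N N K(2)])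
    have "Cmp E B N N (Cmp E N X N v w) h = Cmp E B X N v (Cmp E B N X w h)" using O N v w(1) hn by (simp add: Cmp_assoc)
    then show "Cmp E B N N (Cmp E N X N v w) h = Cmp E B N N (Idm E N) h" unfolding w(2) vi2 using O N hn by simp
    have "Cmp E A N N (Cmp E N X N v w) n = Cmp E A X N v (Cmp E A N X w n)" using O N v w(1) hn by (simp add: Cmp_assoc)
    then show "Cmp E A N N (Cmp E N X N v w) n = Cmp E A N N (Idm E N) n" unfolding w(3) vi1 using O N hn by simp
  qed (use O N K v w in auto)
  then have iso: "is_iso E N X w" using is_isoI[OF w(1) v] wv by blast
  obtain q Z where cN: "conflation E A n N q Z" using inf unfolding inflation_def by blast
  have Z: "Z \<in> Ob E" "q \<in> Mor E N Z" using conflation_objects[OF cN] conflation_morphisms[OF cN] by auto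
  have "conflation E A i1 X (Cmp E X N Z q v) Z"
  proof (rule conflation_iso[OF cN O(1,3) Z(1) M(1) _ is_iso_Idm[OF O(1)] iso is_iso_Idm[OF Z(1)]])
    show "Cmp E X N Z q v \<in> Mor E X Z" using O N Z v by simp
    show "Cmp E A A X i1 (Idm E A) = Cmp E A N X w n" using w O M by simp
    have "Cmp E N X Z (Cmp E X N Z q v) w = Cmp E N N Z q (Cmp E N X N v w)" using O N Z v w(1) by (simp add: Cmp_assoc)
    then show "Cmp E N X Z (Cmp E X N Z q v) w = Cmp E N Z Z (Idm E Z) q"
      unfolding \<open>Cmp E N X N v w = Idm E N\<close> using N Z by simp
  qed
  then show ?thesis unfolding inflation_def by blast
qed

text \<open>The inclusion of a summand is an inflation, and inflations compose.\<close>

lemma retract_syzygies: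
  assumes "retract A X" "X \<in> syzygies" shows "A \<in> syzygies"
proof -
  obtain s r where sr: "A \<in> Ob E" "X \<in> Ob E" "s \<in> Mor E A X" "r \<in> Mor E X A" "Cmp E A X A r s = Idm E A"
    using assms(1) unfolding retract_def by blast
  obtain B i p where "biproduct A B X s i r p" using retract_biproduct[OF sr] by blast
  then have "inflation E A s X" by (rule biproduct_inflation)
  moreover obtain Q f where "projective E Q" "inflation E X f Q" using assms(2) unfolding syzygies_def by blast
  ultimately show ?thesis unfolding syzygies_def using inflation_Cmp sr(1) by blast
qed

text \<open>The two inflations into projectives are pushed out one after the other; that the resulting
  object, a direct sum of \<open>Q\<close> and \<open>Q'\<close>, is projective is read off its universal property.\<close>

lemma biproduct_syzygies:
  assumes b: "biproduct A B X i1 i2 p1 p2" and "A \<in> syzygies" "B \<in> syzygies" shows "X \<in> syzygies"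
proof -
  have O: "A \<in> Ob E" "B \<in> Ob E" "X \<in> Ob E" and M: "i1 \<in> Mor E A X" "i2 \<in> Mor E B X" "p1 \<in> Mor E X A" "p2 \<in> Mor E X B"
    and r: "Cmp E A X A p1 i1 = Idm E A" "Cmp E B X B p2 i2 = Idm E B" "Cmp E B X A p1 i2 = zmor E B A"
      "Cmp E A X B p2 i1 = zmor E A B"
    and s: "Cmp E X A X i1 p1 \<oplus>\<^bsub>Hom E X X\<^esub> Cmp E X B X i2 p2 = Idm E X"
    using b by (auto simp: biproduct_def)
  obtain Q i where Q: "projective E Q" "inflation E A i Q" using assms(2) unfolding syzygies_def by blast
  obtain Q' i' where Q': "projective E Q'" "inflation E B i' Q'" using assms(3) unfolding syzygies_def by blast
  have OQ: "Q \<in> Ob E" "Q' \<in> Ob E" using Q Q' projective_Ob by auto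
  have MQ: "i \<in> Mor E A Q" "i' \<in> Mor E B Q'" using Q(2) Q'(2) conflation_morphisms unfolding inflation_def by blast+
  from inflation_pushout[OF Q(2) O(3) M(1)] obtain N h n where N: "N \<in> Ob E"
    and po: "is_pushout E A i Q i1 X h n N" and inf: "inflation E X n N" by blast
  have hn: "h \<in> Mor E Q N" "n \<in> Mor E X N" "Cmp E A Q N h i = Cmp E A X N n i1" using po by (auto simp: is_pushout_def)
  have ni2: "Cmp E B X N n i2 \<in> Mor E B N" using O M N hn by simp
  \<comment> \<open>The first pushout replaces the summand A of X by Q, the second replaces B by Q'.
    The composite n' n embeds X into N'.\<close>
  from inflation_pushout[OF Q'(2) N ni2] obtain N' h' n' where N': "N' \<in> Ob E"
    and po': "is_pushout E B i' Q' (Cmp E B X N n i2) N h' n' N'" and inf': "inflation E N n' N'" by blast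
  have hn': "h' \<in> Mor E Q' N'" "n' \<in> Mor E N N'" "Cmp E B Q' N' h' i' = Cmp E B N N' n' (Cmp E B X N n i2)"
    using po' by (auto simp: is_pushout_def)
  have "projective E N'" unfolding projective_def
  proof (intro conjI allI impI ballI N')
    fix Y e Z y assume "deflation E Y e Z" and y: "y \<in> Mor E N' Z"
    then obtain K f where c: "conflation E K f Y e Z" unfolding deflation_def by blast
    have OY: "Y \<in> Ob E" "Z \<in> Ob E" and e: "e \<in> Mor E Y Z" using conflation_objects[OF c] conflation_morphisms[OF c] by auto
    obtain a where a: "a \<in> Mor E Q Y" "Cmp E Q Y Z e a = Cmp E Q N Z (Cmp E N N' Z y n') h"
      using projective_lift[OF Q(1) c, of "Cmp E Q N Z (Cmp E N N' Z y n') h"] OQ N N' OY y hn hn' by auto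
    obtain a' where a': "a' \<in> Mor E Q' Y" "Cmp E Q' Y Z e a' = Cmp E Q' N' Z y h'"
      using projective_lift[OF Q'(1) c, of "Cmp E Q' N' Z y h'"] OQ N N' OY y hn hn' by auto
    define ai ai' where "ai = Cmp E A Q Y a i" and "ai' = Cmp E B Q' Y a' i'"
    have ac: "ai \<in> Mor E A Y" "ai' \<in> Mor E B Y" unfolding ai_def ai'_def using O OQ OY MQ a a' by simp_all
    \<comment> \<open>Lifts a on Q and a' on Q' are available. On X = A \<oplus> B they prescribe a
      i and a' i', so v is the compatible map on X; the two universal properties then glue a, v and
      a' to a map z on N'.\<close>
    define v where "v = Cmp E X A Y ai p1 \<oplus>\<^bsub>Hom E X Y\<^esub> Cmp E X B Y ai' p2"
    have v: "v \<in> Mor E X Y" unfolding v_def using O OY M ac by simp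
    have "Cmp E A X Y v i1 = Cmp E A A Y ai (Cmp E A X A p1 i1) \<oplus>\<^bsub>Hom E A Y\<^esub> Cmp E A B Y ai' (Cmp E A X B p2 i1)"
      unfolding v_def using O OY M ac by (simp add: Cmp_add_left Cmp_assoc)
    then have vi1: "Cmp E A X Y v i1 = ai" unfolding r using O OY ac by simp
    have "Cmp E B X Y v i2 = Cmp E B A Y ai (Cmp E B X A p1 i2) \<oplus>\<^bsub>Hom E B Y\<^esub> Cmp E B B Y ai' (Cmp E B X B p2 i2)"
      unfolding v_def using O OY M ac by (simp add: Cmp_add_left Cmp_assoc)
    then have vi2: "Cmp E B X Y v i2 = ai'" unfolding r using O OY ac by simp
    have "\<exists>!w. w \<in> Mor E N Y \<and> Cmp E Q N Y w h = a \<and> Cmp E X N Y w n = v"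
      using po OY a(1) v vi1 unfolding is_pushout_def ai_def by simp
    then obtain w where w: "w \<in> Mor E N Y" "Cmp E Q N Y w h = a" "Cmp E X N Y w n = v" by blast
    have "Cmp E B N Y w (Cmp E B X N n i2) = Cmp E B X Y (Cmp E X N Y w n) i2" using O OY N M hn w(1) by (simp add: Cmp_assoc)
    then have "Cmp E B N Y w (Cmp E B X N n i2) = Cmp E B Q' Y a' i'" unfolding w(3) vi2 ai'_def .
    then have "\<exists>!z. z \<in> Mor E N' Y \<and> Cmp E Q' N' Y z h' = a' \<and> Cmp E N N' Y z n' = w"
      using po' OY a'(1) w(1) unfolding is_pushout_def by simp
    then obtain z where z: "z \<in> Mor E N' Y" "Cmp E Q' N' Y z h' = a'" "Cmp E N N' Y z n' = w" by blast
    define yn where "yn = Cmp E N N' Z y n'"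
    have yn: "yn \<in> Mor E N Z" unfolding yn_def using N N' OY y hn' by simp
    \<comment> \<open>Uniqueness for the first pushout, tested on Q and on X. On X the equality is
      checked on the two summands and reassembled by the biproduct identity.\<close>
    have ew: "Cmp E N Y Z e w = yn"
    proof (rule pushout_unique[OF po O(1) OQ(1) O(3) N OY(2) MQ(1) M(1) _ yn])
      show "Cmp E N Y Z e w \<in> Mor E N Z" using N OY e w by simp
      have "Cmp E Q N Z (Cmp E N Y Z e w) h = Cmp E Q Y Z e (Cmp E Q N Y w h)" using OQ N OY e w(1) hn by (simp add: Cmp_assoc)
      then show "Cmp E Q N Z (Cmp E N Y Z e w) h = Cmp E Q N Z yn h" unfolding w(2) a(2) yn_def .
      have eai: "Cmp E A Y Z e ai = Cmp E A X Z (Cmp E X N Z yn n) i1"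
      proof -
        have "Cmp E A Y Z e ai = Cmp E A Q Z (Cmp E Q Y Z e a) i" unfolding ai_def using O OQ OY e MQ a(1) by (simp add: Cmp_assoc)
        also have "\<dots> = Cmp E A N Z yn (Cmp E A Q N h i)"
          unfolding a(2) yn_def[symmetric] using O OQ OY N MQ hn(1) yn by (simp add: Cmp_assoc)
        also have "\<dots> = Cmp E A X Z (Cmp E X N Z yn n) i1" unfolding hn(3) using O OY N M hn(2) yn by (simp add: Cmp_assoc)
        finally show ?thesis .
      qed
      have eai': "Cmp E B Y Z e ai' = Cmp E B X Z (Cmp E X N Z yn n) i2"
      proof -
        have "Cmp E B Y Z e ai' = Cmp E B Q' Z (Cmp E Q' Y Z e a') i'" unfolding ai'_def using O OQ OY e MQ a'(1) by (simp add: Cmp_assoc)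
        also have "\<dots> = Cmp E B N' Z y (Cmp E B Q' N' h' i')" unfolding a'(2) using O OQ OY N' MQ hn'(1) y by (simp add: Cmp_assoc)
        also have "\<dots> = Cmp E B N Z yn (Cmp E B X N n i2)"
          unfolding hn'(3) yn_def by (rule Cmp_assoc[OF O(2) N N' OY(2) ni2 hn'(2) y])
        also have "\<dots> = Cmp E B X Z (Cmp E X N Z yn n) i2" using O OY N M hn(2) yn by (simp add: Cmp_assoc)
        finally show ?thesis .
      qed
      have "Cmp E X N Z (Cmp E N Y Z e w) n = Cmp E X Y Z e (Cmp E X N Y w n)" using O N OY e w(1) hn(2) by (simp add: Cmp_assoc)
      also have "\<dots> = Cmp E X A Z (Cmp E A Y Z e ai) p1 \<oplus>\<^bsub>Hom E X Z\<^esub> Cmp E X B Z (Cmp E B Y Z e ai') p2"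
        unfolding w(3) v_def using O OY e M ac by (simp add: Cmp_add_right Cmp_assoc)
      also have "\<dots> = Cmp E X X Z (Cmp E X N Z yn n) (Cmp E X A X i1 p1 \<oplus>\<^bsub>Hom E X X\<^esub> Cmp E X B X i2 p2)"
        unfolding eai eai' using O OY N M hn(2) yn by (simp add: Cmp_add_right Cmp_assoc)
      also have "\<dots> = Cmp E X N Z yn n" unfolding s using O OY N hn(2) yn by simp
      finally show "Cmp E X N Z (Cmp E N Y Z e w) n = Cmp E X N Z yn n" .
    qed
    have "Cmp E N' Y Z e z = y"
    proof (rule pushout_unique[OF po' O(2) OQ(2) N N' OY(2) MQ(2) ni2 _ y])
      show "Cmp E N' Y Z e z \<in> Mor E N' Z" using N' OY e z by simp
      have "Cmp E Q' N' Z (Cmp E N' Y Z e z) h' = Cmp E Q' Y Z e (Cmp E Q' N' Y z h')" using OQ N' OY e z(1) hn' by (simp add: Cmp_assoc)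
      then show "Cmp E Q' N' Z (Cmp E N' Y Z e z) h' = Cmp E Q' N' Z y h'" unfolding z(2) a'(2) .
      have "Cmp E N N' Z (Cmp E N' Y Z e z) n' = Cmp E N Y Z e (Cmp E N N' Y z n')" using N N' OY e z(1) hn' by (simp add: Cmp_assoc)
      then show "Cmp E N N' Z (Cmp E N' Y Z e z) n' = Cmp E N N' Z y n'" unfolding z(3) ew yn_def .
    qed
    then show "\<exists>u\<in>Mor E N' Y. Cmp E N' Y Z e u = y" using z(1) by blast
  qed
  moreover have "inflation E X (Cmp E X N N' n' n) N'" by (rule inflation_Cmp[OF inf inf'])
  ultimately show ?thesis unfolding syzygies_def using O(3) by blast
qed

lemma direct_sum_syzygies:
  assumes "set Xs \<subseteq> syzygies" shows "\<exists>Y\<in>syzygies. direct_sum E Xs Y"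
  using assms
proof (induction Xs)
  case Nil
  obtain X where X: "direct_sum E [] X" using has_direct_sums[of "[]"] by auto
  then have XO: "X \<in> Ob E" by (simp add: direct_sum_def)
  interpret H: module R "Hom E X X" using XO XO by (rule Hom_module)
  have "zero_object E X" using X by (auto simp: zero_object_def direct_sum_def)
  then show ?case using X zero_object_projective projective_syzygies by blast
next
  case (Cons x xs)
  then obtain Y where Y: "Y \<in> syzygies" "direct_sum E xs Y" by auto
  have x: "x \<in> syzygies" using Cons by simp
  obtain Z i1 i2 p1 p2 where b: "biproduct x Y Z i1 i2 p1 p2" using biproduct_exists syzygies_Ob x Y by metis
  have "direct_sum E ([x] @ xs) Z"
    using direct_sum_append[OF direct_sum_single[of x x] Y(2)] b direct_sum_pair_iff isomorphic_refl syzygies_Ob[OF x] by blast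
  then show ?case using biproduct_syzygies[OF b x Y(1)] by auto
qed

section \<open>Indecomposable summands and finite type\<close>

lemma direct_sum_retract:
  assumes "direct_sum E Xs X" "Y \<in> set Xs" shows "retract Y X"
proof -
  obtain k where k: "k < length Xs" "Y = Xs ! k" using assms(2) by (auto simp: in_set_conv_nth)
  from assms(1) obtain \<iota> \<pi> where "X \<in> Ob E" "\<And>k. k < length Xs \<Longrightarrow> Xs ! k \<in> Ob E"
    "\<And>k. k < length Xs \<Longrightarrow> \<iota> k \<in> Mor E (Xs ! k) X" "\<And>k. k < length Xs \<Longrightarrow> \<pi> k \<in> Mor E X (Xs ! k)"
    "\<And>j k. \<lbrakk>j < length Xs; k < length Xs\<rbrakk> \<Longrightarrow> Cmp E (Xs ! k) X (Xs ! j) (\<pi> j) (\<iota> k) =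
          (if j = k then Idm E (Xs ! k) else zmor E (Xs ! k) (Xs ! j))"
    by (rule direct_sumE) blast
  then have "Xs ! k \<in> Ob E" "X \<in> Ob E" "\<iota> k \<in> Mor E (Xs ! k) X" "\<pi> k \<in> Mor E X (Xs ! k)"
    "Cmp E (Xs ! k) X (Xs ! k) (\<pi> k) (\<iota> k) = Idm E (Xs ! k)" using k(1) by simp_all
  then show ?thesis unfolding retract_def k(2) by blast
qed

text \<open>The identity of X is the sum of its components through the members of \<open>Ys\<close>.
  If none of these split, all components are radical, and so is the identity of X, which is
  absurd.\<close>

lemma indecomposable_retract_sum:
  assumes X: "indecomposable E X" and "direct_sum E Ys Y" "retract X Y"
  shows "\<exists>P\<in>set Ys. retract X P"
proof (rule ccontr)
  assume no: "\<not> ?thesis"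
  obtain s r where sr: "X \<in> Ob E" "Y \<in> Ob E" "s \<in> Mor E X Y" "r \<in> Mor E Y X" "Cmp E X Y X r s = Idm E X"
    using assms(3) unfolding retract_def by blast
  from assms(2) obtain \<iota> \<pi> where Ys: "\<And>k. k < length Ys \<Longrightarrow> Ys ! k \<in> Ob E"
    and i: "\<And>k. k < length Ys \<Longrightarrow> \<iota> k \<in> Mor E (Ys ! k) Y" and p: "\<And>k. k < length Ys \<Longrightarrow> \<pi> k \<in> Mor E Y (Ys ! k)"
    and sum: "finsum (Hom E Y Y) (\<lambda>k. Cmp E Y (Ys ! k) Y (\<iota> k) (\<pi> k)) {..<length Ys} = Idm E Y"
    by (rule direct_sumE) blast
  let ?N = "{h \<in> Mor E X Y. Cmp E X Y X r h \<in> jacobson_radical E X X}"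
  have N: "submodule ?N R (Hom E X Y)"
    by (rule submodule_preimage[OF Hom_module[OF sr(1,2)] Hom_module[OF sr(1,1)] linear_postcomp[OF sr(1,2,1,4)]
          submodule_jacobson[OF sr(1,1)]])
  have "s \<in> ?N"
  proof (rule direct_sum_mem[OF sr(1,2) Ys i p sum N sr(3)])
    fix k assume k: "k < length Ys"
    let ?u = "Cmp E X Y (Ys ! k) (\<pi> k) s" and ?v = "Cmp E (Ys ! k) Y X r (\<iota> k)"
    have uv: "?u \<in> Mor E X (Ys ! k)" "?v \<in> Mor E (Ys ! k) X" using sr Ys[OF k] i[OF k] p[OF k] by simp_all
    have "Cmp E X (Ys ! k) X ?v ?u \<in> jacobson_radical E X X"
    proof (rule ccontr)
      assume n: "Cmp E X (Ys ! k) X ?v ?u \<notin> jacobson_radical E X X"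
      have "Cmp E X (Ys ! k) X ?v ?u \<in> Mor E X X" using uv sr Ys[OF k] by simp
      then obtain t where t: "t \<in> Mor E X X" "Cmp E X X X t (Cmp E X (Ys ! k) X ?v ?u) = Idm E X"
        using nonradical_from_indecomposable[OF X sr(1) _ n] by blast
      have tv: "Cmp E (Ys ! k) X X t ?v \<in> Mor E (Ys ! k) X" using t(1) uv sr Ys[OF k] by simp
      have "Cmp E X (Ys ! k) X (Cmp E (Ys ! k) X X t ?v) ?u = Idm E X"
        unfolding t(2)[symmetric] by (rule Cmp_assoc[OF sr(1) Ys[OF k] sr(1,1) uv t(1), symmetric])
      then have "retract X (Ys ! k)" unfolding retract_def using sr(1) Ys[OF k] uv(1) tv by blast
      then show False using no k by (meson nth_mem)
    qed
    then show "Cmp E X (Ys ! k) Y (\<iota> k) (Cmp E X Y (Ys ! k) (\<pi> k) s) \<in> ?N"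
      using sr Ys[OF k] i[OF k] p[OF k] by (simp add: Cmp_assoc)
  qed
  then have "Idm E X \<in> jacobson_radical E X X" using sr by simp
  then show False using Idm_not_radical X sr(1) by (simp add: indecomposable_def)
qed

text \<open>The roles are exchanged by locality of End(X). If s r is invertible, X is an honest
  retract of A. Otherwise 1 - s r is invertible, and (1 - s r) s = s (1 - r s) factors through a
  projective; then so does s, and A would be projective.\<close>

lemma stable_retract_indecomposable:
  assumes X: "indecomposable E X" and A: "\<not> projective E A" "stable_retract A X"
  shows "retract X A"
proof -
  obtain s r where 1: "A \<in> Ob E" "X \<in> Ob E" "s \<in> Mor E A X" "r \<in> Mor E X A"
    and rs: "Cmp E A X A r s \<ominus>\<^bsub>Hom E A A\<^esub> Idm E A \<in> projI A A"
    using A(2) unfolding stable_retract_def by blast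
  interpret AA: module R "Hom E A A" using 1(1,1) by (rule Hom_module)
  let ?f = "Cmp E X A X s r"
  have f: "?f \<in> Mor E X X" using 1 by simp
  consider "is_iso E X X ?f" | "is_iso E X X (Idm E X \<ominus>\<^bsub>Hom E X X\<^esub> ?f)" using indecomposable_local[OF X f] by blast
  then show ?thesis
  proof cases
    case 1
    note o = \<open>A \<in> Ob E\<close> \<open>X \<in> Ob E\<close> \<open>s \<in> Mor E A X\<close> \<open>r \<in> Mor E X A\<close>
    obtain u where u: "u \<in> Mor E X X" "Cmp E X X X ?f u = Idm E X" using 1 unfolding is_iso_def by blast
    have "Cmp E X A X s (Cmp E X X A r u) = Idm E X" unfolding u(2)[symmetric] using o u(1) by (simp add: Cmp_assoc)
    moreover have "Cmp E X X A r u \<in> Mor E X A" using o u by simp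
    ultimately show ?thesis unfolding retract_def using o by blast
  next
    case 2
    note o = \<open>A \<in> Ob E\<close> \<open>X \<in> Ob E\<close> \<open>s \<in> Mor E A X\<close> \<open>r \<in> Mor E X A\<close>
    obtain u where u: "u \<in> Mor E X X" "Cmp E X X X u (Idm E X \<ominus>\<^bsub>Hom E X X\<^esub> ?f) = Idm E X" using 2 unfolding is_iso_def by blast
    have rs': "Idm E A \<ominus>\<^bsub>Hom E A A\<^esub> Cmp E A X A r s \<in> projI A A"
      using AA.sm_neg[OF submodule_projI[OF o(1,1)] rs] AA.minus_swap[of "Cmp E A X A r s" "Idm E A"] o by simp
    have "s = Cmp E A X X (Cmp E X X X u (Idm E X \<ominus>\<^bsub>Hom E X X\<^esub> ?f)) s" unfolding u(2) using o by simp
    also have "\<dots> = Cmp E A X X u (Cmp E A A X s (Idm E A \<ominus>\<^bsub>Hom E A A\<^esub> Cmp E A X A r s))"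
      using o u(1) by (simp add: Cmp_minus_left Cmp_minus_right Cmp_assoc)
    also have "\<dots> \<in> projI A X"
      using projI_postcomp[OF o(1,2,2) projI_postcomp[OF o(1,1,2) rs' o(3)] u(1)] .
    finally have "Cmp E A X A r s \<in> projI A A" using projI_postcomp[OF o(1,2,1) _ o(4)] by blast
    then have "Idm E A \<in> projI A A" using AA.sm_add_cancel(3)[OF submodule_projI[OF o(1,1)] Idm_closed[OF o(1)]] rs' by blast
    then show ?thesis using A(1) Idm_projI_iff[OF o(1)] by blast
  qed
qed

lemma retract_biproduct_mono:
  assumes b: "biproduct A B X i1 i2 p1 p2" and b': "biproduct A' B' X' j1 j2 q1 q2"
    and "retract A A'" "retract B B'"
  shows "retract X X'"
proof -
  have O: "A \<in> Ob E" "B \<in> Ob E" "X \<in> Ob E" and M: "i1 \<in> Mor E A X" "i2 \<in> Mor E B X" "p1 \<in> Mor E X A" "p2 \<in> Mor E X B"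
    and s: "Cmp E X A X i1 p1 \<oplus>\<^bsub>Hom E X X\<^esub> Cmp E X B X i2 p2 = Idm E X"
    using b by (auto simp: biproduct_def)
  have O': "A' \<in> Ob E" "B' \<in> Ob E" "X' \<in> Ob E" and M': "j1 \<in> Mor E A' X'" "j2 \<in> Mor E B' X'" "q1 \<in> Mor E X' A'" "q2 \<in> Mor E X' B'"
    and r: "Cmp E A' X' A' q1 j1 = Idm E A'" "Cmp E B' X' B' q2 j2 = Idm E B'" "Cmp E B' X' A' q1 j2 = zmor E B' A'"
      "Cmp E A' X' B' q2 j1 = zmor E A' B'"
    using b' by (auto simp: biproduct_def)
  obtain a a' where a: "a \<in> Mor E A A'" "a' \<in> Mor E A' A" "Cmp E A A' A a' a = Idm E A" using assms(3) unfolding retract_def by blast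
  obtain c c' where c: "c \<in> Mor E B B'" "c' \<in> Mor E B' B" "Cmp E B B' B c' c = Idm E B" using assms(4) unfolding retract_def by blast
  define ap cp where "ap = Cmp E X A A' a p1" and "cp = Cmp E X B B' c p2"
  define ia ic where "ia = Cmp E A' A X i1 a'" and "ic = Cmp E B' B X i2 c'"
  have m: "ap \<in> Mor E X A'" "cp \<in> Mor E X B'" "ia \<in> Mor E A' X" "ic \<in> Mor E B' X"
    unfolding ap_def cp_def ia_def ic_def using O O' M a c by simp_all
  let ?s = "Cmp E X A' X' j1 ap \<oplus>\<^bsub>Hom E X X'\<^esub> Cmp E X B' X' j2 cp"
  let ?r = "Cmp E X' A' X ia q1 \<oplus>\<^bsub>Hom E X' X\<^esub> Cmp E X' B' X ic q2"
  have sr: "?s \<in> Mor E X X'" "?r \<in> Mor E X' X" using O O' M' m by simp_all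
  have "Cmp E X X' A' q1 ?s = Cmp E X A' A' (Cmp E A' X' A' q1 j1) ap \<oplus>\<^bsub>Hom E X A'\<^esub> Cmp E X B' A' (Cmp E B' X' A' q1 j2) cp"
    using O O' M' m by (simp add: Cmp_add_right Cmp_assoc)
  then have q1: "Cmp E X X' A' q1 ?s = ap" unfolding r using O O' m by simp
  have "Cmp E X X' B' q2 ?s = Cmp E X A' B' (Cmp E A' X' B' q2 j1) ap \<oplus>\<^bsub>Hom E X B'\<^esub> Cmp E X B' B' (Cmp E B' X' B' q2 j2) cp"
    using O O' M' m by (simp add: Cmp_add_right Cmp_assoc)
  then have q2: "Cmp E X X' B' q2 ?s = cp" unfolding r using O O' m by simp
  have "Cmp E X X' X ?r ?s = Cmp E X A' X ia (Cmp E X X' A' q1 ?s) \<oplus>\<^bsub>Hom E X X\<^esub> Cmp E X B' X ic (Cmp E X X' B' q2 ?s)"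
    using O O' M' m sr(1) by (subst Cmp_add_left) (simp_all add: Cmp_assoc)
  also have "\<dots> = Cmp E X A' X ia ap \<oplus>\<^bsub>Hom E X X\<^esub> Cmp E X B' X ic cp" unfolding q1 q2 ..
  also have "\<dots> = Cmp E X A X i1 (Cmp E X A A (Cmp E A A' A a' a) p1) \<oplus>\<^bsub>Hom E X X\<^esub> Cmp E X B X i2 (Cmp E X B B (Cmp E B B' B c' c) p2)"
    unfolding ap_def cp_def ia_def ic_def using O O' M a(1,2) c(1,2) by (simp add: Cmp_assoc)
  also have "\<dots> = Idm E X" unfolding a(3) c(3) using O M s by simp
  finally show ?thesis unfolding retract_def using O O' sr by blast
qed

lemma Ob_Omega: "Ob (Omega E) = syzygies"
  by (simp add: Omega_def full_subcategory_def syzygies_def)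

lemma direct_sum_Omega: "direct_sum (Omega E) Xs X \<longleftrightarrow> X \<in> syzygies \<and> set Xs \<subseteq> syzygies \<and> direct_sum E Xs X"
proof -
  have "Hom (Omega E) = Hom E" "Cmp (Omega E) = Cmp E" "Idm (Omega E) = Idm E"
    by (simp_all add: Omega_def full_subcategory_def)
  then show ?thesis using syzygies_Ob unfolding direct_sum_def Ob_Omega by auto
qed

text \<open>The generator G is the sum of P and the test objects lying in \<Omega>E. P accounts for
  the indecomposable projectives; a nonprojective indecomposable X in \<Omega>E has a nonzero stable
  map to D, so some test object has X as a summand.\<close>

theorem Omega_finite_type:
  assumes tensor: "tensor_rat (AR_group E) = tensor_rat (Ex_group E)"
    and P: "projective_generator E P" and D: "weak_cogenerator st D"
  shows "finite_type (Omega E)"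
proof -
  have DO: "D \<in> Ob E" using D by (simp add: weak_cogenerator_def)
  \<comment> \<open>This conflation presents stable Hom(-, D), because a map into D that factors
    through g factors through the projective Q0.\<close>
  obtain K k Q0 g where Q0: "projective E Q0" and d: "conflation E K k Q0 g D" by (rule projective_cover[OF DO])
  have O0: "Q0 \<in> Ob E" "g \<in> Mor E Q0 D" using conflation_objects[OF d] conflation_morphisms[OF d] by auto
  obtain T where T: "finite T" "T \<subseteq> Ob E"
    and test: "\<And>U i Q p V. \<lbrakk>projective E Q; conflation E U i Q p V; image_of Q0 g D U \<noteq> Mor E U D\<rbrakk> \<Longrightarrow>
      \<exists>A\<in>T. \<not> projective E A \<and> stable_retract A U"
    using finite_test_set[OF tensor d] by blast
  obtain ts where ts: "set ts = T \<inter> syzygies" using T(1) finite_list by (metis finite_Int)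
  \<comment> \<open>P belongs to add P through the decomposition of P as P \<oplus> 0, hence it is
    projective.\<close>
  have P': "projective E P"
  proof -
    have "\<exists>Y. direct_sum E (replicate 1 P) Y \<and> (\<exists>X'. direct_sum E [P, X'] Y)"
    proof -
      have PO: "P \<in> Ob E" using P by (simp add: projective_generator_def)
      obtain X' where X': "direct_sum E [] X'" using has_direct_sums[of "[]"] by auto
      then have XO: "X' \<in> Ob E" by (simp add: direct_sum_def)
      have "biproduct P X' P (Idm E P) (zmor E X' P) (Idm E P) (zmor E P X')"
      proof -
        interpret H: module R "Hom E X' X'" using XO XO by (rule Hom_module)
        have "zero_object E X'" using X' XO by (auto simp: zero_object_def direct_sum_def)
        then show ?thesis unfolding biproduct_def using PO XO by (simp add: zero_object_def)
      qed
      then have "direct_sum E [P, X'] P" using direct_sum_pair_iff by blast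
      moreover have "direct_sum E (replicate 1 P) P" using direct_sum_single[of P P] isomorphic_refl PO by simp
      ultimately show ?thesis by blast
    qed
    then have "P \<in> add_of E P" unfolding add_of_def by blast
    then show ?thesis using P unfolding projective_generator_def by blast
  qed
  have "set (P # ts) \<subseteq> syzygies" using ts projective_syzygies[OF P'] by auto
  then obtain G where G: "G \<in> syzygies" "direct_sum E (P # ts) G" using direct_sum_syzygies by blast
  have GO: "G \<in> Ob E" using G syzygies_Ob by blast
  \<comment> \<open>Y is required to lie in \<Omega>E, so that the complement of X in Y lies there
    too and the decomposition is one in \<open>Omega E\<close>.\<close>
  define addG where "addG X \<longleftrightarrow> (\<exists>n Y. Y \<in> syzygies \<and> direct_sum E (replicate n G) Y \<and> retract X Y)" for X
  have addG_G: "addG X" if X: "retract X A" and A: "A \<in> set (P # ts)" for X A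
  proof -
    have "retract X G" using retract_trans[OF X direct_sum_retract[OF G(2) A]] .
    moreover have "direct_sum E (replicate 1 G) G" using direct_sum_single[of G G] isomorphic_refl GO by simp
    ultimately show ?thesis unfolding addG_def using G(1) by blast
  qed
  have "X \<in> syzygies \<longrightarrow> addG X" if "X \<in> Ob E" for X
    using that
  proof (induction X rule: krull_schmidt_induct)
    case (zero X)
    have XO: "X \<in> Ob E" using zero by (simp add: zero_object_def)
    have "direct_sum E (replicate 0 G) X" using direct_sum_empty[OF zero] by simp
    then show ?case unfolding addG_def using projective_syzygies[OF zero_object_projective[OF zero]] retract_refl[OF XO] by blast
  next
    case (indecomposable X)
    show ?case
    proof
      assume X: "X \<in> syzygies"
      have XO: "X \<in> Ob E" using X syzygies_Ob by blast
      show "addG X"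
      proof (cases "projective E X")
        case True
        then have "X \<in> add_of E P" using P unfolding projective_generator_def by blast
        then obtain n Y X' where Y: "direct_sum E (replicate n P) Y" "direct_sum E [X, X'] Y" unfolding add_of_def by blast
        have "retract X Y" using direct_sum_retract[OF Y(2)] by simp
        then obtain A where "A \<in> set (replicate n P)" "retract X A"
          using indecomposable_retract_sum[OF indecomposable Y(1)] by blast
        then have "retract X P" by (simp split: if_splits)
        then show ?thesis using addG_G by simp
      next
        case False
        then have "\<not> zero_object st X" using st_zero_object_iff by blast
        then have "Mor st X D \<noteq> {zmor st X D}" using D XO unfolding weak_cogenerator_def by auto
        moreover have "zmor st X D \<in> Mor st X D" using st_cl[OF XO DO, of "zmor E X D"] cl_zero[OF XO DO] XO DO by simp
        ultimately obtain F where "F \<in> Mor st X D" "F \<noteq> zmor st X D" by blast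
        then obtain h where h: "h \<in> Mor E X D" "h \<notin> projI X D"
          using st_rep[OF XO DO] cl_eq_zero_iff[OF XO DO] by metis
        have "h \<notin> image_of Q0 g D X"
        proof
          assume "h \<in> image_of Q0 g D X"
          then obtain y where "y \<in> Mor E X Q0" "h = Cmp E X Q0 D g y" unfolding image_of_def by blast
          then show False using projI_I[OF Q0 XO DO _ O0(2)] h(2) by blast
        qed
        then have n: "image_of Q0 g D X \<noteq> Mor E X D" using h(1) by blast
        obtain Q i where Q: "projective E Q" "inflation E X i Q" using X unfolding syzygies_def by blast
        then obtain p V where "conflation E X i Q p V" unfolding inflation_def by blast
        then obtain A where A: "A \<in> T" "\<not> projective E A" "stable_retract A X" using test[OF Q(1)] n by blast
        obtain Q' Y i1 i2 p1 p2 where Q': "projective E Q'" and b: "biproduct X Q' Y i1 i2 p1 p2" and AY: "retract A Y"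
          by (rule stable_retract_biproduct[OF A(3)])
        \<comment> \<open>A is an honest summand of X \<oplus> Q' with Q' projective, and both terms
          embed into projectives; so A is among the test objects that were kept.\<close>
        have "A \<in> syzygies" using retract_syzygies[OF AY biproduct_syzygies[OF b X projective_syzygies[OF Q']]] .
        then have "A \<in> set (P # ts)" using A(1) ts by simp
        then show ?thesis using addG_G[OF stable_retract_indecomposable[OF indecomposable A(2,3)]] by blast
      qed
    qed
  next
    case (sum A B X)
    show ?case
    proof
      assume X: "X \<in> syzygies"
      obtain i1 i2 p1 p2 where b: "biproduct A B X i1 i2 p1 p2" using sum(1) direct_sum_pair_iff by blast
      have "A \<in> syzygies" "B \<in> syzygies" using retract_syzygies[OF _ X] biproduct_retract[OF b] by blast+
      then obtain n Y n' Y' where Y: "Y \<in> syzygies" "direct_sum E (replicate n G) Y" "retract A Y"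
        and Y': "Y' \<in> syzygies" "direct_sum E (replicate n' G) Y'" "retract B Y'"
        using sum(2,3) unfolding addG_def by blast
      obtain Z j1 j2 q1 q2 where b': "biproduct Y Y' Z j1 j2 q1 q2" using biproduct_exists syzygies_Ob Y(1) Y'(1) by metis
      have "direct_sum E (replicate n G @ replicate n' G) Z"
        using direct_sum_append[OF Y(2) Y'(2)] b' direct_sum_pair_iff by blast
      then have "direct_sum E (replicate (n + n') G) Z" by (simp add: replicate_add)
      then show "addG X" unfolding addG_def
        using biproduct_syzygies[OF b' Y(1) Y'(1)] retract_biproduct_mono[OF b b' Y(3) Y'(3)] by blast
    qed
  qed
  then have all: "addG X" if "X \<in> syzygies" for X using that syzygies_Ob by blast
  have "X \<in> add_of (Omega E) G" if X: "X \<in> syzygies" for X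
  proof -
    obtain n Y where Y: "Y \<in> syzygies" "direct_sum E (replicate n G) Y" "retract X Y" using all[OF X] unfolding addG_def by blast
    obtain s r where sr: "X \<in> Ob E" "Y \<in> Ob E" "s \<in> Mor E X Y" "r \<in> Mor E Y X" "Cmp E X Y X r s = Idm E X"
      using Y(3) unfolding retract_def by blast
    obtain X' i p where b: "biproduct X X' Y s i r p" using retract_biproduct[OF sr] by blast
    have X': "X' \<in> syzygies" using retract_syzygies[OF biproduct_retract(2)[OF b] Y(1)] .
    have "direct_sum (Omega E) [X, X'] Y"
      unfolding direct_sum_Omega using X X' Y(1) b direct_sum_pair_iff by auto
    moreover have "direct_sum (Omega E) (replicate n G) Y"
      unfolding direct_sum_Omega using Y G(1) by auto
    ultimately show ?thesis unfolding add_of_def by blast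
  qed
  moreover have "add_of (Omega E) G \<subseteq> syzygies" unfolding add_of_def direct_sum_Omega by auto
  ultimately show ?thesis unfolding finite_type_def Ob_Omega using G(1) by blast
qed

end

theorem theorem5p2:
  fixes R :: "('r, 'b) ring_scheme" and E :: "('r, 'o, 'm) excat" and P :: 'o
  assumes "complete_noetherian_local_ring R"
    and "exact_category R E"
    and "hom_noetherian R E"
    and "idempotent_complete E"
    and "projective_generator E P"
    and "has_AR_conflations E"
    and "tensor_rat (AR_group E) = tensor_rat (Ex_group E)"
  shows "(\<forall>M \<in> (eff E :: ('o, 'm, 'g) cofunctor set).
            finite (supp E M \<inter> ind (Omega_stable E))) \<and>
         ((\<exists>D. weak_cogenerator (stable_category E) D) \<longrightarrow> finite_type (Omega E))"
proof -
  interpret exact_category R E by fact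
  interpret ar_category R E
    by unfold_locales (use assms in \<open>auto simp: projective_generator_def\<close>)
  show ?thesis using finite_support[OF assms(7)] Omega_finite_type[OF assms(7,5)] by blast
qed

end
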